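(* Let $\mathbb{k} \in \{\mathbb{R}, \mathbb{C}\}$ and for every integer $r\ge 1$ let $\Gamma_r$ be a lattice in the symplectic group $\mathrm{Sp}_{2r}(\mathbb{k})$. Then bounded cohomology $\mathrm{H}_{\rm b}^\bullet$ is stable along $(\Gamma_r)_{r \geq 1}$, i.e. for every integer $q \ge 0$ there exists $r_0=r_0(q)$ such that $$\mathrm{H}_{\rm b}^q(\Gamma_{r_0}) \cong \mathrm{H}_{\rm b}^q(\Gamma_{r_0+1}) \cong \mathrm{H}_{\rm b}^q(\Gamma_{r_0+2}) \cong \cdots.$$ In particular, $\mathrm{H}_{\rm b}^\bullet$ is stable (in the same sense) along $(\mathrm{Sp}_{2r}(\mathbb{Z}))_{r\ge1}$ and along $(\mathrm{Sp}_{2r}(\mathbb{Z}[i]))_{r\ge1}$.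
   Context: $\mathrm{Sp}_{2r}(\mathbb{k})$ is the group of linear automorphisms of $\mathbb{k}^{2r}$ preserving the standard symplectic form, with its Lie group topology. $\mathrm{H}_{\rm b}^\bullet(\Gamma)$ denotes the bounded cohomology (in the sense of Gromov) of the discrete group $\Gamma$ with trivial real coefficients, i.e. the cohomology of the complex of $\Gamma$-invariant bounded functions $\ell^\infty(\Gamma^{\bullet+1})^\Gamma$ with the homogeneous coboundary. No compatibility between the lattices $\Gamma_r$ for different $r$ is assumed; the isomorphisms are isomorphisms of vector spaces. *)

theory Defs
  imports
    "HOL-Analysis.Analysis"
    "HOL-Algebra.Left_Coset"
    "HOL-Algebra.AbelCoset"
    "HOL-Algebra.Module"
    "Jordan_Normal_Form.Matrix"
begin

no_notation vec_nth (infixl \<open>$\<close> 90)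
hide_const (open) Finite_Cartesian_Product.mat

section \<open>Symplectic groups\<close>

text \<open>The size \<open>r\<close> varies inside the statement, hence matrices with explicit dimensions.\<close>

definition symplectic_form :: "nat \<Rightarrow> 'a::comm_ring_1 Matrix.vec \<Rightarrow> 'a Matrix.vec \<Rightarrow> 'a" where
  "symplectic_form r v w = (\<Sum>i<r. v $ i * w $ (r + i) - v $ (r + i) * w $ i)"

definition Sp :: "nat \<Rightarrow> 'a::comm_ring_1 mat monoid" where
  "Sp r = \<lparr>carrier = {M \<in> carrier_mat (2 * r) (2 * r). invertible_mat M \<and>
              (\<forall>v \<in> carrier_vec (2 * r). \<forall>w \<in> carrier_vec (2 * r).
                 symplectic_form r (M *\<^sub>v v) (M *\<^sub>v w) = symplectic_form r v w)},
           monoid.mult = (*), one = 1\<^sub>m (2 * r)\<rparr>"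

text \<open>
  The points of the symplectic group with entries in a subring \<open>R\<close> of \<open>'a\<close>. Invertibility over
  \<open>R\<close> is automatic: if \<open>J\<close> is the Gram matrix of the form, the inverse of a symplectic \<open>M\<close> is
  \<open>J\<^sup>-\<^sup>1 M\<^sup>T J\<close>, which again has entries in \<open>R\<close>.
\<close>

definition Sp_over :: "'a::comm_ring_1 set \<Rightarrow> nat \<Rightarrow> 'a mat monoid" where
  "Sp_over R r = (Sp r)\<lparr>carrier := {M \<in> carrier (Sp r). elements_mat M \<subseteq> R}\<rparr>"

definition gaussian_integers :: "complex set" where
  "gaussian_integers = {z. Re z \<in> \<int> \<and> Im z \<in> \<int>}"

text \<open>
  The Lie group topology: the topology induced from the space of all \<open>2r \<times> 2r\<close> matrices, that is,
  from the product topology on the families of matrix entries.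
\<close>

definition Sp_topology :: "nat \<Rightarrow> 'a::{comm_ring_1,topological_space} mat topology" where
  "Sp_topology r = pullback_topology (carrier (Sp r))
     (\<lambda>M. \<lambda>ij \<in> {..<2 * r} \<times> {..<2 * r}. M $$ ij)
     (product_topology (\<lambda>_. euclidean) ({..<2 * r} \<times> {..<2 * r}))"


section \<open>Lattices\<close>

text \<open>
  The Borel sets of the quotient \<open>G/\<Gamma>\<close> are generated by the sets of left cosets that are open in
  the quotient topology, i.e. whose preimage in the group is open.
\<close>

definition quotient_borel ::
    "('g, 'b) monoid_scheme \<Rightarrow> 'g topology \<Rightarrow> 'g set \<Rightarrow> 'g set set set" where
  "quotient_borel G T \<Gamma> = sigma_sets (lcosets\<^bsub>G\<^esub> \<Gamma>)
     {U. U \<subseteq> lcosets\<^bsub>G\<^esub> \<Gamma> \<and> openin T {g \<in> carrier G. g <#\<^bsub>G\<^esub> \<Gamma> \<in> U}}"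

text \<open>
  A lattice is a discrete subgroup \<open>\<Gamma>\<close> such that \<open>G/\<Gamma>\<close> carries a nonzero finite Borel measure
  invariant under left translation by \<open>G\<close>.
\<close>

definition lattice_subgroup ::
    "('g, 'b) monoid_scheme \<Rightarrow> 'g topology \<Rightarrow> 'g set \<Rightarrow> bool" where
  "lattice_subgroup G T \<Gamma> \<longleftrightarrow>
     subgroup \<Gamma> G \<and> subtopology T \<Gamma> = discrete_topology \<Gamma> \<and>
     (\<exists>\<mu>. space \<mu> = lcosets\<^bsub>G\<^esub> \<Gamma> \<and> sets \<mu> = quotient_borel G T \<Gamma> \<and>
        finite_measure \<mu> \<and> emeasure \<mu> (space \<mu>) \<noteq> 0 \<and>
        (\<forall>g \<in> carrier G. \<forall>A \<in> sets \<mu>.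
           emeasure \<mu> ((\<lambda>C. g <#\<^bsub>G\<^esub> C) ` A) = emeasure \<mu> A))"


section \<open>Bounded cohomology of a discrete group\<close>

text \<open>
  A function on \<open>G\<^sup>q\<^sup>+\<^sup>1\<close> is represented by a function on lists that vanishes off the lists of
  length \<open>q + 1\<close> over the carrier.
\<close>

definition tuples :: "('g, 'b) monoid_scheme \<Rightarrow> nat \<Rightarrow> 'g list set" where
  "tuples G q = {gs. length gs = q + 1 \<and> set gs \<subseteq> carrier G}"

definition bounded_cochains :: "('g, 'b) monoid_scheme \<Rightarrow> nat \<Rightarrow> ('g list \<Rightarrow> real) set" where
  "bounded_cochains G q = {f. (\<forall>gs. gs \<notin> tuples G q \<longrightarrow> f gs = 0) \<and>
     bounded (f ` tuples G q) \<and>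
     (\<forall>g \<in> carrier G. \<forall>gs \<in> tuples G q. f (map (\<lambda>x. g \<otimes>\<^bsub>G\<^esub> x) gs) = f gs)}"

definition coboundary ::
    "('g, 'b) monoid_scheme \<Rightarrow> nat \<Rightarrow> ('g list \<Rightarrow> real) \<Rightarrow> 'g list \<Rightarrow> real" where
  "coboundary G q f gs = (if gs \<in> tuples G (q + 1)
     then \<Sum>i\<le>q + 1. (-1) ^ i * f (take i gs @ drop (Suc i) gs) else 0)"

definition bounded_cocycles :: "('g, 'b) monoid_scheme \<Rightarrow> nat \<Rightarrow> ('g list \<Rightarrow> real) set" where
  "bounded_cocycles G q = {f \<in> bounded_cochains G q. coboundary G q f = (\<lambda>_. 0)}"

fun bounded_coboundaries :: "('g, 'b) monoid_scheme \<Rightarrow> nat \<Rightarrow> ('g list \<Rightarrow> real) set" where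
  "bounded_coboundaries G 0 = {\<lambda>_. 0}"
| "bounded_coboundaries G (Suc q) = coboundary G q ` bounded_cochains G q"

text \<open>
  Real vector spaces are HOL-Algebra modules with scalars in the type \<open>real\<close>; the fields \<open>mult\<close>
  and \<open>one\<close>, which the module record inherits from rings, play no role.
\<close>

definition cocycle_space ::
    "('g, 'b) monoid_scheme \<Rightarrow> nat \<Rightarrow> (real, 'g list \<Rightarrow> real) module" where
  "cocycle_space G q = \<lparr>carrier = bounded_cocycles G q, monoid.mult = undefined, one = undefined,
     zero = (\<lambda>_. 0), add = (\<lambda>f h gs. f gs + h gs), smult = (\<lambda>c f gs. c * f gs)\<rparr>"

definition quotient_module :: "('k, 'v) module \<Rightarrow> 'v set \<Rightarrow> ('k, 'v set) module" where
  "quotient_module V N = \<lparr>carrier = a_rcosets\<^bsub>V\<^esub> N, monoid.mult = undefined, one = undefined,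
     zero = N, add = set_add V, smult = (\<lambda>c A. \<Union>x\<in>A. N +>\<^bsub>V\<^esub> (c \<odot>\<^bsub>V\<^esub> x))\<rparr>"

definition bounded_cohomology ::
    "('g, 'b) monoid_scheme \<Rightarrow> nat \<Rightarrow> (real, ('g list \<Rightarrow> real) set) module" where
  "bounded_cohomology G q = quotient_module (cocycle_space G q) (bounded_coboundaries G q)"

definition linearly_isomorphic :: "(real, 'v) module \<Rightarrow> (real, 'w) module \<Rightarrow> bool" where
  "linearly_isomorphic V W \<longleftrightarrow> (\<exists>h \<in> iso (add_monoid V) (add_monoid W).
     \<forall>c. \<forall>x \<in> carrier V. h (c \<odot>\<^bsub>V\<^esub> x) = c \<odot>\<^bsub>W\<^esub> h x)"

definition bounded_cohomology_stable :: "(nat \<Rightarrow> ('g, 'b) monoid_scheme) \<Rightarrow> bool" where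
  "bounded_cohomology_stable G \<longleftrightarrow> (\<forall>q. \<exists>r\<^sub>0\<ge>1. \<forall>r\<ge>r\<^sub>0.
     linearly_isomorphic (bounded_cohomology (G r) q) (bounded_cohomology (G (r + 1)) q))"

end

(*
  Only the isomorphism type of the vector spaces matters. Cardinals are well-ordered, so a sequence of
  vector spaces with a linear injection of each into its predecessor has eventually constant dimension;
  it is therefore enough to inject the bounded cohomology at r + 1 into that at r when r is large.

  For the groups Sp_2r(R) over a field or a Euclidean ring R the injection is restriction to the
  stabilizer of a hyperbolic pair. This is Quillen's argument on the complex of mutually orthogonal
  hyperbolic pairs, whose columns are exact by coning off with a pair orthogonal to all given ones, and
  whose augmentation is controlled by the symplectic maps exchanging two orthogonal pairs.

  For a lattice \<Gamma> in G = Sp_2r(k), averaging over G / \<Gamma> maps the bounded cohomology of \<Gamma> to that of G as a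
  discrete group. The obstruction to the injectivity of this map is a cocycle with values in the
  additive set functions on G / \<Gamma> which are dominated by the invariant measure and vanish on the whole
  space. A transvection along a vector u is central in the stabilizer of u and fixes all vectors
  orthogonal to u, so averaging over its powers and Quillen's argument on tuples of orthogonal vectors
  reduce the vanishing of the obstruction to the absence of set functions invariant under a
  transvection, which is the Mautner phenomenon. Radon-Nikodym densities turn the resulting primitive
  into one over \<Gamma>. The comparison map for lattices is averaging followed by restriction; that it is
  injective follows because averaging the restricted class again gives the restriction of the average.
*)
theory Submission
  imports Defs "HOL-Library.Function_Algebras" "Jordan_Normal_Form.Determinant"
begin

section \<open>Alternating sums over the faces of a list\<close>

text \<open>Nothing relates \<open>\<Gamma> (r + 1)\<close> to \<open>\<Gamma> r\<close>, so every
  comparison passes through the ambient group, taken as a discrete group: its cochains carry no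
  measurability, and measure theory enters only through the quotient by the lattice. This shapes the
  coefficients of the obstruction. For set functions, as opposed to classes of bounded measurable
  functions, equality, bounds and limits along a filter are all pointwise; finite additivity
  survives such limits, and domination by a finite measure restores countable additivity and hence
  densities at the end. Lattices are countable, so all the almost sure identities hold off one
  invariant null set. Two kinds of points occur. The stabilizer of a hyperbolic pair is the next
  smaller symplectic group, which suits stability; the stabilizer of a vector contains a
  transvection, which suits vanishing. The range \<open>2 * (q + 2)^2\<close> has two sources: the
  induction over degrees asks for a pair orthogonal to \<open>(q + 2)^2\<close> given ones, and n
  pairs in general position are only known to lie in a frame of 2 n pairs.\<close>

primrec bd :: "('x list \<Rightarrow> real) \<Rightarrow> 'x list \<Rightarrow> real" where
 "bd f [] = 0"
| "bd f (x # xs) = f xs - bd (\<lambda>ys. f (x # ys)) xs"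

lemma bd_eq_sum: "bd f xs = (\<Sum>i<length xs. (-1) ^ i * f (take i xs @ drop (Suc i) xs))"
proof (induction xs arbitrary: f)
 case (Cons x xs)
 show ?case
  unfolding bd.simps Cons list.size add_Suc_right sum.lessThan_Suc_shift
  by (simp add: sum_negf)
qed simp

lemma bd_cong:
 assumes "\<And>ys. length xs = Suc (length ys) \<Longrightarrow> set ys \<subseteq> set xs \<Longrightarrow> f ys = g ys"
 shows "bd f xs = bd g xs"
 using assms
proof (induction xs arbitrary: f g)
 case (Cons x xs)
 have "bd (\<lambda>ys. f (x # ys)) xs = bd (\<lambda>ys. g (x # ys)) xs"
  by (rule Cons.IH, rule Cons.prems) auto
 moreover have "f xs = g xs" by (rule Cons.prems) auto
 ultimately show ?case by simp
qed simp

lemma bd_add: "bd (\<lambda>ys. f ys + g ys) xs = bd f xs + bd g xs"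
 by (induction xs arbitrary: f g) (simp_all add: algebra_simps)

lemma bd_cmult: "bd (\<lambda>ys. c * f ys) xs = c * bd f xs"
 by (induction xs arbitrary: f) (simp_all add: algebra_simps)

lemma bd_diff: "bd (\<lambda>ys. f ys - g ys) xs = bd f xs - bd g xs"
 by (induction xs arbitrary: f g) (simp_all add: algebra_simps)

lemma bd_zero [simp]: "bd (\<lambda>ys. 0) xs = 0"
 by (induction xs) auto

lemma bd_sum: "bd (\<lambda>ys. \<Sum>i\<in>A. f i ys) xs = (\<Sum>i\<in>A. bd (f i) xs)"
 by (simp add: bd_eq_sum sum_distrib_left sum.swap[of _ A])

lemma bd_map: "bd f (map \<alpha> xs) = bd (\<lambda>ys. f (map \<alpha> ys)) xs"
 by (induction xs arbitrary: f) simp_all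

text \<open>Valid for one-element lists too, because the empty list counts as a face. The complex is
  thus augmented, and on lists of points the augmentation is the map from \<open>S\<close> to
  \<open>Y S 1\<close> below.\<close>

lemma bd_bd [simp]: "bd (bd f) xs = 0"
 by (induction xs arbitrary: f) (simp_all add: bd_diff)

text \<open>Makes the squares of the double complex in points and group entries commute, so that no
  signs enter the diagram chases.\<close>

lemma bd_swap: "bd (\<lambda>s. bd (\<lambda>t. f s t) ys) xs = bd (\<lambda>t. bd (\<lambda>s. f s t) xs) ys"
 by (induction xs arbitrary: f) (simp_all add: bd_diff)

lemma bd_bound:
 assumes "\<And>ys. length xs = Suc (length ys) \<Longrightarrow> set ys \<subseteq> set xs \<Longrightarrow> \<bar>f ys\<bar> \<le> C"
 shows "\<bar>bd f xs\<bar> \<le> real (length xs) * C"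
 using assms
proof (induction xs arbitrary: f)
 case (Cons x xs)
 have "\<bar>bd (\<lambda>ys. f (x # ys)) xs\<bar> \<le> real (length xs) * C"
  by (rule Cons.IH, rule Cons.prems) auto
 moreover have "\<bar>f xs\<bar> \<le> C" by (rule Cons.prems) auto
 ultimately show ?case by (simp add: algebra_simps)
qed simp

section \<open>Simplicial homotopies between induced maps\<close>

text \<open>The usual prism operator: the alternating sum of \<open>f\<close> over the lists
  \<alpha> x0, ..., \<alpha> xi, \<beta> xi, ..., \<beta> xn. It is used with equivariant pairs of
  maps, for which the resulting primitive is again invariant.\<close>

primrec prism :: "('x \<Rightarrow> 'y) \<Rightarrow> ('x \<Rightarrow> 'y) \<Rightarrow> ('y list \<Rightarrow> real) \<Rightarrow> 'x list \<Rightarrow> real" where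
 "prism \<alpha> \<beta> f [] = 0"
| "prism \<alpha> \<beta> f (x # xs) = f (\<alpha> x # \<beta> x # map \<beta> xs) - prism \<alpha> \<beta> (\<lambda>ys. f (\<alpha> x # ys)) xs"

lemma prism_diff: "prism \<alpha> \<beta> (\<lambda>ys. f ys - g ys) xs = prism \<alpha> \<beta> f xs - prism \<alpha> \<beta> g xs"
 by (induction xs arbitrary: f g) (simp_all add: algebra_simps)

lemma prism_zero [simp]: "prism \<alpha> \<beta> (\<lambda>ys. 0) xs = 0"
 by (induction xs) auto

lemma prism_homotopy:
 "bd (prism \<alpha> \<beta> f) xs + prism \<alpha> \<beta> (bd f) xs = f (map \<beta> xs) - f (map \<alpha> xs)"
proof (induction xs arbitrary: f)
 case (Cons x xs)
 show ?case
  using Cons[of "\<lambda>ys. f (\<alpha> x # ys)"]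
  by (simp add: bd_diff prism_diff bd_map)
qed simp

lemma prism_cong:
 assumes "\<And>ys. length ys = Suc (length xs) \<Longrightarrow> set ys \<subseteq> \<alpha> ` set xs \<union> \<beta> ` set xs \<Longrightarrow> f ys = g ys"
 shows "prism \<alpha> \<beta> f xs = prism \<alpha> \<beta> g xs"
 using assms
proof (induction xs arbitrary: f g)
 case (Cons x xs)
 have "prism \<alpha> \<beta> (\<lambda>ys. f (\<alpha> x # ys)) xs = prism \<alpha> \<beta> (\<lambda>ys. g (\<alpha> x # ys)) xs"
  by (rule Cons.IH, rule Cons.prems) auto
 moreover have "f (\<alpha> x # \<beta> x # map \<beta> xs) = g (\<alpha> x # \<beta> x # map \<beta> xs)"
  by (rule Cons.prems) auto
 ultimately show ?case by simp
qed simp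

lemma prism_bound:
 assumes "\<And>ys. length ys = Suc (length xs) \<Longrightarrow> set ys \<subseteq> \<alpha> ` set xs \<union> \<beta> ` set xs \<Longrightarrow> \<bar>f ys\<bar> \<le> C"
 shows "\<bar>prism \<alpha> \<beta> f xs\<bar> \<le> real (length xs) * C"
 using assms
proof (induction xs arbitrary: f)
 case (Cons x xs)
 have "\<bar>prism \<alpha> \<beta> (\<lambda>ys. f (\<alpha> x # ys)) xs\<bar> \<le> real (length xs) * C"
  by (rule Cons.IH, rule Cons.prems) auto
 moreover have "\<bar>f (\<alpha> x # \<beta> x # map \<beta> xs)\<bar> \<le> C"
  by (rule Cons.prems) auto
 ultimately show ?case by (simp add: algebra_simps)
qed simp

lemma prism_map: "prism \<alpha> \<beta> f (map h xs) = prism (\<alpha> \<circ> h) (\<beta> \<circ> h) f xs"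
 by (induction xs arbitrary: f) (simp_all add: comp_def)

lemma prism_map_fun: "prism (h \<circ> \<alpha>) (h \<circ> \<beta>) f xs = prism \<alpha> \<beta> (\<lambda>ys. f (map h ys)) xs"
 by (induction xs arbitrary: f) (simp_all add: comp_def)

lemma prism_fun_cong:
 assumes "\<And>x. x \<in> set xs \<Longrightarrow> \<alpha> x = \<alpha>' x" "\<And>x. x \<in> set xs \<Longrightarrow> \<beta> x = \<beta>' x"
 shows "prism \<alpha> \<beta> f xs = prism \<alpha>' \<beta>' f xs"
 using assms
proof (induction xs arbitrary: f)
 case (Cons x xs)
 have "map \<beta> xs = map \<beta>' xs" using Cons.prems by auto
 moreover have "prism \<alpha> \<beta> (\<lambda>ys. f (\<alpha> x # ys)) xs = prism \<alpha>' \<beta>' (\<lambda>ys. f (\<alpha> x # ys)) xs"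
  by (rule Cons.IH) (use Cons.prems in auto)
 moreover have "\<alpha> x = \<alpha>' x" "\<beta> x = \<beta>' x" using Cons.prems by auto
 ultimately show ?case by (simp only: prism.simps)
qed simp

lemma coboundary_eq_bd:
 assumes "gs \<in> tuples G (q + 1)"
 shows "coboundary G q f gs = bd f gs"
proof -
 have "length gs = q + 2" using assms by (auto simp: tuples_def)
 then have "{..<length gs} = {..q + 1}" by auto
 then show ?thesis using assms by (simp add: coboundary_def bd_eq_sum)
qed

lemma tuples_map:
 assumes "Group.group G" "g \<in> carrier G" "gs \<in> tuples G q"
 shows "map ((\<otimes>\<^bsub>G\<^esub>) g) gs \<in> tuples G q"
proof -
 interpret Group.group G by fact
 show ?thesis using assms by (auto simp: tuples_def)
qed

lemma tuples_face:
 assumes "gs \<in> tuples G (Suc q)" "length gs = Suc (length hs)" "set hs \<subseteq> set gs"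
 shows "hs \<in> tuples G q"
 using assms by (auto simp: tuples_def)

section \<open>Equivariant bounded cochains over tuples of perpendicular points\<close>

text \<open>One setting for two coefficient modules, each consisting of functions on an index set
  \<open>I\<close> dominated by multiples of \<open>wt\<close>. For real coefficients
  \<open>I\<close> is a single index of weight 1; for the obstruction \<open>I\<close> is a
  sigma-algebra and \<open>wt\<close> the invariant measure. The rank enters only through
  \<open>N\<close>, the number of points for which \<open>rich\<close> supplies a common
  perpendicular.\<close>

locale equivariant_complex = Group.group G for G :: "('g, 'b) monoid_scheme" (structure) +
 fixes act :: "'g \<Rightarrow> 'p \<Rightarrow> 'p" and P :: "'p set" and perp :: "'p \<Rightarrow> 'p \<Rightarrow> bool"
  and ia :: "'g \<Rightarrow> 'i \<Rightarrow> 'i" and I :: "'i set" and wt :: "'i \<Rightarrow> real"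
  and W :: "('i \<Rightarrow> real) set" and N :: nat
 assumes act_closed: "\<lbrakk>g \<in> carrier G; p \<in> P\<rbrakk> \<Longrightarrow> act g p \<in> P"
  and act_mult: "\<lbrakk>g \<in> carrier G; h \<in> carrier G; p \<in> P\<rbrakk> \<Longrightarrow> act (g \<otimes> h) p = act g (act h p)"
  and act_one: "p \<in> P \<Longrightarrow> act \<one> p = p"
  and perp_act: "\<lbrakk>g \<in> carrier G; a \<in> P; b \<in> P; perp a b\<rbrakk> \<Longrightarrow> perp (act g a) (act g b)"
  and rich: "\<lbrakk>length ps \<le> N; set ps \<subseteq> P\<rbrakk> \<Longrightarrow> \<exists>p\<in>P. \<forall>b\<in>set ps. perp p b"
  and ia_closed: "\<lbrakk>g \<in> carrier G; i \<in> I\<rbrakk> \<Longrightarrow> ia g i \<in> I"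
  and wt_nonneg: "i \<in> I \<Longrightarrow> 0 \<le> wt i"
  and wt_ia: "\<lbrakk>g \<in> carrier G; i \<in> I\<rbrakk> \<Longrightarrow> wt (ia g i) = wt i"
  and W_zero: "(\<lambda>i. 0) \<in> W"
  and W_add: "\<lbrakk>v \<in> W; w \<in> W\<rbrakk> \<Longrightarrow> (\<lambda>i. v i + w i) \<in> W"
  and W_cmult: "v \<in> W \<Longrightarrow> (\<lambda>i. c * v i) \<in> W"
begin

lemma act_inv: "\<lbrakk>g \<in> carrier G; p \<in> P\<rbrakk> \<Longrightarrow> act g (act (inv g) p) = p"
 by (metis act_mult act_one inv_closed r_inv)

lemma W_diff: "\<lbrakk>v \<in> W; w \<in> W\<rbrakk> \<Longrightarrow> (\<lambda>i. v i - w i) \<in> W"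
 using W_add[OF _ W_cmult[of w "-1"], of v] by simp

lemma W_bd:
 assumes "\<And>ys. length xs = Suc (length ys) \<Longrightarrow> set ys \<subseteq> set xs \<Longrightarrow> f ys \<in> W"
 shows "(\<lambda>i. bd (\<lambda>ys. f ys i) xs) \<in> W"
 using assms
proof (induction xs arbitrary: f)
 case (Cons x xs)
 have "(\<lambda>i. bd (\<lambda>ys. f (x # ys) i) xs) \<in> W"
  by (rule Cons.IH, rule Cons.prems) auto
 moreover have "f xs \<in> W" by (rule Cons.prems) auto
 ultimately show ?case by (simp add: W_diff)
qed (simp add: W_zero)

lemma W_prism:
 assumes "\<And>ys. length ys = Suc (length xs) \<Longrightarrow> set ys \<subseteq> \<alpha> ` set xs \<union> \<beta> ` set xs \<Longrightarrow> f ys \<in> W"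
 shows "(\<lambda>i. prism \<alpha> \<beta> (\<lambda>ys. f ys i) xs) \<in> W"
 using assms
proof (induction xs arbitrary: f)
 case (Cons x xs)
 have "(\<lambda>i. prism \<alpha> \<beta> (\<lambda>ys. f (\<alpha> x # ys) i) xs) \<in> W"
  by (rule Cons.IH, rule Cons.prems) auto
 moreover have "f (\<alpha> x # \<beta> x # map \<beta> xs) \<in> W" by (rule Cons.prems) auto
 ultimately show ?case by (simp add: W_diff)
qed (simp add: W_zero)

text \<open>Bounded cochains of the group with coefficients in bounded families over
  \<open>S\<close>: the constant is uniform in the points as well as in the group entries, so a
  primitive found one orbit at a time must come with a common bound.\<close>

definition cochain :: "'p list set \<Rightarrow> nat \<Rightarrow> ('p list \<Rightarrow> 'g list \<Rightarrow> 'i \<Rightarrow> real) \<Rightarrow> bool" where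
 "cochain S q f \<longleftrightarrow> (\<forall>s\<in>S. \<forall>gs\<in>tuples G q. f s gs \<in> W) \<and>
   (\<forall>g\<in>carrier G. \<forall>s\<in>S. \<forall>gs\<in>tuples G q. \<forall>i\<in>I.
    f (map (act g) s) (map ((\<otimes>) g) gs) (ia g i) = f s gs i) \<and>
   (\<exists>C. \<forall>s\<in>S. \<forall>gs\<in>tuples G q. \<forall>i\<in>I. \<bar>f s gs i\<bar> \<le> C * wt i)"

text \<open>Values off \<open>S\<close>, off the tuples and off \<open>I\<close> are arbitrary;
  equality of cochains always means agreement on these sets.\<close>

definition agree ::
  "'p list set \<Rightarrow> nat \<Rightarrow> ('p list \<Rightarrow> 'g list \<Rightarrow> 'i \<Rightarrow> real) \<Rightarrow> ('p list \<Rightarrow> 'g list \<Rightarrow> 'i \<Rightarrow> real) \<Rightarrow> bool" where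
 "agree S q f f' \<longleftrightarrow> (\<forall>s\<in>S. \<forall>gs\<in>tuples G q. \<forall>i\<in>I. f s gs i = f' s gs i)"

abbreviation null :: "'p list set \<Rightarrow> nat \<Rightarrow> ('p list \<Rightarrow> 'g list \<Rightarrow> 'i \<Rightarrow> real) \<Rightarrow> bool" where
 "null S q f \<equiv> agree S q f (\<lambda>s gs i. 0)"

definition dd :: "('p list \<Rightarrow> 'g list \<Rightarrow> 'i \<Rightarrow> real) \<Rightarrow> 'p list \<Rightarrow> 'g list \<Rightarrow> 'i \<Rightarrow> real" where
 "dd f s gs i = bd (\<lambda>hs. f s hs i) gs"

definition dl :: "nat \<Rightarrow> ('p list \<Rightarrow> 'g list \<Rightarrow> 'i \<Rightarrow> real) \<Rightarrow> 'p list \<Rightarrow> 'g list \<Rightarrow> 'i \<Rightarrow> real" where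
 "dl n f u gs i = bd (\<lambda>t. f (t @ drop n u) gs i) (take n u)"

definition cob :: "'p list set \<Rightarrow> nat \<Rightarrow> ('p list \<Rightarrow> 'g list \<Rightarrow> 'i \<Rightarrow> real) \<Rightarrow> bool" where
 "cob S q f \<longleftrightarrow> (case q of 0 \<Rightarrow> null S 0 f | Suc k \<Rightarrow> \<exists>w. cochain S k w \<and> agree S (Suc k) f (dd w))"

definition points :: "nat \<Rightarrow> 'p list set \<Rightarrow> bool" where
 "points m S \<longleftrightarrow> (\<forall>s\<in>S. length s = m \<and> set s \<subseteq> P \<and> (\<forall>g\<in>carrier G. map (act g) s \<in> S))"

text \<open>The added points are perpendicular to \<open>s\<close> but subject to no condition among
  themselves. A cone whose apex is perpendicular to \<open>s\<close> alone therefore stays inside,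
  so exactness of the columns costs no more than the length of \<open>s\<close>, however long
  \<open>t\<close> is.\<close>

definition Y :: "'p list set \<Rightarrow> nat \<Rightarrow> 'p list set" where
 "Y S n = {t @ s |t s. length t = n \<and> set t \<subseteq> P \<and> s \<in> S \<and> (\<forall>a\<in>set t. \<forall>b\<in>set s. perp a b)}"

lemma cochainD:
 assumes "cochain S q f"
 shows "\<And>s gs. s \<in> S \<Longrightarrow> gs \<in> tuples G q \<Longrightarrow> f s gs \<in> W"
  "\<And>g s gs i. g \<in> carrier G \<Longrightarrow> s \<in> S \<Longrightarrow> gs \<in> tuples G q \<Longrightarrow> i \<in> I \<Longrightarrow>
    f (map (act g) s) (map ((\<otimes>) g) gs) (ia g i) = f s gs i"
 using assms unfolding cochain_def by blast+

lemma cochain_bound: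
 assumes "cochain S q f"
 obtains C where "0 \<le> C" "\<forall>s\<in>S. \<forall>gs\<in>tuples G q. \<forall>i\<in>I. \<bar>f s gs i\<bar> \<le> C * wt i"
proof -
 obtain C where C: "\<forall>s\<in>S. \<forall>gs\<in>tuples G q. \<forall>i\<in>I. \<bar>f s gs i\<bar> \<le> C * wt i"
  using assms unfolding cochain_def by blast
 show ?thesis
 proof (rule that[of "\<bar>C\<bar>"])
  show "\<forall>s\<in>S. \<forall>gs\<in>tuples G q. \<forall>i\<in>I. \<bar>f s gs i\<bar> \<le> \<bar>C\<bar> * wt i"
  proof (intro ballI)
   fix s gs i assume "s \<in> S" "gs \<in> tuples G q" "i \<in> I"
   with C[rule_format, OF this] wt_nonneg[of i] show "\<bar>f s gs i\<bar> \<le> \<bar>C\<bar> * wt i"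
    by (meson abs_ge_self mult_right_mono order_trans)
  qed
 qed simp
qed

lemma cochainI:
 assumes "\<And>s gs. s \<in> S \<Longrightarrow> gs \<in> tuples G q \<Longrightarrow> f s gs \<in> W"
  "\<And>g s gs i. g \<in> carrier G \<Longrightarrow> s \<in> S \<Longrightarrow> gs \<in> tuples G q \<Longrightarrow> i \<in> I \<Longrightarrow>
    f (map (act g) s) (map ((\<otimes>) g) gs) (ia g i) = f s gs i"
  "\<And>s gs i. s \<in> S \<Longrightarrow> gs \<in> tuples G q \<Longrightarrow> i \<in> I \<Longrightarrow> \<bar>f s gs i\<bar> \<le> C * wt i"
 shows "cochain S q f"
 unfolding cochain_def
 by (intro conjI ballI exI[of _ C]) (rule assms; assumption)+

lemma cochain_subset:
 assumes "cochain S q f" "T \<subseteq> S"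
 shows "cochain T q f"
proof -
 obtain C where "0 \<le> C" and C0: "\<forall>s\<in>S. \<forall>gs\<in>tuples G q. \<forall>i\<in>I. \<bar>f s gs i\<bar> \<le> C * wt i"
  by (rule cochain_bound[OF assms(1)])
 note C = C0[rule_format]
 note sub = subsetD[OF assms(2)]
 show ?thesis
  by (rule cochainI[of _ _ _ C])
   (rule cochainD[OF assms(1)] C; (rule sub)?; assumption)+
qed

lemma agree_subset: "agree S q f f' \<Longrightarrow> T \<subseteq> S \<Longrightarrow> agree T q f f'"
 unfolding agree_def by blast

lemma cochain_zero: "cochain S q (\<lambda>s gs i. 0)"
 by (rule cochainI[of _ _ _ 0]) (auto simp: W_zero)

lemma cochain_add:
 assumes "cochain S q f" "cochain S q f'"
 shows "cochain S q (\<lambda>s gs i. f s gs i + f' s gs i)"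
proof -
 obtain C where "0 \<le> C" and C0: "\<forall>s\<in>S. \<forall>gs\<in>tuples G q. \<forall>i\<in>I. \<bar>f s gs i\<bar> \<le> C * wt i"
  by (rule cochain_bound[OF assms(1)])
 note C = C0[rule_format]
 obtain C' where "0 \<le> C'" and C'0: "\<forall>s\<in>S. \<forall>gs\<in>tuples G q. \<forall>i\<in>I. \<bar>f' s gs i\<bar> \<le> C' * wt i"
  by (rule cochain_bound[OF assms(2)])
 note C' = C'0[rule_format]
 show ?thesis
 proof (rule cochainI[of _ _ _ "C + C'"])
  fix s gs i assume "s \<in> S" "gs \<in> tuples G q" "i \<in> I"
  from C[OF this] C'[OF this] show "\<bar>f s gs i + f' s gs i\<bar> \<le> (C + C') * wt i"
   by (simp add: algebra_simps)
 next
  fix s gs assume "s \<in> S" "gs \<in> tuples G q"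
  then show "(\<lambda>i. f s gs i + f' s gs i) \<in> W"
   by (intro W_add cochainD(1)[OF assms(1)] cochainD(1)[OF assms(2)])
 next
  fix g s gs i assume "g \<in> carrier G" "s \<in> S" "gs \<in> tuples G q" "i \<in> I"
  note this = cochainD(2)[OF assms(1) this] cochainD(2)[OF assms(2) this]
  then show "f (map (act g) s) (map ((\<otimes>) g) gs) (ia g i) + f' (map (act g) s) (map ((\<otimes>) g) gs) (ia g i)
   = f s gs i + f' s gs i" by simp
 qed
qed

lemma cochain_cmult:
 assumes "cochain S q f"
 shows "cochain S q (\<lambda>s gs i. c * f s gs i)"
proof -
 obtain C where "0 \<le> C" and C0: "\<forall>s\<in>S. \<forall>gs\<in>tuples G q. \<forall>i\<in>I. \<bar>f s gs i\<bar> \<le> C * wt i"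
  by (rule cochain_bound[OF assms(1)])
 note C = C0[rule_format]
 show ?thesis
 proof (rule cochainI[of _ _ _ "\<bar>c\<bar> * C"])
  fix s gs i assume "s \<in> S" "gs \<in> tuples G q" "i \<in> I"
  from C[OF this] have "\<bar>c\<bar> * \<bar>f s gs i\<bar> \<le> \<bar>c\<bar> * (C * wt i)"
   by (rule mult_left_mono) simp
  then show "\<bar>c * f s gs i\<bar> \<le> (\<bar>c\<bar> * C) * wt i"
   by (simp add: abs_mult)
 next
  fix s gs assume "s \<in> S" "gs \<in> tuples G q"
  then show "(\<lambda>i. c * f s gs i) \<in> W"
   by (intro W_cmult cochainD(1)[OF assms])
 next
  fix g s gs i assume "g \<in> carrier G" "s \<in> S" "gs \<in> tuples G q" "i \<in> I"
  from cochainD(2)[OF assms this]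
  show "c * f (map (act g) s) (map ((\<otimes>) g) gs) (ia g i) = c * f s gs i" by simp
 qed
qed

lemma cochain_diff:
 assumes "cochain S q f" "cochain S q f'"
 shows "cochain S q (\<lambda>s gs i. f s gs i - f' s gs i)"
 using cochain_add[OF assms(1) cochain_cmult[OF assms(2), of "-1"]] by simp

lemma dd_face:
 assumes "agree S q f f'"
 shows "agree S (Suc q) (dd f) (dd f')"
 unfolding agree_def dd_def
 by (intro ballI bd_cong) (use assms in \<open>auto simp: agree_def intro!: tuples_face\<close>)

lemma dd_dd: "dd (dd f) s gs i = 0"
 by (simp add: dd_def)

lemma dd_diff: "dd (\<lambda>s gs i. f s gs i - f' s gs i) s gs i = dd f s gs i - dd f' s gs i"
 by (simp add: dd_def bd_diff)

lemma dl_diff: "dl n (\<lambda>s gs i. f s gs i - f' s gs i) s gs i = dl n f s gs i - dl n f' s gs i"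
 by (simp add: dl_def bd_diff)

lemma dd_add: "dd (\<lambda>s gs i. f s gs i + f' s gs i) s gs i = dd f s gs i + dd f' s gs i"
 by (simp add: dd_def bd_add)

lemma dl_dd: "dl n (dd f) = dd (dl n f)"
 by (intro ext) (simp add: dd_def dl_def bd_swap[of _ "take n _"])

lemma cochain_dd:
 assumes "cochain S q f"
 shows "cochain S (Suc q) (dd f)"
proof -
 obtain C where "0 \<le> C" and C0: "\<forall>s\<in>S. \<forall>gs\<in>tuples G q. \<forall>i\<in>I. \<bar>f s gs i\<bar> \<le> C * wt i"
  by (rule cochain_bound[OF assms(1)])
 note C = C0[rule_format]
 show ?thesis
 proof (rule cochainI[of _ _ _ "real (q + 2) * C"])
  fix s gs assume s: "s \<in> S" and gs: "gs \<in> tuples G (Suc q)"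
  show "dd f s gs \<in> W"
   unfolding dd_def[abs_def] by (intro W_bd cochainD(1)[OF assms] s tuples_face[OF gs])
  fix i assume i: "i \<in> I"
  have "\<bar>dd f s gs i\<bar> \<le> real (length gs) * (C * wt i)"
   unfolding dd_def by (rule bd_bound) (intro C s i tuples_face[OF gs])
  then show "\<bar>dd f s gs i\<bar> \<le> real (q + 2) * C * wt i"
   using gs by (simp add: tuples_def mult.assoc)
  fix g assume "g \<in> carrier G"
  then show "dd f (map (act g) s) (map ((\<otimes>) g) gs) (ia g i) = dd f s gs i"
   unfolding dd_def bd_map by (intro bd_cong cochainD[OF assms] s i tuples_face[OF gs])
 qed
qed

lemma YI: "length t = n \<Longrightarrow> set t \<subseteq> P \<Longrightarrow> s \<in> S \<Longrightarrow> (\<And>a b. a \<in> set t \<Longrightarrow> b \<in> set s \<Longrightarrow> perp a b)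
  \<Longrightarrow> t @ s \<in> Y S n"
 unfolding Y_def by blast

lemma YE:
 assumes "u \<in> Y S n"
 obtains t s where "u = t @ s" "length t = n" "set t \<subseteq> P" "s \<in> S" "\<forall>a\<in>set t. \<forall>b\<in>set s. perp a b"
 using assms unfolding Y_def by blast

lemma Y_append:
 assumes "t @ s \<in> Y S n" "length t = n"
 shows "set t \<subseteq> P" "s \<in> S" "\<And>a b. a \<in> set t \<Longrightarrow> b \<in> set s \<Longrightarrow> perp a b"
 using assms by (auto elim!: YE)

lemma Y_face:
 assumes "t @ s \<in> Y S (Suc n)" "length t = Suc n" "length t = Suc (length t')" "set t' \<subseteq> set t"
 shows "t' @ s \<in> Y S n"
proof (rule YI)
 show "length t' = n" using assms by simp
qed (use Y_append[OF assms(1,2)] assms(4) in auto)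

lemma Y_0 [simp]: "Y S 0 = S"
 by (auto simp: Y_def)

lemma points_Y:
 assumes "points m S"
 shows "points (n + m) (Y S n)"
 unfolding points_def
proof
 fix u assume "u \<in> Y S n"
 then obtain t s where u: "u = t @ s" "length t = n" "set t \<subseteq> P" "s \<in> S"
  and perp: "\<forall>a\<in>set t. \<forall>b\<in>set s. perp a b" by (rule YE)
 have s: "length s = m" "set s \<subseteq> P" "\<And>g. g \<in> carrier G \<Longrightarrow> map (act g) s \<in> S"
  using assms u(4) by (auto simp: points_def)
 have "map (act g) (t @ s) \<in> Y S n" if g: "g \<in> carrier G" for g
  unfolding map_append
 proof (rule YI)
  show "set (map (act g) t) \<subseteq> P" using u(3) g by (auto intro: act_closed)
  fix a b assume "a \<in> set (map (act g) t)" "b \<in> set (map (act g) s)"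
  then obtain a' b' where "a' \<in> set t" "b' \<in> set s" "a = act g a'" "b = act g b'" by auto
  then show "perp a b" using perp u(3) s(2) g by (auto intro!: perp_act)
 qed (use u s g in auto)
 then show "length u = n + m \<and> set u \<subseteq> P \<and> (\<forall>g\<in>carrier G. map (act g) u \<in> Y S n)"
  using u s by auto
qed

text \<open>On the left the new point must be perpendicular to the other added points as well.
  Restricting cochains along this inclusion is the first move in the contraction of the
  rows.\<close>

lemma Y_Y_subset: "Y (Y S n) 1 \<subseteq> Y S (Suc n)"
proof
 fix u assume "u \<in> Y (Y S n) 1"
 then obtain w v where u: "u = w @ v" "length w = 1" "set w \<subseteq> P" "v \<in> Y S n"
  and p: "\<forall>a\<in>set w. \<forall>b\<in>set v. perp a b" by (rule YE)
 obtain t s where v: "v = t @ s" "length t = n" "set t \<subseteq> P" "s \<in> S"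
  "\<forall>a\<in>set t. \<forall>b\<in>set s. perp a b" using u(4) by (rule YE)
 have "(w @ t) @ s \<in> Y S (Suc n)"
  using u v p by (intro YI) auto
 then show "u \<in> Y S (Suc n)" by (simp add: u v)
qed

lemma cochain_dl:
 assumes "points m S" "cochain (Y S n) q f"
 shows "cochain (Y S (Suc n)) q (dl (Suc n) f)"
proof -
 obtain C where "0 \<le> C" and C0: "\<forall>s\<in>Y S n. \<forall>gs\<in>tuples G q. \<forall>i\<in>I. \<bar>f s gs i\<bar> \<le> C * wt i"
  by (rule cochain_bound[OF assms(2)])
 note C = C0[rule_format]
 show ?thesis
 proof (rule cochainI[of _ _ _ "real (Suc n) * C"])
  fix u gs assume u: "u \<in> Y S (Suc n)" and gs: "gs \<in> tuples G q"
  obtain t s where ts: "u = t @ s" "length t = Suc n" using u by (rule YE)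
  have face: "t' @ s \<in> Y S n" if "length t = Suc (length t')" "set t' \<subseteq> set t" for t'
   using Y_face u ts that by blast
  show "dl (Suc n) f u gs \<in> W"
   unfolding dl_def[abs_def] using ts face gs
   by (intro W_bd cochainD[OF assms(2)]) auto
  fix i assume i: "i \<in> I"
  have "\<bar>bd (\<lambda>t. f (t @ s) gs i) t\<bar> \<le> real (length t) * (C * wt i)"
   by (rule bd_bound) (intro C face gs i)
  then show "\<bar>dl (Suc n) f u gs i\<bar> \<le> real (Suc n) * C * wt i"
   using ts by (simp add: dl_def mult.assoc)
  fix g assume g: "g \<in> carrier G"
  have "bd (\<lambda>t. f (t @ map (act g) s) (map ((\<otimes>) g) gs) (ia g i)) (map (act g) t) = bd (\<lambda>t. f (t @ s) gs i) t"
   unfolding bd_map map_append[symmetric]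
   by (intro bd_cong cochainD[OF assms(2)] face g i gs)
  then show "dl (Suc n) f (map (act g) u) (map ((\<otimes>) g) gs) (ia g i) = dl (Suc n) f u gs i"
   using ts by (simp add: dl_def)
 qed
qed

lemma dl_agree:
 assumes "agree (Y S n) q f f'"
 shows "agree (Y S (Suc n)) q (dl (Suc n) f) (dl (Suc n) f')"
 unfolding agree_def
proof (intro ballI)
 fix u gs i assume u: "u \<in> Y S (Suc n)" and gs: "gs \<in> tuples G q" and i: "i \<in> I"
 obtain t s where ts: "u = t @ s" "length t = Suc n" using u by (rule YE)
 have face: "t' @ s \<in> Y S n" if "length t = Suc (length t')" "set t' \<subseteq> set t" for t'
  using Y_face u ts that by blast
 have "bd (\<lambda>t. f (t @ s) gs i) t = bd (\<lambda>t. f' (t @ s) gs i) t"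
  by (intro bd_cong) (use assms face gs i in \<open>auto simp: agree_def\<close>)
 then show "dl (Suc n) f u gs i = dl (Suc n) f' u gs i"
  using ts by (simp add: dl_def)
qed

lemma dl_dl: "null (Y S (Suc (Suc n))) q (dl (Suc (Suc n)) (dl (Suc n) f))"
 unfolding agree_def
proof (intro ballI)
 fix u gs i assume u: "u \<in> Y S (Suc (Suc n))"
 obtain t s where ts: "u = t @ s" "length t = Suc (Suc n)" using u by (rule YE)
 have "bd (\<lambda>t. dl (Suc n) f (t @ s) gs i) t = bd (bd (\<lambda>t. f (t @ s) gs i)) t"
  by (rule bd_cong) (use ts in \<open>simp add: dl_def\<close>)
 then show "dl (Suc (Suc n)) (dl (Suc n) f) u gs i = 0"
  using ts by (simp add: dl_def)
qed

lemma dl_1: "dl 1 f (w # u) gs i = f u gs i"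
 by (simp add: dl_def)

lemma Y_1I: "w \<in> P \<Longrightarrow> s \<in> S \<Longrightarrow> (\<And>b. b \<in> set s \<Longrightarrow> perp w b) \<Longrightarrow> w # s \<in> Y S 1"
 using YI[of "[w]" 1 s S] by simp

lemma Y_1E:
 assumes "u \<in> Y S 1"
 obtains w s where "u = w # s" "w \<in> P" "s \<in> S" "\<forall>b\<in>set s. perp w b"
 using assms by (fastforce simp: Y_def length_Suc_conv)

text \<open>Every \<open>s\<close> is a face of some \<open>w # s\<close>, and \<open>dl 1\<close>
  merely forgets \<open>w\<close>.\<close>

lemma dl_injective:
 assumes "points m S" "m \<le> N" "null (Y S 1) q (dl 1 x)"
 shows "null S q x"
 unfolding agree_def
proof (intro ballI)
 fix s gs i assume s: "s \<in> S" and gs: "gs \<in> tuples G q" and i: "i \<in> I"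
 have "length s \<le> N" "set s \<subseteq> P" using assms s by (auto simp: points_def)
 then obtain w where "w \<in> P" "\<forall>b\<in>set s. perp w b" using rich by blast
 then have "w # s \<in> Y S 1" using s by (intro Y_1I) auto
 then have "dl 1 x (w # s) gs i = 0" using assms(3) gs i by (simp add: agree_def)
 then show "x s gs i = 0" by (simp only: dl_1)
qed

text \<open>A cone with apex \<open>b s\<close> perpendicular to \<open>s\<close>, translated by the first group entry to make it
 equivariant.\<close>

lemma column_exact:
 assumes S: "points m S" and m: "m \<le> N" and x: "cochain (Y S (Suc n)) q x"
  and dx: "null (Y S (Suc (Suc n))) q (dl (Suc (Suc n)) x)"
 shows "\<exists>y. cochain (Y S n) q y \<and> agree (Y S (Suc n)) q x (dl (Suc n) y)"
proof -
 have "\<forall>s\<in>S. \<exists>w\<in>P. \<forall>b\<in>set s. perp w b"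
  using S m by (intro ballI rich) (auto simp: points_def)
 then obtain b where b: "\<And>s. s \<in> S \<Longrightarrow> b s \<in> P" "\<And>s a. s \<in> S \<Longrightarrow> a \<in> set s \<Longrightarrow> perp (b s) a"
  by metis
 define c where "c g s = act g (b (map (act (inv g)) s))" for g s
 define y where "y u gs = x (c (hd gs) (drop n u) # u) gs" for u gs
 have mapinv: "map (act g) (map (act (inv g)) s) = s" if "g \<in> carrier G" "s \<in> S" for g s
 proof -
  have "set s \<subseteq> P" using that S by (auto simp: points_def)
  then have "\<And>p. p \<in> set s \<Longrightarrow> (act g \<circ> act (inv g)) p = p"
   using that(1) act_inv by auto
  then show ?thesis unfolding map_map by (rule map_idI)
 qed
 have invS: "map (act g) s \<in> S" if "g \<in> carrier G" "s \<in> S" for g s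
  using that S by (auto simp: points_def)
 have SP: "set s \<subseteq> P" if "s \<in> S" for s
  using that S by (auto simp: points_def)
 have c: "c g s \<in> P" "\<And>a. a \<in> set s \<Longrightarrow> perp (c g s) a" if "g \<in> carrier G" "s \<in> S" for g s
 proof -
  let ?s = "map (act (inv g)) s"
  have s: "?s \<in> S" using that invS by auto
  then show "c g s \<in> P" using b that by (simp add: c_def act_closed)
  fix a assume a: "a \<in> set s"
  then have "perp (b ?s) (act (inv g) a)" using b(2)[OF s] by auto
  then have "perp (act g (b ?s)) (act g (act (inv g) a))"
   using a that SP s b by (intro perp_act) (auto intro!: act_closed)
  then show "perp (c g s) a"
   using a that SP[OF that(2)] act_inv[of g a] by (simp add: c_def subset_iff)
 qed
 have c_act: "c (g \<otimes> h) (map (act g) s) = act g (c h s)"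
  if "g \<in> carrier G" "h \<in> carrier G" "s \<in> S" for g h s
 proof -
  have "act (inv (g \<otimes> h)) (act g p) = act (inv h) p" if "p \<in> set s" for p
  proof -
   have "inv (g \<otimes> h) \<otimes> g = inv h"
    using \<open>g \<in> carrier G\<close> \<open>h \<in> carrier G\<close> by (simp add: inv_mult_group m_assoc)
   moreover have "p \<in> P" using SP[OF \<open>s \<in> S\<close>] that by auto
   ultimately show ?thesis
    using \<open>g \<in> carrier G\<close> \<open>h \<in> carrier G\<close> act_mult[of "inv (g \<otimes> h)" g p] by simp
  qed
  then have "map (act (inv (g \<otimes> h))) (map (act g) s) = map (act (inv h)) s" by simp
  moreover have "b (map (act (inv h)) s) \<in> P" using b(1) invS that by simp
  ultimately show ?thesis
   unfolding c_def using that by (simp add: act_mult del: map_map)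
 qed
 have cone: "c g s # t @ s \<in> Y S (Suc n)" if "t @ s \<in> Y S n" "length t = n" "g \<in> carrier G" for t s g
 proof -
  note ts = Y_append[OF that(1,2)]
  have "(c g s # t) @ s \<in> Y S (Suc n)"
   by (rule YI) (use ts c[OF that(3) ts(2)] that(2) in auto)
  then show ?thesis by simp
 qed
 have hd: "hd gs \<in> carrier G" "gs \<noteq> []" if gs: "gs \<in> tuples G q" for gs
 proof -
  obtain a as where "gs = a # as" using gs by (cases gs) (auto simp: tuples_def)
  then show "hd gs \<in> carrier G" "gs \<noteq> []" using gs by (auto simp: tuples_def)
 qed
 obtain C where "0 \<le> C" and C0: "\<forall>s\<in>Y S (Suc n). \<forall>gs\<in>tuples G q. \<forall>i\<in>I. \<bar>x s gs i\<bar> \<le> C * wt i"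
  by (rule cochain_bound[OF x])
 note C = C0[rule_format]
 have "cochain (Y S n) q y"
 proof (rule cochainI[of _ _ _ C])
  fix u gs assume u: "u \<in> Y S n" and gs: "gs \<in> tuples G q"
  obtain t s where ts: "u = t @ s" "length t = n" "s \<in> S" using u by (rule YE)
  have cu: "c (hd gs) s # t @ s \<in> Y S (Suc n)" using cone u ts hd gs by auto
  then show "y u gs \<in> W" using cochainD[OF x] gs ts by (simp add: y_def)
  fix i assume i: "i \<in> I"
  show "\<bar>y u gs i\<bar> \<le> C * wt i" using C cu gs i ts by (simp add: y_def)
  fix g assume g: "g \<in> carrier G"
  have "hd (map ((\<otimes>) g) gs) = g \<otimes> hd gs" using hd gs by (simp add: hd_map)
  then have "y (map (act g) u) (map ((\<otimes>) g) gs) (ia g i)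
    = x (map (act g) (c (hd gs) s # t @ s)) (map ((\<otimes>) g) gs) (ia g i)"
   using ts g hd gs by (simp add: y_def c_act)
  also have "\<dots> = x (c (hd gs) s # t @ s) gs i"
   using cochainD(2)[OF x g cu gs i] .
  finally show "y (map (act g) u) (map ((\<otimes>) g) gs) (ia g i) = y u gs i"
   using ts by (simp add: y_def)
 qed
 moreover have "agree (Y S (Suc n)) q x (dl (Suc n) y)"
  unfolding agree_def
 proof (intro ballI)
  fix u gs i assume u: "u \<in> Y S (Suc n)" and gs: "gs \<in> tuples G q" and i: "i \<in> I"
  obtain t s where ts: "u = t @ s" "length t = Suc n" "set t \<subseteq> P" "s \<in> S"
   "\<forall>a\<in>set t. \<forall>b\<in>set s. perp a b" using u by (rule YE)
  let ?c = "c (hd gs) s"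
  have "(?c # t) @ s \<in> Y S (Suc (Suc n))"
   by (rule YI) (use ts c[OF hd(1)[OF gs] ts(4)] in auto)
  then have "dl (Suc (Suc n)) x ((?c # t) @ s) gs i = 0"
   using dx gs i by (auto simp: agree_def)
  \<comment> \<open>In the vanishing differential of the cone over \<open>t @ s\<close>, the face
    omitting the apex is \<open>x\<close> itself, and the faces keeping the apex are values of
    \<open>y\<close>.\<close>
  then have "x (t @ s) gs i = bd (\<lambda>t. x (?c # t @ s) gs i) t"
   using ts by (simp add: dl_def)
  also have "\<dots> = bd (\<lambda>t. y (t @ s) gs i) t"
   by (rule bd_cong) (use ts in \<open>simp add: y_def\<close>)
  finally show "x u gs i = dl (Suc n) y u gs i"
   using ts by (simp add: dl_def)
 qed
 ultimately show ?thesis by blast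
qed

end

section \<open>Diagram chases in the double complex\<close>

context equivariant_complex
begin

lemma agree_trans: "agree S q f f' \<Longrightarrow> agree S q f' f'' \<Longrightarrow> agree S q f f''"
 unfolding agree_def by simp

lemma cob_0 [simp]: "cob S 0 f \<longleftrightarrow> null S 0 f"
 by (simp add: cob_def)

lemma cob_Suc: "cob S (Suc k) f \<longleftrightarrow> (\<exists>w. cochain S k w \<and> agree S (Suc k) f (dd w))"
 by (simp add: cob_def)

lemma cob_agree:
 assumes "cob S q f" "agree S q f' f"
 shows "cob S q f'"
 using assms by (cases q) (auto simp: cob_Suc intro: agree_trans)

lemma cob_diff:
 assumes "cob S q f" "cob S q f'"
 shows "cob S q (\<lambda>s gs i. f s gs i - f' s gs i)"
proof (cases q)
 case 0
 with assms show ?thesis by (simp add: agree_def)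
next
 case (Suc k)
 obtain w where w: "cochain S k w" "agree S (Suc k) f (dd w)"
  using assms(1) Suc by (auto simp: cob_Suc)
 obtain w' where w': "cochain S k w'" "agree S (Suc k) f' (dd w')"
  using assms(2) Suc by (auto simp: cob_Suc)
 have "agree S (Suc k) (\<lambda>s gs i. f s gs i - f' s gs i) (dd (\<lambda>s gs i. w s gs i - w' s gs i))"
  using w w' by (simp add: agree_def dd_diff)
 then show ?thesis
  using cochain_diff[OF w(1) w'(1)] unfolding Suc cob_Suc by blast
qed

lemma cob_zero: "cob S q (\<lambda>s gs i. 0)"
proof (cases q)
 case (Suc k)
 have "agree S (Suc k) (\<lambda>s gs i. 0) (dd (\<lambda>s gs i. 0))" by (simp add: agree_def dd_def)
 then show ?thesis using cochain_zero unfolding Suc cob_Suc by blast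
qed (simp add: agree_def)

lemma cob_cocycle:
 assumes "cob S q f"
 shows "null S (Suc q) (dd f)"
proof (cases q)
 case 0
 then have "null S 0 f" using assms by simp
 from dd_face[OF this] show ?thesis by (simp add: 0 agree_def dd_def)
next
 case (Suc k)
 then obtain w where w: "cochain S k w" "agree S (Suc k) f (dd w)"
  using assms by (auto simp: cob_Suc)
 from dd_face[OF w(2)] show ?thesis by (simp add: Suc agree_def dd_dd)
qed

text \<open>Exactness of the row of cohomology groups in degree \<open>k\<close>, tested only on
  cocycles that \<open>dl\<close> annihilates on the nose and not merely up to coboundaries. This
  weaker form is what the chase below can use, since there the class is always of the shape
  \<open>dl y\<close>.\<close>

definition row_exact :: "'p list set \<Rightarrow> nat \<Rightarrow> nat \<Rightarrow> bool" where
 "row_exact S n k \<longleftrightarrow> (\<forall>x. cochain (Y S (Suc n)) k x \<longrightarrow> null (Y S (Suc n)) (Suc k) (dd x) \<longrightarrow>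
   null (Y S (Suc (Suc n))) k (dl (Suc (Suc n)) x) \<longrightarrow>
   (\<exists>z. cochain (Y S n) k z \<and> null (Y S n) (Suc k) (dd z) \<and>
    cob (Y S (Suc n)) k (\<lambda>s gs i. x s gs i - dl (Suc n) z s gs i)))"

text \<open>The differentials of a spectral sequence, done by hand along one antidiagonal: column
  plus degree is constant in \<open>rows\<close>. Row exactness replaces \<open>dl y\<close> by
  \<open>dl z\<close> up to some \<open>dd y'\<close>. The induction hypothesis applied to
  \<open>y'\<close>, one degree lower and one column further, turns \<open>dd y'\<close> into
  \<open>dl (dd v')\<close>. Then \<open>y - z - dd v'\<close> is killed by \<open>dl\<close>, and
  column exactness yields \<open>v\<close>.\<close>

lemma zigzag:
 assumes S: "points m S" "m \<le> N"
  and rows: "\<And>j. j \<le> k \<Longrightarrow> row_exact S (Suc n + (k - j)) j"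
  and y: "cochain (Y S (Suc n)) k y" "null (Y S (Suc (Suc n))) (Suc k) (dd (dl (Suc (Suc n)) y))"
 shows "\<exists>z v. cochain (Y S (Suc n)) k z \<and> null (Y S (Suc n)) (Suc k) (dd z) \<and> cochain (Y S n) k v \<and>
   agree (Y S (Suc n)) k y (\<lambda>s gs i. z s gs i + dl (Suc n) v s gs i)"
 using rows y
proof (induction k arbitrary: n y)
 case 0
 let ?x = "dl (Suc (Suc n)) y"
 have "row_exact S (Suc n) 0" using "0.prems"(1)[of 0] by simp
 then obtain z where z: "cochain (Y S (Suc n)) 0 z" "null (Y S (Suc n)) (Suc 0) (dd z)"
   "null (Y S (Suc (Suc n))) 0 (\<lambda>s gs i. ?x s gs i - dl (Suc (Suc n)) z s gs i)"
  using cochain_dl[OF S(1) "0.prems"(2)] "0.prems"(3) dl_dl unfolding row_exact_def cob_0 by blast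
 let ?y = "\<lambda>s gs i. y s gs i - z s gs i"
 have y: "cochain (Y S (Suc n)) 0 ?y" using "0.prems"(2) z(1) by (rule cochain_diff)
 have "null (Y S (Suc (Suc n))) 0 (dl (Suc (Suc n)) ?y)"
  using z(3) by (simp add: agree_def dl_diff)
 then obtain v where "cochain (Y S n) 0 v" "agree (Y S (Suc n)) 0 ?y (dl (Suc n) v)"
  using column_exact[OF S y] by blast
 moreover from this have "agree (Y S (Suc n)) 0 y (\<lambda>s gs i. z s gs i + dl (Suc n) v s gs i)"
  by (simp add: agree_def algebra_simps)
 ultimately show ?case using z by blast
next
 case (Suc k)
 let ?x = "dl (Suc (Suc n)) y"
 have "row_exact S (Suc n) (Suc k)" using Suc.prems(1)[of "Suc k"] by simp
 then obtain z where z: "cochain (Y S (Suc n)) (Suc k) z" "null (Y S (Suc n)) (Suc (Suc k)) (dd z)"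
   "cob (Y S (Suc (Suc n))) (Suc k) (\<lambda>s gs i. ?x s gs i - dl (Suc (Suc n)) z s gs i)"
  using cochain_dl[OF S(1) Suc.prems(2)] Suc.prems(3) dl_dl unfolding row_exact_def by blast
 then obtain y' where y': "cochain (Y S (Suc (Suc n))) k y'"
   "agree (Y S (Suc (Suc n))) (Suc k) (\<lambda>s gs i. ?x s gs i - dl (Suc (Suc n)) z s gs i) (dd y')"
  unfolding cob_Suc by blast
 have "null (Y S (Suc (Suc (Suc n)))) (Suc k) (dl (Suc (Suc (Suc n))) (\<lambda>s gs i. ?x s gs i - dl (Suc (Suc n)) z s gs i))"
  using dl_dl[of S "Suc n" _ y] dl_dl[of S "Suc n" _ z] unfolding agree_def by (simp add: dl_diff)
 with dl_agree[OF y'(2)] have "null (Y S (Suc (Suc (Suc n)))) (Suc k) (dl (Suc (Suc (Suc n))) (dd y'))"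
  by (simp add: agree_def)
 then have dy': "null (Y S (Suc (Suc (Suc n)))) (Suc k) (dd (dl (Suc (Suc (Suc n))) y'))"
  by (simp add: dl_dd)
 have "\<exists>z v. cochain (Y S (Suc (Suc n))) k z \<and> null (Y S (Suc (Suc n))) (Suc k) (dd z) \<and> cochain (Y S (Suc n)) k v \<and>
   agree (Y S (Suc (Suc n))) k y' (\<lambda>s gs i. z s gs i + dl (Suc (Suc n)) v s gs i)"
 proof (rule Suc.IH[OF _ y'(1) dy'])
  fix j assume "j \<le> k"
  then show "row_exact S (Suc (Suc n) + (k - j)) j"
   using Suc.prems(1)[of j] by (simp add: Suc_diff_le)
 qed
 then obtain z' v' where z': "null (Y S (Suc (Suc n))) (Suc k) (dd z')"
  and v': "cochain (Y S (Suc n)) k v'"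
  and y'_eq: "agree (Y S (Suc (Suc n))) k y' (\<lambda>s gs i. z' s gs i + dl (Suc (Suc n)) v' s gs i)"
  by blast
 have dy'_eq: "agree (Y S (Suc (Suc n))) (Suc k) (dd y') (dl (Suc (Suc n)) (dd v'))"
  using dd_face[OF y'_eq] z' by (simp add: agree_def dd_add dl_dd)
 let ?y = "\<lambda>s gs i. y s gs i - z s gs i - dd v' s gs i"
 have y: "cochain (Y S (Suc n)) (Suc k) ?y"
  by (intro cochain_diff Suc.prems(2) z(1) cochain_dd[OF v'])
 have "null (Y S (Suc (Suc n))) (Suc k) (dl (Suc (Suc n)) ?y)"
  using y'(2) dy'_eq by (simp add: agree_def dl_diff)
 then obtain v where v: "cochain (Y S n) (Suc k) v" "agree (Y S (Suc n)) (Suc k) ?y (dl (Suc n) v)"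
  using column_exact[OF S y] by blast
 let ?z = "\<lambda>s gs i. z s gs i + dd v' s gs i"
 have "cochain (Y S (Suc n)) (Suc k) ?z" by (intro cochain_add z(1) cochain_dd[OF v'])
 moreover have "null (Y S (Suc n)) (Suc (Suc k)) (dd ?z)"
  using z(2) by (simp add: agree_def dd_add dd_dd)
 moreover have "agree (Y S (Suc n)) (Suc k) y (\<lambda>s gs i. ?z s gs i + dl (Suc n) v s gs i)"
  using v(2) by (simp add: agree_def algebra_simps)
 ultimately show ?case using v(1) by blast
qed

text \<open>For a transitive action on points, the cohomology over \<open>Y {[]} 1\<close> is that
  of the stabilizer of a point and \<open>dl 1\<close> is the restriction to it. So this and
  \<open>surj_at\<close> express the two halves of stability under passing to one more perpendicular
  point.\<close>

definition inj_at :: "'p list set \<Rightarrow> nat \<Rightarrow> bool" where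
 "inj_at S q \<longleftrightarrow> (\<forall>x. cochain S q x \<longrightarrow> null S (Suc q) (dd x) \<longrightarrow> cob (Y S 1) q (dl 1 x) \<longrightarrow> cob S q x)"

definition surj_at :: "'p list set \<Rightarrow> nat \<Rightarrow> bool" where
 "surj_at S q \<longleftrightarrow> (\<forall>x. cochain (Y S 1) q x \<longrightarrow> null (Y S 1) (Suc q) (dd x) \<longrightarrow>
   (\<exists>z. cochain S q z \<and> null S (Suc q) (dd z) \<and> cob (Y S 1) q (\<lambda>s gs i. x s gs i - dl 1 z s gs i)))"

text \<open>If \<open>dl 1 x = dd y\<close>, then \<open>dl 2 y\<close> is a cocycle because
  \<open>dl\<close> after \<open>dl\<close> vanishes. The zigzag writes \<open>y\<close> as a
  cocycle plus \<open>dl 1 v\<close>, so \<open>dl 1\<close> annihilates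
  \<open>x - dd v\<close>.\<close>

lemma inj_step:
 assumes S: "points m S" "m \<le> N"
  and rows: "\<And>j. j < q \<Longrightarrow> row_exact S (q - j) j"
 shows "inj_at S q"
 unfolding inj_at_def
proof (intro allI impI)
 fix x assume x: "cochain S q x" "null S (Suc q) (dd x)" "cob (Y S 1) q (dl 1 x)"
 show "cob S q x"
 proof (cases q)
  case 0
  with x dl_injective[OF S] show ?thesis by simp
 next
  case (Suc k)
  then obtain y where y: "cochain (Y S (Suc 0)) k y" "agree (Y S (Suc 0)) (Suc k) (dl (Suc 0) x) (dd y)"
   using x(3) by (auto simp: cob_Suc)
  have "null (Y S (Suc (Suc 0))) (Suc k) (dl (Suc (Suc 0)) (dd y))"
   using dl_agree[OF y(2)] dl_dl[of S 0 _ x] by (simp add: agree_def)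
  then have "null (Y S (Suc (Suc 0))) (Suc k) (dd (dl (Suc (Suc 0)) y))"
   by (simp add: dl_dd)
  moreover have "row_exact S (Suc 0 + (k - j)) j" if "j \<le> k" for j
   using rows[of j] that Suc by (simp add: Suc_diff_le)
  ultimately obtain z v where z: "null (Y S (Suc 0)) (Suc k) (dd z)" and v: "cochain S k v"
   and yzv: "agree (Y S (Suc 0)) k y (\<lambda>s gs i. z s gs i + dl (Suc 0) v s gs i)"
   using zigzag[OF S _ y(1)] unfolding Y_0 by blast
  have "null (Y S 1) (Suc k) (dl 1 (\<lambda>s gs i. x s gs i - dd v s gs i))"
   using dd_face[OF yzv] z y(2) by (simp add: agree_def dd_add dl_dd dl_diff)
  then have "null S (Suc k) (\<lambda>s gs i. x s gs i - dd v s gs i)"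
   by (rule dl_injective[OF S])
  then have "agree S (Suc k) x (dd v)" by (simp add: agree_def)
  with v show ?thesis unfolding Suc cob_Suc by blast
 qed
qed

text \<open>The last hypothesis says that the two ways of restricting to two added points agree in
  cohomology. The zigzag improves this to strict agreement after subtracting a coboundary from
  \<open>x\<close>; column exactness then descends the corrected cocycle to
  \<open>S\<close>.\<close>

lemma surj_step:
 assumes S: "points m S" "m \<le> N"
  and rows: "\<And>j. j < q \<Longrightarrow> row_exact S (Suc (q - j)) j"
  and x: "cochain (Y S 1) q x" "null (Y S 1) (Suc q) (dd x)" "cob (Y S 2) q (dl 2 x)"
 shows "\<exists>z. cochain S q z \<and> null S (Suc q) (dd z) \<and> cob (Y S 1) q (\<lambda>s gs i. x s gs i - dl 1 z s gs i)"
proof -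
 have "\<exists>v'. cob (Y S (Suc 0)) q v' \<and> cochain (Y S (Suc 0)) q v' \<and>
   null (Y S (Suc (Suc 0))) q (dl (Suc (Suc 0)) (\<lambda>s gs i. x s gs i - v' s gs i))"
 proof (cases q)
  case 0
  then have "null (Y S (Suc (Suc 0))) q (dl (Suc (Suc 0)) (\<lambda>s gs i. x s gs i - 0))"
   using x(3) by (simp add: numeral_2_eq_2)
  then show ?thesis using cob_zero cochain_zero by blast
 next
  case (Suc k)
  then obtain y where y: "cochain (Y S (Suc (Suc 0))) k y"
    "agree (Y S (Suc (Suc 0))) (Suc k) (dl (Suc (Suc 0)) x) (dd y)"
   using x(3) by (auto simp: cob_Suc numeral_2_eq_2)
  have "null (Y S (Suc (Suc (Suc 0)))) (Suc k) (dl (Suc (Suc (Suc 0))) (dd y))"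
   using dl_agree[OF y(2)] dl_dl[of S "Suc 0" _ x] by (simp add: agree_def)
  then have "null (Y S (Suc (Suc (Suc 0)))) (Suc k) (dd (dl (Suc (Suc (Suc 0))) y))"
   by (simp add: dl_dd)
  moreover have "row_exact S (Suc (Suc 0) + (k - j)) j" if "j \<le> k" for j
   using rows[of j] that Suc by (simp add: Suc_diff_le)
  ultimately obtain z v where z: "null (Y S (Suc (Suc 0))) (Suc k) (dd z)" and v: "cochain (Y S (Suc 0)) k v"
   and yzv: "agree (Y S (Suc (Suc 0))) k y (\<lambda>s gs i. z s gs i + dl (Suc (Suc 0)) v s gs i)"
   using zigzag[OF S _ y(1)] by blast
  have "null (Y S (Suc (Suc 0))) (Suc k) (dl (Suc (Suc 0)) (\<lambda>s gs i. x s gs i - dd v s gs i))"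
   using dd_face[OF yzv] z y(2) by (simp add: agree_def dd_add dl_dd dl_diff)
  moreover have "cob (Y S (Suc 0)) (Suc k) (dd v)"
   using v unfolding cob_Suc by (auto simp: agree_def)
  ultimately show ?thesis using cochain_dd[OF v] Suc by blast
 qed
 then obtain v' where v': "cob (Y S (Suc 0)) q v'" "cochain (Y S (Suc 0)) q v'"
  and d: "null (Y S (Suc (Suc 0))) q (dl (Suc (Suc 0)) (\<lambda>s gs i. x s gs i - v' s gs i))" by blast
 have "cochain (Y S (Suc 0)) q (\<lambda>s gs i. x s gs i - v' s gs i)"
  using x(1) v'(2) cochain_diff by simp
 from column_exact[OF S this d] obtain z where z: "cochain S q z"
  and xz: "agree (Y S (Suc 0)) q (\<lambda>s gs i. x s gs i - v' s gs i) (dl (Suc 0) z)" by auto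
 have "null (Y S 1) (Suc q) (dl 1 (dd z))"
  using dd_face[OF xz] x(2) cob_cocycle[OF v'(1)] by (simp add: agree_def dd_diff dl_dd)
 then have "null S (Suc q) (dd z)" by (rule dl_injective[OF S])
 moreover have "cob (Y S 1) q (\<lambda>s gs i. x s gs i - dl 1 z s gs i)"
 proof (rule cob_agree)
  show "cob (Y S 1) q v'" using v'(1) by simp
  have "x s gs i - dl 1 z s gs i = v' s gs i"
   if "s \<in> Y S 1" "gs \<in> tuples G q" "i \<in> I" for s gs i
   using xz that unfolding agree_def by force
  then show "agree (Y S 1) q (\<lambda>s gs i. x s gs i - dl 1 z s gs i) v'" by (simp add: agree_def)
 qed
 ultimately show ?thesis using z by blast
qed

text \<open>The contracting homotopy of a row: restrict to the tuples \<open>w # u\<close> with \<open>w\<close> perpendicular to all of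
 \<open>u\<close> and forget \<open>w\<close>.\<close>

definition dw :: "nat \<Rightarrow> ('p list \<Rightarrow> 'g list \<Rightarrow> 'i \<Rightarrow> real) \<Rightarrow> 'p list \<Rightarrow> 'g list \<Rightarrow> 'i \<Rightarrow> real" where
 "dw n f u gs i = bd (\<lambda>t. f (hd u # t @ drop n (tl u)) gs i) (take n (tl u))"

lemma dw_dd: "dw n (dd f) = dd (dw n f)"
 by (intro ext) (simp add: dd_def dw_def bd_swap[of _ "take n _"])

lemma Y_1_face:
 assumes "w # t @ s \<in> Y (Y S (Suc n)) 1" "length t = Suc n" "length t = Suc (length t')" "set t' \<subseteq> set t"
 shows "w # t' @ s \<in> Y (Y S n) 1"
proof -
 from assms(1) have "[w] @ (t @ s) \<in> Y (Y S (Suc n)) 1" by simp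
 note u = Y_append[OF this]
 have "t @ s \<in> Y S (Suc n)" using u by simp
 from Y_face[OF this assms(2-4)] have "t' @ s \<in> Y S n" .
 with u assms(4) show ?thesis by (intro Y_1I) auto
qed

lemma cochain_dw:
 assumes S: "points m S" and f: "cochain (Y (Y S n) 1) q f"
 shows "cochain (Y (Y S (Suc n)) 1) q (dw (Suc n) f)"
proof -
 obtain C where "0 \<le> C" and C0: "\<forall>s\<in>Y (Y S n) 1. \<forall>gs\<in>tuples G q. \<forall>i\<in>I. \<bar>f s gs i\<bar> \<le> C * wt i"
  by (rule cochain_bound[OF f])
 note C = C0[rule_format]
 show ?thesis
 proof (rule cochainI[of _ _ _ "real (Suc n) * C"])
  fix u gs assume u: "u \<in> Y (Y S (Suc n)) 1" and gs: "gs \<in> tuples G q"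
  obtain w v where v: "u = w # v" "w \<in> P" "v \<in> Y S (Suc n)" using u by (rule Y_1E)
  obtain t s where ts: "v = t @ s" "length t = Suc n" using v(3) by (rule YE)
  have face: "w # t' @ s \<in> Y (Y S n) 1" if "length t = Suc (length t')" "set t' \<subseteq> set t" for t'
   using Y_1_face u v ts that by blast
  show "dw (Suc n) f u gs \<in> W"
   unfolding dw_def[abs_def] v ts(1) list.sel using ts(2)
   by (simp, intro W_bd cochainD(1)[OF f] face gs)
  fix i assume i: "i \<in> I"
  have "\<bar>bd (\<lambda>t. f (w # t @ s) gs i) t\<bar> \<le> real (length t) * (C * wt i)"
   by (rule bd_bound) (intro C face gs i)
  then show "\<bar>dw (Suc n) f u gs i\<bar> \<le> real (Suc n) * C * wt i"
   using v ts by (simp add: dw_def mult.assoc)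
  fix g assume g: "g \<in> carrier G"
  have "bd (\<lambda>t. f (act g w # t @ map (act g) s) (map ((\<otimes>) g) gs) (ia g i)) (map (act g) t) = bd (\<lambda>t. f (w # t @ s) gs i) t"
   unfolding bd_map map_append[symmetric] list.map(2)[symmetric]
   by (intro bd_cong cochainD(2)[OF f] face g i gs)
  then show "dw (Suc n) f (map (act g) u) (map ((\<otimes>) g) gs) (ia g i) = dw (Suc n) f u gs i"
   using v ts by (simp add: dw_def)
 qed
qed

text \<open>Surjectivity over \<open>Y S n\<close> approximates \<open>x\<close> on those tuples
  whose first point is perpendicular to all others. As \<open>dl\<close> annihilates
  \<open>x\<close>, this approximation propagates to all tuples to which such a point
  \<open>w\<close> can be added, and injectivity over \<open>Y S (Suc n)\<close> forgets
  \<open>w\<close> again.\<close>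

lemma row_exactI:
 assumes S: "points m S" and surj: "surj_at (Y S n) k" and inj: "inj_at (Y S (Suc n)) k"
 shows "row_exact S n k"
 unfolding row_exact_def
proof (intro allI impI)
 let ?T = "Y S (Suc n)"
 fix x assume x: "cochain ?T k x" "null ?T (Suc k) (dd x)"
  and dx: "null (Y S (Suc (Suc n))) k (dl (Suc (Suc n)) x)"
 have "cochain (Y (Y S n) 1) k x" "null (Y (Y S n) 1) (Suc k) (dd x)"
  using x Y_Y_subset by (auto intro: cochain_subset agree_subset)
 then obtain z where z: "cochain (Y S n) k z" "null (Y S n) (Suc k) (dd z)"
  and cz: "cob (Y (Y S n) 1) k (\<lambda>s gs i. x s gs i - dl 1 z s gs i)"
  using surj unfolding surj_at_def by blast
 let ?x = "\<lambda>s gs i. x s gs i - dl (Suc n) z s gs i"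
 have cx: "cochain ?T k ?x" by (intro cochain_diff x(1) cochain_dl[OF S z(1)])
 have ddx: "null ?T (Suc k) (dd ?x)"
  using x(2) dl_agree[OF z(2)] by (simp add: agree_def dd_diff dl_dd[symmetric] dl_def[of _ "\<lambda>s gs i. 0"])
 \<comment> \<open>The relation \<open>dl x = 0\<close> at \<open>w # t @ s\<close> expresses
   \<open>x (t @ s)\<close> through the faces that still contain \<open>w\<close>, which is where
   \<open>z\<close> approximates \<open>x\<close>.\<close>
 have eq: "dl 1 ?x u gs i = dw (Suc n) (\<lambda>s gs i. x s gs i - dl 1 z s gs i) u gs i"
  if u: "u \<in> Y ?T 1" and gs: "gs \<in> tuples G k" and i: "i \<in> I" for u gs i
 proof -
  obtain w v where v: "u = w # v" "w \<in> P" "v \<in> ?T" "\<forall>b\<in>set v. perp w b" using u by (rule Y_1E)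
  obtain t s where ts: "v = t @ s" "length t = Suc n" using v(3) by (rule YE)
  have "w # t @ s \<in> Y S (Suc (Suc n))" using Y_Y_subset u v ts by blast
  then have "dl (Suc (Suc n)) x (w # t @ s) gs i = 0" using dx gs i by (simp add: agree_def)
  then have "x (t @ s) gs i = bd (\<lambda>t. x (w # t @ s) gs i) t" using ts by (simp add: dl_def)
  then show ?thesis
   unfolding v(1) dl_1 dw_def list.sel using ts by (simp add: bd_diff dl_def)
 qed
 have "cob (Y ?T 1) k (dl 1 ?x)"
 proof (cases k)
  case 0
  have "dw (Suc n) (\<lambda>s gs i. x s gs i - dl 1 z s gs i) u gs i = 0"
   if u: "u \<in> Y ?T 1" and gs: "gs \<in> tuples G 0" and i: "i \<in> I" for u gs i
  proof -
   obtain w v where v: "u = w # v" "w \<in> P" "v \<in> ?T" using u by (rule Y_1E)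
   obtain t s where ts: "v = t @ s" "length t = Suc n" using v(3) by (rule YE)
   have face: "w # t' @ s \<in> Y (Y S n) 1" if "length t = Suc (length t')" "set t' \<subseteq> set t" for t'
    using Y_1_face u v ts that by blast
   have "bd (\<lambda>t. x (w # t @ s) gs i - dl 1 z (w # t @ s) gs i) t = bd (\<lambda>_. 0) t"
    by (intro bd_cong) (use cz face gs i 0 in \<open>auto simp: agree_def\<close>)
   then show ?thesis using v ts by (simp add: dw_def)
  qed
  then show ?thesis using eq by (simp add: 0 agree_def)
 next
  case (Suc j)
  then obtain e where e: "cochain (Y (Y S n) 1) j e"
   and ae: "agree (Y (Y S n) 1) k (\<lambda>s gs i. x s gs i - dl 1 z s gs i) (dd e)"
   using cz by (auto simp: cob_Suc)
  have "dw (Suc n) (\<lambda>s gs i. x s gs i - dl 1 z s gs i) u gs i = dw (Suc n) (dd e) u gs i"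
   if u: "u \<in> Y ?T 1" and gs: "gs \<in> tuples G k" and i: "i \<in> I" for u gs i
  proof -
   obtain w v where v: "u = w # v" "w \<in> P" "v \<in> ?T" using u by (rule Y_1E)
   obtain t s where ts: "v = t @ s" "length t = Suc n" using v(3) by (rule YE)
   have face: "w # t' @ s \<in> Y (Y S n) 1" if "length t = Suc (length t')" "set t' \<subseteq> set t" for t'
    using Y_1_face u v ts that by blast
   have "bd (\<lambda>t. x (w # t @ s) gs i - dl 1 z (w # t @ s) gs i) t = bd (\<lambda>t. dd e (w # t @ s) gs i) t"
    by (intro bd_cong) (use ae face gs i in \<open>auto simp: agree_def\<close>)
   then show ?thesis using v ts by (simp add: dw_def)
  qed
  then have "agree (Y ?T 1) (Suc j) (dl 1 ?x) (dd (dw (Suc n) e))"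
   using eq by (simp add: Suc agree_def dw_dd[symmetric])
  then show ?thesis using cochain_dw[OF S e] unfolding Suc cob_Suc by blast
 qed
 then have "cob ?T k ?x" using inj cx ddx unfolding inj_at_def by blast
 then show "\<exists>z. cochain (Y S n) k z \<and> null (Y S n) (Suc k) (dd z) \<and>
    cob ?T k (\<lambda>s gs i. x s gs i - dl (Suc n) z s gs i)" using z by blast
qed

text \<open>Translating the group entries by \<open>\<sigma> u\<close> moves the point \<open>f u\<close> instead.\<close>

lemma prism_translate:
 fixes \<sigma> :: "'p list \<Rightarrow> 'g" and f :: "'p list \<Rightarrow> 'p list"
 assumes x: "cochain S q x" "null S (Suc q) (dd x)"
  and f: "\<And>u. u \<in> T \<Longrightarrow> f u \<in> S" "\<And>g u. g \<in> carrier G \<Longrightarrow> u \<in> T \<Longrightarrow> f (map (act g) u) = map (act g) (f u)"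
  and \<sigma>: "\<And>u. u \<in> T \<Longrightarrow> \<sigma> u \<in> carrier G"
   "\<And>g u. g \<in> carrier G \<Longrightarrow> u \<in> T \<Longrightarrow> \<sigma> (map (act g) u) = g \<otimes> \<sigma> u \<otimes> inv g"
  and q: "q = Suc k"
 defines "y \<equiv> (\<lambda>u gs i. prism (\<lambda>g. g) (\<lambda>g. inv (\<sigma> u) \<otimes> g) (\<lambda>hs. x (f u) hs i) gs)"
 shows "cochain T k y"
  and "agree T q (\<lambda>u gs i. x (f u) (map (\<lambda>g. inv (\<sigma> u) \<otimes> g) gs) i - x (f u) gs i) (dd y)"
  and "\<And>C u gs i. \<forall>s\<in>S. \<forall>gs\<in>tuples G q. \<forall>i\<in>I. \<bar>x s gs i\<bar> \<le> C * wt i \<Longrightarrow>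
   u \<in> T \<Longrightarrow> gs \<in> tuples G k \<Longrightarrow> i \<in> I \<Longrightarrow> \<bar>y u gs i\<bar> \<le> real q * C * wt i"
proof -
 have tup: "hs \<in> tuples G q"
  if "u \<in> T" "gs \<in> tuples G k" "length hs = Suc (length gs)"
   "set hs \<subseteq> (\<lambda>g. g) ` set gs \<union> (\<lambda>g. inv (\<sigma> u) \<otimes> g) ` set gs" for u gs hs
  using that \<sigma>(1)[of u] by (auto simp: tuples_def q)
 show bound: "\<bar>y u gs i\<bar> \<le> real q * C * wt i"
  if C: "\<forall>s\<in>S. \<forall>gs\<in>tuples G q. \<forall>i\<in>I. \<bar>x s gs i\<bar> \<le> C * wt i"
   and "u \<in> T" "gs \<in> tuples G k" "i \<in> I" for C u gs i
 proof -
  have "\<bar>y u gs i\<bar> \<le> real (length gs) * (C * wt i)"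
   unfolding y_def by (rule prism_bound) (intro C[rule_format] f(1) that(2,4) tup[OF that(2,3)])
  then show ?thesis using that(3) by (simp add: tuples_def q mult.assoc)
 qed
 obtain C where "0 \<le> C" and C: "\<forall>s\<in>S. \<forall>gs\<in>tuples G q. \<forall>i\<in>I. \<bar>x s gs i\<bar> \<le> C * wt i"
  by (rule cochain_bound[OF x(1)])
 show "cochain T k y"
 proof (rule cochainI[of _ _ _ "real q * C"])
  fix u gs assume u: "u \<in> T" and gs: "gs \<in> tuples G k"
  show "y u gs \<in> W"
   unfolding y_def by (rule W_prism) (intro cochainD(1)[OF x(1)] f(1) u tup[OF u gs])
  fix i assume i: "i \<in> I"
  show "\<bar>y u gs i\<bar> \<le> real q * C * wt i" using bound[OF C u gs i] .
  fix g assume g: "g \<in> carrier G"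
  have "inv (\<sigma> (map (act g) u)) \<otimes> (g \<otimes> h) = g \<otimes> (inv (\<sigma> u) \<otimes> h)" if "h \<in> set gs" for h
  proof -
   have h: "h \<in> carrier G" using that gs by (auto simp: tuples_def)
   then show ?thesis using \<sigma>(1)[OF u] g unfolding \<sigma>(2)[OF g u]
    by (simp add: inv_mult_group m_assoc) (simp add: m_assoc[symmetric])
  qed
  then have "y (map (act g) u) (map ((\<otimes>) g) gs) (ia g i) =
    prism ((\<otimes>) g \<circ> (\<lambda>h. h)) ((\<otimes>) g \<circ> (\<lambda>h. inv (\<sigma> u) \<otimes> h)) (\<lambda>hs. x (map (act g) (f u)) hs (ia g i)) gs"
   unfolding y_def prism_map f(2)[OF g u] by (intro prism_fun_cong) auto
  also have "\<dots> = y u gs i"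
   unfolding y_def prism_map_fun
   by (intro prism_cong cochainD(2)[OF x(1)] g f(1) u i tup[OF u gs])
  finally show "y (map (act g) u) (map ((\<otimes>) g) gs) (ia g i) = y u gs i" .
 qed
 show "agree T q (\<lambda>u gs i. x (f u) (map (\<lambda>g. inv (\<sigma> u) \<otimes> g) gs) i - x (f u) gs i) (dd y)"
  unfolding agree_def
 proof (intro ballI)
  fix u gs i assume u: "u \<in> T" and gs: "gs \<in> tuples G q" and i: "i \<in> I"
  let ?c = "\<lambda>hs. x (f u) hs i"
  have "prism (\<lambda>g. g) (\<lambda>g. inv (\<sigma> u) \<otimes> g) (bd ?c) gs = prism (\<lambda>g. g) (\<lambda>g. inv (\<sigma> u) \<otimes> g) (\<lambda>_. 0) gs"
  proof (rule prism_cong)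
   fix hs assume "length hs = Suc (length gs)"
    "set hs \<subseteq> (\<lambda>g. g) ` set gs \<union> (\<lambda>g. inv (\<sigma> u) \<otimes> g) ` set gs"
   then have "hs \<in> tuples G (Suc q)"
    using gs \<sigma>(1)[OF u] by (auto simp: tuples_def)
   then show "bd ?c hs = 0"
    using x(2) f(1)[OF u] i by (simp add: agree_def dd_def)
  qed
  with prism_homotopy[of "\<lambda>g. g" "\<lambda>g. inv (\<sigma> u) \<otimes> g" ?c gs]
  show "x (f u) (map (\<lambda>g. inv (\<sigma> u) \<otimes> g) gs) i - x (f u) gs i = dd y u gs i"
   by (simp add: dd_def y_def)
 qed
qed

lemma degree_zero_constant:
 assumes x: "null S (Suc 0) (dd x)" and s: "s \<in> S" "i \<in> I" "gs \<in> tuples G 0" "hs \<in> tuples G 0"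
 shows "x s gs i = x s hs i"
proof -
 obtain g h where "gs = [g]" "hs = [h]" "g \<in> carrier G" "h \<in> carrier G"
  using s(3,4) by (auto simp: tuples_def length_Suc_conv)
 moreover from this have "[h, g] \<in> tuples G (Suc 0)" by (simp add: tuples_def)
 with x s have "dd x s [h, g] i = 0" by (simp add: agree_def)
 ultimately show ?thesis by (simp add: dd_def)
qed

end

section \<open>Stability for actions with swaps\<close>

text \<open>\<open>sw_act\<close> says that the swaps are chosen equivariantly, by an explicit
  formula in the application. This is what allows \<open>prism_translate\<close> to produce an
  equivariant primitive.\<close>

locale swap_complex = equivariant_complex +
 fixes sw :: "'c \<Rightarrow> 'c \<Rightarrow> 'a"
 assumes ia_trivial: "\<lbrakk>g \<in> carrier G; i \<in> I\<rbrakk> \<Longrightarrow> ia g i = i"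
  and sw_closed: "\<lbrakk>a \<in> P; b \<in> P; perp a b\<rbrakk> \<Longrightarrow> sw a b \<in> carrier G"
  and sw_swap: "\<lbrakk>a \<in> P; b \<in> P; perp a b\<rbrakk> \<Longrightarrow> act (sw a b) a = b"
  and sw_fix: "\<lbrakk>a \<in> P; b \<in> P; perp a b; c \<in> P; perp a c; perp b c\<rbrakk> \<Longrightarrow> act (sw a b) c = c"
  and sw_act: "\<lbrakk>g \<in> carrier G; a \<in> P; b \<in> P; perp a b\<rbrakk> \<Longrightarrow> sw (act g a) (act g b) = g \<otimes> sw a b \<otimes> inv g"
begin

text \<open>At \<open>a # b # s\<close> the cochain \<open>dl 2 x\<close> is the difference of
  \<open>x\<close> at \<open>b # s\<close> and at \<open>a # s\<close>. No swap between
  \<open>a\<close> and \<open>b\<close> is available, as they need not be perpendicular. After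
  adding \<open>w\<close> perpendicular to everything, both values are cohomologous to the one at
  \<open>w # s\<close>, by the swaps from \<open>w\<close>, which fix \<open>s\<close>; injectivity
  over \<open>Y S 2\<close> removes \<open>w\<close>.\<close>

lemma equalize:
 assumes S: "points m S" and inj: "inj_at (Y S 2) q"
  and x: "cochain (Y S 1) q x" "null (Y S 1) (Suc q) (dd x)"
 shows "cob (Y S 2) q (dl 2 x)"
proof -
 let ?T = "Y (Y S 2) 1"
 have T: "\<exists>w a b s. v = w # a # b # s \<and> w \<in> P \<and> a \<in> P \<and> b \<in> P \<and> s \<in> S \<and> perp w a \<and> perp w b \<and>
   set s \<subseteq> P \<and> (\<forall>c\<in>set s. perp w c \<and> perp a c \<and> perp b c)" if vT: "v \<in> ?T" for v
 proof -
  obtain w u where v: "v = w # u" "w \<in> P" "u \<in> Y S 2" "\<forall>b\<in>set u. perp w b"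
   using vT by (rule Y_1E)
  obtain t s where u: "u = t @ s" "length t = 2" "set t \<subseteq> P" "s \<in> S" "\<forall>a\<in>set t. \<forall>b\<in>set s. perp a b"
   using v(3) by (rule YE)
  obtain a b where "t = [a, b]" using u(2) by (auto simp: numeral_2_eq_2 length_Suc_conv)
  moreover have "set s \<subseteq> P" using S u(4) by (auto simp: points_def)
  ultimately show ?thesis using v u by auto
 qed
 have f_act: "hd (map (act g) v) # drop 3 (map (act g) v) = map (act g) (hd v # drop 3 v)"
  if "v \<in> ?T" for g v
  using T[OF that] by auto
 have inS: "hd v # drop 3 v \<in> Y S 1" if "v \<in> ?T" for v
  using T[OF that] by (auto simp del: One_nat_def intro!: Y_1I)
 have swap: "cob ?T q (\<lambda>v gs i. x (v ! j # drop 3 v) gs i - x (hd v # drop 3 v) gs i)" if j: "j \<in> {1, 2}" for j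
 proof -
  define \<sigma> where "\<sigma> v = sw (hd v) (v ! j)" for v
  have \<sigma>: "\<sigma> v \<in> carrier G" "map (act (\<sigma> v)) (hd v # drop 3 v) = v ! j # drop 3 v"
   "g \<in> carrier G \<Longrightarrow> \<sigma> (map (act g) v) = g \<otimes> \<sigma> v \<otimes> inv g" if v: "v \<in> ?T" for v g
   using T[OF v] j unfolding \<sigma>_def by (auto simp: sw_closed sw_swap sw_act intro!: map_idI sw_fix)
  have translate: "x (v ! j # drop 3 v) gs i = x (hd v # drop 3 v) (map (\<lambda>g. inv (\<sigma> v) \<otimes> g) gs) i"
   if v: "v \<in> ?T" and gs: "gs \<in> tuples G q" and i: "i \<in> I" for v gs i
  proof -
   let ?hs = "map (\<lambda>g. inv (\<sigma> v) \<otimes> g) gs"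
   have "map ((\<otimes>) (\<sigma> v)) ?hs = gs"
    unfolding map_map by (rule map_idI) (use gs \<sigma>(1)[OF v] in \<open>auto simp: tuples_def m_assoc[symmetric]\<close>)
   moreover have "?hs \<in> tuples G q"
    using tuples_map[OF is_group inv_closed[OF \<sigma>(1)[OF v]] gs] .
   ultimately show ?thesis
    using cochainD(2)[OF x(1) \<sigma>(1)[OF v] inS[OF v] _ i, of ?hs] \<sigma>(2)[OF v] ia_trivial[OF \<sigma>(1)[OF v] i] by simp
  qed
  show ?thesis
  proof (cases q)
   case 0
   have "null ?T 0 (\<lambda>v gs i. x (v ! j # drop 3 v) gs i - x (hd v # drop 3 v) gs i)"
    unfolding agree_def
   proof (intro ballI)
    fix v gs i assume v: "v \<in> ?T" and gs: "gs \<in> tuples G 0" and i: "i \<in> I"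
    have "map (\<lambda>g. inv (\<sigma> v) \<otimes> g) gs \<in> tuples G 0"
     using tuples_map[OF is_group inv_closed[OF \<sigma>(1)[OF v]] gs] .
    from degree_zero_constant[OF x(2)[unfolded 0] inS[OF v] i gs this]
    show "x (v ! j # drop 3 v) gs i - x (hd v # drop 3 v) gs i = 0"
     using translate[OF v _ i] gs 0 by simp
   qed
   then show ?thesis by (simp add: 0)
  next
   case (Suc k)
   note pt = prism_translate(1,2)[OF x inS f_act \<sigma>(1) \<sigma>(3) Suc]
   have "agree ?T q (\<lambda>v gs i. x (v ! j # drop 3 v) gs i - x (hd v # drop 3 v) gs i)
     (\<lambda>v gs i. x (hd v # drop 3 v) (map (\<lambda>g. inv (\<sigma> v) \<otimes> g) gs) i - x (hd v # drop 3 v) gs i)"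
    using translate by (simp add: agree_def)
   from agree_trans[OF this pt(2)] pt(1) show ?thesis
    unfolding Suc cob_Suc by blast
  qed
 qed
 have "cob ?T q (dl 1 (dl 2 x))"
 proof (rule cob_agree[OF cob_diff[OF swap[of 2] swap[of 1]]])
  show "agree ?T q (dl 1 (dl 2 x)) (\<lambda>v gs i.
   x (v ! 2 # drop 3 v) gs i - x (hd v # drop 3 v) gs i - (x (v ! 1 # drop 3 v) gs i - x (hd v # drop 3 v) gs i))"
   unfolding agree_def
  proof (intro ballI)
   fix v gs i assume "v \<in> ?T"
   from T[OF this] obtain w a b s where "v = w # a # b # s" by blast
   then show "dl 1 (dl 2 x) v gs i =
    x (v ! 2 # drop 3 v) gs i - x (hd v # drop 3 v) gs i - (x (v ! 1 # drop 3 v) gs i - x (hd v # drop 3 v) gs i)"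
    by (simp add: dl_def numeral_2_eq_2)
  qed
 qed simp_all
 moreover have "cochain (Y S 2) q (dl 2 x)"
  using cochain_dl[OF S, of 1] x(1) by (simp add: numeral_2_eq_2)
 moreover have "null (Y S 2) (Suc q) (dd (dl 2 x))"
  using dl_agree[of S 1, OF x(2)] by (simp add: numeral_2_eq_2 agree_def dl_dd[symmetric] dl_def[of _ "\<lambda>s gs i. 0"])
 ultimately show ?thesis using inj unfolding inj_at_def by blast
qed

text \<open>Surjectivity in lower degrees feeds injectivity in higher ones through
  \<open>row_exactI\<close>, so both are proved together. The square solves the recursion for the
  number of points: going from degree \<open>q\<close> to a smaller degree adds at most
  \<open>q + 4\<close> points, which for \<open>q >= 1\<close> is within the increment
  \<open>2 * q + 3\<close> of the square.\<close>

theorem stability: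
 assumes "points m S" "m + (q + 2) ^ 2 \<le> N"
 shows "inj_at S q \<and> surj_at S q"
 using assms
proof (induction q arbitrary: m S rule: less_induct)
 case (less q)
 have rows: "row_exact S' n j"
  if S': "points m' S'" and j: "j < q" and n: "n \<le> q + 1 - j" and m': "m' + (2 * q + 3) + (q + 1)\<^sup>2 \<le> N + q + 1"
  for S' m' n j
 proof -
  have "(j + 2)\<^sup>2 \<le> (q + 1)\<^sup>2" using j by (intro power_mono) auto
  then have "n + m' + (j + 2)\<^sup>2 \<le> N" "Suc n + m' + (j + 2)\<^sup>2 \<le> N"
   using m' n j by linarith+
  then show ?thesis
   using less.IH[OF j points_Y[OF S']] by (intro row_exactI[OF S']) blast+
 qed
 have sq: "(q + 2)\<^sup>2 = (q + 1)\<^sup>2 + 2 * q + 3" by (simp add: power2_eq_square)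
 have "inj_at S' q" if S': "points m' S'" "m' \<le> m + 2" for m' S'
 proof (rule inj_step[OF S'(1)])
  show "m' \<le> N" using S' less.prems(2) sq by simp
  show "row_exact S' (q - j) j" if "j < q" for j
   by (rule rows[OF S'(1) that]) (use S' less.prems(2) sq that in simp_all)
 qed
 then have inj: "inj_at S q" "inj_at (Y S 2) q"
  using less.prems(1) points_Y[of m S 2] by auto
 have "surj_at S q"
  unfolding surj_at_def
 proof (intro allI impI)
  fix x assume x: "cochain (Y S 1) q x" "null (Y S 1) (Suc q) (dd x)"
  show "\<exists>z. cochain S q z \<and> null S (Suc q) (dd z) \<and> cob (Y S 1) q (\<lambda>s gs i. x s gs i - dl 1 z s gs i)"
  proof (rule surj_step[OF less.prems(1) _ _ x equalize[OF less.prems(1) inj(2) x]])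
   show "m \<le> N" using less.prems(2) by simp
   show "row_exact S (Suc (q - j)) j" if "j < q" for j
    by (rule rows[OF less.prems(1) that]) (use less.prems(2) sq that in simp_all)
  qed
 qed
 with inj show ?case by blast
qed

end

section \<open>Vanishing for actions with central unipotents\<close>

text \<open>A substitute for a free ultrafilter. The evaluations at k form a sequence in a product
  of compact intervals indexed by all bounded sequences; by Tychonoff it has a cluster point, whose
  neighbourhoods, pulled back to the natural numbers and joined with the tails, form the
  filter.\<close>

lemma limit_filter_exists:
 "\<exists>F :: nat filter. F \<noteq> bot \<and> F \<le> sequentially \<and>
   (\<forall>b :: nat \<Rightarrow> real. (\<exists>C. \<forall>k. \<bar>b k\<bar> \<le> C) \<longrightarrow> (\<exists>l. (b \<longlongrightarrow> l) F))"
proof -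
 \<comment> \<open>Unbounded sequences get the one-point factor \<open>{0}\<close>, so that the
   product can be indexed by all sequences.\<close>
 let ?R = "\<lambda>b :: nat \<Rightarrow> real. if \<exists>C. \<forall>k. \<bar>b k\<bar> \<le> C then {- (SUP k. \<bar>b k\<bar>)..(SUP k. \<bar>b k\<bar>)} else {0}"
 let ?e = "\<lambda>k b. if \<exists>C. \<forall>k. \<bar>b k\<bar> \<le> C then b k else (0 :: real)"
 have "compactin (product_topology (\<lambda>_. euclidean) UNIV) (PiE UNIV ?R)"
  by (simp add: compactin_PiE)
 then have cpt: "compact (PiE UNIV ?R)"
  by (simp add: euclidean_product_topology compactin_euclidean_iff)
 have mem: "?e k \<in> PiE UNIV ?R" for k
 proof (rule PiE_I)
  fix b :: "nat \<Rightarrow> real"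
  have "\<bar>b k\<bar> \<le> (SUP k. \<bar>b k\<bar>)" if "\<forall>k. \<bar>b k\<bar> \<le> C" for C
   using that by (intro cSUP_upper bdd_aboveI[of _ C]) auto
  then show "?e k b \<in> ?R b" by auto (meson abs_le_iff minus_le_iff)+
 qed simp
 have "\<exists>x\<in>PiE UNIV ?R. inf (nhds x) (filtermap ?e sequentially) \<noteq> bot"
  using cpt unfolding compact_filter
  by (auto simp: filtermap_bot_iff le_principal eventually_filtermap mem)
 then obtain x where x: "inf (nhds x) (filtermap ?e sequentially) \<noteq> bot" by blast
 define F where "F = inf (filtercomap ?e (nhds x)) sequentially"
 have "F \<noteq> bot"
 proof
  assume "F = bot"
  then have "eventually (\<lambda>k. False) F" by simp
  then obtain A B where "eventually A (nhds x)" "eventually B sequentially" and AB: "\<And>k. A (?e k) \<Longrightarrow> B k \<Longrightarrow> False"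
   unfolding F_def eventually_inf eventually_filtercomap by blast
  have "eventually (\<lambda>y. \<not> A y) (filtermap ?e sequentially)"
   unfolding eventually_filtermap by (rule eventually_mono[OF \<open>eventually B sequentially\<close>]) (use AB in blast)
  with \<open>eventually A (nhds x)\<close> have "eventually (\<lambda>y. False) (inf (nhds x) (filtermap ?e sequentially))"
   unfolding eventually_inf by blast
  with x show False by (simp add: trivial_limit_def)
 qed
 moreover have "F \<le> sequentially" by (simp add: F_def)
 moreover have "(b \<longlongrightarrow> x b) F" if "\<exists>C. \<forall>k. \<bar>b k\<bar> \<le> C" for b
 proof -
  have "filterlim ?e (nhds x) F"
   unfolding F_def filterlim_def by (meson filtermap_filtercomap filtermap_mono inf_le1 order_trans)
  moreover have c: "continuous_on UNIV (\<lambda>y :: (nat \<Rightarrow> real) \<Rightarrow> real. y b)"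
   by (intro continuous_on_product_coordinates)
  then have "((\<lambda>y :: (nat \<Rightarrow> real) \<Rightarrow> real. y b) \<longlongrightarrow> x b) (nhds x)"
  proof (intro topological_tendstoI)
   fix U :: "real set" assume "open U" "x b \<in> U"
   with open_vimage[OF _ c] show "\<forall>\<^sub>F y in nhds x. y b \<in> U"
    unfolding eventually_nhds by (intro exI[of _ "(\<lambda>y. y b) -` U"]) auto
  qed
  ultimately have "((\<lambda>k. ?e k b) \<longlongrightarrow> x b) F" by (rule filterlim_compose[rotated])
  with that show ?thesis by simp
 qed
 ultimately show ?thesis by blast
qed

text \<open>\<open>W_fix\<close> is where ergodicity will enter: a dominated coefficient fixed by a
  single \<tau> vanishes. \<open>W_lim\<close> is stated for filters because the means over powers
  of \<tau> need not converge as sequences.\<close>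

locale transvection_complex = equivariant_complex +
 fixes \<tau> :: "'c \<Rightarrow> 'a"
 assumes \<tau>_closed: "a \<in> P \<Longrightarrow> \<tau> a \<in> carrier G"
  and \<tau>_self: "a \<in> P \<Longrightarrow> act (\<tau> a) a = a"
  and \<tau>_fix: "\<lbrakk>a \<in> P; b \<in> P; perp a b\<rbrakk> \<Longrightarrow> act (\<tau> a) b = b"
  and \<tau>_act: "\<lbrakk>g \<in> carrier G; a \<in> P\<rbrakk> \<Longrightarrow> \<tau> (act g a) = g \<otimes> \<tau> a \<otimes> inv g"
  and ia_mult: "\<lbrakk>g \<in> carrier G; h \<in> carrier G; i \<in> I\<rbrakk> \<Longrightarrow> ia (g \<otimes> h) i = ia g (ia h i)"
  and ia_one: "i \<in> I \<Longrightarrow> ia \<one> i = i"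
  and W_ia: "\<lbrakk>g \<in> carrier G; w \<in> W\<rbrakk> \<Longrightarrow> (\<lambda>i. w (ia g i)) \<in> W"
  and W_lim: "\<lbrakk>F \<noteq> bot; \<And>k :: nat. v k \<in> W; \<And>i. i \<in> I \<Longrightarrow> ((\<lambda>k. v k i) \<longlongrightarrow> l i) F\<rbrakk> \<Longrightarrow> l \<in> W"
  and W_fix: "\<lbrakk>a \<in> P; w \<in> W; \<And>i. i \<in> I \<Longrightarrow> \<bar>w i\<bar> \<le> C * wt i; \<And>i. i \<in> I \<Longrightarrow> w (ia (\<tau> a) i) = w i; i \<in> I\<rbrakk> \<Longrightarrow> w i = 0"
begin

lemma ia_pow:
 assumes "g \<in> carrier G" "i \<in> I"
 shows "ia (g [^] n) (ia g i) = ia (g [^] Suc n) i"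
 using assms by (simp add: ia_mult)

lemma W_sum: "(\<And>n. n \<in> A \<Longrightarrow> v n \<in> W) \<Longrightarrow> (\<lambda>i. \<Sum>n\<in>A. v n i) \<in> W"
 by (induction A rule: infinite_finite_induct) (auto simp: W_zero intro: W_add)

lemma mean_bound:
 assumes "\<And>n :: nat. \<bar>v n\<bar> \<le> (C :: real)"
 shows "\<bar>1 / real (Suc k) * (\<Sum>n<Suc k. v n)\<bar> \<le> C"
proof -
 have "\<bar>\<Sum>n<Suc k. v n\<bar> \<le> (\<Sum>n<Suc k. C)"
  using assms by (intro order_trans[OF sum_abs] sum_mono)
 also have "\<dots> = real (Suc k) * C" by simp
 finally show ?thesis by (simp add: abs_mult divide_simps mult.commute del: of_nat_Suc sum.lessThan_Suc)
qed

text \<open>A cocycle is cohomologous to its mean over the powers of \<open>\<tau>\<close>, whose values are fixed by \<open>\<tau>\<close>.\<close>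

lemma vanishing_transvection:
 assumes S: "points m S" and x: "cochain (Y S 1) q x" "null (Y S 1) (Suc q) (dd x)"
 shows "cob (Y S 1) q x"
proof -
 let ?T = "Y S 1"
 define \<sigma> where "\<sigma> n v = \<tau> (hd v) [^] (n :: nat)" for n v
 have T: "hd v \<in> P" "\<forall>b\<in>set v. b \<in> P \<and> act (\<tau> (hd v)) b = b" "v \<noteq> []" if v: "v \<in> ?T" for v
 proof -
  obtain w s where s: "v = w # s" "w \<in> P" "s \<in> S" "\<forall>b\<in>set s. perp w b" using v by (rule Y_1E)
  have "set s \<subseteq> P" using S s(3) by (auto simp: points_def)
  with s show "hd v \<in> P" "\<forall>b\<in>set v. b \<in> P \<and> act (\<tau> (hd v)) b = b" "v \<noteq> []"
   by (auto simp: \<tau>_self intro!: \<tau>_fix)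
 qed
 have \<tau>c: "\<tau> (hd v) \<in> carrier G" if "v \<in> ?T" for v using T(1)[OF that] by (rule \<tau>_closed)
 have \<sigma>_closed: "\<sigma> n v \<in> carrier G" if "v \<in> ?T" for n v
  using \<tau>c[OF that] by (simp add: \<sigma>_def)
 have \<sigma>_fix: "map (act (\<sigma> n v)) v = v" if v: "v \<in> ?T" for n v
 proof (rule map_idI)
  fix b assume "b \<in> set v"
  then have b: "b \<in> P" "act (\<tau> (hd v)) b = b" using T(2)[OF v] by auto
  show "act (\<sigma> n v) b = b"
   unfolding \<sigma>_def by (induction n) (use b \<tau>c[OF v] in \<open>auto simp: act_one act_mult\<close>)
 qed
 have conj_pow: "(g \<otimes> h \<otimes> inv g) [^] n = g \<otimes> h [^] n \<otimes> inv g" if "g \<in> carrier G" "h \<in> carrier G" for g h and n :: nat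
 proof (induction n)
  case (Suc n)
  have "g \<otimes> h [^] n \<otimes> inv g \<otimes> (g \<otimes> h \<otimes> inv g) = g \<otimes> h [^] n \<otimes> (inv g \<otimes> g) \<otimes> h \<otimes> inv g"
   using that by (simp only: m_assoc m_closed inv_closed nat_pow_closed)
  with Suc that show ?case by (simp add: m_assoc)
 qed (use that in simp)
 have \<sigma>_act: "\<sigma> n (map (act g) v) = g \<otimes> \<sigma> n v \<otimes> inv g" if "g \<in> carrier G" "v \<in> ?T" for n g v
  using T[OF that(2)] \<tau>c[OF that(2)] that(1) by (simp add: \<sigma>_def hd_map \<tau>_act conj_pow)
 \<comment> \<open>Powers of \<tau> fix the whole tuple \<open>v\<close>, so equivariance trades a
   translation of the group entries for the action on the coefficients.\<close>
 have translate: "x v (map (\<lambda>g. inv (\<sigma> n v) \<otimes> g) gs) i = x v gs (ia (\<sigma> n v) i)"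
  if v: "v \<in> ?T" and gs: "gs \<in> tuples G q" and i: "i \<in> I" for n v gs i
 proof -
  let ?hs = "map (\<lambda>g. inv (\<sigma> n v) \<otimes> g) gs"
  have "map ((\<otimes>) (\<sigma> n v)) ?hs = gs"
   unfolding map_map by (rule map_idI) (use gs \<sigma>_closed[OF v] in \<open>auto simp: tuples_def m_assoc[symmetric]\<close>)
  moreover have "?hs \<in> tuples G q"
   using tuples_map[OF is_group inv_closed[OF \<sigma>_closed[OF v]] gs] .
  ultimately show ?thesis
   using cochainD(2)[OF x(1) \<sigma>_closed[OF v, of n] v _ i, of ?hs] \<sigma>_fix[OF v, of n]
   by (simp del: map_map)
 qed
 obtain C where "0 \<le> C" and C0: "\<forall>s\<in>?T. \<forall>gs\<in>tuples G q. \<forall>i\<in>I. \<bar>x s gs i\<bar> \<le> C * wt i"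
  by (rule cochain_bound[OF x(1)])
 note C = C0[rule_format]
 show ?thesis
 proof (cases q)
  case 0
  have "x v gs i = 0" if v: "v \<in> ?T" and gs: "gs \<in> tuples G q" and i: "i \<in> I" for v gs i
  proof (rule W_fix[OF T(1)[OF v] cochainD(1)[OF x(1) v gs] C[OF v gs] _ i])
   fix i assume i: "i \<in> I"
   have "map (\<lambda>g. inv (\<sigma> 1 v) \<otimes> g) gs \<in> tuples G 0"
    using tuples_map[OF is_group inv_closed[OF \<sigma>_closed[OF v]]] gs 0 by blast
   from degree_zero_constant[OF x(2)[unfolded 0] v i this] gs 0 translate[OF v gs i, of 1]
   show "x v gs (ia (\<tau> (hd v)) i) = x v gs i" using \<tau>c[OF v] by (simp add: \<sigma>_def)
  qed
  then show ?thesis by (simp add: 0 agree_def)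
 next
  case (Suc k)
  obtain F :: "nat filter" where F: "F \<noteq> bot" "F \<le> sequentially"
   and F_lim: "\<forall>b :: nat \<Rightarrow> real. (\<exists>C. \<forall>k. \<bar>b k\<bar> \<le> C) \<longrightarrow> (\<exists>l. (b \<longlongrightarrow> l) F)"
   using limit_filter_exists by blast
  define mean where "mean b K = 1 / real (Suc K) * (\<Sum>n<Suc K. b n)" for b :: "nat \<Rightarrow> real" and K :: nat
  define avg where "avg b = Lim F (mean b)" for b
  have avg: "(mean b \<longlongrightarrow> avg b) F" if b: "\<And>n. \<bar>b n\<bar> \<le> D" for b D
  proof -
   have "\<bar>mean b K\<bar> \<le> D" for K
    unfolding mean_def by (rule mean_bound) (rule b)
   then have "\<exists>l. (mean b \<longlongrightarrow> l) F" using F_lim by blast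
   then show ?thesis unfolding avg_def using tendsto_Lim[OF F(1)] by metis
  qed
  have avg_bound: "\<bar>avg b\<bar> \<le> D" if b: "\<And>n. \<bar>b n\<bar> \<le> D" for b D
  proof (rule tendsto_upperbound[OF tendsto_rabs[OF avg[of b D]] _ F(1)])
   show "\<forall>\<^sub>F K in F. \<bar>mean b K\<bar> \<le> D"
    unfolding mean_def by (intro always_eventually allI mean_bound b)
  qed (rule b)
  define y where "y n = (\<lambda>v gs i. prism (\<lambda>g. g) (\<lambda>g. inv (\<sigma> n v) \<otimes> g) (\<lambda>hs. x v hs i) gs)" for n
  have y: "cochain ?T k (y n)"
    "agree ?T q (\<lambda>v gs i. x v gs (ia (\<sigma> n v) i) - x v gs i) (dd (y n))"
    \<comment> \<open>This bound does not depend on \<open>n\<close>; hence the means of these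
      primitives have limits along \<open>F\<close> that obey it too.\<close>
    "\<And>v gs i. v \<in> ?T \<Longrightarrow> gs \<in> tuples G k \<Longrightarrow> i \<in> I \<Longrightarrow> \<bar>y n v gs i\<bar> \<le> real q * C * wt i" for n
  proof -
   have idT: "\<And>u. u \<in> ?T \<Longrightarrow> u \<in> ?T" "\<And>g u. g \<in> carrier G \<Longrightarrow> u \<in> ?T \<Longrightarrow> map (act g) u = map (act g) u"
    by simp_all
   note pt = prism_translate[OF x, of ?T "\<lambda>v. v" "\<sigma> n", OF idT(1) idT(2) \<sigma>_closed \<sigma>_act Suc]
   show "cochain ?T k (y n)" unfolding y_def by (rule pt(1)) assumption+
   have "agree ?T q (\<lambda>v gs i. x v (map (\<lambda>g. inv (\<sigma> n v) \<otimes> g) gs) i - x v gs i) (dd (y n))"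
    unfolding y_def by (rule pt(2)) assumption+
   then show "agree ?T q (\<lambda>v gs i. x v gs (ia (\<sigma> n v) i) - x v gs i) (dd (y n))"
    using translate by (simp add: agree_def)
   show "\<And>v gs i. v \<in> ?T \<Longrightarrow> gs \<in> tuples G k \<Longrightarrow> i \<in> I \<Longrightarrow> \<bar>y n v gs i\<bar> \<le> real q * C * wt i"
    unfolding y_def by (rule pt(3)) (assumption | rule C0)+
  qed
  have Y_cochain: "cochain ?T k (\<lambda>v gs i. avg (\<lambda>n. y n v gs i))"
  proof (rule cochainI[of _ _ _ "real q * C"])
   fix v gs assume v: "v \<in> ?T" and gs: "gs \<in> tuples G k"
   show "(\<lambda>i. avg (\<lambda>n. y n v gs i)) \<in> W"
   proof (rule W_lim[OF F(1)])
    show "(\<lambda>i. mean (\<lambda>n. y n v gs i) K) \<in> W" for K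
     unfolding mean_def by (intro W_cmult W_sum cochainD(1)[OF y(1)] v gs)
    show "((\<lambda>K. mean (\<lambda>n. y n v gs i) K) \<longlongrightarrow> avg (\<lambda>n. y n v gs i)) F" if "i \<in> I" for i
     by (rule avg) (rule y(3)[OF v gs that])
   qed
   fix i assume i: "i \<in> I"
   show "\<bar>avg (\<lambda>n. y n v gs i)\<bar> \<le> real q * C * wt i" by (rule avg_bound) (rule y(3)[OF v gs i])
   fix g assume g: "g \<in> carrier G"
   show "avg (\<lambda>n. y n (map (act g) v) (map ((\<otimes>) g) gs) (ia g i)) = avg (\<lambda>n. y n v gs i)"
    unfolding cochainD(2)[OF y(1) g v gs i] ..
  qed
  let ?x = "\<lambda>n v gs i. x v gs (ia (\<sigma> n v) i)"
  have x_bound: "\<bar>x v gs (ia (\<sigma> n v) i)\<bar> \<le> C * wt i"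
   if v: "v \<in> ?T" and gs: "gs \<in> tuples G q" and i: "i \<in> I" for n v gs i
   using C[OF v gs ia_closed[OF \<sigma>_closed[OF v] i]] wt_ia[OF \<sigma>_closed[OF v] i] by simp
  have lim_zero: "avg (\<lambda>n. ?x n v gs i) = 0"
   if v: "v \<in> ?T" and gs: "gs \<in> tuples G q" and i: "i \<in> I" for v gs i
  proof (rule W_fix[OF T(1)[OF v] _ _ _ i])
   show "(\<lambda>i. avg (\<lambda>n. ?x n v gs i)) \<in> W"
   proof (rule W_lim[OF F(1)])
    show "(\<lambda>i. mean (\<lambda>n. ?x n v gs i) K) \<in> W" for K
     unfolding mean_def by (intro W_cmult W_sum W_ia cochainD(1)[OF x(1)] v gs \<sigma>_closed)
    show "((\<lambda>K. mean (\<lambda>n. ?x n v gs i) K) \<longlongrightarrow> avg (\<lambda>n. ?x n v gs i)) F" if "i \<in> I" for i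
     by (rule avg) (rule x_bound[OF v gs that])
   qed
   show "\<bar>avg (\<lambda>n. ?x n v gs i)\<bar> \<le> C * wt i" if i: "i \<in> I" for i
    by (rule avg_bound) (rule x_bound[OF v gs i])
   fix i assume i: "i \<in> I"
   let ?j = "ia (\<tau> (hd v)) i"
   have j: "?j \<in> I" using ia_closed[OF \<tau>c[OF v] i] .
   have shift: "ia (\<sigma> n v) ?j = ia (\<sigma> (Suc n) v) i" for n
    unfolding \<sigma>_def by (rule ia_pow[OF \<tau>c[OF v] i])
   \<comment> \<open>Shifting the averaged sequence by one step changes each mean by a telescoping
     remainder of size at most \<open>2 * C * wt i\<close> divided by the number of terms. So the
     limit is fixed by \<tau>.\<close>
   have "(\<lambda>K. 1 / real (Suc K) * (2 * (C * wt i))) \<longlonglongrightarrow> 0"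
    using LIMSEQ_inverse_real_of_nat by (intro tendsto_mult_left_zero) (simp add: inverse_eq_divide)
   then have "(\<lambda>K. mean (\<lambda>n. ?x n v gs ?j) K - mean (\<lambda>n. ?x n v gs i) K) \<longlonglongrightarrow> 0"
   proof (rule Lim_null_comparison[rotated], intro always_eventually allI)
    fix K
    have "mean (\<lambda>n. ?x n v gs ?j) K - mean (\<lambda>n. ?x n v gs i) K =
      1 / real (Suc K) * (x v gs (ia (\<sigma> (Suc K) v) i) - x v gs (ia (\<sigma> 0 v) i))"
     unfolding mean_def shift right_diff_distrib[symmetric] sum_subtractf[symmetric]
     using sum_lessThan_telescope[of "\<lambda>n. x v gs (ia (\<sigma> n v) i)" "Suc K"] by simp
    moreover have "\<bar>x v gs (ia (\<sigma> (Suc K) v) i) - x v gs (ia (\<sigma> 0 v) i)\<bar> \<le> 2 * (C * wt i)"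
     using x_bound[OF v gs i, of "Suc K"] x_bound[OF v gs i, of 0] by linarith
    ultimately show "norm (mean (\<lambda>n. ?x n v gs ?j) K - mean (\<lambda>n. ?x n v gs i) K) \<le> 1 / real (Suc K) * (2 * (C * wt i))"
     by (simp add: abs_mult divide_right_mono)
   qed
   then have "((\<lambda>K. mean (\<lambda>n. ?x n v gs ?j) K - mean (\<lambda>n. ?x n v gs i) K) \<longlongrightarrow> 0) F"
    using F(2) by (rule tendsto_mono[rotated])
   moreover have "((\<lambda>K. mean (\<lambda>n. ?x n v gs ?j) K - mean (\<lambda>n. ?x n v gs i) K) \<longlongrightarrow> avg (\<lambda>n. ?x n v gs ?j) - avg (\<lambda>n. ?x n v gs i)) F"
    by (intro tendsto_diff avg) (rule x_bound[OF v gs j] x_bound[OF v gs i])+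
   ultimately show "avg (\<lambda>n. ?x n v gs ?j) = avg (\<lambda>n. ?x n v gs i)"
    using tendsto_unique[OF F(1), of _ "0" "avg (\<lambda>n. ?x n v gs ?j) - avg (\<lambda>n. ?x n v gs i)"] by simp
  qed
  \<comment> \<open>Each \<open>y n\<close> bounds the n-th translate of \<open>x\<close> minus
    \<open>x\<close>. The translates average to zero, which leaves \<open>- x\<close> and explains
    the sign.\<close>
  have "agree ?T q x (dd (\<lambda>v gs i. -1 * avg (\<lambda>n. y n v gs i)))"
   unfolding agree_def
  proof (intro ballI)
   fix v gs i assume v: "v \<in> ?T" and gs: "gs \<in> tuples G q" and i: "i \<in> I"
   have face: "hs \<in> tuples G k" if "length gs = Suc (length hs)" "set hs \<subseteq> set gs" for hs
    using tuples_face[OF gs[unfolded Suc] that] .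
   have bd_lim: "((\<lambda>K. bd (\<lambda>hs. mean (\<lambda>n. y n v hs i) K) gs) \<longlongrightarrow> bd (\<lambda>hs. avg (\<lambda>n. y n v hs i)) gs) F"
    unfolding bd_eq_sum
   proof (intro tendsto_sum tendsto_mult tendsto_const)
    fix j assume "j \<in> {..<length gs}"
    then have "take j gs @ drop (Suc j) gs \<in> tuples G k"
     by (intro face) (auto dest: in_set_takeD in_set_dropD)
    from y(3)[OF v this i]
    show "((\<lambda>K. mean (\<lambda>n. y n v (take j gs @ drop (Suc j) gs) i) K) \<longlongrightarrow> avg (\<lambda>n. y n v (take j gs @ drop (Suc j) gs) i)) F"
     by (rule avg)
   qed
   have "bd (\<lambda>hs. mean (\<lambda>n. y n v hs i) K) gs = mean (\<lambda>n. ?x n v gs i) K - x v gs i" for K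
   proof -
    have "bd (\<lambda>hs. y n v hs i) gs = ?x n v gs i - x v gs i" for n
     using y(2)[of n] v gs i by (simp add: agree_def dd_def)
    then have "bd (\<lambda>hs. mean (\<lambda>n. y n v hs i) K) gs = 1 / real (Suc K) * (\<Sum>n<Suc K. ?x n v gs i - x v gs i)"
     unfolding mean_def bd_cmult bd_sum by simp
    then show ?thesis
     unfolding mean_def sum_subtractf right_diff_distrib by (simp del: sum.lessThan_Suc)
   qed
   moreover have "((\<lambda>K. mean (\<lambda>n. ?x n v gs i) K - x v gs i) \<longlongrightarrow> avg (\<lambda>n. ?x n v gs i) - x v gs i) F"
    by (intro tendsto_diff tendsto_const avg) (rule x_bound[OF v gs i])
   ultimately have "bd (\<lambda>hs. avg (\<lambda>n. y n v hs i)) gs = avg (\<lambda>n. ?x n v gs i) - x v gs i"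
    using bd_lim tendsto_unique[OF F(1)] by simp
   then show "x v gs i = dd (\<lambda>v gs i. -1 * avg (\<lambda>n. y n v gs i)) v gs i"
    unfolding dd_def bd_cmult lim_zero[OF v gs i] by simp
  qed
  then show ?thesis using cochain_cmult[OF Y_cochain] unfolding Suc cob_Suc by blast
 qed
qed

text \<open>\<open>vanishing_transvection\<close> covers \<open>Y S 1\<close>, but not longer
  tuples, since their added points need not be perpendicular to one another. Those are handled by
  the induction hypothesis with \<open>Y S n\<close> as the base set, which makes the rows exact for
  trivial reasons. Degree \<open>j\<close> in column \<open>q - j + 1\<close> costs
  \<open>m + q + j + 1\<close> points including the \<open>2 * j\<close> of the hypothesis, hence at
  most \<open>m + 2 * q\<close>.\<close>

theorem vanishing:
 assumes "points m S" "m + 2 * q \<le> N" "cochain S q x" "null S (Suc q) (dd x)"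
 shows "cob S q x"
 using assms
proof (induction q arbitrary: m S x rule: less_induct)
 case (less q)
 have "row_exact S (q - j) j" if j: "j < q" for j
  unfolding row_exact_def
 proof (intro allI impI)
  fix x assume x: "cochain (Y S (Suc (q - j))) j x" "null (Y S (Suc (q - j))) (Suc j) (dd x)"
  have "cob (Y S (Suc (q - j))) j x"
   by (rule less.IH[OF j points_Y[OF less.prems(1)] _ x]) (use less.prems(2) j in simp)
  moreover have "dl n (\<lambda>s gs i. 0) = (\<lambda>s gs i. 0)" "dd (\<lambda>s gs i. 0) = (\<lambda>s gs i. 0)" for n
   by (simp_all add: dl_def[abs_def] dd_def[abs_def])
  ultimately show "\<exists>z. cochain (Y S (q - j)) j z \<and> null (Y S (q - j)) (Suc j) (dd z) \<and>
    cob (Y S (Suc (q - j))) j (\<lambda>s gs i. x s gs i - dl (Suc (q - j)) z s gs i)"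
   by (intro exI[of _ "\<lambda>s gs i. 0"] conjI) (simp_all only: cochain_zero agree_def diff_zero simp_thms ball_simps ball_triv)
 qed
 then have "inj_at S q"
  using less.prems(2) by (intro inj_step[OF less.prems(1)]) simp_all
 moreover have "cob (Y S 1) q (dl 1 x)"
 proof (rule vanishing_transvection[OF less.prems(1)])
  show "cochain (Y S 1) q (dl 1 x)"
   using cochain_dl[OF less.prems(1), of 0 q x] less.prems(3) by simp
  show "null (Y S 1) (Suc q) (dd (dl 1 x))"
   using dl_agree[of S 0 "Suc q" "dd x" "\<lambda>s gs i. 0"] less.prems(4)
   by (simp add: agree_def dl_dd[symmetric] dl_def[of _ "\<lambda>s gs i. 0"])
 qed
 ultimately show ?case using less.prems(3,4) unfolding inj_at_def by blast
qed

end

section \<open>Descending chains of injections of vector spaces\<close>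

context vector_space
begin

lemma complement_basis:
 assumes "subspace B" "subspace Z" "B \<subseteq> Z"
 obtains b c where "independent (b \<union> c)" "b \<inter> c = {}" "span b = B" "span (b \<union> c) = Z"
proof -
 obtain b where b: "b \<subseteq> B" "independent b" "B \<subseteq> span b"
  using maximal_independent_subset[of B] by blast
 obtain d where d: "b \<subseteq> d" "d \<subseteq> Z" "independent d" "Z \<subseteq> span d"
  using maximal_independent_subset_extend[of b Z] b assms by blast
 have "span b = B" "span d = Z"
  using b(3) d(4) span_minimal[OF b(1) assms(1)] span_minimal[OF d(2) assms(2)] by auto
 with d show ?thesis
  by (intro that[of b "d - b"]) (auto simp: Un_absorb1)
qed

lemma mem_span_Un:
 assumes "x \<in> span (b \<union> c)"
 obtains u v where "u \<in> span b" "v \<in> span c" "x = u + v"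
 using assms unfolding span_Un by blast

lemma projection_exists:
 assumes "independent (b \<union> c)" "b \<inter> c = {}"
 obtains p where "Vector_Spaces.linear scale scale p" "\<And>x. x \<in> span b \<Longrightarrow> p x = 0" "\<And>x. x \<in> span c \<Longrightarrow> p x = x"
proof -
 interpret pair: vector_space_pair scale scale ..
 obtain p where p: "Vector_Spaces.linear scale scale p" "\<forall>y\<in>b \<union> c. p y = (if y \<in> c then y else 0)"
  using pair.linear_independent_extend[OF assms(1), of "\<lambda>y. if y \<in> c then y else 0"] by blast
 show ?thesis
 proof (rule that[OF p(1)])
  show "p x = 0" if "x \<in> span b" for x
   by (rule pair.linear_eq_0_on_span[OF p(1) _ that]) (use p(2) assms(2) in auto)
  show "p x = x" if "x \<in> span c" for x
   using pair.linear_eq_on_span[OF p(1) linear_ident, of c x] p(2) that by auto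
 qed
qed

lemma span_Int_independent:
 assumes "independent (b \<union> c)" "b \<inter> c = {}" "x \<in> span b" "x \<in> span c"
 shows "x = 0"
 using projection_exists[OF assms(1,2)] assms(3,4) by metis

text \<open>Cardinals are well-ordered, so the cardinality of a basis of \<open>Z r / B r\<close>, which cannot increase
 with \<open>r\<close>, is eventually constant.\<close>

theorem decreasing_quotients:
 fixes Z B :: "nat \<Rightarrow> 'b set" and t :: "nat \<Rightarrow> 'b \<Rightarrow> 'b"
 assumes Z: "\<And>r. subspace (Z r)" and B: "\<And>r. subspace (B r)" and BZ: "\<And>r. B r \<subseteq> Z r"
  and t_add: "\<And>r x y. r \<ge> R \<Longrightarrow> x \<in> Z (Suc r) \<Longrightarrow> y \<in> Z (Suc r) \<Longrightarrow> t r (x + y) = t r x + t r y"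
  and t_scale: "\<And>r a x. r \<ge> R \<Longrightarrow> x \<in> Z (Suc r) \<Longrightarrow> t r (scale a x) = scale a (t r x)"
  and tZ: "\<And>r x. r \<ge> R \<Longrightarrow> x \<in> Z (Suc r) \<Longrightarrow> t r x \<in> Z r"
  and tB: "\<And>r x. r \<ge> R \<Longrightarrow> x \<in> Z (Suc r) \<Longrightarrow> t r x \<in> B r \<longleftrightarrow> x \<in> B (Suc r)"
 shows "\<exists>r0\<ge>R. \<forall>r\<ge>r0. \<exists>\<phi>. Vector_Spaces.linear scale scale \<phi> \<and> (\<forall>x\<in>Z r. \<phi> x \<in> Z (Suc r) \<and> (\<phi> x \<in> B (Suc r) \<longleftrightarrow> x \<in> B r)) \<and>
   (\<forall>y\<in>Z (Suc r). \<exists>x\<in>Z r. y - \<phi> x \<in> B (Suc r))"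
proof -
 interpret pair: vector_space_pair scale scale ..
 have "\<forall>r. \<exists>b c. independent (b \<union> c) \<and> b \<inter> c = {} \<and> span b = B r \<and> span (b \<union> c) = Z r"
  using complement_basis[OF B Z BZ] by metis
 then obtain b c where bc: "\<And>r. independent (b r \<union> c r)" "\<And>r. b r \<inter> c r = {}" "\<And>r. span (b r) = B r"
   "\<And>r. span (b r \<union> c r) = Z r" by metis
 have c_indep: "independent (c r)" for r
  using bc(1)[of r] by (rule independent_mono) auto
 have cZ: "span (c r) \<subseteq> Z r" for r
  using span_mono[of "c r" "b r \<union> c r"] bc(4) by auto
 have card: "(card_of (c (Suc r)), card_of (c r)) \<in> ordLeq" if r: "r \<ge> R" for r
 proof -
  obtain p where p: "Vector_Spaces.linear scale scale p" "\<And>x. x \<in> B r \<Longrightarrow> p x = 0" "\<And>x. x \<in> span (c r) \<Longrightarrow> p x = x"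
   using projection_exists[OF bc(1,2), of r] bc(3)[of r] by metis
  interpret p: Vector_Spaces.linear scale scale p by fact
  \<comment> \<open>\<open>t r\<close> is additive only on \<open>Z (Suc r)\<close>, so a linear map
    on the whole space is built from its values on the basis and then compared with \<open>p\<close>
    after \<open>t r\<close> on the span of that basis.\<close>
  obtain g where g: "Vector_Spaces.linear scale scale g" "\<forall>x\<in>c (Suc r). g x = p (t r x)"
   using pair.linear_independent_extend[OF c_indep, where f = "\<lambda>x. p (t r x)"] by blast
  interpret g: Vector_Spaces.linear scale scale g by fact
  have t0: "t r 0 = 0" using t_scale[OF r subspace_0[OF Z], of 0] by simp
  have gp: "g x = p (t r x)" if "x \<in> span (c (Suc r))" for x
  proof -
   have "x \<in> Z (Suc r) \<and> g x = p (t r x)"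
    using that
   proof (induction rule: span_induct_alt)
    case base
    then show ?case by (simp add: t0 subspace_0 Z g.zero p.zero)
   next
    case (step a x y)
    then have x: "x \<in> Z (Suc r)" using cZ[of "Suc r"] span_base by blast
    with step g(2) show ?case
     by (simp add: t_add t_scale r subspace_add subspace_scale Z g.add g.scale p.add p.scale)
   qed
   then show ?thesis ..
  qed
  have inj: "inj_on g (span (c (Suc r)))"
   unfolding pair.linear_inj_on_iff_eq_0[OF g(1) subspace_span]
  proof (intro ballI impI)
   fix x assume x: "x \<in> span (c (Suc r))" "g x = 0"
   have xZ: "x \<in> Z (Suc r)" using x cZ by auto
   have "t r x \<in> span (b r \<union> c r)" using tZ[OF r xZ] bc(4) by simp
   then obtain u v where uv: "u \<in> span (b r)" "v \<in> span (c r)" "t r x = u + v"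
    by (rule mem_span_Un)
   then have "p (t r x) = v" using p bc(3) by (simp add: p.add)
   with x gp have "v = 0" by simp
   with uv bc(3) have "t r x \<in> B r" by simp
   then have "x \<in> span (b (Suc r))" using tB[OF r xZ] bc(3) by simp
   then show "x = 0" using span_Int_independent[OF bc(1,2)] x by blast
  qed
  have indep: "independent (g ` c (Suc r))"
   by (rule g.independent_injective_image[OF c_indep inj])
  have sub: "g ` c (Suc r) \<subseteq> span (c r)"
  proof
   fix y assume "y \<in> g ` c (Suc r)"
   then obtain x where x: "x \<in> c (Suc r)" "y = p (t r x)" using g(2) by auto
   then have "t r x \<in> span (b r \<union> c r)" using tZ[OF r] cZ[of "Suc r"] span_base bc(4) by blast
   then obtain u v where uv: "u \<in> span (b r)" "v \<in> span (c r)" "t r x = u + v"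
    by (rule mem_span_Un)
   then show "y \<in> span (c r)" using x p bc(3) by (simp add: p.add)
  qed
  obtain e where e: "g ` c (Suc r) \<subseteq> e" "e \<subseteq> span (c r)" "independent e" "span (c r) \<subseteq> span e"
   using maximal_independent_subset_extend[OF sub indep] by blast
  have "span e = span (c r)"
   using e(4) span_minimal[OF e(2) subspace_span] by auto
  then obtain h where "bij_betw h e (c r)"
   using bij_if_span_eq_span_bases[OF e(3) c_indep] by blast
  then have "(card_of (e), card_of (c r)) \<in> ordIso" using card_of_ordIso by blast
  moreover have "(card_of (g ` c (Suc r)), card_of (e)) \<in> ordLeq" using e(1) by (rule card_of_mono1)
  moreover have "(card_of (c (Suc r)), card_of (g ` c (Suc r))) \<in> ordIso"
  proof -
   have "inj_on g (c (Suc r))" using inj span_superset by (rule inj_on_subset)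
   then show ?thesis using card_of_ordIso inj_on_imp_bij_betw by blast
  qed
  ultimately show ?thesis
   using ordIso_ordLeq_trans ordLeq_ordIso_trans by blast
 qed
 have mono: "(card_of (c (r + k)), card_of (c r)) \<in> ordLeq" if "r \<ge> R" for r k
 proof (induction k)
  case 0
  show ?case by (simp add: card_of_mono1)
 next
  case (Suc k)
  have "(card_of (c (Suc (r + k))), card_of (c (r + k))) \<in> ordLeq" using that by (intro card) simp
  with Suc show ?case using ordLeq_transitive by auto
 qed
 let ?S = "(\<lambda>r. card_of (c r)) ` {R..}"
 \<comment> \<open>A minimal cardinal among those of the bases exists by well-foundedness; being
   attained at \<open>r0\<close>, it persists from there on because the sequence cannot
   increase.\<close>
 obtain r0 where r0: "r0 \<ge> R" "\<And>r. r \<ge> R \<Longrightarrow> (card_of (c r), card_of (c r0)) \<notin> ordLess"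
 proof -
  have "card_of (c R) \<in> ?S" by simp
  then obtain z where "z \<in> ?S" "\<And>y. (y, z) \<in> ordLess \<Longrightarrow> y \<notin> ?S"
   using wfE_min[OF wf_ordLess, of "card_of (c R)" ?S] by blast
  then show ?thesis using that by blast
 qed
 have eq: "(card_of (c r), card_of (c r0)) \<in> ordIso" if "r \<ge> r0" for r
 proof -
  have "(card_of (c r), card_of (c r0)) \<in> ordLeq" using mono[OF r0(1), of "r - r0"] that by simp
  moreover have "(card_of (c r), card_of (c r0)) \<notin> ordLess" using r0 that by simp
  ultimately show ?thesis using ordLeq_iff_ordLess_or_ordIso by blast
 qed
 show ?thesis
 proof (intro exI[of _ r0] conjI allI impI r0(1))
  fix r assume r: "r0 \<le> r"
  have "(card_of (c r), card_of (c (Suc r))) \<in> ordIso"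
   using eq[OF r] eq[of "Suc r"] r ordIso_symmetric ordIso_transitive by (meson le_SucI)
  then obtain h where h: "bij_betw h (c r) (c (Suc r))" using card_of_ordIso by blast
  \<comment> \<open>This isomorphism goes upwards and is unrelated to \<open>t\<close>: any
    bijection between the complementary bases extends to one.\<close>
  obtain \<phi> where \<phi>: "Vector_Spaces.linear scale scale \<phi>" "\<forall>x\<in>b r \<union> c r. \<phi> x = (if x \<in> c r then h x else 0)"
   using pair.linear_independent_extend[OF bc(1), of _ "\<lambda>x. if x \<in> c r then h x else 0"] by blast
  interpret \<phi>: Vector_Spaces.linear scale scale \<phi> by fact
  have \<phi>b: "\<phi> x = 0" if "x \<in> span (b r)" for x
   by (rule pair.linear_eq_0_on_span[OF \<phi>(1) _ that]) (use \<phi>(2) bc(2)[of r] in auto)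
  have \<phi>c: "\<phi> ` c r = c (Suc r)" "inj_on \<phi> (c r)"
   using h \<phi>(2) by (auto simp: bij_betw_def inj_on_def)
  have \<phi>span: "\<phi> ` span (c r) = span (c (Suc r))"
   using \<phi>.span_image[of "c r"] \<phi>c by simp
  have \<phi>inj: "inj_on \<phi> (span (c r))"
   using \<phi>.inj_on_span_independent_image[of "c r"] \<phi>c c_indep by simp
  have "\<phi> x \<in> Z (Suc r) \<and> (\<phi> x \<in> B (Suc r) \<longleftrightarrow> x \<in> B r)" if x: "x \<in> Z r" for x
  proof -
   have "x \<in> span (b r \<union> c r)" using x bc(4) by simp
   then obtain u v where uv: "u \<in> span (b r)" "v \<in> span (c r)" "x = u + v" by (rule mem_span_Un)
   have \<phi>x: "\<phi> x = \<phi> v" using uv \<phi>b by (simp add: \<phi>.add)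
   have v': "\<phi> v \<in> span (c (Suc r))" using uv(2) \<phi>span by blast
   have "x \<in> B r" if "\<phi> x \<in> B (Suc r)"
   proof -
    have "\<phi> v = 0" using span_Int_independent[OF bc(1,2) _ v'] that \<phi>x bc(3) by simp
    then have "v = 0" using \<phi>inj uv(2) by (metis \<phi>.zero inj_onD span_zero)
    then show ?thesis using uv bc(3) by simp
   qed
   moreover have "\<phi> x \<in> B (Suc r)" if "x \<in> B r"
    using \<phi>b that bc(3) subspace_0[OF B] by simp
   ultimately show ?thesis using v' cZ \<phi>x by auto
  qed
  moreover have "\<exists>x\<in>Z r. y - \<phi> x \<in> B (Suc r)" if y: "y \<in> Z (Suc r)" for y
  proof -
   have "y \<in> span (b (Suc r) \<union> c (Suc r))" using y bc(4) by simp
   then obtain u v where uv: "u \<in> span (b (Suc r))" "v \<in> span (c (Suc r))" "y = u + v" by (rule mem_span_Un)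
   then obtain x where "x \<in> span (c r)" "v = \<phi> x" using \<phi>span by blast
   with uv bc(3) cZ show ?thesis by (intro bexI[of _ x]) auto
  qed
  ultimately show "\<exists>\<phi>. Vector_Spaces.linear scale scale \<phi> \<and> (\<forall>x\<in>Z r. \<phi> x \<in> Z (Suc r) \<and> (\<phi> x \<in> B (Suc r) \<longleftrightarrow> x \<in> B r)) \<and>
   (\<forall>y\<in>Z (Suc r). \<exists>x\<in>Z r. y - \<phi> x \<in> B (Suc r))"
   using \<phi>(1) by blast
 qed
qed

end

section \<open>Bounded cohomology as a vector space\<close>

abbreviation "cochains \<equiv> bounded_cochains"
abbreviation "cocycles \<equiv> bounded_cocycles"
abbreviation "cobs \<equiv> bounded_coboundaries"

lemma cochainsD:
 assumes "f \<in> cochains G q"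
 shows "\<And>gs. gs \<notin> tuples G q \<Longrightarrow> f gs = 0"
  "\<And>g gs. g \<in> carrier G \<Longrightarrow> gs \<in> tuples G q \<Longrightarrow> f (map (\<lambda>x. g \<otimes>\<^bsub>G\<^esub> x) gs) = f gs"
 using assms by (auto simp: bounded_cochains_def)

lemma cochains_bound:
 assumes "f \<in> cochains G q"
 obtains C where "0 \<le> C" "\<forall>gs. \<bar>f gs\<bar> \<le> C"
proof -
 obtain C where C: "\<forall>x\<in>tuples G q. \<bar>f x\<bar> \<le> C"
  using assms unfolding bounded_cochains_def bounded_iff by auto
 have "\<bar>f gs\<bar> \<le> max C 0" for gs
  using C cochainsD(1)[OF assms, of gs] by (cases "gs \<in> tuples G q") (auto simp: le_max_iff_disj)
 then show ?thesis by (intro that[of "max C 0"]) auto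
qed

lemma cochainsI:
 assumes "\<And>gs. gs \<notin> tuples G q \<Longrightarrow> f gs = 0" "\<And>gs. gs \<in> tuples G q \<Longrightarrow> \<bar>f gs\<bar> \<le> C"
  "\<And>g gs. g \<in> carrier G \<Longrightarrow> gs \<in> tuples G q \<Longrightarrow> f (map (\<lambda>x. g \<otimes>\<^bsub>G\<^esub> x) gs) = f gs"
 shows "f \<in> cochains G q"
 using assms by (auto simp: bounded_cochains_def bounded_iff)

interpretation fun_space: vector_space "\<lambda>c (f :: 'x \<Rightarrow> real) x. c * f x"
 by unfold_locales (auto simp: fun_eq_iff algebra_simps)

lemma subspace_cochains: "fun_space.subspace (cochains G q)"
proof (rule fun_space.subspaceI)
 show "0 \<in> cochains G q" by (rule cochainsI[of _ _ _ 0]) auto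
next
 fix f h assume f: "f \<in> cochains G q" and h: "h \<in> cochains G q"
 obtain C where "0 \<le> C" and C: "\<forall>gs. \<bar>f gs\<bar> \<le> C" by (rule cochains_bound[OF f])
 obtain D where "0 \<le> D" and D: "\<forall>gs. \<bar>h gs\<bar> \<le> D" by (rule cochains_bound[OF h])
 show "f + h \<in> cochains G q"
 proof (rule cochainsI[of _ _ _ "C + D"])
  show "\<bar>(f + h) gs\<bar> \<le> C + D" for gs
   using C[rule_format, of gs] D[rule_format, of gs] by simp
 qed (simp_all add: cochainsD[OF f] cochainsD[OF h])
next
 fix c f assume f: "f \<in> cochains G q"
 obtain C where C: "0 \<le> C" "\<forall>gs. \<bar>f gs\<bar> \<le> C" by (rule cochains_bound[OF f])
 show "(\<lambda>x. c * f x) \<in> cochains G q"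
 proof (rule cochainsI[of _ _ _ "\<bar>c\<bar> * C"])
  show "\<bar>c * f gs\<bar> \<le> \<bar>c\<bar> * C" for gs
   using C(2)[rule_format, of gs] by (simp add: abs_mult mult_left_mono)
 qed (simp_all add: cochainsD[OF f])
qed

lemma coboundary_eq: "coboundary G q f = (\<lambda>gs. if gs \<in> tuples G (Suc q) then bd f gs else 0)"
 using coboundary_eq_bd[of _ G q f] by (auto simp: fun_eq_iff coboundary_def)

lemma coboundary_linear:
 "coboundary G q (f + h) = coboundary G q f + coboundary G q h"
 "coboundary G q (\<lambda>x. c * f x) = (\<lambda>x. c * coboundary G q f x)"
 by (auto simp: coboundary_eq fun_eq_iff plus_fun_def bd_add bd_cmult)

lemma subspace_cocycles: "fun_space.subspace (cocycles G q)"
 using subspace_cochains[of G q] coboundary_linear[of G q]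
 unfolding bounded_cocycles_def fun_space.subspace_def
 by (auto simp: coboundary_eq fun_eq_iff zero_fun_def plus_fun_def)

lemma subspace_cobs: "fun_space.subspace (cobs G q)"
proof (cases q)
 case 0
 then show ?thesis by (simp add: zero_fun_def[symmetric] fun_space.subspace_0 fun_space.subspace_single_0)
next
 case (Suc k)
 have "module_hom (\<lambda>c (f :: 'a list \<Rightarrow> real) x. c * f x) (\<lambda>c f x. c * f x) (coboundary G k)"
  by unfold_locales (simp_all add: coboundary_linear)
 from module_hom.subspace_image[OF this subspace_cochains] show ?thesis
  by (simp add: Suc)
qed

lemma cobs_subset:
 assumes "Group.group G"
 shows "cobs G q \<subseteq> cocycles G q"
proof (cases q)
 case 0
 show ?thesis
  using fun_space.subspace_0[OF subspace_cocycles[of G 0]] by (simp add: 0 zero_fun_def)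
next
 case (Suc k)
 show ?thesis
 proof
  fix h assume "h \<in> cobs G q"
  then obtain f where f: "f \<in> cochains G k" "h = coboundary G k f" by (auto simp: Suc)
  obtain C where "0 \<le> C" and C: "\<forall>gs. \<bar>f gs\<bar> \<le> C" by (rule cochains_bound[OF f(1)])
  have face: "hs \<in> tuples G k" if "gs \<in> tuples G (Suc k)" "length gs = Suc (length hs)" "set hs \<subseteq> set gs" for gs hs
   using that by (auto simp: tuples_def)
  have map: "map (\<lambda>x. g \<otimes>\<^bsub>G\<^esub> x) gs \<in> tuples G p" if "g \<in> carrier G" "gs \<in> tuples G p" for g gs p
  proof -
   interpret Group.group G by fact
   show ?thesis using that by (auto simp: tuples_def)
  qed
  have "h \<in> cochains G q"
   unfolding f(2) Suc
  proof (rule cochainsI[of _ _ _ "real (k + 2) * C"])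
   fix gs assume gs: "gs \<in> tuples G (Suc k)"
   have "\<bar>bd f gs\<bar> \<le> real (length gs) * C" by (rule bd_bound) (simp add: C)
   then show "\<bar>coboundary G k f gs\<bar> \<le> real (k + 2) * C"
    using gs by (simp add: coboundary_eq tuples_def)
   fix g assume g: "g \<in> carrier G"
   have "bd f (map (\<lambda>x. g \<otimes>\<^bsub>G\<^esub> x) gs) = bd f gs"
    unfolding bd_map by (intro bd_cong cochainsD(2)[OF f(1)] g face[OF gs])
   then show "coboundary G k f (map (\<lambda>x. g \<otimes>\<^bsub>G\<^esub> x) gs) = coboundary G k f gs"
    using map[OF g gs] gs by (simp add: coboundary_eq)
  qed (simp add: coboundary_eq)
  moreover have "coboundary G q h = (\<lambda>_. 0)"
  proof (rule ext)
   fix gs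
   have "bd h gs = bd (bd f) gs" if "gs \<in> tuples G (Suc q)"
    by (rule bd_cong) (use that in \<open>auto simp: f(2) coboundary_eq Suc tuples_def\<close>)
   then show "coboundary G q h gs = 0" by (simp add: coboundary_eq)
  qed
  ultimately show "h \<in> cocycles G q" by (simp add: bounded_cocycles_def)
 qed
qed

lemma cocycle_space_simps:
 "x \<oplus>\<^bsub>cocycle_space G q\<^esub> y = x + y" "c \<odot>\<^bsub>cocycle_space G q\<^esub> x = (\<lambda>gs. c * x gs)"
 "carrier (cocycle_space G q) = cocycles G q"
 by (auto simp: cocycle_space_def plus_fun_def)

lemma a_r_coset_cocycle_space:
 "N +>\<^bsub>cocycle_space G q\<^esub> x = (\<lambda>n. n + x) ` N"
 by (auto simp: a_r_coset_def r_coset_def cocycle_space_def plus_fun_def)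

lemma linearly_isomorphicI:
 fixes G :: "('g, 'b) monoid_scheme" and H :: "('g, 'c) monoid_scheme" and q :: nat
 defines "Z \<equiv> cocycles G q" and "Z' \<equiv> cocycles H q"
  and "B \<equiv> cobs G q" and "B' \<equiv> cobs H q"
 assumes groups: "Group.group G" "Group.group H"
  and \<phi>: "Vector_Spaces.linear (\<lambda>c f x. c * f x) (\<lambda>c f x. c * f x) \<phi>"
  and \<phi>Z: "\<And>x. x \<in> Z \<Longrightarrow> \<phi> x \<in> Z'" and \<phi>B: "\<And>x. x \<in> Z \<Longrightarrow> \<phi> x \<in> B' \<longleftrightarrow> x \<in> B"
  and surj: "\<And>y. y \<in> Z' \<Longrightarrow> \<exists>x\<in>Z. y - \<phi> x \<in> B'"
 shows "linearly_isomorphic (bounded_cohomology G q) (bounded_cohomology H q)"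
proof -
 interpret \<phi>: Vector_Spaces.linear "\<lambda>c (f :: 'g list \<Rightarrow> real) x. c * f x" "\<lambda>c f x. c * f x" \<phi> by fact
 have sub: "fun_space.subspace Z" "fun_space.subspace Z'" "fun_space.subspace B" "fun_space.subspace B'"
  unfolding Z_def Z'_def B_def B'_def by (rule subspace_cocycles subspace_cobs)+
 have BZ: "B \<subseteq> Z" "B' \<subseteq> Z'"
  unfolding Z_def Z'_def B_def B'_def by (rule cobs_subset groups)+
 define cs where "cs N x = (\<lambda>n. n + x) ` N" for N :: "('g list \<Rightarrow> real) set" and x
 have cs_eq: "cs N x = cs N y \<longleftrightarrow> x - y \<in> N" if N: "fun_space.subspace N" for N x y
 proof
  assume "cs N x = cs N y"
  moreover have "x \<in> cs N x" unfolding cs_def using fun_space.subspace_0[OF N] by force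
  ultimately obtain n where "n \<in> N" "x = n + y" unfolding cs_def by auto
  then show "x - y \<in> N" by simp
 next
  assume xy: "x - y \<in> N"
  have "cs N x \<subseteq> cs N y" if "x - y \<in> N" for x y
  proof
   fix z assume "z \<in> cs N x"
   then obtain n where "n \<in> N" "z = n + x" by (auto simp: cs_def)
   then have "z = (n + (x - y)) + y" "n + (x - y) \<in> N"
    using fun_space.subspace_add[OF N] that by auto
   then show "z \<in> cs N y" unfolding cs_def by blast
  qed
  moreover have "y - x \<in> N" using fun_space.subspace_neg[OF N xy] by simp
  ultimately show "cs N x = cs N y" using xy by blast
 qed
 have cs_add: "(\<Union>u\<in>cs N x. \<Union>v\<in>cs N y. {u + v}) = cs N (x + y)" if N: "fun_space.subspace N" for N x y
 proof (intro equalityI subsetI)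
  fix z assume "z \<in> (\<Union>u\<in>cs N x. \<Union>v\<in>cs N y. {u + v})"
  then obtain n m where "n \<in> N" "m \<in> N" "z = (n + x) + (m + y)" unfolding cs_def by blast
  then have "z = (n + m) + (x + y)" "n + m \<in> N"
   using fun_space.subspace_add[OF N] by (auto simp: algebra_simps)
  then show "z \<in> cs N (x + y)" unfolding cs_def by blast
 next
  fix z assume "z \<in> cs N (x + y)"
  then obtain n where "n \<in> N" "z = (n + x) + (0 + y)" unfolding cs_def by (auto simp: algebra_simps)
  then show "z \<in> (\<Union>u\<in>cs N x. \<Union>v\<in>cs N y. {u + v})"
   unfolding cs_def using fun_space.subspace_0[OF N] by blast
 qed
 have cs_smult: "(\<Union>z\<in>cs N x. cs N (\<lambda>gs. c * z gs)) = cs N (\<lambda>gs. c * x gs)" if N: "fun_space.subspace N" for N x c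
 proof -
  have "cs N (\<lambda>gs. c * z gs) = cs N (\<lambda>gs. c * x gs)" if "z \<in> cs N x" for z
  proof -
   obtain n where n: "n \<in> N" "z = n + x" using \<open>z \<in> _\<close> by (auto simp: cs_def)
   have "(\<lambda>gs. c * z gs) - (\<lambda>gs. c * x gs) = (\<lambda>gs. c * n gs)"
    by (auto simp: n(2) algebra_simps fun_eq_iff)
   then show ?thesis using cs_eq[OF N] fun_space.subspace_scale[OF N n(1), of c] by simp
  qed
  moreover have "x \<in> cs N x" unfolding cs_def using fun_space.subspace_0[OF N] by force
  ultimately show ?thesis by blast
 qed
 \<comment> \<open>The union over all representatives avoids choosing one; every term of it is the
   same coset.\<close>
 define h where "h A = (\<Union>x\<in>A. cs B' (\<phi> x))" for A
 have h: "h (cs B x) = cs B' (\<phi> x)" if "x \<in> Z" for x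
 proof -
  have "cs B' (\<phi> z) = cs B' (\<phi> x)" if z: "z \<in> cs B x" for z
  proof -
   obtain n where n: "n \<in> B" "z = n + x" using z by (auto simp: cs_def)
   then have "\<phi> z - \<phi> x \<in> B'" using \<phi>B[of n] BZ by (auto simp: \<phi>.add)
   then show ?thesis by (simp add: cs_eq sub)
  qed
  moreover have "x \<in> cs B x" unfolding cs_def using fun_space.subspace_0[OF sub(3)] by force
  ultimately show ?thesis unfolding h_def by blast
 qed
 let ?V = "bounded_cohomology G q" and ?W = "bounded_cohomology H q"
 have carrier: "carrier ?V = cs B ` Z" "carrier ?W = cs B' ` Z'"
  unfolding bounded_cohomology_def quotient_module_def Z_def Z'_def B_def B'_def cs_def
  by (auto simp: A_RCOSETS_def RCOSETS_def r_coset_def cocycle_space_def plus_fun_def)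
 have add: "x \<oplus>\<^bsub>?V\<^esub> y = (\<Union>u\<in>x. \<Union>v\<in>y. {u + v})" "x \<oplus>\<^bsub>?W\<^esub> y = (\<Union>u\<in>x. \<Union>v\<in>y. {u + v})" for x y
  unfolding bounded_cohomology_def quotient_module_def
  by (auto simp: set_add_def set_mult_def cocycle_space_def plus_fun_def)
 have smult: "c \<odot>\<^bsub>?V\<^esub> x = (\<Union>z\<in>x. cs B (\<lambda>gs. c * z gs))" "c \<odot>\<^bsub>?W\<^esub> x = (\<Union>z\<in>x. cs B' (\<lambda>gs. c * z gs))" for x c
  unfolding bounded_cohomology_def quotient_module_def B_def B'_def cs_def
  by (simp_all add: a_r_coset_cocycle_space cocycle_space_simps)
 have "h \<in> hom (add_monoid ?V) (add_monoid ?W)"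
 proof (rule homI)
  fix x y assume "x \<in> carrier (add_monoid ?V)" "y \<in> carrier (add_monoid ?V)"
  then obtain a b where ab: "a \<in> Z" "b \<in> Z" "x = cs B a" "y = cs B b" by (auto simp: carrier)
  then show "h (x \<otimes>\<^bsub>add_monoid ?V\<^esub> y) = h x \<otimes>\<^bsub>add_monoid ?W\<^esub> h y"
   by (simp add: add cs_add sub h fun_space.subspace_add \<phi>.add)
 next
  fix x assume "x \<in> carrier (add_monoid ?V)"
  then show "h x \<in> carrier (add_monoid ?W)" using h \<phi>Z by (auto simp: carrier)
 qed
 moreover have "bij_betw h (carrier ?V) (carrier ?W)"
 proof (rule bij_betw_imageI)
  show "inj_on h (carrier ?V)"
  proof (rule inj_onI)
   fix x y assume "x \<in> carrier ?V" "y \<in> carrier ?V" "h x = h y"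
   then obtain a b where ab: "a \<in> Z" "b \<in> Z" "x = cs B a" "y = cs B b" "cs B' (\<phi> a) = cs B' (\<phi> b)"
    by (auto simp: carrier h)
   then have "\<phi> (a - b) \<in> B'" by (simp add: cs_eq sub \<phi>.diff)
   then have "a - b \<in> B" using \<phi>B ab fun_space.subspace_diff[OF sub(1)] by blast
   then show "x = y" using ab by (simp add: cs_eq sub)
  qed
  show "h ` carrier ?V = carrier ?W"
  proof (intro equalityI subsetI)
   fix y assume "y \<in> carrier ?W"
   then obtain b where b: "b \<in> Z'" "y = cs B' b" by (auto simp: carrier)
   then obtain a where a: "a \<in> Z" "b - \<phi> a \<in> B'" using surj by blast
   with b show "y \<in> h ` carrier ?V"
    using h cs_eq[OF sub(4)] by (intro image_eqI[of _ _ "cs B a"]) (auto simp: carrier)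
  qed (use h \<phi>Z in \<open>auto simp: carrier\<close>)
 qed
 moreover have "h (c \<odot>\<^bsub>?V\<^esub> x) = c \<odot>\<^bsub>?W\<^esub> h x" if x: "x \<in> carrier ?V" for c x
 proof -
  obtain a where a: "a \<in> Z" "x = cs B a" using x by (auto simp: carrier)
  moreover have "(\<lambda>gs. c * a gs) \<in> Z" using fun_space.subspace_scale[OF sub(1) a(1)] .
  ultimately show ?thesis
   using \<phi>.scale[of c a] by (simp add: smult cs_smult sub h)
 qed
 ultimately show ?thesis
  unfolding linearly_isomorphic_def iso_def by (intro bexI[of _ h]) auto
qed

section \<open>A stability criterion by injections into the predecessor\<close>

text \<open>A map of cocycles that is linear and whose equivalence about coboundaries contains both
  halves at once: it descends to cohomology, and the descended map is injective.\<close>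

definition comparison ::
  "('g, 'b) monoid_scheme \<Rightarrow> ('g, 'b) monoid_scheme \<Rightarrow> nat \<Rightarrow> (('g list \<Rightarrow> real) \<Rightarrow> 'g list \<Rightarrow> real) \<Rightarrow> bool" where
 "comparison G H q t \<longleftrightarrow> (\<forall>x\<in>cocycles G q. t x \<in> cocycles H q \<and> (t x \<in> cobs H q \<longleftrightarrow> x \<in> cobs G q) \<and>
   (\<forall>y\<in>cocycles G q. t (\<lambda>gs. x gs + y gs) = (\<lambda>gs. t x gs + t y gs)) \<and>
   (\<forall>c. t (\<lambda>gs. c * x gs) = (\<lambda>gs. c * t x gs)))"

theorem bounded_cohomology_stableI:
 fixes G :: "nat \<Rightarrow> ('g, 'b) monoid_scheme"
 assumes group: "\<And>r. r \<ge> 1 \<Longrightarrow> Group.group (G r)"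
  and maps: "\<And>q. \<exists>R\<ge>1. \<forall>r\<ge>R. \<exists>t. comparison (G (Suc r)) (G r) q t"
 shows "bounded_cohomology_stable G"
 unfolding bounded_cohomology_stable_def
proof
 fix q
 let ?Z = "\<lambda>r. cocycles (G r) q" and ?B = "\<lambda>r. cobs (G r) q"
 obtain R where R: "R \<ge> 1" "\<forall>r\<ge>R. \<exists>t. comparison (G (Suc r)) (G r) q t"
  using maps[of q] by auto
 then have "\<forall>r. \<exists>t. R \<le> r \<longrightarrow> comparison (G (Suc r)) (G r) q t" by auto
 from choice[OF this] obtain t where t0: "\<forall>r. R \<le> r \<longrightarrow> comparison (G (Suc r)) (G r) q (t r)" ..
 let ?s = "\<lambda>c (f :: 'g list \<Rightarrow> real) x. c * f x"
 \<comment> \<open>Nothing is known about the group at index 0, so the chain of vector spaces starts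
   at index 1 and everything is shifted by \<open>Suc\<close>.\<close>
 have "\<exists>r0\<ge>R - 1. \<forall>r\<ge>r0. \<exists>\<phi>. Vector_Spaces.linear ?s ?s \<phi> \<and>
   (\<forall>x\<in>?Z (Suc r). \<phi> x \<in> ?Z (Suc (Suc r)) \<and>
    (\<phi> x \<in> ?B (Suc (Suc r)) \<longleftrightarrow> x \<in> ?B (Suc r))) \<and>
   (\<forall>y\<in>?Z (Suc (Suc r)). \<exists>x\<in>?Z (Suc r).
    y - \<phi> x \<in> ?B (Suc (Suc r)))"
 proof (rule fun_space.decreasing_quotients[of _ _ _ "\<lambda>r. t (Suc r)"])
  fix r :: nat
  show "?B (Suc r) \<subseteq> ?Z (Suc r)"
   by (intro cobs_subset group) simp
 next
  fix r x assume "R - 1 \<le> r" and x: "x \<in> ?Z (Suc (Suc r))"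
  then have r: "R \<le> Suc r" by simp
  have "comparison (G (Suc (Suc r))) (G (Suc r)) q (t (Suc r))" using t0 r by simp
  note tx = bspec[OF this[unfolded comparison_def] x]
  show "t (Suc r) x \<in> ?Z (Suc r)"
   "t (Suc r) x \<in> ?B (Suc r) \<longleftrightarrow> x \<in> ?B (Suc (Suc r))"
   using tx by blast+
  show "t (Suc r) (\<lambda>gs. c * x gs) = (\<lambda>gs. c * t (Suc r) x gs)" for c using tx by blast
  show "t (Suc r) (x + y) = t (Suc r) x + t (Suc r) y" if "y \<in> ?Z (Suc (Suc r))" for y
   using tx that by (simp add: plus_fun_def)
 qed (rule subspace_cocycles subspace_cobs)+
 then obtain r0 where r0: "r0 \<ge> R - 1" and *: "\<And>r. r \<ge> r0 \<Longrightarrow> \<exists>\<phi>. Vector_Spaces.linear ?s ?s \<phi> \<and>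
   (\<forall>x\<in>?Z (Suc r). \<phi> x \<in> ?Z (Suc (Suc r)) \<and>
    (\<phi> x \<in> ?B (Suc (Suc r)) \<longleftrightarrow> x \<in> ?B (Suc r))) \<and>
   (\<forall>y\<in>?Z (Suc (Suc r)). \<exists>x\<in>?Z (Suc r).
    y - \<phi> x \<in> ?B (Suc (Suc r)))"
  by blast
 have "linearly_isomorphic (bounded_cohomology (G r) q) (bounded_cohomology (G (r + 1)) q)" if r: "r \<ge> Suc r0" for r
 proof -
  obtain k where k: "r = Suc k" "k \<ge> r0" using r by (cases r) auto
  obtain \<phi> where "Vector_Spaces.linear ?s ?s \<phi>"
   "\<forall>x\<in>?Z r. \<phi> x \<in> ?Z (Suc r) \<and>
    (\<phi> x \<in> ?B (Suc r) \<longleftrightarrow> x \<in> ?B r)"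
   "\<forall>y\<in>?Z (Suc r). \<exists>x\<in>?Z r.
    y - \<phi> x \<in> ?B (Suc r)"
   using *[OF k(2)] unfolding k(1) by blast
  moreover have "Group.group (G r)" "Group.group (G (Suc r))" using group k by auto
  ultimately show ?thesis unfolding Suc_eq_plus1[symmetric] by (intro linearly_isomorphicI) blast+
 qed
 then show "\<exists>r0\<ge>1. \<forall>r\<ge>r0. linearly_isomorphic (bounded_cohomology (G r) q) (bounded_cohomology (G (r + 1)) q)"
  by (intro exI[of _ "Suc r0"]) auto
qed

section \<open>Symplectic linear algebra\<close>

abbreviation "vecs r \<equiv> carrier_vec (2 * r)"
abbreviation "sf \<equiv> symplectic_form"
abbreviation "basis r \<equiv> unit_vec (2 * r)"
abbreviation "zv r \<equiv> 0\<^sub>v (2 * r)"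
abbreviation "idm r \<equiv> 1\<^sub>m (2 * r)"
abbreviation "mats r \<equiv> carrier_mat (2 * r) (2 * r)"

lemma sf_add_left:
 assumes "u \<in> vecs r" "v \<in> vecs r"
 shows "sf r (u + v) w = sf r u w + sf r v w"
 using assms by (simp add: symplectic_form_def algebra_simps sum.distrib sum_subtractf)

lemma sf_minus_left:
 assumes "u \<in> vecs r" "v \<in> vecs r"
 shows "sf r (u - v) w = sf r u w - sf r v w"
 using assms by (simp add: symplectic_form_def algebra_simps sum.distrib sum_subtractf)

lemma sf_smult_left:
 assumes "u \<in> vecs r"
 shows "sf r (c \<cdot>\<^sub>v u) w = c * sf r u w"
 using assms by (simp add: symplectic_form_def algebra_simps sum_distrib_left)

lemma sf_skew: "sf r u w = - sf r w u"
 by (simp add: symplectic_form_def sum_negf[symmetric] algebra_simps)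

lemma sf_self [simp]: "sf r u u = 0"
 by (simp add: symplectic_form_def mult.commute)

lemma sf_zero_left [simp]: "sf r (zv r) w = 0"
 by (simp add: symplectic_form_def)

lemma sf_zero_right [simp]: "sf r w (zv r) = 0"
 by (simp add: symplectic_form_def)

lemma sf_add_right:
 assumes "u \<in> vecs r" "v \<in> vecs r"
 shows "sf r w (u + v) = sf r w u + sf r w v"
 using assms by (simp add: symplectic_form_def algebra_simps sum.distrib sum_subtractf)

lemma sf_minus_right:
 assumes "u \<in> vecs r" "v \<in> vecs r"
 shows "sf r w (u - v) = sf r w u - sf r w v"
 using assms by (simp add: symplectic_form_def algebra_simps sum.distrib sum_subtractf)

lemma sf_smult_right:
 assumes "u \<in> vecs r"
 shows "sf r w (c \<cdot>\<^sub>v u) = c * sf r w u"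
 using assms by (simp add: symplectic_form_def algebra_simps sum_distrib_left)

lemmas sf_linear = sf_add_left sf_add_right sf_minus_left sf_minus_right sf_smult_left sf_smult_right

lemma sf_unit_right:
 assumes "v \<in> vecs r" "i < r"
 shows "sf r v (basis r i) = - v $ (r + i)"
  "sf r v (basis r (r + i)) = v $ i"
proof -
 have "sf r v (basis r i) = (\<Sum>k<r. if k = i then - v $ (r + i) else 0)"
  unfolding symplectic_form_def by (rule sum.cong) (use assms in \<open>auto simp: unit_vec_def\<close>)
 then show "sf r v (basis r i) = - v $ (r + i)" using assms by simp
 have "sf r v (basis r (r + i)) = (\<Sum>k<r. if k = i then v $ i else 0)"
  unfolding symplectic_form_def by (rule sum.cong) (use assms in \<open>auto simp: unit_vec_def\<close>)
 then show "sf r v (basis r (r + i)) = v $ i" using assms by simp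
qed

lemma sf_nondegenerate:
 assumes "v \<in> vecs r" "\<And>w. w \<in> vecs r \<Longrightarrow> sf r v w = 0"
 shows "v = zv r"
proof (rule eq_vecI)
 fix i assume "i < dim_vec (zv r)"
 then have i: "i < 2 * r" by simp
 show "v $ i = zv r $ i"
 proof (cases "i < r")
  case True
  then show ?thesis using sf_unit_right(2)[OF assms(1) True] assms(2)[of "basis r (r + i)"] i by simp
 next
  case False
  then have "i - r < r" "r + (i - r) = i" using i by auto
  then show ?thesis using sf_unit_right(1)[OF assms(1), of "i - r"] assms(2)[of "basis r (i - r)"] i by simp
 qed
qed (use assms in simp)

text \<open>The coordinate row of the linear form that pairs its argument with \<open>c\<close> on
  the left.\<close>

definition sf_dual :: "nat \<Rightarrow> 'a::comm_ring_1 Matrix.vec \<Rightarrow> 'a Matrix.vec" where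
 "sf_dual r c = Matrix.vec (2 * r) (\<lambda>j. if j < r then - c $ (r + j) else c $ (j - r))"

lemma sf_dual_scalar_prod:
 assumes "x \<in> vecs r"
 shows "sf_dual r c \<bullet> x = sf r c x"
proof -
 have split: "{0..<2 * r} = {0..<r} \<union> {r..<2 * r}" by auto
 have "sf_dual r c \<bullet> x = (\<Sum>j\<in>{0..<r}. sf_dual r c $ j * x $ j) + (\<Sum>j\<in>{r..<2 * r}. sf_dual r c $ j * x $ j)"
  using assms unfolding scalar_prod_def by (simp add: split sum.union_disjoint)
 also have "(\<Sum>j\<in>{r..<2 * r}. sf_dual r c $ j * x $ j) = (\<Sum>j\<in>{0..<r}. sf_dual r c $ (j + r) * x $ (j + r))"
  using sum.shift_bounds_nat_ivl[of "\<lambda>j. sf_dual r c $ j * x $ j" 0 r r] by (simp add: mult_2)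
 finally show ?thesis
  by (simp add: sf_dual_def symplectic_form_def sum.distrib[symmetric] atLeast0LessThan algebra_simps)
qed

text \<open>The matrix of \<open>x \<mapsto> \<omega>(c, x) d\<close>.\<close>

definition rank_one :: "nat \<Rightarrow> 'a::comm_ring_1 Matrix.vec \<Rightarrow> 'a Matrix.vec \<Rightarrow> 'a mat" where
 "rank_one r c d = Matrix.mat (2 * r) (2 * r) (\<lambda>(i, j). d $ i * sf_dual r c $ j)"

lemma rank_one_carrier [simp]: "rank_one r c d \<in> mats r"
 by (simp add: rank_one_def)

lemma rank_one_apply:
 assumes "x \<in> vecs r" "d \<in> vecs r"
 shows "rank_one r c d *\<^sub>v x = sf r c x \<cdot>\<^sub>v d"
proof (rule eq_vecI)
 fix i assume "i < dim_vec (sf r c x \<cdot>\<^sub>v d)"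
 then have i: "i < 2 * r" using assms by simp
 have "(rank_one r c d *\<^sub>v x) $ i = (\<Sum>j\<in>{0..<2 * r}. d $ i * (sf_dual r c $ j * x $ j))"
  using i assms by (simp add: rank_one_def scalar_prod_def mult.assoc)
 also have "\<dots> = d $ i * (sf_dual r c \<bullet> x)"
  using assms by (simp add: scalar_prod_def sum_distrib_left)
 finally show "(rank_one r c d *\<^sub>v x) $ i = (sf r c x \<cdot>\<^sub>v d) $ i"
  using i assms by (simp add: sf_dual_scalar_prod mult.commute)
qed (use assms in \<open>simp add: rank_one_def\<close>)

lemma mat_apply_unit:
 assumes "A \<in> carrier_mat n n" "i < n" "j < n"
 shows "(A *\<^sub>v unit_vec n j) $ i = (A :: 'a::comm_ring_1 mat) $$ (i, j)"
 using assms by (simp add: mult_mat_vec_def)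

lemma mat_eqI_apply:
 assumes "A \<in> carrier_mat n n" "B \<in> carrier_mat n n"
  and "\<And>x. x \<in> carrier_vec n \<Longrightarrow> A *\<^sub>v x = B *\<^sub>v (x :: 'a::comm_ring_1 Matrix.vec)"
 shows "A = B"
proof (rule eq_matI)
 fix i j assume "i < dim_row B" "j < dim_col B"
 then have ij: "i < n" "j < n" using assms by auto
 have "A *\<^sub>v unit_vec n j = B *\<^sub>v unit_vec n j" by (rule assms(3)) simp
 then show "A $$ (i, j) = B $$ (i, j)"
  using mat_apply_unit[OF assms(1) ij] mat_apply_unit[OF assms(2) ij] by metis
qed (use assms in auto)

lemma carrier_Sp:
 "M \<in> carrier (Sp r) \<longleftrightarrow> M \<in> mats r \<and> invertible_mat M \<and>
   (\<forall>v \<in> vecs r. \<forall>w \<in> vecs r.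
    sf r (M *\<^sub>v v) (M *\<^sub>v w) = sf r v w)"
 by (simp add: Sp_def)

lemma invertible_matI:
 fixes M :: "'a::field mat"
 assumes "M \<in> carrier_mat n n" "L \<in> carrier_mat n n" "L * M = 1\<^sub>m n"
 shows "invertible_mat M"
 using assms mat_mult_left_right_inverse[OF assms(2,1,3)]
 unfolding invertible_mat_def inverts_mat_def by (auto simp: square_mat.simps)

lemma SpI:
 fixes M :: "'a::field mat"
 assumes "M \<in> mats r" "L \<in> mats r" "L * M = idm r"
  and "\<And>v w. v \<in> vecs r \<Longrightarrow> w \<in> vecs r \<Longrightarrow>
   sf r (M *\<^sub>v v) (M *\<^sub>v w) = sf r v w"
 shows "M \<in> carrier (Sp r)"
 using assms invertible_matI[OF assms(1-3)] by (simp add: carrier_Sp)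

lemma Sp_inverse:
 fixes M :: "'a::field mat"
 assumes "M \<in> carrier (Sp r)"
 obtains L where "L \<in> carrier (Sp r)" "L * M = idm r" "M * L = idm r"
proof -
 have M: "M \<in> mats r" "invertible_mat M" using assms by (auto simp: carrier_Sp)
 then obtain L where "inverts_mat M L" "inverts_mat L M" unfolding invertible_mat_def by blast
 then have MLone: "M * L = idm r" and LMone: "L * M = 1\<^sub>m (dim_row L)"
  using M(1) by (auto simp: inverts_mat_def)
 have "dim_col L = 2 * r" using arg_cong[OF MLone, of dim_col] by simp
 moreover have "dim_row L = 2 * r" using arg_cong[OF LMone, of dim_col] M(1) by simp
 ultimately have L: "L \<in> mats r" by auto
 have "sf r (L *\<^sub>v v) (L *\<^sub>v w) = sf r v w"
  if "v \<in> vecs r" "w \<in> vecs r" for v w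
 proof -
  have "sf r (M *\<^sub>v (L *\<^sub>v v)) (M *\<^sub>v (L *\<^sub>v w)) = sf r (L *\<^sub>v v) (L *\<^sub>v w)"
   using assms L that by (simp add: carrier_Sp)
  then show ?thesis
   using M(1) L that MLone assoc_mult_mat_vec[OF M(1) L, symmetric] by simp
 qed
 then have "L \<in> carrier (Sp r)" using M(1) L MLone by (intro SpI)
 then show ?thesis using that MLone LMone \<open>dim_row L = 2 * r\<close> by simp
qed

text \<open>The inverse of a symplectic matrix is its adjoint for the form, so up to sign its
  entries are entries of the matrix. This keeps inverses inside a subring and later makes inversion
  continuous in coordinates.\<close>

lemma Sp_entries_inverse:
 fixes M :: "'a::field mat"
 assumes M: "M \<in> carrier (Sp r)" and L: "L \<in> carrier (Sp r)" and MLone: "M * L = idm r" and j: "j < 2 * r"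
 shows "i < r \<Longrightarrow> L $$ (i, j) = sf r (basis r j) (M *\<^sub>v basis r (r + i))"
  and "i < r \<Longrightarrow> L $$ (r + i, j) = - sf r (basis r j) (M *\<^sub>v basis r i)"
proof -
 have M': "M \<in> mats r" and L': "L \<in> mats r"
  using M L by (auto simp: carrier_Sp)
 have *: "sf r (L *\<^sub>v basis r j) w = sf r (basis r j) (M *\<^sub>v w)"
  if "w \<in> vecs r" for w
 proof -
  have "sf r (M *\<^sub>v (L *\<^sub>v basis r j)) (M *\<^sub>v w) = sf r (L *\<^sub>v basis r j) w"
   using M L' that by (simp add: carrier_Sp)
  then show ?thesis
   using M' L' MLone assoc_mult_mat_vec[OF M' L', symmetric] by simp
 qed
 have Lj: "L *\<^sub>v basis r j \<in> vecs r" using L' by simp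
 show "L $$ (i, j) = sf r (basis r j) (M *\<^sub>v basis r (r + i))" if "i < r"
  using sf_unit_right(2)[OF Lj that] *[of "basis r (r + i)"] mat_apply_unit[OF L', of i j] that j by simp
 show "L $$ (r + i, j) = - sf r (basis r j) (M *\<^sub>v basis r i)" if "i < r"
  using sf_unit_right(1)[OF Lj that] *[of "basis r i"] mat_apply_unit[OF L', of "r + i" j] that j by simp
qed

section \<open>Symplectic groups over a subring\<close>

text \<open>\<open>bezout\<close> says that every nonzero vector over \<open>R\<close> is a
  multiple, with factor in \<open>R\<close>, of a unimodular one. It holds for fields and for
  Euclidean rings alike. Characteristic zero is used to read off a dimension from a trace.\<close>

locale symplectic_ring =
 fixes R :: "'a::field_char_0 set" and r :: nat
 assumes R_zero: "0 \<in> R" and R_one: "1 \<in> R" and R_add: "\<lbrakk>a \<in> R; b \<in> R\<rbrakk> \<Longrightarrow> a + b \<in> R"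
  and R_mult: "\<lbrakk>a \<in> R; b \<in> R\<rbrakk> \<Longrightarrow> a * b \<in> R" and R_uminus: "a \<in> R \<Longrightarrow> - a \<in> R"
  and bezout: "\<lbrakk>\<And>i :: nat. i < n \<Longrightarrow> x i \<in> R; \<exists>i<n. x i \<noteq> 0\<rbrakk> \<Longrightarrow>
   \<exists>d y z. d \<in> R \<and> (\<forall>i<n. y i \<in> R \<and> z i \<in> R \<and> x i = d * y i) \<and> (\<Sum>i<n. y i * z i) = 1"
begin

abbreviation \<omega> :: "'a Matrix.vec \<Rightarrow> 'a Matrix.vec \<Rightarrow> 'a" where
 "\<omega> \<equiv> sf r"

definition V :: "'a Matrix.vec set" where
 "V = {v \<in> vecs r. \<forall>i<2 * r. v $ i \<in> R}"

lemma VI: "\<lbrakk>v \<in> vecs r; \<And>i. i < 2 * r \<Longrightarrow> v $ i \<in> R\<rbrakk> \<Longrightarrow> v \<in> V"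
 by (simp add: V_def)

lemma V_carrier: "v \<in> V \<Longrightarrow> v \<in> vecs r"
 by (simp add: V_def)

lemma R_minus: "\<lbrakk>a \<in> R; b \<in> R\<rbrakk> \<Longrightarrow> a - b \<in> R"
 using R_add[OF _ R_uminus, of a b] by simp

lemma R_sum: "(\<And>i. i \<in> A \<Longrightarrow> f i \<in> R) \<Longrightarrow> sum f A \<in> R"
 by (induction A rule: infinite_finite_induct) (auto intro: R_zero R_add)

lemma V_add: "\<lbrakk>u \<in> V; v \<in> V\<rbrakk> \<Longrightarrow> u + v \<in> V"
 unfolding V_def by (auto intro!: R_add)

lemma V_minus: "\<lbrakk>u \<in> V; v \<in> V\<rbrakk> \<Longrightarrow> u - v \<in> V"
 unfolding V_def by (auto intro!: R_minus)

lemma V_smult: "\<lbrakk>c \<in> R; v \<in> V\<rbrakk> \<Longrightarrow> c \<cdot>\<^sub>v v \<in> V"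
 unfolding V_def by (auto intro!: R_mult)

lemma V_zero: "zv r \<in> V"
 unfolding V_def by (auto intro: R_zero)

lemma V_unit: "basis r j \<in> V"
 unfolding V_def by (auto simp: unit_vec_def R_zero R_one)

lemma V_nth: "\<lbrakk>v \<in> V; i < 2 * r\<rbrakk> \<Longrightarrow> v $ i \<in> R"
 by (simp add: V_def)

declare V_carrier [simp]

lemma \<omega>_closed:
 assumes "u \<in> V" "v \<in> V"
 shows "\<omega> u v \<in> R"
 unfolding symplectic_form_def
proof (rule R_sum)
 fix i assume "i \<in> {..<r}"
 then have "i < 2 * r" "r + i < 2 * r" by auto
 then show "u $ i * v $ (r + i) - u $ (r + i) * v $ i \<in> R"
  using assms by (blast intro: R_minus R_mult V_nth)
qed

abbreviation G :: "'a mat monoid" where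
 "G \<equiv> Sp_over R r"

abbreviation mul (infixl "\<star>" 70) where "x \<star> y \<equiv> x \<otimes>\<^bsub>G\<^esub> y"
abbreviation ginv where "ginv x \<equiv> inv\<^bsub>G\<^esub> x"

lemma carrier_G: "M \<in> carrier G \<longleftrightarrow> M \<in> carrier (Sp r) \<and> (\<forall>i<2 * r. \<forall>j<2 * r. M $$ (i, j) \<in> R)"
proof -
 have "elements_mat M \<subseteq> R \<longleftrightarrow> (\<forall>i<2 * r. \<forall>j<2 * r. M $$ (i, j) \<in> R)" if "M \<in> mats r"
  using that unfolding elements_mat_def by fastforce
 then show ?thesis by (auto simp: Sp_over_def carrier_Sp)
qed

lemma G_simps [simp]: "x \<star> y = x * y" "\<one>\<^bsub>G\<^esub> = idm r"
 by (simp_all add: Sp_over_def Sp_def)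

lemma G_carrier_mat: "M \<in> carrier G \<Longrightarrow> M \<in> mats r"
 by (simp add: carrier_G carrier_Sp)

lemma G_sf: "\<lbrakk>M \<in> carrier G; v \<in> vecs r; w \<in> vecs r\<rbrakk> \<Longrightarrow> \<omega> (M *\<^sub>v v) (M *\<^sub>v w) = \<omega> v w"
 by (simp add: carrier_G carrier_Sp)

lemma G_apply_V:
 assumes "M \<in> carrier G" "v \<in> V"
 shows "M *\<^sub>v v \<in> V"
proof -
 have "(M *\<^sub>v v) $ i \<in> R" if "i < 2 * r" for i
 proof -
  have "(M *\<^sub>v v) $ i = (\<Sum>j\<in>{0..<2 * r}. M $$ (i, j) * v $ j)"
   using that G_carrier_mat[OF assms(1)] V_carrier[OF assms(2)] by (auto simp: scalar_prod_def intro!: sum.cong)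
  also have "\<dots> \<in> R" using assms that by (intro R_sum R_mult) (auto simp: carrier_G intro: V_nth)
  finally show ?thesis .
 qed
 then show ?thesis using G_carrier_mat[OF assms(1)] assms(2) by (intro VI) auto
qed

lemma G_group: "Group.group G"
proof (rule groupI)
 fix x y assume x: "x \<in> carrier G" and y: "y \<in> carrier G"
 note xy = G_carrier_mat[OF x] G_carrier_mat[OF y]
 have xS: "x \<in> carrier (Sp r)" and yS: "y \<in> carrier (Sp r)" using x y by (auto simp: carrier_G)
 obtain x' where x': "x' \<in> carrier (Sp r)" "x' * x = idm r" "x * x' = idm r" by (rule Sp_inverse[OF xS])
 obtain y' where y': "y' \<in> carrier (Sp r)" "y' * y = idm r" "y * y' = idm r" by (rule Sp_inverse[OF yS])
 have c: "x' \<in> mats r" "y' \<in> mats r"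
  using x' y' by (auto simp: carrier_Sp)
 have "x' * (x * y) = (x' * x) * y" using assoc_mult_mat[OF c(1) xy] by simp
 also have "\<dots> = y" using x'(2) xy by simp
 finally have "y' * x' * (x * y) = y' * y" using assoc_mult_mat[OF c(2,1), of "x * y" "2 * r"] xy by simp
 then have inv: "y' * x' * (x * y) = idm r" using y'(2) by simp
 have sf: "sf r (x * y *\<^sub>v v) (x * y *\<^sub>v w) = sf r v w"
  if "v \<in> vecs r" "w \<in> vecs r" for v w
  using that assoc_mult_mat_vec[OF xy that(1)] assoc_mult_mat_vec[OF xy that(2)] xy G_sf[OF x, of "y *\<^sub>v v" "y *\<^sub>v w"] G_sf[OF y that]
  by simp
 have "x * y \<in> carrier (Sp r)"
  by (rule SpI[OF _ _ inv sf]) (use c xy in auto)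
 moreover have "(x * y) $$ (i, j) \<in> R" if "i < 2 * r" "j < 2 * r" for i j
 proof -
  have "(x * y) $$ (i, j) = (\<Sum>k\<in>{0..<2 * r}. x $$ (i, k) * y $$ (k, j))"
   using that xy by (simp add: scalar_prod_def)
  also have "\<dots> \<in> R" using x y that by (intro R_sum R_mult) (auto simp: carrier_G)
  finally show ?thesis .
 qed
 ultimately show "x \<star> y \<in> carrier G" by (simp add: carrier_G)
next
 have "(idm r :: 'a mat) \<in> carrier (Sp r)"
  by (rule SpI[where L = "idm r"]) auto
 then show "\<one>\<^bsub>G\<^esub> \<in> carrier G" by (simp add: carrier_G R_zero R_one)
next
 fix x y z assume "x \<in> carrier G" "y \<in> carrier G" "z \<in> carrier G"
 from this[THEN G_carrier_mat] show "x \<star> y \<star> z = x \<star> (y \<star> z)"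
  by simp
next
 fix x assume "x \<in> carrier G"
 from G_carrier_mat[OF this] show "\<one>\<^bsub>G\<^esub> \<star> x = x" by simp
next
 fix x assume x: "x \<in> carrier G"
 have xS: "x \<in> carrier (Sp r)" using x by (simp add: carrier_G)
 obtain y where y: "y \<in> carrier (Sp r)" "y * x = idm r" "x * y = idm r" by (rule Sp_inverse[OF xS])
 have "y $$ (i, j) \<in> R" if ij: "i < 2 * r" "j < 2 * r" for i j
 proof (cases "i < r")
  case True
  then show ?thesis
   using Sp_entries_inverse(1)[OF xS y(1,3) ij(2), of i] \<omega>_closed[OF V_unit G_apply_V[OF x V_unit]] by simp
 next
  case False
  then have "i = r + (i - r)" "i - r < r" using ij by auto
  then show ?thesis
   using Sp_entries_inverse(2)[OF xS y(1,3) ij(2), of "i - r"] R_uminus[OF \<omega>_closed[OF V_unit G_apply_V[OF x V_unit]]] by simp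
 qed
 then show "\<exists>y\<in>carrier G. y \<star> x = \<one>\<^bsub>G\<^esub>" using y by (auto simp: carrier_G)
qed

sublocale Group.group G by (rule G_group)

lemma rank_one_entries: "\<lbrakk>c \<in> V; d \<in> V; i < 2 * r; j < 2 * r\<rbrakk> \<Longrightarrow> rank_one r c d $$ (i, j) \<in> R"
 by (auto simp: rank_one_def sf_dual_def intro!: R_mult R_uminus V_nth)

lemma apply_mult: "\<lbrakk>A \<in> carrier G; B \<in> carrier G; x \<in> vecs r\<rbrakk> \<Longrightarrow> (A * B) *\<^sub>v x = A *\<^sub>v (B *\<^sub>v x)"
 by (rule assoc_mult_mat_vec[OF G_carrier_mat G_carrier_mat])

lemma apply_carrier [simp]: "\<lbrakk>A \<in> carrier G; x \<in> vecs r\<rbrakk> \<Longrightarrow> A *\<^sub>v x \<in> vecs r"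
 by (rule mult_mat_vec_carrier[OF G_carrier_mat])

lemma apply_inv:
 assumes "A \<in> carrier G" "x \<in> vecs r"
 shows "A *\<^sub>v (ginv A *\<^sub>v x) = x" "ginv A *\<^sub>v (A *\<^sub>v x) = x"
 using apply_mult[OF assms(1) inv_closed[OF assms(1)] assms(2)] apply_mult[OF inv_closed[OF assms(1)] assms(1,2)]
  r_inv[OF assms(1)] l_inv[OF assms(1)] assms by simp_all

lemma G_eqI:
 assumes "A \<in> carrier G" "B \<in> carrier G" "\<And>x. x \<in> vecs r \<Longrightarrow> A *\<^sub>v x = B *\<^sub>v x"
 shows "A = B"
 using mat_eqI_apply[OF G_carrier_mat[OF assms(1)] G_carrier_mat[OF assms(2)]] assms(3) by blast


subsection \<open>Hyperbolic pairs\<close>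

definition hyp :: "('a Matrix.vec \<times> 'a Matrix.vec) set" where
 "hyp = {(u, v). u \<in> V \<and> v \<in> V \<and> \<omega> u v = 1}"

definition orth :: "'a Matrix.vec \<times> 'a Matrix.vec \<Rightarrow> 'a Matrix.vec \<times> 'a Matrix.vec \<Rightarrow> bool" where
 "orth p q \<longleftrightarrow> \<omega> (fst p) (fst q) = 0 \<and> \<omega> (fst p) (snd q) = 0 \<and> \<omega> (snd p) (fst q) = 0 \<and> \<omega> (snd p) (snd q) = 0"

definition act2 :: "'a mat \<Rightarrow> 'a Matrix.vec \<times> 'a Matrix.vec \<Rightarrow> 'a Matrix.vec \<times> 'a Matrix.vec" where
 "act2 M p = (M *\<^sub>v fst p, M *\<^sub>v snd p)"

lemma hypD: "p \<in> hyp \<Longrightarrow> fst p \<in> V" "p \<in> hyp \<Longrightarrow> snd p \<in> V" "p \<in> hyp \<Longrightarrow> \<omega> (fst p) (snd p) = 1"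
  "p \<in> hyp \<Longrightarrow> \<omega> (snd p) (fst p) = -1"
 using sf_skew[of r "snd p" "fst p"] by (auto simp: hyp_def)

lemma hyp_carrier [simp]: "p \<in> hyp \<Longrightarrow> fst p \<in> vecs r" "p \<in> hyp \<Longrightarrow> snd p \<in> vecs r"
 using hypD by auto

lemma hyp_dim [simp]: "p \<in> hyp \<Longrightarrow> dim_vec (fst p) = 2 * r" "p \<in> hyp \<Longrightarrow> dim_vec (snd p) = 2 * r"
 using hyp_carrier by auto

lemma orth_sym: "orth p q \<Longrightarrow> orth q p"
 using sf_skew[of r "fst p"] sf_skew[of r "snd p"] by (auto simp: orth_def)

primrec frame :: "('a Matrix.vec \<times> 'a Matrix.vec) list \<Rightarrow> bool" where
 "frame [] \<longleftrightarrow> True"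
| "frame (p # ps) \<longleftrightarrow> p \<in> hyp \<and> (\<forall>q\<in>set ps. orth p q) \<and> frame ps"

lemma frame_hyp: "frame ps \<Longrightarrow> set ps \<subseteq> hyp"
 by (induction ps) auto

text \<open>The linear map taking the frame \<open>ps\<close> to the frame \<open>qs\<close> and vanishing on the complement of \<open>ps\<close>.\<close>

fun transfer :: "('a Matrix.vec \<times> 'a Matrix.vec) list \<Rightarrow> ('a Matrix.vec \<times> 'a Matrix.vec) list \<Rightarrow> 'a Matrix.vec \<Rightarrow> 'a Matrix.vec" where
 "transfer (p # ps) (q # qs) x = (\<omega> x (snd p) \<cdot>\<^sub>v fst q - \<omega> x (fst p) \<cdot>\<^sub>v snd q) + transfer ps qs x"
| "transfer _ _ x = zv r"

lemma transfer_carrier [simp]: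
 "set qs \<subseteq> hyp \<Longrightarrow> transfer ps qs x \<in> vecs r"
 by (induction ps qs x rule: transfer.induct) auto

lemma transfer_dim [simp]: "set qs \<subseteq> hyp \<Longrightarrow> dim_vec (transfer ps qs x) = 2 * r"
 using transfer_carrier by (rule carrier_vecD)

lemma transfer_V:
 "\<lbrakk>set ps \<subseteq> hyp; set qs \<subseteq> hyp; x \<in> V\<rbrakk> \<Longrightarrow> transfer ps qs x \<in> V"
 by (induction ps qs x rule: transfer.induct) (auto intro!: V_add V_minus V_smult \<omega>_closed V_zero dest: hypD)

lemma sf_transfer_zero:
 assumes "set qs \<subseteq> hyp" "w \<in> vecs r" "\<And>q. q \<in> set qs \<Longrightarrow> \<omega> (fst q) w = 0 \<and> \<omega> (snd q) w = 0"
 shows "\<omega> (transfer ps qs x) w = 0"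
 using assms
proof (induction ps qs x rule: transfer.induct)
 case (1 p ps q qs x)
 then have "\<omega> (transfer ps qs x) w = 0" by simp
 moreover have "\<omega> (fst q) w = 0" "\<omega> (snd q) w = 0" using 1(4)[of q] by auto
 moreover have "q \<in> hyp" "set qs \<subseteq> hyp" using 1(2) by auto
 ultimately show ?case by (simp add: sf_linear)
qed auto

text \<open>The left side depends on \<open>x\<close> and \<open>y\<close> only through their
  coefficients with respect to \<open>ps\<close>, and equals the pairing of those coefficients
  whichever frame carries them. When \<open>ps\<close> spans, the map is therefore
  symplectic.\<close>

lemma sf_transfer:
 assumes "frame ps" "frame qs" "length ps = length qs" "x \<in> vecs r" "y \<in> vecs r"
 shows "\<omega> (transfer ps qs x) (transfer ps qs y) = \<omega> (transfer ps ps x) y"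
 using assms
proof (induction ps arbitrary: qs)
 case (Cons p ps)
 then obtain q qs' where q: "qs = q # qs'" by (cases qs) auto
 have ph: "p \<in> hyp" "set ps \<subseteq> hyp" and qh: "q \<in> hyp" "set qs' \<subseteq> hyp"
  using Cons.prems frame_hyp by (auto simp: q)
 have c: "fst q \<in> vecs r" "snd q \<in> vecs r" "fst p \<in> vecs r" "snd p \<in> vecs r"
  using ph qh by auto
 let ?X = "transfer ps qs' x" and ?Y = "transfer ps qs' y"
 have XY: "?X \<in> vecs r" "?Y \<in> vecs r" "transfer ps ps x \<in> vecs r"
  using ph qh by auto
 have z: "\<omega> (transfer ps qs' z) (fst q) = 0 \<and> \<omega> (transfer ps qs' z) (snd q) = 0" for z
 proof -
  have "\<And>q'. q' \<in> set qs' \<Longrightarrow> orth q' q" using Cons.prems(2) orth_sym by (auto simp: q)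
  then show ?thesis
   using sf_transfer_zero[OF qh(2) c(1), of ps z] sf_transfer_zero[OF qh(2) c(2), of ps z] by (auto simp: orth_def)
 qed
 have z': "\<omega> (fst q) (transfer ps qs' w) = 0" "\<omega> (snd q) (transfer ps qs' w) = 0" for w
  using z[of w] sf_skew[of r "fst q" "transfer ps qs' w"] sf_skew[of r "snd q" "transfer ps qs' w"] by simp_all
 have ih: "\<omega> ?X ?Y = \<omega> (transfer ps ps x) y" using Cons q by simp
 have sk: "\<omega> (fst p) y = - \<omega> y (fst p)" "\<omega> (snd p) y = - \<omega> y (snd p)" by (rule sf_skew)+
 show ?case
  using z z' c XY Cons.prems(4,5) hypD[OF qh(1)] sk by (simp add: q sf_linear ih algebra_simps)
qed simp

fun transfer_mat :: "('a Matrix.vec \<times> 'a Matrix.vec) list \<Rightarrow> ('a Matrix.vec \<times> 'a Matrix.vec) list \<Rightarrow> 'a mat" where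
 "transfer_mat (p # ps) (q # qs) = (rank_one r (fst p) (snd q) - rank_one r (snd p) (fst q)) + transfer_mat ps qs"
| "transfer_mat _ _ = 0\<^sub>m (2 * r) (2 * r)"

lemma transfer_mat_carrier [simp]: "transfer_mat ps qs \<in> mats r"
 by (induction ps qs rule: transfer_mat.induct) auto

lemma transfer_mat_apply:
 assumes "set ps \<subseteq> hyp" "set qs \<subseteq> hyp" "x \<in> vecs r"
 shows "transfer_mat ps qs *\<^sub>v x = transfer ps qs x"
 using assms
proof (induction ps qs rule: transfer_mat.induct)
 case (1 p ps q qs)
 then have c: "fst q \<in> vecs r" "snd q \<in> vecs r" by auto
 have "transfer_mat (p # ps) (q # qs) *\<^sub>v x = (\<omega> (fst p) x \<cdot>\<^sub>v snd q - \<omega> (snd p) x \<cdot>\<^sub>v fst q) + transfer ps qs x"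
 proof -
  have "transfer_mat (p # ps) (q # qs) *\<^sub>v x =
    (rank_one r (fst p) (snd q) - rank_one r (snd p) (fst q)) *\<^sub>v x + transfer_mat ps qs *\<^sub>v x"
   unfolding transfer_mat.simps by (rule add_mult_distrib_mat_vec[of _ "2 * r" "2 * r"]) (use 1 in \<open>auto intro!: minus_carrier_mat\<close>)
  also have "(rank_one r (fst p) (snd q) - rank_one r (snd p) (fst q)) *\<^sub>v x =
    rank_one r (fst p) (snd q) *\<^sub>v x - rank_one r (snd p) (fst q) *\<^sub>v x"
   by (rule minus_mult_distrib_mat_vec[of _ "2 * r" "2 * r"]) (use 1 in auto)
  finally show ?thesis using 1 c by (simp add: rank_one_apply)
 qed
 also have "\<dots> = transfer (p # ps) (q # qs) x"
  using 1 sf_skew[of r "fst p" x] sf_skew[of r "snd p" x] by (intro eq_vecI) auto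
 finally show ?case .
qed auto

lemma transfer_mat_entries:
 assumes "set ps \<subseteq> hyp" "set qs \<subseteq> hyp" "i < 2 * r" "j < 2 * r"
 shows "transfer_mat ps qs $$ (i, j) \<in> R"
 using assms
proof (induction ps qs rule: transfer_mat.induct)
 case (1 p ps q qs)
 then have "rank_one r (fst p) (snd q) $$ (i, j) \<in> R" "rank_one r (snd p) (fst q) $$ (i, j) \<in> R"
  by (auto intro!: rank_one_entries dest: hypD)
 with 1 show ?case
  using transfer_mat_carrier[of ps qs] rank_one_carrier[of r "fst p" "snd q"] rank_one_carrier[of r "snd p" "fst q"]
  by (simp del: transfer_mat_carrier rank_one_carrier) (intro R_add R_minus)
qed (use R_zero in auto)

text \<open>The trace of the projection onto the span of \<open>ps\<close>.\<close>

lemma transfer_trace: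
 assumes "set ps \<subseteq> hyp"
 shows "(\<Sum>l<2 * r. transfer ps ps (basis r l) $ l) = 2 * of_nat (length ps)"
 using assms
proof (induction ps)
 case (Cons p ps)
 have c: "fst p \<in> vecs r" "snd p \<in> vecs r" "p \<in> hyp" "set ps \<subseteq> hyp" using Cons.prems by auto
 have dual: "(\<Sum>l<2 * r. \<omega> u (basis r l) * w $ l) = \<omega> u w"
  if u: "u \<in> vecs r" and w: "w \<in> vecs r" for u w
 proof -
  have "\<omega> u (basis r l) = sf_dual r u $ l" if "l < 2 * r" for l
   using sf_dual_scalar_prod[of "basis r l" r u] that
   by (simp add: sf_dual_def)
  then show ?thesis
   using sf_dual_scalar_prod[OF w, of u] w by (simp add: scalar_prod_def atLeast0LessThan)
 qed
 have nth: "transfer (p # ps) (p # ps) (basis r l) $ l =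
   \<omega> (fst p) (basis r l) * snd p $ l - \<omega> (snd p) (basis r l) * fst p $ l + transfer ps ps (basis r l) $ l"
  if "l < 2 * r" for l
  using that c sf_skew[of r _ "fst p"] sf_skew[of r _ "snd p"] transfer_carrier[OF c(4), of ps "basis r l"] by simp
 have "(\<Sum>l<2 * r. transfer (p # ps) (p # ps) (basis r l) $ l) = \<omega> (fst p) (snd p) - \<omega> (snd p) (fst p) + 2 * of_nat (length ps)"
  unfolding dual[OF c(1,2), symmetric] dual[OF c(2,1), symmetric] Cons.IH[OF c(4), symmetric] sum_subtractf[symmetric] sum.distrib[symmetric]
  by (rule sum.cong) (use nth in auto)
 then show ?case using hypD[OF c(3)] by (simp add: algebra_simps)
qed simp

section \<open>Extending frames over the ring\<close>

lemma primitive_part: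
 assumes "x \<in> V" "x \<noteq> zv r"
 obtains d p q where "d \<in> R" "p \<in> V" "q \<in> V" "x = d \<cdot>\<^sub>v p" "\<omega> p q = 1" "d \<noteq> 0"
proof -
 have "\<exists>i<2 * r. x $ i \<noteq> 0"
 proof (rule ccontr)
  assume "\<not> ?thesis"
  then have "x = zv r" using V_carrier[OF assms(1)] by (intro eq_vecI) auto
  with assms(2) show False by simp
 qed
 then obtain d y z where d: "d \<in> R" "\<forall>i<2 * r. y i \<in> R \<and> z i \<in> R \<and> x $ i = d * y i" "(\<Sum>i<2 * r. y i * z i) = 1"
  using bezout[of "2 * r" "\<lambda>i. x $ i"] V_nth[OF assms(1)] by blast
 define p where "p = Matrix.vec (2 * r) y"
 \<comment> \<open>The Bezout coefficients turned by the Gram matrix of the form, so that the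
   pairing of \<open>p\<close> and \<open>q\<close> becomes the Bezout sum.\<close>
 define q where "q = Matrix.vec (2 * r) (\<lambda>i. if i < r then - z (r + i) else z (i - r))"
 have pq: "p \<in> V" "q \<in> V" using d by (auto simp: p_def q_def intro!: VI R_uminus)
 have xp: "x = d \<cdot>\<^sub>v p" using d V_carrier[OF assms(1)] by (intro eq_vecI) (auto simp: p_def)
 have split: "{..<2 * r} = {..<r} \<union> {r..<2 * r}" "{..<r} \<inter> {r..<2 * r} = {}" by auto
 have "(\<Sum>i<2 * r. y i * z i) = (\<Sum>i<r. y i * z i) + (\<Sum>i\<in>{r..<2 * r}. y i * z i)"
  unfolding split(1) by (rule sum.union_disjoint) (use split(2) in auto)
 also have "(\<Sum>i\<in>{r..<2 * r}. y i * z i) = (\<Sum>i<r. y (r + i) * z (r + i))"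
  using sum.shift_bounds_nat_ivl[of "\<lambda>j. y j * z j" 0 r r] by (simp add: mult_2 atLeast0LessThan add.commute)
 finally have "\<omega> p q = 1"
  using d(3) by (simp add: symplectic_form_def p_def q_def sum.distrib)
 moreover have "d \<noteq> 0"
  using assms(2) xp V_carrier[OF pq(1)] by (auto simp: smult_vec_def)
 ultimately show ?thesis using that d(1) pq xp by blast
qed

text \<open>A symplectic Gram-Schmidt step. The remainder of \<open>x\<close> is orthogonal to
  \<open>ps\<close>, and so is its primitive part. A partner for the primitive part exists by
  unimodularity; subtracting its own projection makes it orthogonal to \<open>ps\<close> without
  changing the pairing 1.\<close>

lemma frame_extend:
 assumes ps: "frame ps" and x: "x \<in> V" and nx: "x - transfer ps ps x \<noteq> zv r"
 obtains p d where "p \<in> hyp" "\<forall>q\<in>set ps. orth p q" "x - transfer ps ps x = d \<cdot>\<^sub>v fst p"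
proof -
 have psh: "set ps \<subseteq> hyp" using frame_hyp ps by auto
 have comp: "\<omega> (y - transfer ps ps y) (fst q) = 0 \<and> \<omega> (y - transfer ps ps y) (snd q) = 0"
  if y: "y \<in> V" and q: "q \<in> set ps" for y q
  using ps q
 proof (induction ps)
  case (Cons p ps)
  have c: "p \<in> hyp" "set ps \<subseteq> hyp" using frame_hyp[of "p # ps"] Cons.prems by auto
  have t: "transfer ps ps y \<in> vecs r" using c by auto
  show ?case
  proof (cases "q = p")
   case True
   have "\<And>q'. q' \<in> set ps \<Longrightarrow> orth q' p" using Cons.prems(1) orth_sym by auto
   then have "\<omega> (transfer ps ps y) (fst p) = 0" "\<omega> (transfer ps ps y) (snd p) = 0"
    using sf_transfer_zero[OF c(2), of _ ps y] c by (auto simp: orth_def)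
   then show ?thesis using True c t y hypD[OF c(1)] by (simp add: sf_linear)
  next
   case False
   then have q: "q \<in> set ps" "orth p q" using Cons.prems by auto
   with Cons have "\<omega> (y - transfer ps ps y) (fst q) = 0" "\<omega> (y - transfer ps ps y) (snd q) = 0" by auto
   then show ?thesis using q(2) c t y by (simp add: sf_linear orth_def)
  qed
 qed simp
 let ?x = "x - transfer ps ps x"
 have xV: "?x \<in> V" using x psh by (intro V_minus transfer_V)
 obtain d p q where d: "d \<in> R" "p \<in> V" "q \<in> V" "?x = d \<cdot>\<^sub>v p" "\<omega> p q = 1" "d \<noteq> 0"
  by (rule primitive_part[OF xV nx])
 let ?q = "q - transfer ps ps q"
 have qV: "?q \<in> V" using d psh by (intro V_minus transfer_V)
 \<comment> \<open>The factor \<open>d\<close> cancels since it is nonzero in a field: orthogonality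
   passes from the remainder to its primitive part.\<close>
 have p0: "\<omega> p (fst s) = 0" "\<omega> p (snd s) = 0" if "s \<in> set ps" for s
  using comp[OF x that] d(2,4,6) by (auto simp: sf_linear)
 have "\<omega> (transfer ps ps q) p = 0"
  using p0 sf_skew[of r _ p] by (intro sf_transfer_zero[OF psh]) (use d in auto)
 then have "\<omega> p (transfer ps ps q) = 0" using sf_skew[of r p "transfer ps ps q"] by simp
 then have "\<omega> p ?q = 1" using d psh by (simp add: sf_linear)
 then have "(p, ?q) \<in> hyp" using d qV by (simp add: hyp_def)
 moreover have "orth (p, ?q) s" if "s \<in> set ps" for s
  using p0[OF that] comp[OF d(3) that] by (simp add: orth_def)
 ultimately show ?thesis using that[of "(p, ?q)" d] d(4) by simp
qed

text \<open>If the projection onto a short frame fixed every basis vector, its trace would be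
  \<open>2 * r\<close>, whereas it is twice the length of the frame.\<close>

lemma frame_extend_short:
 assumes "frame ps" "length ps < r"
 obtains p where "p \<in> hyp" "\<forall>q\<in>set ps. orth p q"
proof -
 have psh: "set ps \<subseteq> hyp" using frame_hyp assms by auto
 have "\<exists>l<2 * r. basis r l - transfer ps ps (basis r l) \<noteq> (zv r :: 'a Matrix.vec)"
 proof (rule ccontr)
  assume "\<not> ?thesis"
  then have z: "basis r l - transfer ps ps (basis r l) = (zv r :: 'a Matrix.vec)" if "l < 2 * r" for l
   using that by blast
  have "transfer ps ps (basis r l) $ l = (1 :: 'a)" if "l < 2 * r" for l
   using arg_cong[OF z[OF that], of "\<lambda>v. v $ l"] that transfer_carrier[OF psh, of ps "basis r l"] by simp
  then have "(\<Sum>l<2 * r. transfer ps ps (basis r l) $ l) = (\<Sum>l<2 * r. 1)"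
   by (intro sum.cong) auto
  then have "(of_nat (2 * length ps) :: 'a) = of_nat (2 * r)"
   using transfer_trace[OF psh] by simp
  then show False using assms(2) unfolding of_nat_eq_iff by simp
 qed
 then obtain l where l: "basis r l - transfer ps ps (basis r l) \<noteq> (zv r :: 'a Matrix.vec)" by blast
 obtain p d where "p \<in> hyp" "\<forall>q\<in>set ps. orth p q"
  "basis r l - transfer ps ps (basis r l) = d \<cdot>\<^sub>v fst p"
  by (rule frame_extend[OF assms(1) V_unit l])
 then show ?thesis by (intro that)
qed

text \<open>Each vector forces at most one new pair: its remainder is a multiple of the first vector
  of that pair, and the vectors treated earlier are orthogonal to the new pair.\<close>

lemma frame_spanning:
 assumes "set xs \<subseteq> V"
 shows "\<exists>ps. frame ps \<and> length ps \<le> length xs \<and> (\<forall>x\<in>set xs. x - transfer ps ps x = zv r)"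
 using assms
proof (induction xs)
 case Nil
 show ?case by (intro exI[of _ "[]"]) simp
next
 case (Cons x xs)
 then obtain ps where ps: "frame ps" "length ps \<le> length xs" "\<forall>x\<in>set xs. x - transfer ps ps x = zv r" by auto
 have psh: "set ps \<subseteq> hyp" using frame_hyp ps by auto
 have xV: "x \<in> V" "set xs \<subseteq> V" using Cons.prems by auto
 show ?case
 proof (cases "x - transfer ps ps x = zv r")
  case True
  with ps show ?thesis by (intro exI[of _ ps]) auto
 next
  case False
  obtain p d where p: "p \<in> hyp" "\<forall>q\<in>set ps. orth p q" "x - transfer ps ps x = d \<cdot>\<^sub>v fst p"
   by (rule frame_extend[OF ps(1) xV(1) False])
  have po: "orth q p" if "q \<in> set ps" for q using p(2) that orth_sym by blast
  have tz: "\<omega> (transfer ps ps y) (fst p) = 0" "\<omega> (transfer ps ps y) (snd p) = 0" for y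
   by (rule sf_transfer_zero[OF psh]; use p(1) po in \<open>simp add: orth_def\<close>)+
  have pc: "fst p \<in> vecs r" "snd p \<in> vecs r" using p(1) by auto
  have "y - transfer (p # ps) (p # ps) y = zv r" if y: "y \<in> set xs" for y
  proof -
   have yc: "y \<in> vecs r" using y xV(2) by auto
   have tc: "transfer ps ps y \<in> vecs r" using psh by simp
   have y0: "y - transfer ps ps y = zv r" using ps(3) y by blast
   have yt: "y = transfer ps ps y"
   proof (rule eq_vecI)
    show "y $ i = transfer ps ps y $ i" if "i < dim_vec (transfer ps ps y)" for i
     using arg_cong[OF y0, of "\<lambda>v. v $ i"] that tc yc by simp
   qed (use tc yc in simp)
   from arg_cong[OF this, of "\<lambda>v. \<omega> v (fst p)"] arg_cong[OF this, of "\<lambda>v. \<omega> v (snd p)"]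
   have "\<omega> y (fst p) = 0" "\<omega> y (snd p) = 0" using tz by simp_all
   note y\<omega> = this
   show ?thesis
   proof (rule eq_vecI)
    show "(y - transfer (p # ps) (p # ps) y) $ i = zv r $ i" if "i < dim_vec (zv r)" for i
     using arg_cong[OF y0, of "\<lambda>v. v $ i"] that tc yc pc y\<omega> by simp
   qed (use tc yc pc in simp)
  qed
  moreover have "x - transfer (p # ps) (p # ps) x = zv r"
  proof -
   have xc: "x \<in> vecs r" using xV(1) by auto
   have tc: "transfer ps ps x \<in> vecs r" using psh by simp
   have xd: "x = d \<cdot>\<^sub>v fst p + transfer ps ps x"
   proof (rule eq_vecI)
    show "x $ i = (d \<cdot>\<^sub>v fst p + transfer ps ps x) $ i" if "i < dim_vec (d \<cdot>\<^sub>v fst p + transfer ps ps x)" for i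
     using arg_cong[OF p(3), of "\<lambda>v. v $ i"] that tc xc pc by (simp add: algebra_simps)
   qed (use tc xc pc in simp)
   have "\<omega> (d \<cdot>\<^sub>v fst p + transfer ps ps x) (snd p) = d" "\<omega> (d \<cdot>\<^sub>v fst p + transfer ps ps x) (fst p) = 0"
    using tz pc tc hypD[OF p(1)] by (simp_all add: sf_linear)
   with arg_cong[OF xd, of "\<lambda>v. \<omega> v (fst p)"] arg_cong[OF xd, of "\<lambda>v. \<omega> v (snd p)"]
   have \<omega>x: "\<omega> x (snd p) = d" "\<omega> x (fst p) = 0" by simp_all
   show ?thesis
   proof (rule eq_vecI)
    show "(x - transfer (p # ps) (p # ps) x) $ i = zv r $ i" if "i < dim_vec (zv r)" for i
     using arg_cong[OF xd, of "\<lambda>v. v $ i"] that tc xc pc \<omega>x by simp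
   qed (use tc xc pc in simp)
  qed
  ultimately show ?thesis
   using ps p by (intro exI[of _ "p # ps"]) auto
 qed
qed

text \<open>The given pairs may be in any mutual position. Their two components are treated as
  separate vectors, contained in a frame of at most \<open>2 * length ps\<close> pairs; if this is
  shorter than \<open>r\<close>, a further pair orthogonal to the frame is orthogonal to all of
  them. This is the origin of the factor 2 in the stable range.\<close>

lemma hyp_rich:
 assumes "set ps \<subseteq> hyp" "2 * length ps < r"
 shows "\<exists>p\<in>hyp. \<forall>q\<in>set ps. orth p q"
proof -
 let ?xs = "map fst ps @ map snd ps"
 obtain qs where qs: "frame qs" "length qs \<le> length ?xs" "\<forall>x\<in>set ?xs. x - transfer qs qs x = zv r"
 proof -
  have "set ?xs \<subseteq> V" using assms(1) hypD(1,2) by auto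
  from frame_spanning[OF this] show ?thesis using that by blast
 qed
 have qsh: "set qs \<subseteq> hyp" using frame_hyp qs by auto
 have xsV: "set ?xs \<subseteq> V" using assms(1) hypD(1,2) by auto
 have "length qs < r" using qs(2) assms(2) by simp
 then obtain p where p: "p \<in> hyp" "\<forall>q\<in>set qs. orth p q"
  by (rule frame_extend_short[OF qs(1)])
 have "\<omega> w x = 0" if x: "x \<in> set ?xs" and w: "w \<in> {fst p, snd p}" for x w
 proof -
  have c: "x \<in> vecs r" "transfer qs qs x \<in> vecs r" "w \<in> vecs r"
   using subsetD[OF xsV x] w qsh p(1) by auto
  have x0: "x - transfer qs qs x = zv r" using qs(3) x by blast
  have "\<omega> (transfer qs qs x) w = 0"
  proof (rule sf_transfer_zero[OF qsh c(3)])
   fix q assume "q \<in> set qs"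
   then have "orth q p" using p(2) orth_sym by blast
   then show "\<omega> (fst q) w = 0 \<and> \<omega> (snd q) w = 0" using w by (auto simp: orth_def)
  qed
  then have "\<omega> w (transfer qs qs x) = 0" using sf_skew[of r w "transfer qs qs x"] by simp
  moreover have "\<omega> w (x - transfer qs qs x) = 0" unfolding x0 by simp
  ultimately show ?thesis using c by (simp add: sf_linear)
 qed
 then have "orth p q" if "q \<in> set ps" for q
  using that by (auto simp: orth_def)
 with p(1) show ?thesis by blast
qed

end

lemma SpI_form:
 fixes M :: "'a::field mat"
 assumes M: "M \<in> mats r"
  and sf: "\<And>v w. v \<in> vecs r \<Longrightarrow> w \<in> vecs r \<Longrightarrow>
   sf r (M *\<^sub>v v) (M *\<^sub>v w) = sf r v w"
 shows "M \<in> carrier (Sp r)"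
proof -
 have "det M \<noteq> 0"
 proof
  assume "det M = 0"
  then obtain v where v: "v \<in> vecs r" "v \<noteq> zv r" "M *\<^sub>v v = zv r"
   using det_0_iff_vec_prod_zero[OF M] by blast
  have "sf r v w = 0" if "w \<in> vecs r" for w
   using sf[OF v(1) that] v(3) by simp
  with v sf_nondegenerate show False by blast
 qed
 then obtain L where "L \<in> mats r" "M * L = idm r" "L * M = idm r"
  using det_non_zero_imp_unit[OF M, of "()"] unfolding Units_def by (auto simp: ring_mat_simps)
 then show ?thesis using M sf by (intro SpI) auto
qed

section \<open>Swaps of orthogonal hyperbolic pairs\<close>

context symplectic_ring
begin

lemma apply_linear:
 assumes "M \<in> carrier G" "x \<in> vecs r" "y \<in> vecs r"
 shows "M *\<^sub>v (x + y) = M *\<^sub>v x + M *\<^sub>v y" "M *\<^sub>v (x - y) = M *\<^sub>v x - M *\<^sub>v y" "M *\<^sub>v (c \<cdot>\<^sub>v x) = c \<cdot>\<^sub>v (M *\<^sub>v x)"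
 using mult_add_distrib_mat_vec[OF G_carrier_mat[OF assms(1)] assms(2,3)]
  mult_minus_distrib_mat_vec[OF G_carrier_mat[OF assms(1)] assms(2,3)]
  mult_mat_vec[OF G_carrier_mat[OF assms(1)] assms(2)] by auto

lemma sf_apply_inv:
 assumes "M \<in> carrier G" "x \<in> vecs r" "y \<in> vecs r"
 shows "\<omega> x (ginv M *\<^sub>v y) = \<omega> (M *\<^sub>v x) y"
 using G_sf[OF assms(1,2), of "ginv M *\<^sub>v y"] apply_inv(1)[OF assms(1,3)] assms by simp

lemma GI_form:
 assumes "M \<in> mats r" "\<And>i j. i < 2 * r \<Longrightarrow> j < 2 * r \<Longrightarrow> M $$ (i, j) \<in> R"
  "\<And>v w. v \<in> vecs r \<Longrightarrow> w \<in> vecs r \<Longrightarrow> \<omega> (M *\<^sub>v v) (M *\<^sub>v w) = \<omega> v w"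
 shows "M \<in> carrier G"
 using SpI_form[OF assms(1,3)] assms(2) by (simp add: carrier_G)

text \<open>For orthogonal \<open>p\<close> and \<open>q\<close> the differences of first and of
  second components pair to 2. The matrix is minus the identity on the plane they span and the
  identity on its orthogonal complement; written this way it involves no division by 2, so its
  entries stay in \<open>R\<close>.\<close>

definition swap :: "'a Matrix.vec \<times> 'a Matrix.vec \<Rightarrow> 'a Matrix.vec \<times> 'a Matrix.vec \<Rightarrow> 'a mat" where
 "swap p q = idm r + (rank_one r (snd p - snd q) (fst p - fst q) - rank_one r (fst p - fst q) (snd p - snd q))"

lemma swap_apply:
 assumes "p \<in> hyp" "q \<in> hyp" "x \<in> vecs r"
 shows "swap p q *\<^sub>v x = x + (\<omega> (snd p - snd q) x \<cdot>\<^sub>v (fst p - fst q) - \<omega> (fst p - fst q) x \<cdot>\<^sub>v (snd p - snd q))"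
proof -
 have c: "fst p - fst q \<in> vecs r" "snd p - snd q \<in> vecs r" using assms by auto
 show ?thesis
  unfolding swap_def
  using add_mult_distrib_mat_vec[OF one_carrier_mat[of "2 * r"] minus_carrier_mat[OF rank_one_carrier] assms(3)]
   minus_mult_distrib_mat_vec[OF rank_one_carrier rank_one_carrier assms(3)] rank_one_apply[OF assms(3)] c assms
  by simp
qed

lemma swap_closed:
 assumes "p \<in> hyp" "q \<in> hyp" "orth p q"
 shows "swap p q \<in> carrier G"
proof (rule GI_form)
 show "swap p q \<in> mats r" unfolding swap_def by (intro add_carrier_mat minus_carrier_mat rank_one_carrier)
 have V: "fst p - fst q \<in> V" "snd p - snd q \<in> V" by (intro V_minus hypD assms)+
 show "swap p q $$ (i, j) \<in> R" if ij: "i < 2 * r" "j < 2 * r" for i j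
 proof -
  have "swap p q $$ (i, j) = idm r $$ (i, j) + (rank_one r (snd p - snd q) (fst p - fst q) $$ (i, j)
    - rank_one r (fst p - fst q) (snd p - snd q) $$ (i, j))"
   using ij unfolding swap_def by (simp add: rank_one_def)
  also have "\<dots> \<in> R"
   using ij rank_one_entries[OF V ij] rank_one_entries[OF V(2,1) ij] by (intro R_add R_minus) (auto simp: R_one R_zero)
  finally show ?thesis .
 qed
 have c: "fst p \<in> vecs r" "snd p \<in> vecs r" "fst q \<in> vecs r" "snd q \<in> vecs r"
  using assms by auto
 define a where "a = fst p - fst q"
 define b where "b = snd p - snd q"
 have ab: "a \<in> vecs r" "b \<in> vecs r" using c by (auto simp: a_def b_def)
 have "\<omega> a b = 2" "\<omega> b a = -2"
  using c hypD[OF assms(1)] hypD[OF assms(2)] assms(3) orth_sym[OF assms(3)] by (simp_all add: a_def b_def sf_linear orth_def)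
 moreover fix x y :: "'a Matrix.vec" assume xy: "x \<in> vecs r" "y \<in> vecs r"
 moreover have "\<omega> x a = - \<omega> a x" "\<omega> x b = - \<omega> b x" by (rule sf_skew)+
 ultimately show "\<omega> (swap p q *\<^sub>v x) (swap p q *\<^sub>v y) = \<omega> x y"
  using ab unfolding swap_apply[OF assms(1,2) xy(1)] swap_apply[OF assms(1,2) xy(2)] a_def[symmetric] b_def[symmetric]
  by (simp add: sf_linear algebra_simps)
qed

lemma swap_swaps:
 assumes "p \<in> hyp" "q \<in> hyp" "orth p q"
 shows "act2 (swap p q) p = q"
proof -
 have c: "fst p \<in> vecs r" "snd p \<in> vecs r" "fst q \<in> vecs r" "snd q \<in> vecs r"
  using assms by auto
 note o = orth_sym[OF assms(3), unfolded orth_def] hypD[OF assms(1)]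
 have "swap p q *\<^sub>v fst p = fst q"
  unfolding swap_apply[OF assms(1,2) c(1)] using c o by (intro eq_vecI) (auto simp: sf_linear)
 moreover have "swap p q *\<^sub>v snd p = snd q"
  unfolding swap_apply[OF assms(1,2) c(2)] using c o by (intro eq_vecI) (auto simp: sf_linear)
 ultimately show ?thesis by (simp add: act2_def)
qed

lemma swap_fix:
 assumes "p \<in> hyp" "q \<in> hyp" "s \<in> hyp" "orth p s" "orth q s"
 shows "act2 (swap p q) s = s"
proof -
 have c: "fst p \<in> vecs r" "snd p \<in> vecs r" "fst q \<in> vecs r" "snd q \<in> vecs r"
  "fst s \<in> vecs r" "snd s \<in> vecs r"
  using assms by auto
 have "swap p q *\<^sub>v fst s = fst s"
  unfolding swap_apply[OF assms(1,2) c(5)] using c assms(4,5) by (intro eq_vecI) (auto simp: sf_linear orth_def)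
 moreover have "swap p q *\<^sub>v snd s = snd s"
  unfolding swap_apply[OF assms(1,2) c(6)] using c assms(4,5) by (intro eq_vecI) (auto simp: sf_linear orth_def)
 ultimately show ?thesis by (simp add: act2_def)
qed

lemma act2_closed: "M \<in> carrier G \<Longrightarrow> p \<in> hyp \<Longrightarrow> act2 M p \<in> hyp"
 using hypD[of p] G_sf[of M "fst p" "snd p"] by (auto simp: hyp_def act2_def intro: G_apply_V)

lemma act2_orth: "\<lbrakk>M \<in> carrier G; p \<in> hyp; q \<in> hyp; orth p q\<rbrakk> \<Longrightarrow> orth (act2 M p) (act2 M q)"
 by (simp add: orth_def act2_def G_sf)

lemma act2_mult: "\<lbrakk>M \<in> carrier G; L \<in> carrier G; p \<in> hyp\<rbrakk> \<Longrightarrow> act2 (M \<star> L) p = act2 M (act2 L p)"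
 by (simp add: act2_def apply_mult)

lemma act2_one: "p \<in> hyp \<Longrightarrow> act2 \<one>\<^bsub>G\<^esub> p = p"
 by (simp add: act2_def)

lemma swap_act:
 assumes M: "M \<in> carrier G" and pq: "p \<in> hyp" "q \<in> hyp" "orth p q"
 shows "swap (act2 M p) (act2 M q) = M \<star> swap p q \<star> ginv M"
proof (rule G_eqI)
 have sc: "swap p q \<in> carrier G" using swap_closed pq by simp
 show "swap (act2 M p) (act2 M q) \<in> carrier G"
  using M pq by (intro swap_closed act2_closed act2_orth)
 show "M \<star> swap p q \<star> ginv M \<in> carrier G"
  using M sc by (intro m_closed inv_closed)
 fix x :: "'a Matrix.vec" assume x: "x \<in> vecs r"
 have c: "fst p \<in> vecs r" "snd p \<in> vecs r" "fst q \<in> vecs r" "snd q \<in> vecs r"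
  using pq by auto
 let ?y = "ginv M *\<^sub>v x"
 have y: "?y \<in> vecs r" using M x by simp
 have "(M \<star> swap p q \<star> ginv M) *\<^sub>v x = M *\<^sub>v (swap p q *\<^sub>v ?y)"
  using M sc x m_closed[OF M sc] by (simp add: apply_mult[of M] apply_mult[of "M * swap p q"])
 also have "\<dots> = M *\<^sub>v ?y + (\<omega> (snd p - snd q) ?y \<cdot>\<^sub>v (M *\<^sub>v (fst p - fst q)) - \<omega> (fst p - fst q) ?y \<cdot>\<^sub>v (M *\<^sub>v (snd p - snd q)))"
  unfolding swap_apply[OF pq(1,2) y] using M c y by (simp add: apply_linear(1,2)[OF M] apply_linear(3)[OF M _ y])
 also have "\<dots> = swap (act2 M p) (act2 M q) *\<^sub>v x"
  unfolding swap_apply[OF act2_closed[OF M pq(1)] act2_closed[OF M pq(2)] x]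
  using M c x by (simp add: act2_def sf_apply_inv[OF M _ x] apply_inv(1)[OF M x] apply_linear(2)[OF M])
 finally show "swap (act2 M p) (act2 M q) *\<^sub>v x = (M \<star> swap p q \<star> ginv M) *\<^sub>v x" by simp
qed

text \<open>Trivial real coefficients: one index, of weight 1, with trivial action and all values
  allowed.\<close>

lemma swap_complex:
 assumes "2 * N < r"
 shows "swap_complex G act2 hyp orth (\<lambda>g (i :: bool). i) {True} (\<lambda>i. 1) UNIV N swap"
proof -
 have "\<exists>p\<in>hyp. \<forall>b\<in>set ps. orth p b" if "length ps \<le> N" "set ps \<subseteq> hyp" for ps
  using hyp_rich[OF that(2)] that(1) assms by simp
 then show ?thesis
  by unfold_locales
   (auto simp: act2_mult[simplified] act2_one[simplified] swap_swaps swap_act[simplified]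
    intro: act2_closed act2_orth swap_closed swap_fix)
qed

subsection \<open>Transitivity on hyperbolic pairs\<close>

abbreviation std_pair :: "nat \<Rightarrow> 'a Matrix.vec \<times> 'a Matrix.vec" where
 "std_pair i \<equiv> (basis r i, basis r (r + i))"

lemma std_pair_hyp: "i < r \<Longrightarrow> std_pair i \<in> hyp"
 using sf_unit_right(2)[of "basis r i :: 'a Matrix.vec" r i] by (simp add: hyp_def V_unit)

lemma std_pair_orth: "\<lbrakk>i < r; j < r; i \<noteq> j\<rbrakk> \<Longrightarrow> orth (std_pair i) (std_pair j)"
 using sf_unit_right[of "basis r i :: 'a Matrix.vec" r j] sf_unit_right[of "basis r (r + i) :: 'a Matrix.vec" r j]
 by (simp add: orth_def)

lemma std_frame: "frame (map std_pair [k..<r])"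
proof (cases "k \<le> r")
 case True
 then show ?thesis
  by (induction rule: inc_induct) (auto simp: upt_conv_Cons std_pair_hyp intro: std_pair_orth)
qed simp

lemma std_transfer:
 assumes "x \<in> vecs r" "k \<le> r" "l < 2 * r"
 shows "transfer (map std_pair [k..<r]) (map std_pair [k..<r]) x $ l =
  (if (k \<le> l \<and> l < r) \<or> r + k \<le> l then x $ l else 0)"
 using assms(2)
proof (induction rule: inc_induct)
 case base
 show ?case using assms by auto
next
 case (step n)
 have h: "set (map std_pair [Suc n..<r]) \<subseteq> hyp" using frame_hyp[OF std_frame] .
 have "transfer (map std_pair [n..<r]) (map std_pair [n..<r]) x $ l =
  x $ n * basis r n $ l + x $ (r + n) * basis r (r + n) $ l
   + transfer (map std_pair [Suc n..<r]) (map std_pair [Suc n..<r]) x $ l"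
  using step.hyps assms(1,3) sf_unit_right[OF assms(1) step.hyps(2)] transfer_dim[OF h, of "map std_pair [Suc n..<r]" x]
  by (simp add: upt_conv_Cons)
 moreover have "basis r n $ l = (if l = n then 1 else 0 :: 'a)" "basis r (r + n) $ l = (if l = r + n then 1 else 0 :: 'a)"
  using assms(3) step.hyps by auto
 moreover have "n \<le> l \<and> l < r \<or> r + n \<le> l \<longleftrightarrow> l = n \<or> l = r + n \<or> (Suc n \<le> l \<and> l < r) \<or> r + Suc n \<le> l"
  using step.hyps by auto
 ultimately show ?case using step by auto
qed

lemma transfer_last:
 assumes "frame ps" "length ps = length qs" "ps \<noteq> []" "set qs \<subseteq> hyp"
 shows "transfer ps qs (fst (last ps)) = fst (last qs) \<and> transfer ps qs (snd (last ps)) = snd (last qs)"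
 using assms
proof (induction ps arbitrary: qs)
 case (Cons p ps)
 then obtain q qs' where q: "qs = q # qs'" by (cases qs) auto
 have p: "p \<in> hyp" using Cons.prems by simp
 have qh: "q \<in> hyp" "set qs' \<subseteq> hyp" using Cons.prems q by auto
 show ?case
 proof (cases "ps = []")
  case True
  then have "qs' = []" using Cons.prems q by simp
  then show ?thesis using True q hypD[OF p] qh by (auto intro!: eq_vecI)
 next
  case False
  then have qne: "qs' \<noteq> []" using Cons.prems(2) q by auto
  have "last ps \<in> set ps" "last qs' \<in> set qs'" using False qne by auto
  then have "orth (last ps) p" "last qs' \<in> hyp" using Cons.prems(1) orth_sym qh by auto
  moreover have "transfer ps qs' (fst (last ps)) = fst (last qs') \<and> transfer ps qs' (snd (last ps)) = snd (last qs')"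
   using Cons False q qh by auto
  ultimately show ?thesis using False qne q qh by (auto simp: orth_def intro!: eq_vecI)
 qed
qed simp

text \<open>Completing \<open>p\<close> to a frame of \<open>r\<close> pairs and transferring the
  standard frame to it gives a symplectic matrix. Frames grow at the front, so \<open>p\<close>
  stays last, opposite the last standard pair, whose stabilizer is the image of
  \<open>emb\<close>.\<close>

lemma hyp_transitive:
 assumes p: "p \<in> hyp" and r: "r \<ge> 1"
 obtains M where "M \<in> carrier G" "act2 M (std_pair (r - 1)) = p"
proof -
 have "\<exists>ps. frame ps \<and> length ps = k \<and> last ps = p" if "1 \<le> k" "k \<le> r" for k
  using that
 proof (induction k rule: dec_induct)
  case base
  show ?case by (rule exI[of _ "[p]"]) (simp add: p)
 next
  case (step n)
  then obtain ps where ps: "frame ps" "length ps = n" "last ps = p" by auto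
  have "length ps < r" using ps step by simp
  then obtain q where "q \<in> hyp" "\<forall>s\<in>set ps. orth q s" by (rule frame_extend_short[OF ps(1)])
  moreover have "ps \<noteq> []" using ps(2) step by auto
  ultimately show ?case using ps by (intro exI[of _ "q # ps"]) auto
 qed
 then obtain ps where ps: "frame ps" "length ps = r" "last ps = p" using r by blast
 let ?s = "map std_pair [0..<r]"
 have sh: "set ?s \<subseteq> hyp" "set ps \<subseteq> hyp" using frame_hyp[OF std_frame, of 0] frame_hyp[OF ps(1)] by auto
 have last: "?s \<noteq> []" "last ?s = std_pair (r - 1)" using r by (auto simp: last_map)
 let ?M = "transfer_mat ?s ps"
 have M: "?M \<in> carrier G"
 proof (rule GI_form)
  fix x y :: "'a Matrix.vec" assume xy: "x \<in> vecs r" "y \<in> vecs r"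
  have "transfer ?s ?s x = x"
   using std_transfer[OF xy(1), of 0] transfer_dim[OF sh(1), of ?s x] xy(1)
   by (intro eq_vecI) auto
  then show "\<omega> (?M *\<^sub>v x) (?M *\<^sub>v y) = \<omega> x y"
   using sf_transfer[OF std_frame ps(1) _ xy, of 0] ps(2) transfer_mat_apply[OF sh] xy by simp
 qed (use transfer_mat_entries[OF sh] in auto)
 moreover have "act2 ?M (std_pair (r - 1)) = p"
  using transfer_last[OF std_frame _ last(1) sh(2)] ps last(2) transfer_mat_apply[OF sh]
  by (auto simp: act2_def)
 ultimately show ?thesis by (rule that)
qed

end

section \<open>Restriction along group homomorphisms\<close>

definition restr :: "('h, 'd) monoid_scheme \<Rightarrow> ('h \<Rightarrow> 'g) \<Rightarrow> nat \<Rightarrow> ('g list \<Rightarrow> real) \<Rightarrow> 'h list \<Rightarrow> real" where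
 "restr H \<iota> q f gs = (if gs \<in> tuples H q then f (map \<iota> gs) else 0)"

lemma tuples_map_closed: "(\<And>h. h \<in> carrier H \<Longrightarrow> \<iota> h \<in> carrier G) \<Longrightarrow> gs \<in> tuples H q \<Longrightarrow> map \<iota> gs \<in> tuples G q"
 by (auto simp: tuples_def)

lemma restr_cochain:
 assumes \<iota>: "\<And>h. h \<in> carrier H \<Longrightarrow> \<iota> h \<in> carrier G"
  "\<And>a b. a \<in> carrier H \<Longrightarrow> b \<in> carrier H \<Longrightarrow> \<iota> (a \<otimes>\<^bsub>H\<^esub> b) = \<iota> a \<otimes>\<^bsub>G\<^esub> \<iota> b"
  and H: "Group.group H" and f: "f \<in> cochains G q"
 shows "restr H \<iota> q f \<in> cochains H q"
proof -
 obtain C where C: "0 \<le> C" "\<forall>gs. \<bar>f gs\<bar> \<le> C" by (rule cochains_bound[OF f])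
 show ?thesis
 proof (rule cochainsI[of _ _ _ C])
  fix g gs assume g: "g \<in> carrier H" and gs: "gs \<in> tuples H q"
  have "map \<iota> (map (\<lambda>x. g \<otimes>\<^bsub>H\<^esub> x) gs) = map (\<lambda>x. \<iota> g \<otimes>\<^bsub>G\<^esub> x) (map \<iota> gs)"
   using gs g \<iota>(2) by (auto simp: tuples_def)
  then show "restr H \<iota> q f (map (\<lambda>x. g \<otimes>\<^bsub>H\<^esub> x) gs) = restr H \<iota> q f gs"
   using cochainsD(2)[OF f \<iota>(1)[OF g] tuples_map_closed[of H \<iota> G, OF \<iota>(1) gs]]
    tuples_map[OF H g gs] gs by (simp del: map_map add: restr_def)
 qed (use C in \<open>auto simp: restr_def\<close>)
qed

lemma restr_coboundary:
 assumes \<iota>: "\<And>h. h \<in> carrier H \<Longrightarrow> \<iota> h \<in> carrier G"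
 shows "coboundary H q (restr H \<iota> q f) = restr H \<iota> (Suc q) (coboundary G q f)"
proof
 fix gs
 have "bd (restr H \<iota> q f) gs = bd f (map \<iota> gs)" if "gs \<in> tuples H (Suc q)"
  unfolding bd_map by (rule bd_cong) (use that in \<open>auto simp: restr_def tuples_def\<close>)
 then show "coboundary H q (restr H \<iota> q f) gs = restr H \<iota> (Suc q) (coboundary G q f) gs"
  using tuples_map_closed[of H \<iota> G gs "Suc q", OF \<iota>] by (simp add: coboundary_eq restr_def)
qed

lemma restr_cocycle:
 assumes "\<And>h. h \<in> carrier H \<Longrightarrow> \<iota> h \<in> carrier G"
  "\<And>a b. a \<in> carrier H \<Longrightarrow> b \<in> carrier H \<Longrightarrow> \<iota> (a \<otimes>\<^bsub>H\<^esub> b) = \<iota> a \<otimes>\<^bsub>G\<^esub> \<iota> b"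
  "Group.group H" "f \<in> cocycles G q"
 shows "restr H \<iota> q f \<in> cocycles H q"
 using restr_cochain[of H \<iota> G f q] restr_coboundary[of H \<iota> G q f] assms
 by (auto simp: bounded_cocycles_def fun_eq_iff restr_def)

lemma restr_coboundaries:
 assumes "\<And>h. h \<in> carrier H \<Longrightarrow> \<iota> h \<in> carrier G"
  "\<And>a b. a \<in> carrier H \<Longrightarrow> b \<in> carrier H \<Longrightarrow> \<iota> (a \<otimes>\<^bsub>H\<^esub> b) = \<iota> a \<otimes>\<^bsub>G\<^esub> \<iota> b"
  "Group.group H" "f \<in> cobs G q"
 shows "restr H \<iota> q f \<in> cobs H q"
proof (cases q)
 case 0
 with assms(4) show ?thesis by (auto simp: restr_def fun_eq_iff)
next
 case (Suc k)
 then obtain w where w: "w \<in> cochains G k" "f = coboundary G k w" using assms(4) by auto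
 then have "restr H \<iota> q f = coboundary H k (restr H \<iota> k w)"
  using restr_coboundary[of H \<iota> G k w] assms(1) Suc by simp
 then show ?thesis using restr_cochain[of H \<iota> G w k] assms w Suc by auto
qed

lemma cocyclesD:
 assumes "f \<in> cocycles G q"
 shows "f \<in> cochains G q" "\<And>gs. gs \<in> tuples G (Suc q) \<Longrightarrow> bd f gs = 0"
 using assms by (auto simp: bounded_cocycles_def coboundary_eq fun_eq_iff split: if_splits)

lemma cobsI:
 assumes "f \<in> cochains G q"
  and "q = 0 \<Longrightarrow> \<forall>gs\<in>tuples G 0. f gs = 0"
  and "\<And>k. q = Suc k \<Longrightarrow> \<exists>w C. (\<forall>gs\<in>tuples G k. \<bar>w gs\<bar> \<le> C) \<and>
   (\<forall>g\<in>carrier G. \<forall>gs\<in>tuples G k. w (map (\<lambda>x. g \<otimes>\<^bsub>G\<^esub> x) gs) = w gs) \<and> (\<forall>gs\<in>tuples G q. f gs = bd w gs)"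
  and G: "Group.group G"
 shows "f \<in> cobs G q"
proof (cases q)
 case 0
 then show ?thesis using assms(1,2) cochainsD(1)[OF assms(1)] by (auto simp: fun_eq_iff)
next
 case (Suc k)
 then obtain w C where w: "\<forall>gs\<in>tuples G k. \<bar>w gs\<bar> \<le> C"
   "\<forall>g\<in>carrier G. \<forall>gs\<in>tuples G k. w (map (\<lambda>x. g \<otimes>\<^bsub>G\<^esub> x) gs) = w gs" "\<forall>gs\<in>tuples G q. f gs = bd w gs"
  using assms(3) by blast
 let ?w = "\<lambda>gs. if gs \<in> tuples G k then w gs else 0"
 have "?w \<in> cochains G k"
  by (rule cochainsI[of _ _ _ C]) (use w tuples_map[OF G] in auto)
 moreover have "f = coboundary G k ?w"
 proof
  fix gs
  have "bd w gs = bd ?w gs" if "gs \<in> tuples G (Suc k)"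
   by (rule bd_cong) (use that in \<open>auto simp: tuples_def\<close>)
  then show "f gs = coboundary G k ?w gs"
   using w(3) cochainsD(1)[OF assms(1), of gs] by (auto simp: coboundary_eq Suc)
 qed
 ultimately show ?thesis by (auto simp: Suc)
qed

section \<open>The stabilizer of a hyperbolic pair\<close>

text \<open>In size \<open>2 * Suc k\<close> the last standard pair occupies the positions
  \<open>k\<close> and \<open>2 * k + 1\<close>; these are the two that \<open>skip\<close>
  omits.\<close>

definition skip :: "nat \<Rightarrow> nat \<Rightarrow> nat" where
 "skip k i = (if i < k then i else Suc i)"

definition emb :: "nat \<Rightarrow> 'a::field mat \<Rightarrow> 'a mat" where
 "emb k A = Matrix.mat (2 * Suc k) (2 * Suc k) (\<lambda>(i, j).
   if i = k \<or> i = 2 * k + 1 \<or> j = k \<or> j = 2 * k + 1 then (if i = j then 1 else 0)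
   else A $$ (if i < k then i else i - 1, if j < k then j else j - 1))"

definition unemb :: "nat \<Rightarrow> 'a::field mat \<Rightarrow> 'a mat" where
 "unemb k M = Matrix.mat (2 * k) (2 * k) (\<lambda>(i, j). M $$ (skip k i, skip k j))"

definition res :: "nat \<Rightarrow> 'a Matrix.vec \<Rightarrow> 'a Matrix.vec" where
 "res k x = Matrix.vec (2 * k) (\<lambda>i. x $ skip k i)"

definition ext :: "nat \<Rightarrow> 'a::field Matrix.vec \<Rightarrow> 'a Matrix.vec" where
 "ext k y = Matrix.vec (2 * Suc k) (\<lambda>i. if i = k \<or> i = 2 * k + 1 then 0 else y $ (if i < k then i else i - 1))"

lemma emb_carrier [simp]: "emb k A \<in> mats (Suc k)"
 by (simp add: emb_def)

lemma unemb_carrier [simp]: "unemb k M \<in> mats k"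
 by (simp add: unemb_def)

lemma res_carrier [simp]: "res k x \<in> vecs k"
 by (simp add: res_def)

lemma ext_carrier [simp]: "ext k y \<in> vecs (Suc k)"
 unfolding ext_def by (rule vec_carrier)

lemma unemb_emb: "A \<in> mats k \<Longrightarrow> unemb k (emb k A) = A"
 by (rule eq_matI) (auto simp: unemb_def emb_def skip_def)

lemma res_ext: "y \<in> vecs k \<Longrightarrow> res k (ext k y) = y"
 by (rule eq_vecI) (auto simp: res_def ext_def skip_def)

lemma ext_special: "ext k y $ k = 0" "ext k y $ (2 * k + 1) = 0"
 by (simp_all add: ext_def)

lemma index_cases:
 assumes "i < 2 * Suc k"
 obtains "i = k" | "i = 2 * k + 1" | j where "j < 2 * k" "i = skip k j"
proof (cases "i = k \<or> i = 2 * k + 1")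
 case False
 then have "(if i < k then i else i - 1) < 2 * k" "i = skip k (if i < k then i else i - 1)"
  using assms by (auto simp: skip_def)
 then show ?thesis by (rule that(3))
qed (use that in auto)

lemma sum_skip:
 "(\<Sum>j<2 * Suc k. f j) = (\<Sum>j<2 * k. f (skip k j)) + f k + (f (2 * k + 1) :: 'a::comm_monoid_add)"
proof -
 have inj: "inj_on (skip k) {..<2 * k}" by (auto simp: inj_on_def skip_def split: if_splits)
 have "{..<2 * Suc k} = skip k ` {..<2 * k} \<union> {k, 2 * k + 1}"
 proof (intro equalityI subsetI)
  fix i assume "i \<in> {..<2 * Suc k}"
  then have "i < 2 * Suc k" by simp
  then show "i \<in> skip k ` {..<2 * k} \<union> {k, 2 * k + 1}" by (cases rule: index_cases) auto
 qed (auto simp: skip_def split: if_splits)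
 moreover have "skip k ` {..<2 * k} \<inter> {k, 2 * k + 1} = {}" by (auto simp: skip_def)
 ultimately have "(\<Sum>j<2 * Suc k. f j) = sum f (skip k ` {..<2 * k}) + sum f {k, 2 * k + 1}"
  by (simp only: sum.union_disjoint[OF finite_imageI[OF finite_lessThan]] finite.intros)
 also have "sum f (skip k ` {..<2 * k}) = (\<Sum>j<2 * k. f (skip k j))"
  by (simp add: sum.reindex[OF inj])
 finally show ?thesis by (cases "k = 2 * k + 1") (auto simp: add.assoc)
qed

lemma apply_nth:
 "\<lbrakk>A \<in> carrier_mat n n; x \<in> carrier_vec n; i < n\<rbrakk> \<Longrightarrow> (A *\<^sub>v x) $ i = (\<Sum>j<n. A $$ (i, j) * (x $ j :: 'a::semiring_0))"
 by (simp add: scalar_prod_def atLeast0LessThan)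

lemma emb_apply:
 assumes "A \<in> mats k" "x \<in> vecs (Suc k)"
 shows "i < 2 * k \<Longrightarrow> (emb k A *\<^sub>v x) $ skip k i = (A *\<^sub>v res k x) $ i"
  "(emb k A *\<^sub>v x) $ k = x $ k" "(emb k A *\<^sub>v x) $ (2 * k + 1) = x $ (2 * k + 1)"
proof -
 show "(emb k A *\<^sub>v x) $ skip k i = (A *\<^sub>v res k x) $ i" if i: "i < 2 * k"
 proof -
  have "skip k i < 2 * Suc k" "skip k i \<noteq> k" "skip k i \<noteq> 2 * k + 1"
   "(if skip k i < k then skip k i else skip k i - 1) = i"
   using i by (auto simp: skip_def)
  moreover have "skip k j < 2 * Suc k" "skip k j \<noteq> k" "skip k j \<noteq> 2 * k + 1"
   "(if skip k j < k then skip k j else skip k j - 1) = j" if "j < 2 * k" for j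
   using that by (auto simp: skip_def)
  ultimately have "(\<Sum>j<2 * Suc k. emb k A $$ (skip k i, j) * x $ j) = (\<Sum>j<2 * k. A $$ (i, j) * x $ skip k j)"
   unfolding sum_skip by (simp add: emb_def)
  then show ?thesis
   using apply_nth[OF emb_carrier assms(2), of "skip k i" A] apply_nth[OF assms(1) res_carrier i, of x] \<open>skip k i < 2 * Suc k\<close>
   by (simp add: res_def)
 qed
 have "(\<Sum>j<2 * Suc k. emb k A $$ (l, j) * x $ j) = (\<Sum>j<2 * Suc k. if j = l then x $ j else 0)" if "l = k \<or> l = 2 * k + 1" for l
  by (rule sum.cong) (use that in \<open>auto simp: emb_def\<close>)
 then show "(emb k A *\<^sub>v x) $ k = x $ k" "(emb k A *\<^sub>v x) $ (2 * k + 1) = x $ (2 * k + 1)"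
  using apply_nth[OF emb_carrier assms(2), of k A] apply_nth[OF emb_carrier assms(2), of "2 * k + 1" A] by simp_all
qed

lemma res_emb_apply:
 assumes "A \<in> mats k" "x \<in> vecs (Suc k)"
 shows "res k (emb k A *\<^sub>v x) = A *\<^sub>v res k x"
 by (rule eq_vecI) (use emb_apply(1)[OF assms] assms in \<open>auto simp: res_def[of k "emb k A *\<^sub>v x"]\<close>)

lemma sf_Suc:
 "sf (Suc k) x y = symplectic_form k (res k x) (res k y) + (x $ k * y $ (2 * k + 1) - x $ (2 * k + 1) * y $ k)"
 by (simp add: symplectic_form_def res_def skip_def mult_2)

lemma vec_eqI_skip:
 assumes "x \<in> vecs (Suc k)" "y \<in> vecs (Suc k)" "res k x = res k y" "x $ k = y $ k" "x $ (2 * k + 1) = y $ (2 * k + 1)"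
 shows "x = y"
proof (rule eq_vecI)
 fix i assume "i < dim_vec y"
 then have "i < 2 * Suc k" using assms by simp
 then show "x $ i = y $ i"
 proof (cases rule: index_cases)
  case (3 j)
  then show ?thesis using arg_cong[OF assms(3), of "\<lambda>v. v $ j"] by (simp add: res_def)
 qed (use assms in auto)
qed (use assms in simp)

lemma emb_mult:
 assumes "A \<in> mats k" "B \<in> mats k"
 shows "emb k (A * B) = emb k A * emb k B"
proof (rule mat_eqI_apply[of _ "2 * Suc k"])
 fix x :: "'a Matrix.vec" assume x: "x \<in> vecs (Suc k)"
 have AB: "A * B \<in> mats k" using assms by simp
 have Bx: "emb k B *\<^sub>v x \<in> vecs (Suc k)" by (rule mult_mat_vec_carrier[OF emb_carrier x])
 have "emb k (A * B) *\<^sub>v x = emb k A *\<^sub>v (emb k B *\<^sub>v x)"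
 proof (rule vec_eqI_skip)
  show "emb k (A * B) *\<^sub>v x \<in> vecs (Suc k)" by (rule mult_mat_vec_carrier[OF emb_carrier x])
  show "emb k A *\<^sub>v (emb k B *\<^sub>v x) \<in> vecs (Suc k)" by (rule mult_mat_vec_carrier[OF emb_carrier Bx])
  show "res k (emb k (A * B) *\<^sub>v x) = res k (emb k A *\<^sub>v (emb k B *\<^sub>v x))"
   unfolding res_emb_apply[OF AB x] res_emb_apply[OF assms(1) Bx] res_emb_apply[OF assms(2) x]
   by (rule assoc_mult_mat_vec[OF assms res_carrier])
 qed (simp_all only: emb_apply(2,3)[OF AB x] emb_apply(2,3)[OF assms(1) Bx] emb_apply(2,3)[OF assms(2) x])
 then show "emb k (A * B) *\<^sub>v x = emb k A * emb k B *\<^sub>v x"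
  using assoc_mult_mat_vec[OF emb_carrier emb_carrier x] by simp
qed (rule emb_carrier mult_carrier_mat[OF emb_carrier emb_carrier])+

context symplectic_ring
begin

lemma emb_closed:
 assumes "A \<in> carrier (Sp_over R k)" "r = Suc k"
 shows "emb k A \<in> carrier G"
proof -
 interpret k: symplectic_ring R k by (rule symplectic_ring_axioms)
 have A: "A \<in> mats k" "\<forall>i<2 * k. \<forall>j<2 * k. A $$ (i, j) \<in> R"
  using k.G_carrier_mat[OF assms(1)] assms(1) by (auto simp: k.carrier_G)
 show ?thesis
 proof (rule GI_form)
  show "emb k A \<in> mats r" using emb_carrier assms(2) by simp
  show "emb k A $$ (i, j) \<in> R" if "i < 2 * r" "j < 2 * r" for i j
   using that assms(2) A(2) R_zero R_one by (auto simp: emb_def)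
  fix v w :: "'a Matrix.vec" assume "v \<in> vecs r" "w \<in> vecs r"
  then have vw: "v \<in> vecs (Suc k)" "w \<in> vecs (Suc k)" using assms(2) by auto
  show "\<omega> (emb k A *\<^sub>v v) (emb k A *\<^sub>v w) = \<omega> v w"
   unfolding assms(2) sf_Suc res_emb_apply[OF A(1) vw(1)] res_emb_apply[OF A(1) vw(2)]
    emb_apply(2,3)[OF A(1) vw(1)] emb_apply(2,3)[OF A(1) vw(2)]
   using k.G_sf[OF assms(1) res_carrier res_carrier] by simp
 qed
qed

text \<open>Fixing the two basis vectors determines two columns. Preserving the form against the
  same two fixed vectors determines the corresponding rows, so the matrix is block diagonal.\<close>

lemma stabilizer_emb:
 assumes M: "M \<in> carrier G" and r: "r = Suc k" and fix_std: "act2 M (std_pair (r - 1)) = std_pair (r - 1)"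
 shows "unemb k M \<in> carrier (Sp_over R k)" "emb k (unemb k M) = M"
proof -
 interpret k: symplectic_ring R k by (rule symplectic_ring_axioms)
 let ?A = "unemb k M" and ?e = "unit_vec (2 * Suc k) k :: 'a Matrix.vec" and ?f = "unit_vec (2 * Suc k) (2 * k + 1) :: 'a Matrix.vec"
 have Mc: "M \<in> mats (Suc k)" using G_carrier_mat[OF M] r by simp
 have ef: "M *\<^sub>v ?e = ?e" "M *\<^sub>v ?f = ?f" using fix_std r by (auto simp: act2_def mult_2)
 have row: "(M *\<^sub>v x) $ k = x $ k" "(M *\<^sub>v x) $ (2 * k + 1) = x $ (2 * k + 1)" if x: "x \<in> vecs (Suc k)" for x
 proof -
  have Mx: "M *\<^sub>v x \<in> vecs (Suc k)" by (rule mult_mat_vec_carrier[OF Mc x])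
  have c: "x \<in> vecs r" "?e \<in> vecs r" "?f \<in> vecs r" using x r by auto
  have "\<omega> (M *\<^sub>v x) ?f = \<omega> x ?f" "\<omega> (M *\<^sub>v x) ?e = \<omega> x ?e"
   using G_sf[OF M c(1,2)] G_sf[OF M c(1,3)] ef by simp_all
  then show "(M *\<^sub>v x) $ k = x $ k" "(M *\<^sub>v x) $ (2 * k + 1) = x $ (2 * k + 1)"
   using sf_unit_right[OF Mx lessI] sf_unit_right[OF x lessI] r by (simp_all add: mult_2)
 qed
 show eq: "emb k ?A = M"
 proof (rule eq_matI)
  fix i j assume "i < dim_row M" "j < dim_col M"
  then have ij: "i < 2 * Suc k" "j < 2 * Suc k" using Mc by auto
  have Mij: "(M *\<^sub>v unit_vec (2 * Suc k) j) $ i = M $$ (i, j)" by (rule mat_apply_unit[OF Mc ij])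
  show "emb k ?A $$ (i, j) = M $$ (i, j)"
  proof (cases "i = k \<or> i = 2 * k + 1 \<or> j = k \<or> j = 2 * k + 1")
   case True
   then have "M $$ (i, j) = (if i = j then 1 else 0)"
    using Mij row[of "unit_vec (2 * Suc k) j"] ef ij by auto
   then show ?thesis using True ij by (simp add: emb_def)
  next
   case False
   then show ?thesis using ij by (auto simp: emb_def unemb_def skip_def)
  qed
 qed (use Mc in \<open>auto simp: emb_def\<close>)
 show "?A \<in> carrier (Sp_over R k)"
 proof (rule k.GI_form)
  show "?A \<in> mats k" by simp
  show "?A $$ (i, j) \<in> R" if "i < 2 * k" "j < 2 * k" for i j
  proof -
   have "\<And>i j. i < 2 * r \<Longrightarrow> j < 2 * r \<Longrightarrow> M $$ (i, j) \<in> R" using M by (simp add: carrier_G)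
   then show ?thesis using that r by (auto simp: unemb_def skip_def)
  qed
  fix v w :: "'a Matrix.vec" assume vw: "v \<in> vecs k" "w \<in> vecs k"
  have "?A *\<^sub>v y = res k (M *\<^sub>v ext k y)" if "y \<in> vecs k" for y
   using res_emb_apply[OF unemb_carrier ext_carrier, of k M y] res_ext[OF that] eq by simp
  moreover have "\<omega> (M *\<^sub>v ext k v) (M *\<^sub>v ext k w) = \<omega> (ext k v) (ext k w)"
   using M r ext_carrier[of k] by (intro G_sf) auto
  ultimately show "symplectic_form k (?A *\<^sub>v v) (?A *\<^sub>v w) = symplectic_form k v w"
   using vw row[OF ext_carrier] unfolding r sf_Suc by (simp add: ext_special[simplified] res_ext)
 qed
qed

text \<open>On the orbit of the hyperbolic pair stabilized by \<open>H\<close>, \<open>x\<close> is homotopic to a cocycle which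
 factors through an \<open>H\<close>-equivariant retraction onto \<open>H\<close>.\<close>

theorem restr_injective:
 assumes r: "r = Suc k" and q: "2 * (q + 2)\<^sup>2 < r" and x: "x \<in> cocycles G q"
  and rx: "restr (Sp_over R k) (emb k) q x \<in> cobs (Sp_over R k) q"
 shows "x \<in> cobs G q"
proof -
 interpret k: symplectic_ring R k by (rule symplectic_ring_axioms)
 let ?H = "Sp_over R k"
 interpret sw: swap_complex G act2 hyp orth "\<lambda>g (i :: bool). i" "{True}" "\<lambda>i. 1" UNIV "(q + 2)\<^sup>2" swap
  using q by (rule swap_complex)
 \<comment> \<open>The base consists of the empty tuple, so cochains over it are those of the group
   and \<open>Y ?S 1\<close> is the set of single hyperbolic pairs.\<close>
 let ?S = "{[]} :: ('a Matrix.vec \<times> 'a Matrix.vec) list set"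
 have points: "sw.points 0 ?S" by (simp add: sw.points_def)
 have inj: "sw.inj_at ?S q" using sw.stability[OF points, of q] by simp
 define X where "X s gs i = x gs" for s :: "('a Matrix.vec \<times> 'a Matrix.vec) list" and gs and i :: bool
 note xD = cocyclesD[OF x]
 obtain C where C: "0 \<le> C" "\<forall>gs. \<bar>x gs\<bar> \<le> C" by (rule cochains_bound[OF xD(1)])
 have X: "sw.cochain ?S q X" "sw.agree ?S (Suc q) (sw.dd X) (\<lambda>s gs i. 0)"
  using C cochainsD(2)[OF xD(1)] xD(2)
  by (auto simp: sw.cochain_def X_def sw.agree_def sw.dd_def simp del: G_simps)
 have Y1: "\<exists>p\<in>hyp. u = [p]" if u: "u \<in> sw.Y ?S 1" for u
 proof -
  obtain w s where "u = w # s" "w \<in> hyp" "s \<in> ?S" "\<forall>b\<in>set s. orth w b" by (rule sw.Y_1E[OF u])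
  then show ?thesis by simp
 qed
 obtain \<gamma> where \<gamma>: "\<And>p. p \<in> hyp \<Longrightarrow> \<gamma> p \<in> carrier G" "\<And>p. p \<in> hyp \<Longrightarrow> act2 (\<gamma> p) (std_pair (r - 1)) = p"
 proof -
  have "\<exists>M. M \<in> carrier G \<and> act2 M (std_pair (r - 1)) = p" if p: "p \<in> hyp" for p
  proof -
   obtain M where "M \<in> carrier G" "act2 M (std_pair (r - 1)) = p"
    by (rule hyp_transitive[OF p]) (use r in simp)
   then show ?thesis by blast
  qed
  then have "\<forall>p. \<exists>M. p \<in> hyp \<longrightarrow> M \<in> carrier G \<and> act2 M (std_pair (r - 1)) = p" by blast
  from choice[OF this] obtain \<gamma> where "\<forall>p. p \<in> hyp \<longrightarrow> \<gamma> p \<in> carrier G \<and> act2 (\<gamma> p) (std_pair (r - 1)) = p" ..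
  then show ?thesis by (intro that[of \<gamma>]) blast+
 qed
 have std: "std_pair (r - 1) \<in> hyp" using std_pair_hyp r by simp
 \<comment> \<open>The choice \<gamma> p of an element taking the standard pair to \<open>p\<close>
   is not equivariant. Twisting it by \<open>g\<close> makes it equivariant in \<open>p\<close> and
   \<open>g\<close> jointly, while \<open>\<beta> p g\<close> still takes the standard pair to
   \<open>p\<close>.\<close>
 define \<beta> where "\<beta> p g = g \<star> \<gamma> (act2 (ginv g) p)" for p g
 have \<beta>: "\<beta> p g \<in> carrier G" if "p \<in> hyp" "g \<in> carrier G" for p g
  unfolding \<beta>_def using that \<gamma>(1)[OF act2_closed[OF inv_closed]] by (intro m_closed) auto
 have \<beta>_act: "\<beta> (act2 h p) (h \<star> g) = h \<star> \<beta> p g" if "p \<in> hyp" "g \<in> carrier G" "h \<in> carrier G" for p g h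
 proof -
  have "ginv (h \<star> g) \<star> h = ginv g \<star> (ginv h \<star> h)"
   using that by (simp only: inv_mult_group m_assoc inv_closed)
  also have "\<dots> = ginv g" using that by (simp only: l_inv r_one inv_closed)
  finally have "act2 (ginv (h \<star> g)) (act2 h p) = act2 (ginv g) p"
   using act2_mult[OF inv_closed[OF m_closed[OF that(3,2)]] that(3,1)] by (simp only:)
  moreover have "\<gamma> (act2 (ginv g) p) \<in> carrier G" using that by (intro \<gamma> act2_closed) auto
  ultimately show ?thesis unfolding \<beta>_def using that by (simp only: m_assoc)
 qed
 have stab: "ginv (\<gamma> p) \<star> M \<in> carrier G" "act2 (ginv (\<gamma> p) \<star> M) (std_pair (r - 1)) = std_pair (r - 1)"
  if "p \<in> hyp" "M \<in> carrier G" "act2 M (std_pair (r - 1)) = p" for p M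
 proof -
  show "ginv (\<gamma> p) \<star> M \<in> carrier G"
   by (rule m_closed[OF inv_closed[OF \<gamma>(1)[OF that(1)]] that(2)])
  have "act2 (ginv (\<gamma> p) \<star> M) (std_pair (r - 1)) = act2 (ginv (\<gamma> p)) p"
   using act2_mult[OF inv_closed[OF \<gamma>(1)[OF that(1)]] that(2) std] that(3) by simp
  also have "\<dots> = act2 (ginv (\<gamma> p) \<star> \<gamma> p) (std_pair (r - 1))"
   using act2_mult[OF inv_closed[OF \<gamma>(1)[OF that(1)]] \<gamma>(1)[OF that(1)] std] \<gamma>(2)[OF that(1)] by simp
  finally show "act2 (ginv (\<gamma> p) \<star> M) (std_pair (r - 1)) = std_pair (r - 1)"
   using l_inv[OF \<gamma>(1)[OF that(1)]] act2_one[OF std] by simp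
 qed
 define c where "c p g = unemb k (ginv (\<gamma> p) \<star> \<beta> p g)" for p g
 have \<beta>_std: "act2 (\<beta> p g) (std_pair (r - 1)) = p" if "p \<in> hyp" "g \<in> carrier G" for p g
 proof -
  let ?p = "act2 (ginv g) p"
  have p: "?p \<in> hyp" using that by (intro act2_closed) auto
  have "act2 (\<beta> p g) (std_pair (r - 1)) = act2 g ?p"
   unfolding \<beta>_def using act2_mult[OF that(2) \<gamma>(1)[OF p] std] \<gamma>(2)[OF p] by simp
  also have "\<dots> = act2 (g \<star> ginv g) p" using act2_mult[OF that(2) inv_closed[OF that(2)] that(1)] by simp
  finally show ?thesis using r_inv[OF that(2)] act2_one[OF that(1)] by simp
 qed
 have c: "c p g \<in> carrier ?H" "emb k (c p g) = ginv (\<gamma> p) \<star> \<beta> p g" if "p \<in> hyp" "g \<in> carrier G" for p g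
  using stabilizer_emb[OF stab(1)[OF that(1) \<beta>[OF that] \<beta>_std[OF that]] r stab(2)[OF that(1) \<beta>[OF that] \<beta>_std[OF that]]]
  by (simp_all add: c_def)
 \<comment> \<open>The factor \<open>u\<close> depends on \<open>h\<close> and \<open>p\<close> but
   not on \<open>g\<close>, so an invariant cochain of the stabilizer does not notice it.\<close>
 have c_act: "\<exists>u\<in>carrier ?H. \<forall>g\<in>carrier G. c (act2 h p) (h \<star> g) = u \<otimes>\<^bsub>?H\<^esub> c p g"
  if p: "p \<in> hyp" and h: "h \<in> carrier G" for p h
 proof -
  let ?hp = "act2 h p"
  have hp: "?hp \<in> hyp" using act2_closed p h by simp
  let ?v = "ginv (\<gamma> ?hp) \<star> (h \<star> \<gamma> p)"
  have h\<gamma>: "h \<star> \<gamma> p \<in> carrier G" using h \<gamma>(1)[OF p] by (rule m_closed)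
  have "act2 (h \<star> \<gamma> p) (std_pair (r - 1)) = ?hp"
   using act2_mult[OF h \<gamma>(1)[OF p] std] \<gamma>(2)[OF p] by simp
  from stabilizer_emb[OF stab(1)[OF hp h\<gamma> this] r stab(2)[OF hp h\<gamma> this]]
  have u: "unemb k ?v \<in> carrier ?H" "emb k (unemb k ?v) = ?v" .
  have "c ?hp (h \<star> g) = unemb k ?v \<otimes>\<^bsub>?H\<^esub> c p g" if g: "g \<in> carrier G" for g
  proof -
   have hg: "h \<star> g \<in> carrier G" using h g by (rule m_closed)
   have "emb k (unemb k ?v \<otimes>\<^bsub>?H\<^esub> c p g) = ?v \<star> (ginv (\<gamma> p) \<star> \<beta> p g)"
    using emb_mult[OF k.G_carrier_mat[OF u(1)] k.G_carrier_mat[OF c(1)[OF p g]]] u(2) c(2)[OF p g] by simp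
   also have "\<dots> = ginv (\<gamma> ?hp) \<star> (h \<star> (\<gamma> p \<star> ginv (\<gamma> p) \<star> \<beta> p g))"
    using h \<gamma>(1)[OF p] \<gamma>(1)[OF hp] \<beta>[OF p g] by (simp only: m_assoc m_closed inv_closed)
   also have "\<dots> = ginv (\<gamma> ?hp) \<star> (h \<star> \<beta> p g)"
    using r_inv[OF \<gamma>(1)[OF p]] l_one[OF \<beta>[OF p g]] by (simp only:)
   also have "\<dots> = emb k (c ?hp (h \<star> g))"
    using c(2)[OF hp hg] \<beta>_act[OF p g h] by (simp only:)
   finally have "emb k (c ?hp (h \<star> g)) = emb k (unemb k ?v \<otimes>\<^bsub>?H\<^esub> c p g)" by (rule sym)
   from arg_cong[OF this, of "unemb k"] show ?thesis
    using unemb_emb[OF k.G_carrier_mat[OF c(1)[OF hp hg]]]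
     unemb_emb[OF k.G_carrier_mat[OF k.m_closed[OF u(1) c(1)[OF p g]]]] by (simp only:)
  qed
  then show ?thesis using u(1) by blast
 qed
 \<comment> \<open>By invariance the cocycle on \<beta> values may be shifted by the inverse of
   \<gamma> p into the stabilizer, where it is the restricted cocycle.\<close>
 have to_H: "x (map (\<beta> p) gs) = restr ?H (emb k) q x (map (c p) gs)" if p: "p \<in> hyp" and gs: "gs \<in> tuples G q" for p gs
 proof -
  have cgs: "map (c p) gs \<in> tuples ?H q" using gs c(1)[OF p] by (auto simp: tuples_def)
  have \<beta>gs: "map (\<beta> p) gs \<in> tuples G q" using gs \<beta>[OF p] by (auto simp: tuples_def)
  have "map (emb k) (map (c p) gs) = map (\<lambda>y. ginv (\<gamma> p) \<star> y) (map (\<beta> p) gs)"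
   using gs c(2)[OF p] by (auto simp: tuples_def)
  then show ?thesis
   using cochainsD(2)[OF xD(1) inv_closed[OF \<gamma>(1)[OF p]] \<beta>gs] cgs by (simp only: restr_def if_True)
 qed
 have \<beta>_tup: "hs \<in> tuples G p'"
  if "p \<in> hyp" "gs \<in> tuples G p''" "length hs = Suc p'" "set hs \<subseteq> (\<lambda>g. g) ` set gs \<union> \<beta> p ` set gs" for p p' p'' gs hs
  using that \<beta>[OF that(1)] by (auto simp: tuples_def)
 have homotopy: "x (map (\<beta> p) gs) - x gs = bd (prism (\<lambda>g. g) (\<beta> p) x) gs" if p: "p \<in> hyp" and gs: "gs \<in> tuples G q" for p gs
 proof -
  have "prism (\<lambda>g. g) (\<beta> p) (bd x) gs = prism (\<lambda>g. g) (\<beta> p) (\<lambda>_. 0) gs"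
   by (intro prism_cong xD(2) \<beta>_tup[OF p gs]) (use gs in \<open>auto simp: tuples_def\<close>)
  with prism_homotopy[of "\<lambda>g. g" "\<beta> p" x gs] show ?thesis by simp
 qed
 have "sw.cob (sw.Y ?S 1) q (sw.dl 1 X)"
 proof (cases q)
  case 0
  have rx0: "restr ?H (emb k) q x hs = 0" for hs using rx 0 by simp
  have "x gs = 0" if gs: "gs \<in> tuples G q" for gs
  proof -
   have "x (map (\<beta> (std_pair (r - 1))) gs) = 0" using to_H[OF std gs] rx0 by simp
   moreover obtain g where g: "gs = [g]" "g \<in> carrier G" using gs 0 by (auto simp: tuples_def length_Suc_conv)
   moreover have "[\<beta> (std_pair (r - 1)) g, g] \<in> tuples G (Suc q)" using \<beta>[OF std] g 0 by (simp add: tuples_def)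
   from xD(2)[OF this] have "x [g] = x [\<beta> (std_pair (r - 1)) g]" by simp
   ultimately show ?thesis by simp
  qed
  moreover have "sw.dl 1 X u gs i = x gs" if uY: "u \<in> sw.Y ?S 1" for u gs i
  proof -
   obtain p where "u = [p]" using Y1[OF uY] by blast
   then show ?thesis by (simp add: sw.dl_def X_def)
  qed
  ultimately have "sw.agree (sw.Y ?S 1) 0 (sw.dl 1 X) (\<lambda>s gs i. 0)"
   unfolding sw.agree_def 0 by (intro ballI) (simp only:)
  then show ?thesis by (simp only: 0 sw.cob_0)
 next
  case (Suc j)
  obtain w where w: "w \<in> cochains ?H j" "restr ?H (emb k) q x = coboundary ?H j w"
   using rx Suc by auto
  obtain D where D: "0 \<le> D" "\<forall>gs. \<bar>w gs\<bar> \<le> D" by (rule cochains_bound[OF w(1)])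
  define y where "y u gs i = w (map (c (hd u)) gs) - prism (\<lambda>g. g) (\<beta> (hd u)) x gs"
   for u :: "('a Matrix.vec \<times> 'a Matrix.vec) list" and gs and i :: bool
  have "sw.cochain (sw.Y ?S 1) j y"
  proof (rule sw.cochainI[of _ _ _ "D + real q * C"])
   fix u gs and i :: bool assume u: "u \<in> sw.Y ?S 1" and gs: "gs \<in> tuples G j"
   obtain p where p: "p \<in> hyp" "u = [p]" using Y1[OF u] by blast
   have "\<bar>prism (\<lambda>g. g) (\<beta> p) x gs\<bar> \<le> real (length gs) * C" by (rule prism_bound) (simp add: C)
   moreover have "length gs = q" using gs Suc by (simp add: tuples_def)
   moreover have "\<bar>w (map (c p) gs)\<bar> \<le> D" using D by simp
   ultimately show "\<bar>y u gs i\<bar> \<le> (D + real q * C) * 1" 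
    unfolding y_def p(2) list.sel
    using abs_triangle_ineq4[of "w (map (c p) gs)" "prism (\<lambda>g. g) (\<beta> p) x gs"] by simp
   fix h assume h: "h \<in> carrier G"
   have hp: "act2 h p \<in> hyp" using act2_closed h p by simp
   obtain v where v: "v \<in> carrier ?H" "\<forall>g\<in>carrier G. c (act2 h p) (h \<star> g) = v \<otimes>\<^bsub>?H\<^esub> c p g"
    using c_act[OF p(1) h] by blast
   have "map (c (act2 h p)) (map ((\<star>) h) gs) = map (\<lambda>g. v \<otimes>\<^bsub>?H\<^esub> g) (map (c p) gs)"
    using gs v(2) by (auto simp: tuples_def)
   moreover have "map (c p) gs \<in> tuples ?H j" using gs c(1)[OF p(1)] by (auto simp: tuples_def)
   ultimately have "w (map (c (act2 h p)) (map ((\<star>) h) gs)) = w (map (c p) gs)"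
    using cochainsD(2)[OF w(1) v(1)] by (simp only:)
   moreover have "prism (\<lambda>g. g) (\<beta> (act2 h p)) x (map ((\<star>) h) gs) = prism (\<lambda>g. g) (\<beta> p) x gs"
   proof -
    have "prism (\<lambda>g. g) (\<beta> (act2 h p)) x (map ((\<star>) h) gs)
      = prism ((\<star>) h \<circ> (\<lambda>g. g)) ((\<star>) h \<circ> \<beta> p) x gs"
     unfolding prism_map
    proof (rule prism_fun_cong)
     fix g assume "g \<in> set gs"
     then have "g \<in> carrier G" using gs by (auto simp: tuples_def)
     then show "(\<beta> (act2 h p) \<circ> (\<star>) h) g = ((\<star>) h \<circ> \<beta> p) g"
      using \<beta>_act[OF p(1) _ h] by (simp only: o_apply)
    qed simp
    also have "\<dots> = prism (\<lambda>g. g) (\<beta> p) x gs"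
     unfolding prism_map_fun
     by (intro prism_cong cochainsD(2)[OF xD(1) h] \<beta>_tup[OF p(1) gs]) (use gs Suc in \<open>auto simp: tuples_def\<close>)
    finally show ?thesis .
   qed
   ultimately show "y (map (act2 h) u) (map ((\<star>) h) gs) i = y u gs i"
    unfolding y_def p(2) by (simp only: list.map list.sel)
  qed simp
  moreover have "sw.agree (sw.Y ?S 1) (Suc j) (sw.dl 1 X) (sw.dd y)"
   unfolding sw.agree_def
  proof (intro ballI)
   fix u gs and i :: bool assume u: "u \<in> sw.Y ?S 1" and gs: "gs \<in> tuples G (Suc j)"
   obtain p where p: "p \<in> hyp" "u = [p]" using Y1[OF u] by blast
   have gsq: "gs \<in> tuples G q" using gs Suc by simp
   have cgs: "map (c p) gs \<in> tuples ?H (Suc j)" using gs c(1)[OF p(1)] by (auto simp: tuples_def)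
   have "x gs = bd w (map (c p) gs) - bd (prism (\<lambda>g. g) (\<beta> p) x) gs"
    using homotopy[OF p(1) gsq] to_H[OF p(1) gsq] w(2) cgs by (simp add: coboundary_eq)
   then show "sw.dl 1 X u gs i = sw.dd y u gs i"
    unfolding p(2) sw.dl_1 sw.dd_def y_def X_def list.sel bd_diff bd_map by simp
  qed
  ultimately show ?thesis unfolding Suc sw.cob_Suc by blast
 qed
 then have cob: "sw.cob ?S q X" using inj X unfolding sw.inj_at_def by blast
 show ?thesis
 proof (rule cobsI[OF xD(1) _ _ G_group])
  show "\<forall>gs\<in>tuples G 0. x gs = 0" if "q = 0"
   using cob that by (auto simp: sw.agree_def X_def)
  fix j assume j: "q = Suc j"
  then obtain w where w: "sw.cochain ?S j w" "sw.agree ?S (Suc j) X (sw.dd w)"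
   using cob by (auto simp: sw.cob_Suc)
  obtain D where "0 \<le> D" and D: "\<forall>s\<in>?S. \<forall>gs\<in>tuples G j. \<forall>i\<in>{True}. \<bar>w s gs i\<bar> \<le> D * 1"
   by (rule sw.cochain_bound[OF w(1)])
  show "\<exists>w C. (\<forall>gs\<in>tuples G j. \<bar>w gs\<bar> \<le> C) \<and>
   (\<forall>g\<in>carrier G. \<forall>gs\<in>tuples G j. w (map (\<lambda>x. g \<star> x) gs) = w gs) \<and> (\<forall>gs\<in>tuples G q. x gs = bd w gs)"
  proof (intro exI conjI ballI)
   fix gs assume "gs \<in> tuples G j"
   then show "\<bar>w [] gs True\<bar> \<le> D" using D by simp
  next
   fix g gs assume "g \<in> carrier G" "gs \<in> tuples G j"
   then have "w (map (act2 g) []) (map (\<lambda>x. g \<star> x) gs) True = w [] gs True"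
    by (intro sw.cochainD(2)[OF w(1)]) simp_all
   then show "w [] (map (\<lambda>x. g \<star> x) gs) True = w [] gs True" by (simp only: list.map(1))
  next
   fix gs assume "gs \<in> tuples G q"
   then show "x gs = bd (\<lambda>gs. w [] gs True) gs"
    using w(2) j by (simp add: sw.agree_def X_def sw.dd_def)
  qed
 qed
qed

end

section \<open>Euclidean subrings\<close>

text \<open>A nonzero element of least norm in the ideal generated by the entries divides all of
  them, and the coefficients expressing it give the Bezout relation after cancelling it.\<close>

lemma symplectic_ring_euclidean:
 fixes R :: "'a::field_char_0 set" and N :: "'a \<Rightarrow> nat"
 assumes R: "0 \<in> R" "1 \<in> R" "\<And>a b. a \<in> R \<Longrightarrow> b \<in> R \<Longrightarrow> a + b \<in> R" "\<And>a b. a \<in> R \<Longrightarrow> b \<in> R \<Longrightarrow> a * b \<in> R"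
   "\<And>a. a \<in> R \<Longrightarrow> - a \<in> R"
  and N: "\<And>a b. a \<in> R \<Longrightarrow> b \<in> R \<Longrightarrow> b \<noteq> 0 \<Longrightarrow> \<exists>c\<in>R. N (a - c * b) < N b"
 shows "symplectic_ring R"
proof
 fix n :: nat and x :: "nat \<Rightarrow> 'a"
 assume x: "\<And>i. i < n \<Longrightarrow> x i \<in> R" and nz: "\<exists>i<n. x i \<noteq> 0"
 define J where "J = {\<Sum>i<n. x i * c i |c. \<forall>i<n. c i \<in> R}"
 have sum_R: "(\<Sum>i<m. f i) \<in> R" if "\<And>i. i < m \<Longrightarrow> f i \<in> R" for m :: nat and f
  using that by (induction m) (auto intro: R)
 have JR: "J \<subseteq> R" by (auto simp: J_def intro!: sum_R R(4) x)
 have xJ: "x i \<in> J" if "i < n" for i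
 proof -
  have "(\<Sum>j<n. x j * (if j = i then 1 else 0)) = (\<Sum>j<n. if j = i then x i else 0)"
   by (rule sum.cong) auto
  then have "x i = (\<Sum>j<n. x j * (if j = i then 1 else 0))" using that by simp
  moreover have "\<forall>j<n. (if j = i then 1 else 0) \<in> R" using R by auto
  ultimately show ?thesis unfolding J_def by (intro CollectI exI[of _ "\<lambda>j. if j = i then 1 else 0"]) blast
 qed
 obtain i where "i < n" "x i \<noteq> 0" using nz by blast
 then have "\<exists>d. d \<in> J \<and> d \<noteq> 0" using xJ by blast
 then obtain d where d: "d \<in> J" "d \<noteq> 0" and min: "\<And>a. a \<in> J \<and> a \<noteq> 0 \<Longrightarrow> N d \<le> N a"
  using exists_least_iff[of "\<lambda>k. \<exists>a. a \<in> J \<and> a \<noteq> 0 \<and> N a = k"] by (metis not_le)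
 obtain c where c: "\<forall>i<n. c i \<in> R" "d = (\<Sum>i<n. x i * c i)" using d(1) by (auto simp: J_def)
 have "\<exists>y\<in>R. x i = d * y" if i: "i < n" for i
 proof -
  obtain y where y: "y \<in> R" "N (x i - y * d) < N d" using N[OF x[OF i] _ d(2)] d(1) JR by blast
  have "x i - y * d = (\<Sum>j<n. x j * ((if j = i then 1 else 0) - y * c j))"
  proof -
   have "(\<Sum>j<n. x j * ((if j = i then 1 else 0) - y * c j)) = (\<Sum>j<n. (if j = i then x i else 0) - y * (x j * c j))"
    by (rule sum.cong) (auto simp: algebra_simps)
   also have "\<dots> = x i - y * d" using i by (simp add: sum_subtractf c(2) sum_distrib_left)
   finally show ?thesis by simp
  qed
  moreover have "\<forall>j<n. (if j = i then 1 else 0) - y * c j \<in> R"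
   using R(3)[OF _ R(5)[OF R(4)[OF y(1)]]] c(1) R(1,2) by (auto simp: diff_conv_add_uminus simp del: add_uminus_conv_diff)
  ultimately have "x i - y * d \<in> J"
   unfolding J_def by (intro CollectI exI[of _ "\<lambda>j. (if j = i then 1 else 0) - y * c j"] conjI)
  then have "x i - y * d = 0" using min y(2) by (meson leD)
  then show ?thesis using y(1) by (intro bexI[of _ y]) (simp_all add: mult.commute)
 qed
 then obtain y where y: "\<And>i. i < n \<Longrightarrow> y i \<in> R \<and> x i = d * y i" by metis
 have "d = (\<Sum>i<n. (d * y i) * c i)" unfolding c(2) by (rule sum.cong) (use y c(2) in auto)
 then have "d * 1 = d * (\<Sum>i<n. y i * c i)" by (simp add: sum_distrib_left mult.assoc)
 then have "(\<Sum>i<n. y i * c i) = 1" using d(2) by simp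
 then show "\<exists>d y z. d \<in> R \<and> (\<forall>i<n. y i \<in> R \<and> z i \<in> R \<and> x i = d * y i) \<and> (\<Sum>i<n. y i * z i) = 1"
  using y c(1) d(1) JR by blast
qed (use R in auto)

lemma symplectic_ring_UNIV: "symplectic_ring (UNIV :: 'a::field_char_0 set)"
proof (rule symplectic_ring_euclidean[where N = "\<lambda>x. if x = 0 then 0 else 1"])
 fix a b :: 'a assume "b \<noteq> 0"
 then show "\<exists>c\<in>UNIV. (if a - c * b = 0 then 0 else 1) < (if b = 0 then 0 else 1 :: nat)"
  by (intro bexI[of _ "a / b"]) auto
qed auto

lemma symplectic_ring_gaussian:
 "symplectic_ring gaussian_integers"
proof (rule symplectic_ring_euclidean[where N = "\<lambda>z. nat \<lfloor>(cmod z)\<^sup>2\<rfloor>"])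
 fix a b assume ab: "a \<in> gaussian_integers" "b \<in> gaussian_integers" "b \<noteq> 0"
 define c where "c = Complex (of_int (round (Re (a / b)))) (of_int (round (Im (a / b))))"
 have c: "c \<in> gaussian_integers" by (simp add: c_def gaussian_integers_def)
 \<comment> \<open>Rounding both coordinates leaves a remainder of squared modulus at most 1/2,
   below 1 as the Euclidean condition asks.\<close>
 have "\<bar>Re (a / b - c)\<bar> \<le> 1 / 2" "\<bar>Im (a / b - c)\<bar> \<le> 1 / 2"
  using of_int_round_abs_le[of "Re (a / b)"] of_int_round_abs_le[of "Im (a / b)"] by (auto simp: c_def abs_minus_commute)
 then have "(Re (a / b - c))\<^sup>2 \<le> (1 / 2)\<^sup>2" "(Im (a / b - c))\<^sup>2 \<le> (1 / 2)\<^sup>2"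
  by (auto simp: abs_le_square_iff[symmetric])
 then have "(cmod (a / b - c))\<^sup>2 < 1" unfolding cmod_power2 by (simp add: power2_eq_square)
 moreover have "a - c * b = (a / b - c) * b" using ab(3) by (simp add: field_simps)
 ultimately have "(cmod (a - c * b))\<^sup>2 < (cmod b)\<^sup>2"
  using ab(3) by (simp add: norm_mult power_mult_distrib)
 moreover have int: "(cmod z)\<^sup>2 \<in> \<int>" if "z \<in> gaussian_integers" for z
  using that by (auto simp: cmod_power2 gaussian_integers_def)
 moreover have "a - c * b \<in> gaussian_integers" using ab c by (auto simp: gaussian_integers_def)
 ultimately have lt: "(cmod (a - c * b))\<^sup>2 < (cmod b)\<^sup>2" and "(cmod (a - c * b))\<^sup>2 \<in> \<int>" "(cmod b)\<^sup>2 \<in> \<int>"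
  using ab(2) by auto
 then obtain m n where mn: "(cmod (a - c * b))\<^sup>2 = of_int m" "(cmod b)\<^sup>2 = of_int n" by (auto elim!: Ints_cases)
 have "0 \<le> (cmod (a - c * b))\<^sup>2" by simp
 with lt have "0 \<le> m" "m < n" unfolding mn by auto
 then have "nat \<lfloor>(cmod (a - c * b))\<^sup>2\<rfloor> < nat \<lfloor>(cmod b)\<^sup>2\<rfloor>"
  unfolding mn by simp
 then show "\<exists>c\<in>gaussian_integers. nat \<lfloor>(cmod (a - c * b))\<^sup>2\<rfloor> < nat \<lfloor>(cmod b)\<^sup>2\<rfloor>" using c by blast
qed (auto simp: gaussian_integers_def)

lemma symplectic_ring_Ints: "symplectic_ring (\<int> :: real set)"
proof (rule symplectic_ring_euclidean[where N = "\<lambda>x. nat \<lfloor>\<bar>x\<bar>\<rfloor>"])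
 fix a b :: real assume ab: "a \<in> \<int>" "b \<in> \<int>" "b \<noteq> 0"
 define c :: real where "c = of_int (round (a / b))"
 have "\<bar>a / b - c\<bar> < 1"
  using of_int_round_abs_le[of "a / b"] by (simp add: c_def abs_minus_commute)
 moreover have "a - c * b = (a / b - c) * b" using ab(3) by (simp add: field_simps)
 ultimately have "\<bar>a - c * b\<bar> < \<bar>b\<bar>" using ab(3) by (simp add: abs_mult)
 moreover have c: "c \<in> \<int>" by (simp add: c_def)
 have "\<bar>a - c * b\<bar> \<in> \<int>" "\<bar>b\<bar> \<in> \<int>" using ab c by auto
 ultimately have "nat \<lfloor>\<bar>a - c * b\<bar>\<rfloor> < nat \<lfloor>\<bar>b\<bar>\<rfloor>" by (auto elim!: Ints_cases simp: nat_less_iff)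
 then show "\<exists>c\<in>\<int>. nat \<lfloor>\<bar>a - c * b\<bar>\<rfloor> < nat \<lfloor>\<bar>b\<bar>\<rfloor>" using c by blast
qed auto

context symplectic_ring
begin

theorem Sp_over_stable: "bounded_cohomology_stable (Sp_over R)"
proof (rule bounded_cohomology_stableI)
 show "Group.group (Sp_over R k)" for k
  by (rule symplectic_ring.G_group) (rule symplectic_ring_axioms)
next
 fix q :: nat
 have "\<exists>t. comparison (Sp_over R (Suc k)) (Sp_over R k) q t" if k: "2 * (q + 2)\<^sup>2 \<le> k" for k
 proof -
  interpret k: symplectic_ring R k by (rule symplectic_ring_axioms)
  interpret Sk: symplectic_ring R "Suc k" by (rule symplectic_ring_axioms)
  have mult: "emb k (a \<otimes>\<^bsub>Sp_over R k\<^esub> b) = emb k a \<otimes>\<^bsub>Sp_over R (Suc k)\<^esub> emb k b"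
   if "a \<in> carrier (Sp_over R k)" "b \<in> carrier (Sp_over R k)" for a b
   using emb_mult[OF k.G_carrier_mat[OF that(1)] k.G_carrier_mat[OF that(2)]] by simp
  let ?t = "restr (Sp_over R k) (emb k) q"
  have "?t x \<in> cocycles (Sp_over R k) q" if "x \<in> cocycles (Sp_over R (Suc k)) q" for x
   by (rule restr_cocycle[OF Sk.emb_closed[OF _ refl] mult k.G_group that])
  moreover have "?t x \<in> cobs (Sp_over R k) q \<longleftrightarrow> x \<in> cobs (Sp_over R (Suc k)) q"
   if "x \<in> cocycles (Sp_over R (Suc k)) q" for x
  proof
   show "x \<in> cobs (Sp_over R (Suc k)) q" if t: "?t x \<in> cobs (Sp_over R k) q"
    by (rule Sk.restr_injective[OF refl _ \<open>x \<in> cocycles _ q\<close> t]) (use k in simp)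
   show "?t x \<in> cobs (Sp_over R k) q" if "x \<in> cobs (Sp_over R (Suc k)) q"
    by (rule restr_coboundaries[OF Sk.emb_closed[OF _ refl] mult k.G_group that])
  qed
  ultimately show ?thesis unfolding comparison_def by (intro exI[of _ ?t]) (auto simp: restr_def fun_eq_iff)
 qed
 then show "\<exists>R'\<ge>1. \<forall>k\<ge>R'. \<exists>t. comparison (Sp_over R (Suc k)) (Sp_over R k) q t"
  by (intro exI[of _ "2 * (q + 2)\<^sup>2"]) (auto simp: power2_eq_square)
qed

end

section \<open>Random equivariant maps\<close>

lemma measurable_map_countable:
 assumes "countable A" "\<And>g. g \<in> set gs \<Longrightarrow> (\<lambda>\<omega>. \<psi> \<omega> g) \<in> \<Omega> \<rightarrow>\<^sub>M count_space A"
 shows "(\<lambda>\<omega>. map (\<psi> \<omega>) gs) \<in> \<Omega> \<rightarrow>\<^sub>M count_space (lists A)"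
 using assms(2)
proof (induction gs)
 case (Cons g gs)
 have g: "(\<lambda>\<omega>. \<psi> \<omega> g) \<in> \<Omega> \<rightarrow>\<^sub>M count_space A" by (rule Cons.prems) simp
 have gs: "(\<lambda>\<omega>. map (\<psi> \<omega>) gs) \<in> \<Omega> \<rightarrow>\<^sub>M count_space (lists A)" by (rule Cons.IH) (simp add: Cons.prems)
 have "(\<lambda>\<omega>. i # map (\<psi> \<omega>) gs) \<in> \<Omega> \<rightarrow>\<^sub>M count_space (lists A)" if "i \<in> A" for i
  by (rule measurable_compose[OF gs]) (use that in simp)
 then show ?case
  unfolding list.map by (rule measurable_compose_countable'[OF _ g assms(1)])
qed simp

lemma measurable_real_countable:
 assumes "f \<in> \<Omega> \<rightarrow>\<^sub>M count_space A"
 shows "(\<lambda>\<omega>. (h (f \<omega>) :: real)) \<in> borel_measurable \<Omega>"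
 using assms by (rule measurable_compose) simp

text \<open>\<open>P\<close> is the prefix that the recursion of the prism accumulates in front of
  its argument. It is itself random, so the induction has to carry it along.\<close>

lemma measurable_prism_countable:
 assumes A: "countable A" and \<psi>: "\<And>g. g \<in> set gs \<Longrightarrow> (\<lambda>\<omega>. \<psi>\<^sub>0 \<omega> g) \<in> \<Omega> \<rightarrow>\<^sub>M count_space A"
  "\<And>g. g \<in> set gs \<Longrightarrow> (\<lambda>\<omega>. \<psi>\<^sub>1 \<omega> g) \<in> \<Omega> \<rightarrow>\<^sub>M count_space A"
  and P: "P \<in> \<Omega> \<rightarrow>\<^sub>M count_space (lists A)"
 shows "(\<lambda>\<omega>. prism (\<psi>\<^sub>0 \<omega>) (\<psi>\<^sub>1 \<omega>) (\<lambda>ys. a (P \<omega> @ ys)) gs) \<in> borel_measurable \<Omega>"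
 using \<psi> P
proof (induction gs arbitrary: P)
 case (Cons g gs)
 have app: "(\<lambda>\<omega>. P \<omega> @ Q \<omega>) \<in> \<Omega> \<rightarrow>\<^sub>M count_space (lists A)" if "Q \<in> \<Omega> \<rightarrow>\<^sub>M count_space (lists A)" for Q
 proof -
  have "(\<lambda>\<omega>. i @ Q \<omega>) \<in> \<Omega> \<rightarrow>\<^sub>M count_space (lists A)" if "i \<in> lists A" for i
   by (rule measurable_compose[OF \<open>Q \<in> _\<close>]) (use that in auto)
  then show ?thesis
   by (rule measurable_compose_countable'[OF _ Cons.prems(3)]) (use A in auto)
 qed
 \<comment> \<open>A one-element list written as an image, so that
   \<open>measurable_map_countable\<close> applies.\<close>
 have "(\<lambda>\<omega>. map (\<lambda>k. if k then \<psi>\<^sub>1 \<omega> g else \<psi>\<^sub>0 \<omega> g) [False]) \<in> \<Omega> \<rightarrow>\<^sub>M count_space (lists A)"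
  by (rule measurable_map_countable[OF A]) (use Cons.prems in auto)
 then have "(\<lambda>\<omega>. P \<omega> @ [\<psi>\<^sub>0 \<omega> g]) \<in> \<Omega> \<rightarrow>\<^sub>M count_space (lists A)" by (intro app) simp
 then have 1: "(\<lambda>\<omega>. prism (\<psi>\<^sub>0 \<omega>) (\<psi>\<^sub>1 \<omega>) (\<lambda>ys. a ((P \<omega> @ [\<psi>\<^sub>0 \<omega> g]) @ ys)) gs) \<in> borel_measurable \<Omega>"
  by (intro Cons.IH) (use Cons.prems in auto)
 \<comment> \<open>The option type tags the two random maps: a list mixing values of both becomes
   the image of one list under one random map.\<close>
 let ?\<psi> = "\<lambda>\<omega> x. case x of None \<Rightarrow> \<psi>\<^sub>0 \<omega> g | Some h \<Rightarrow> \<psi>\<^sub>1 \<omega> h"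
 have "(\<lambda>\<omega>. map (?\<psi> \<omega>) (None # Some g # map Some gs)) \<in> \<Omega> \<rightarrow>\<^sub>M count_space (lists A)"
  by (rule measurable_map_countable[OF A]) (use Cons.prems in auto)
 then have "(\<lambda>\<omega>. a (P \<omega> @ map (?\<psi> \<omega>) (None # Some g # map Some gs))) \<in> borel_measurable \<Omega>"
  by (intro measurable_real_countable[OF app])
 then have 2: "(\<lambda>\<omega>. a (P \<omega> @ \<psi>\<^sub>0 \<omega> g # \<psi>\<^sub>1 \<omega> g # map (\<psi>\<^sub>1 \<omega>) gs)) \<in> borel_measurable \<Omega>"
  by (simp add: comp_def)
 show ?case using borel_measurable_diff[OF 2 1] by simp
qed simp

lemma bounded_integrable:
 assumes "finite_measure \<Omega>" "f \<in> borel_measurable \<Omega>" "\<And>\<omega>. \<bar>f \<omega>\<bar> \<le> (C :: real)"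
 shows "integrable \<Omega> f"
 using assms by (intro finite_measure.integrable_const_bound[of _ _ C]) auto

lemma bounded_integral_bound:
 assumes "finite_measure \<Omega>" "f \<in> borel_measurable \<Omega>" "\<And>\<omega>. \<bar>f \<omega>\<bar> \<le> (C :: real)" "measure \<Omega> (space \<Omega>) = 1"
 shows "\<bar>\<integral>\<omega>. f \<omega> \<partial>\<Omega>\<bar> \<le> C"
proof -
 have "\<bar>\<integral>\<omega>. f \<omega> \<partial>\<Omega>\<bar> \<le> (\<integral>\<omega>. \<bar>f \<omega>\<bar> \<partial>\<Omega>)" by (rule integral_abs_bound)
 also have "\<dots> \<le> (\<integral>\<omega>. C \<partial>\<Omega>)"
  using bounded_integrable[OF assms(1-3)] finite_measure.integrable_const[OF assms(1)] assms(3)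
  by (intro integral_mono) auto
 also have "\<dots> = C" using assms(4) by simp
 finally show ?thesis .
qed

lemma integral_bd:
 assumes "\<And>ys. length gs = Suc (length ys) \<Longrightarrow> set ys \<subseteq> set gs \<Longrightarrow> integrable \<Omega> (\<lambda>\<omega>. F \<omega> ys)"
 shows "(\<integral>\<omega>. bd (F \<omega>) gs \<partial>\<Omega>) = bd (\<lambda>ys. \<integral>\<omega>. F \<omega> ys \<partial>\<Omega>) gs"
  and "integrable \<Omega> (\<lambda>\<omega>. bd (F \<omega>) gs)"
proof -
 have "integrable \<Omega> (\<lambda>\<omega>. F \<omega> (take i gs @ drop (Suc i) gs))" if "i < length gs" for i
  using that by (intro assms) (auto dest: in_set_takeD in_set_dropD)
 then show "(\<integral>\<omega>. bd (F \<omega>) gs \<partial>\<Omega>) = bd (\<lambda>ys. \<integral>\<omega>. F \<omega> ys \<partial>\<Omega>) gs" "integrable \<Omega> (\<lambda>\<omega>. bd (F \<omega>) gs)"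
  unfolding bd_eq_sum by (auto simp: integral_sum)
qed

lemma integral_invariant:
 assumes "T \<in> \<Omega> \<rightarrow>\<^sub>M \<Omega>" "distr \<Omega> \<Omega> T = \<Omega>" "f \<in> borel_measurable \<Omega>"
 shows "(\<integral>\<omega>. f (T \<omega>) \<partial>\<Omega>) = (\<integral>\<omega>. (f \<omega> :: real) \<partial>\<Omega>)"
 using integral_distr[OF assms(1), of f] assms by simp

definition average :: "'w measure \<Rightarrow> ('w \<Rightarrow> 'h \<Rightarrow> 'g) \<Rightarrow> ('h, 'd) monoid_scheme \<Rightarrow> nat \<Rightarrow> ('g list \<Rightarrow> real) \<Rightarrow> 'h list \<Rightarrow> real" where
 "average \<Omega> \<psi> H q f gs = (if gs \<in> tuples H q then \<integral>\<omega>. f (map (\<psi> \<omega>) gs) \<partial>\<Omega> else 0)"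

text \<open>Equivariance holds up to an element of the target group that may vary with the sample
  point but not with \<open>h\<close>. This is exactly what an invariant cochain ignores, so
  integration turns cochains of \<Gamma> into cochains of \<open>H\<close>.\<close>

locale random_map =
 fixes \<Omega> :: "'w measure" and H :: "('h, 'd) monoid_scheme" and \<Gamma> :: "('g, 'b) monoid_scheme"
  and T :: "'h \<Rightarrow> 'w \<Rightarrow> 'w" and \<psi> :: "'w \<Rightarrow> 'h \<Rightarrow> 'g"
 assumes \<Omega>: "finite_measure \<Omega>" "measure \<Omega> (space \<Omega>) = 1" and H: "Group.group H"
  and T: "\<And>g. g \<in> carrier H \<Longrightarrow> T g \<in> \<Omega> \<rightarrow>\<^sub>M \<Omega>" "\<And>g. g \<in> carrier H \<Longrightarrow> distr \<Omega> \<Omega> (T g) = \<Omega>"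
  and \<Gamma>: "countable (carrier \<Gamma>)"
  and \<psi>: "\<And>g. g \<in> carrier H \<Longrightarrow> (\<lambda>\<omega>. \<psi> \<omega> g) \<in> \<Omega> \<rightarrow>\<^sub>M count_space (carrier \<Gamma>)"
  and equiv: "\<And>g \<omega>. g \<in> carrier H \<Longrightarrow> \<omega> \<in> space \<Omega> \<Longrightarrow>
   \<exists>c\<in>carrier \<Gamma>. \<forall>h\<in>carrier H. \<psi> (T g \<omega>) (g \<otimes>\<^bsub>H\<^esub> h) = c \<otimes>\<^bsub>\<Gamma>\<^esub> \<psi> \<omega> h"
begin

lemma map_measurable:
 assumes "set gs \<subseteq> carrier H"
 shows "(\<lambda>\<omega>. f (map (\<psi> \<omega>) gs) :: real) \<in> borel_measurable \<Omega>"
proof -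
 have "(\<lambda>\<omega>. map (\<psi> \<omega>) gs) \<in> \<Omega> \<rightarrow>\<^sub>M count_space (lists (carrier \<Gamma>))"
  using assms by (intro measurable_map_countable[OF \<Gamma>] \<psi>) auto
 from measurable_real_countable[OF this, where h = f] show ?thesis .
qed

lemma map_integrable:
 assumes "set gs \<subseteq> carrier H" "f \<in> cochains \<Gamma> q"
 shows "integrable \<Omega> (\<lambda>\<omega>. f (map (\<psi> \<omega>) gs))"
proof -
 obtain C where "0 \<le> C" "\<forall>gs. \<bar>f gs\<bar> \<le> C" by (rule cochains_bound[OF assms(2)])
 then show ?thesis by (intro bounded_integrable[OF \<Omega>(1) map_measurable[OF assms(1)], of _ C]) simp
qed

lemma map_tuples:
 assumes "\<omega> \<in> space \<Omega>" "gs \<in> tuples H q"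
 shows "map (\<psi> \<omega>) gs \<in> tuples \<Gamma> q"
proof (rule tuples_map_closed[OF _ assms(2)])
 fix h assume "h \<in> carrier H"
 from measurable_space[OF \<psi>[OF this] assms(1)] show "\<psi> \<omega> h \<in> carrier \<Gamma>" by simp
qed

lemma average_cochain:
 assumes f: "f \<in> cochains \<Gamma> q"
 shows "average \<Omega> \<psi> H q f \<in> cochains H q"
proof -
 obtain C where C: "0 \<le> C" "\<forall>gs. \<bar>f gs\<bar> \<le> C" by (rule cochains_bound[OF f])
 show ?thesis
 proof (rule cochainsI[of _ _ _ C])
  fix gs assume gs: "gs \<in> tuples H q"
  then have gsH: "set gs \<subseteq> carrier H" by (simp add: tuples_def)
  show "\<bar>average \<Omega> \<psi> H q f gs\<bar> \<le> C"
   using gs bounded_integral_bound[OF \<Omega>(1) map_measurable[OF gsH, of f] _ \<Omega>(2), of C] C(2) by (simp add: average_def)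
  fix g assume g: "g \<in> carrier H"
  have gs': "map (\<lambda>x. g \<otimes>\<^bsub>H\<^esub> x) gs \<in> tuples H q" by (rule tuples_map[OF H g gs])
  then have "set (map (\<lambda>x. g \<otimes>\<^bsub>H\<^esub> x) gs) \<subseteq> carrier H" by (simp add: tuples_def)
  then have "(\<integral>\<omega>. f (map (\<psi> \<omega>) (map (\<lambda>x. g \<otimes>\<^bsub>H\<^esub> x) gs)) \<partial>\<Omega>) =
    (\<integral>\<omega>. f (map (\<psi> (T g \<omega>)) (map (\<lambda>x. g \<otimes>\<^bsub>H\<^esub> x) gs)) \<partial>\<Omega>)"
   by (rule integral_invariant[OF T(1)[OF g] T(2)[OF g] map_measurable, symmetric])
  also have "\<dots> = (\<integral>\<omega>. f (map (\<psi> \<omega>) gs) \<partial>\<Omega>)"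
  proof (rule Bochner_Integration.integral_cong[OF refl])
   fix \<omega> assume \<omega>: "\<omega> \<in> space \<Omega>"
   obtain c where c: "c \<in> carrier \<Gamma>" "\<forall>h\<in>carrier H. \<psi> (T g \<omega>) (g \<otimes>\<^bsub>H\<^esub> h) = c \<otimes>\<^bsub>\<Gamma>\<^esub> \<psi> \<omega> h"
    using equiv[OF g \<omega>] by blast
   have "map (\<psi> (T g \<omega>)) (map (\<lambda>x. g \<otimes>\<^bsub>H\<^esub> x) gs) = map (\<lambda>x. c \<otimes>\<^bsub>\<Gamma>\<^esub> x) (map (\<psi> \<omega>) gs)"
    using c(2) gsH by (simp add: subset_iff)
   then show "f (map (\<psi> (T g \<omega>)) (map (\<lambda>x. g \<otimes>\<^bsub>H\<^esub> x) gs)) = f (map (\<psi> \<omega>) gs)"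
    by (simp only: cochainsD(2)[OF f c(1) map_tuples[OF \<omega> gs]])
  qed
  finally show "average \<Omega> \<psi> H q f (map (\<lambda>x. g \<otimes>\<^bsub>H\<^esub> x) gs) = average \<Omega> \<psi> H q f gs"
   using gs gs' by (simp only: average_def if_True)
 qed (simp add: average_def)
qed

lemma average_coboundary:
 assumes f: "f \<in> cochains \<Gamma> q"
 shows "coboundary H q (average \<Omega> \<psi> H q f) = average \<Omega> \<psi> H (Suc q) (coboundary \<Gamma> q f)"
proof
 fix gs
 show "coboundary H q (average \<Omega> \<psi> H q f) gs = average \<Omega> \<psi> H (Suc q) (coboundary \<Gamma> q f) gs"
 proof (cases "gs \<in> tuples H (Suc q)")
  case True
  have face: "hs \<in> tuples H q" if "length gs = Suc (length hs)" "set hs \<subseteq> set gs" for hs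
   using True that by (rule tuples_face)
  have "bd (average \<Omega> \<psi> H q f) gs = bd (\<lambda>hs. \<integral>\<omega>. f (map (\<psi> \<omega>) hs) \<partial>\<Omega>) gs"
   by (rule bd_cong) (simp add: average_def face)
  also have "\<dots> = (\<integral>\<omega>. bd (\<lambda>hs. f (map (\<psi> \<omega>) hs)) gs \<partial>\<Omega>)"
  proof (rule integral_bd(1)[symmetric])
   fix hs assume "length gs = Suc (length hs)" "set hs \<subseteq> set gs"
   from face[OF this] show "integrable \<Omega> (\<lambda>\<omega>. f (map (\<psi> \<omega>) hs))"
    by (intro map_integrable[OF _ f]) (simp add: tuples_def)
  qed
  also have "\<dots> = (\<integral>\<omega>. coboundary \<Gamma> q f (map (\<psi> \<omega>) gs) \<partial>\<Omega>)"
   by (rule Bochner_Integration.integral_cong[OF refl]) (simp add: coboundary_eq bd_map map_tuples[OF _ True])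
  finally show ?thesis using True by (simp add: coboundary_eq average_def)
 qed (simp add: coboundary_eq average_def)
qed

lemma average_cocycle:
 assumes "f \<in> cocycles \<Gamma> q"
 shows "average \<Omega> \<psi> H q f \<in> cocycles H q"
 using assms average_cochain[of f q] average_coboundary[of f q]
 by (simp add: bounded_cocycles_def average_def fun_eq_iff)

lemma average_coboundaries:
 assumes "f \<in> cobs \<Gamma> q"
 shows "average \<Omega> \<psi> H q f \<in> cobs H q"
proof (cases q)
 case 0
 with assms show ?thesis by (simp add: average_def fun_eq_iff)
next
 case (Suc k)
 then obtain w where w: "w \<in> cochains \<Gamma> k" "f = coboundary \<Gamma> k w" using assms by auto
 show ?thesis unfolding Suc w(2) average_coboundary[OF w(1), symmetric]
  using average_cochain[OF w(1)] by simp
qed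

lemma average_add:
 assumes "f \<in> cochains \<Gamma> q" "h \<in> cochains \<Gamma> q"
 shows "average \<Omega> \<psi> H q (\<lambda>x. f x + h x) gs = average \<Omega> \<psi> H q f gs + average \<Omega> \<psi> H q h gs"
proof (cases "gs \<in> tuples H q")
 case True
 then have "set gs \<subseteq> carrier H" by (simp add: tuples_def)
 from map_integrable[OF this assms(1)] map_integrable[OF this assms(2)] show ?thesis
  by (simp add: average_def)
qed (simp add: average_def)

lemma average_cmult: "average \<Omega> \<psi> H q (\<lambda>x. c * f x) gs = c * average \<Omega> \<psi> H q f gs"
 by (simp add: average_def)

end

text \<open>The same group element \<open>c\<close> corrects both maps at each sample point, so the
  prism between them is invariant before averaging, and its integral is an invariant
  primitive.\<close>

lemma random_map_homotopy:
 fixes \<Omega> :: "'w measure" and H :: "('h, 'd) monoid_scheme" and \<Gamma> :: "('g, 'b) monoid_scheme"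
 assumes r: "random_map \<Omega> H \<Gamma> T \<psi>\<^sub>0" "random_map \<Omega> H \<Gamma> T \<psi>\<^sub>1"
  and equiv: "\<And>g \<omega>. g \<in> carrier H \<Longrightarrow> \<omega> \<in> space \<Omega> \<Longrightarrow> \<exists>c\<in>carrier \<Gamma>. \<forall>h\<in>carrier H.
   \<psi>\<^sub>0 (T g \<omega>) (g \<otimes>\<^bsub>H\<^esub> h) = c \<otimes>\<^bsub>\<Gamma>\<^esub> \<psi>\<^sub>0 \<omega> h \<and> \<psi>\<^sub>1 (T g \<omega>) (g \<otimes>\<^bsub>H\<^esub> h) = c \<otimes>\<^bsub>\<Gamma>\<^esub> \<psi>\<^sub>1 \<omega> h"
  and a: "a \<in> cocycles \<Gamma> q"
 shows "(\<lambda>gs. average \<Omega> \<psi>\<^sub>1 H q a gs - average \<Omega> \<psi>\<^sub>0 H q a gs) \<in> cobs H q"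
proof -
 interpret r0: random_map \<Omega> H \<Gamma> T \<psi>\<^sub>0 by (rule r)
 interpret r1: random_map \<Omega> H \<Gamma> T \<psi>\<^sub>1 by (rule r)
 note H = r0.H and T = r0.T and \<Omega> = r0.\<Omega>
 note aD = cocyclesD[OF a]
 obtain C where C: "0 \<le> C" "\<forall>gs. \<bar>a gs\<bar> \<le> C" by (rule cochains_bound[OF aD(1)])
 have \<psi>c: "\<psi>\<^sub>0 \<omega> g \<in> carrier \<Gamma>" "\<psi>\<^sub>1 \<omega> g \<in> carrier \<Gamma>" if "\<omega> \<in> space \<Omega>" "g \<in> carrier H" for \<omega> g
  using measurable_space[OF r0.\<psi>[OF that(2)] that(1)] measurable_space[OF r1.\<psi>[OF that(2)] that(1)] by auto
 have meas: "(\<lambda>\<omega>. prism (\<psi>\<^sub>0 \<omega>) (\<psi>\<^sub>1 \<omega>) a gs) \<in> borel_measurable \<Omega>" if "set gs \<subseteq> carrier H" for gs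
 proof -
  have "(\<lambda>\<omega>. prism (\<psi>\<^sub>0 \<omega>) (\<psi>\<^sub>1 \<omega>) (\<lambda>ys. a ([] @ ys)) gs) \<in> borel_measurable \<Omega>"
   using that r0.\<psi> r1.\<psi> by (intro measurable_prism_countable[OF r0.\<Gamma>]) auto
  then show ?thesis by simp
 qed
 have p_bound: "\<bar>prism \<alpha> \<beta> a gs\<bar> \<le> real (length gs) * C" for \<alpha> \<beta> :: "'h \<Rightarrow> 'g" and gs
  by (rule prism_bound) (simp add: C)
 let ?D = "\<lambda>gs. average \<Omega> \<psi>\<^sub>1 H q a gs - average \<Omega> \<psi>\<^sub>0 H q a gs"
 have int: "integrable \<Omega> (\<lambda>\<omega>. prism (\<psi>\<^sub>0 \<omega>) (\<psi>\<^sub>1 \<omega>) a gs)" if "set gs \<subseteq> carrier H" for gs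
  by (rule bounded_integrable[OF \<Omega>(1) meas[OF that] p_bound])
 show ?thesis
 proof (rule cobsI[OF _ _ _ H])
  show "?D \<in> cochains H q"
   using fun_space.subspace_diff[OF subspace_cochains r1.average_cochain[OF aD(1)] r0.average_cochain[OF aD(1)]]
   by (simp only: fun_diff_def)
  show "\<forall>gs\<in>tuples H 0. ?D gs = 0" if "q = 0"
  proof
   fix gs assume gs: "gs \<in> tuples H 0"
   have "(\<integral>\<omega>. a (map (\<psi>\<^sub>1 \<omega>) gs) \<partial>\<Omega>) = (\<integral>\<omega>. a (map (\<psi>\<^sub>0 \<omega>) gs) \<partial>\<Omega>)"
   proof (rule Bochner_Integration.integral_cong[OF refl])
    fix \<omega> assume \<omega>: "\<omega> \<in> space \<Omega>"
    obtain g where g: "gs = [g]" "g \<in> carrier H" using gs by (auto simp: tuples_def length_Suc_conv)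
    have "[\<psi>\<^sub>0 \<omega> g, \<psi>\<^sub>1 \<omega> g] \<in> tuples \<Gamma> (Suc q)" using \<psi>c[OF \<omega> g(2)] that by (simp add: tuples_def)
    from aD(2)[OF this] show "a (map (\<psi>\<^sub>1 \<omega>) gs) = a (map (\<psi>\<^sub>0 \<omega>) gs)" using g by simp
   qed
   then show "?D gs = 0" by (simp add: average_def)
  qed
  fix k assume q: "q = Suc k"
  let ?w = "\<lambda>gs. \<integral>\<omega>. prism (\<psi>\<^sub>0 \<omega>) (\<psi>\<^sub>1 \<omega>) a gs \<partial>\<Omega>"
  show "\<exists>w C. (\<forall>gs\<in>tuples H k. \<bar>w gs\<bar> \<le> C) \<and>
    (\<forall>g\<in>carrier H. \<forall>gs\<in>tuples H k. w (map (\<lambda>x. g \<otimes>\<^bsub>H\<^esub> x) gs) = w gs) \<and>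
    (\<forall>gs\<in>tuples H q. ?D gs = bd w gs)"
  proof (intro exI conjI ballI)
   fix gs assume gs: "gs \<in> tuples H k"
   then have sub: "set gs \<subseteq> carrier H" "length gs = q" using q by (auto simp: tuples_def)
   show "\<bar>?w gs\<bar> \<le> real q * C"
    using meas[OF sub(1)] p_bound[of _ _ gs] sub(2) by (intro bounded_integral_bound[OF \<Omega>(1) _ _ \<Omega>(2)]) auto
   fix g assume g: "g \<in> carrier H"
   have gs': "set (map (\<lambda>x. g \<otimes>\<^bsub>H\<^esub> x) gs) \<subseteq> carrier H"
    using tuples_map[OF H g gs] by (auto simp: tuples_def)
   have "?w (map (\<lambda>x. g \<otimes>\<^bsub>H\<^esub> x) gs) = (\<integral>\<omega>. prism (\<psi>\<^sub>0 (T g \<omega>)) (\<psi>\<^sub>1 (T g \<omega>)) a (map (\<lambda>x. g \<otimes>\<^bsub>H\<^esub> x) gs) \<partial>\<Omega>)"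
    using meas[OF gs'] by (intro integral_invariant[OF T(1)[OF g] T(2)[OF g], symmetric])
   also have "\<dots> = ?w gs"
   proof (rule Bochner_Integration.integral_cong[OF refl])
    fix \<omega> assume \<omega>: "\<omega> \<in> space \<Omega>"
    obtain c where c: "c \<in> carrier \<Gamma>" "\<forall>h\<in>carrier H. \<psi>\<^sub>0 (T g \<omega>) (g \<otimes>\<^bsub>H\<^esub> h) = c \<otimes>\<^bsub>\<Gamma>\<^esub> \<psi>\<^sub>0 \<omega> h \<and>
      \<psi>\<^sub>1 (T g \<omega>) (g \<otimes>\<^bsub>H\<^esub> h) = c \<otimes>\<^bsub>\<Gamma>\<^esub> \<psi>\<^sub>1 \<omega> h"
     using equiv[OF g \<omega>] by blast
    have "prism (\<psi>\<^sub>0 (T g \<omega>)) (\<psi>\<^sub>1 (T g \<omega>)) a (map (\<lambda>x. g \<otimes>\<^bsub>H\<^esub> x) gs) =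
      prism ((\<lambda>x. c \<otimes>\<^bsub>\<Gamma>\<^esub> x) \<circ> \<psi>\<^sub>0 \<omega>) ((\<lambda>x. c \<otimes>\<^bsub>\<Gamma>\<^esub> x) \<circ> \<psi>\<^sub>1 \<omega>) a gs"
     unfolding prism_map using c(2) sub by (intro prism_fun_cong) auto
    also have "\<dots> = prism (\<psi>\<^sub>0 \<omega>) (\<psi>\<^sub>1 \<omega>) a gs"
     unfolding prism_map_fun
    proof (rule prism_cong)
     fix ys assume ys: "length ys = Suc (length gs)" "set ys \<subseteq> \<psi>\<^sub>0 \<omega> ` set gs \<union> \<psi>\<^sub>1 \<omega> ` set gs"
     have "\<psi>\<^sub>0 \<omega> ` set gs \<union> \<psi>\<^sub>1 \<omega> ` set gs \<subseteq> carrier \<Gamma>" using \<psi>c[OF \<omega>] sub(1) by (auto simp: image_subset_iff subset_iff)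
     with ys(2) have "set ys \<subseteq> carrier \<Gamma>" by (rule order_trans)
     with ys(1) sub(2) have "ys \<in> tuples \<Gamma> q" by (simp add: tuples_def)
     then show "a (map (\<lambda>x. c \<otimes>\<^bsub>\<Gamma>\<^esub> x) ys) = a ys" by (rule cochainsD(2)[OF aD(1) c(1)])
    qed
    finally show "prism (\<psi>\<^sub>0 (T g \<omega>)) (\<psi>\<^sub>1 (T g \<omega>)) a (map (\<lambda>x. g \<otimes>\<^bsub>H\<^esub> x) gs) = prism (\<psi>\<^sub>0 \<omega>) (\<psi>\<^sub>1 \<omega>) a gs" .
   qed
   finally show "?w (map (\<lambda>x. g \<otimes>\<^bsub>H\<^esub> x) gs) = ?w gs" .
  next
   fix gs assume gs: "gs \<in> tuples H q"
   then have sub: "set gs \<subseteq> carrier H" "length gs = Suc q" by (auto simp: tuples_def)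
   have "bd ?w gs = (\<integral>\<omega>. bd (prism (\<psi>\<^sub>0 \<omega>) (\<psi>\<^sub>1 \<omega>) a) gs \<partial>\<Omega>)"
    by (rule integral_bd(1)[symmetric]) (use int sub in auto)
   also have "\<dots> = (\<integral>\<omega>. a (map (\<psi>\<^sub>1 \<omega>) gs) - a (map (\<psi>\<^sub>0 \<omega>) gs) \<partial>\<Omega>)"
   proof (rule Bochner_Integration.integral_cong[OF refl])
    fix \<omega> assume \<omega>: "\<omega> \<in> space \<Omega>"
    have "prism (\<psi>\<^sub>0 \<omega>) (\<psi>\<^sub>1 \<omega>) (bd a) gs = prism (\<psi>\<^sub>0 \<omega>) (\<psi>\<^sub>1 \<omega>) (\<lambda>_. 0) gs"
    proof (rule prism_cong)
     fix ys assume ys: "length ys = Suc (length gs)" "set ys \<subseteq> \<psi>\<^sub>0 \<omega> ` set gs \<union> \<psi>\<^sub>1 \<omega> ` set gs"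
     have "\<psi>\<^sub>0 \<omega> ` set gs \<union> \<psi>\<^sub>1 \<omega> ` set gs \<subseteq> carrier \<Gamma>" using \<psi>c[OF \<omega>] sub(1) by (auto simp: image_subset_iff subset_iff)
     with ys(2) have "set ys \<subseteq> carrier \<Gamma>" by (rule order_trans)
     with ys(1) sub(2) have "ys \<in> tuples \<Gamma> (Suc q)" by (simp add: tuples_def)
     then show "bd a ys = 0" by (rule aD(2))
    qed
    with prism_homotopy[of "\<psi>\<^sub>0 \<omega>" "\<psi>\<^sub>1 \<omega>" a gs]
    show "bd (prism (\<psi>\<^sub>0 \<omega>) (\<psi>\<^sub>1 \<omega>) a) gs = a (map (\<psi>\<^sub>1 \<omega>) gs) - a (map (\<psi>\<^sub>0 \<omega>) gs)" by simp
   qed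
   also have "\<dots> = ?D gs"
    using r0.map_integrable[OF sub(1) aD(1)] r1.map_integrable[OF sub(1) aD(1)] gs by (simp add: average_def)
   finally show "?D gs = bd ?w gs" by simp
  qed
 qed
qed

section \<open>Densities of dominated set functions\<close>

text \<open>Domination by a finite measure upgrades finite to countable additivity, since the tails
  of a disjoint union have small measure. Adding \<open>C\<close> times the measure makes the set
  function nonnegative, and Radon-Nikodym applies.\<close>

lemma dominated_density:
 fixes \<nu> :: "'x set \<Rightarrow> real"
 assumes M: "finite_measure M" and C: "0 \<le> C"
  and add: "\<And>A B. A \<in> sets M \<Longrightarrow> B \<in> sets M \<Longrightarrow> A \<inter> B = {} \<Longrightarrow> \<nu> (A \<union> B) = \<nu> A + \<nu> B"
  and bound: "\<And>A. A \<in> sets M \<Longrightarrow> \<bar>\<nu> A\<bar> \<le> C * measure M A"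
 obtains f where "f \<in> borel_measurable M" "\<forall>x. \<bar>f x\<bar> \<le> C" "\<forall>A\<in>sets M. \<nu> A = (\<integral>x\<in>A. f x \<partial>M)"
proof -
 interpret finite_measure M by fact
 have empty: "\<nu> {} = 0" using bound[of "{}"] by simp
 define \<mu> where "\<mu> = (\<lambda>A. ennreal (\<nu> A + C * measure M A))"
 have nonneg: "0 \<le> \<nu> A + C * measure M A" if "A \<in> sets M" for A using bound[OF that] by simp
 have sums: "(\<lambda>i. \<nu> (A i)) sums \<nu> (\<Union>i. A i)" if A: "range A \<subseteq> sets M" "disjoint_family A" for A :: "nat \<Rightarrow> 'x set"
 proof -
  have Am: "A i \<in> sets M" for i using A(1) by blast
  have fin: "(\<Sum>i<n. \<nu> (A i)) = \<nu> (\<Union>i<n. A i)" for n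
  proof (induction n)
   case (Suc n)
   have "A i \<inter> A n = {}" if "i < n" for i
    using disjoint_family_onD[OF A(2), of i n] that by simp
   then have "(\<Union>i<n. A i) \<inter> A n = {}" by blast
   moreover have "(\<Union>i<Suc n. A i) = (\<Union>i<n. A i) \<union> A n" by (auto simp: lessThan_Suc)
   ultimately show ?case using Suc add[of "\<Union>i<n. A i" "A n"] Am by (simp add: lessThan_Suc add.commute)
  qed (simp add: empty)
  define R where "R n = (\<Union>i. A i) - (\<Union>i<n. A i)" for n
  have Rm: "R n \<in> sets M" for n unfolding R_def using Am by auto
  have split: "\<nu> (\<Union>i. A i) = (\<Sum>i<n. \<nu> (A i)) + \<nu> (R n)" for n
  proof -
   have "(\<Union>i. A i) = (\<Union>i<n. A i) \<union> R n" "(\<Union>i<n. A i) \<inter> R n = {}" by (auto simp: R_def)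
   moreover have "(\<Union>i<n. A i) \<in> sets M" using Am by blast
   ultimately show ?thesis using add[of "\<Union>i<n. A i" "R n"] Rm fin by simp
  qed
  have msplit: "measure M (\<Union>i. A i) = (\<Sum>i<n. measure M (A i)) + measure M (R n)" for n
  proof -
   have U: "(\<Union>i. A i) = (\<Union>i<n. A i) \<union> R n" "(\<Union>i<n. A i) \<inter> R n = {}" by (auto simp: R_def)
   have "measure M (\<Union>i<n. A i) = (\<Sum>i<n. measure M (A i))"
    using A by (intro finite_measure_finite_Union) (auto simp: disjoint_family_on_def)
   then show ?thesis
    using finite_measure_Union[OF _ Rm[of n] U(2)] Am unfolding U(1)[symmetric] by (simp add: sets.finite_UN)
  qed
  have "(\<lambda>n. \<Sum>i<n. measure M (A i)) \<longlonglongrightarrow> measure M (\<Union>i. A i)"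
   using finite_measure_UNION[OF A] by (simp add: sums_def)
  then have "(\<lambda>n. measure M (\<Union>i. A i) - (\<Sum>i<n. measure M (A i))) \<longlonglongrightarrow> measure M (\<Union>i. A i) - measure M (\<Union>i. A i)"
   by (intro tendsto_diff tendsto_const)
  moreover have "measure M (R n) = measure M (\<Union>i. A i) - (\<Sum>i<n. measure M (A i))" for n
   using msplit[of n] by linarith
  ultimately have lim: "(\<lambda>n. C * measure M (R n)) \<longlonglongrightarrow> C * 0"
   by (intro tendsto_mult tendsto_const) simp
  have "(\<lambda>n. \<nu> (R n)) \<longlonglongrightarrow> 0"
   by (rule tendsto_rabs_zero_cancel, rule tendsto_sandwich[OF _ _ tendsto_const])
    (use lim bound[OF Rm] in auto)
  then have "(\<lambda>n. \<nu> (\<Union>i. A i) - \<nu> (R n)) \<longlonglongrightarrow> \<nu> (\<Union>i. A i) - 0" by (intro tendsto_diff tendsto_const)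
  moreover have "(\<Sum>i<n. \<nu> (A i)) = \<nu> (\<Union>i. A i) - \<nu> (R n)" for n using split[of n] by linarith
  ultimately show ?thesis unfolding sums_def by simp
 qed
 define N where "N = measure_of (space M) (sets M) \<mu>"
 have sets_N: "sets N = sets M" by (simp add: N_def)
 have emeasure_N: "emeasure N A = \<mu> A" if "A \<in> sets M" for A
 proof (rule emeasure_measure_of[OF N_def])
  show "countably_additive (sets N) \<mu>"
   unfolding countably_additive_def sets_N
  proof safe
   fix A :: "nat \<Rightarrow> 'x set" assume A: "range A \<subseteq> sets M" "disjoint_family A"
   have "(\<lambda>i. \<nu> (A i) + C * measure M (A i)) sums (\<nu> (\<Union>i. A i) + C * measure M (\<Union>i. A i))"
    using sums[OF A] finite_measure_UNION[OF A] by (intro sums_add sums_mult)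
   moreover have "0 \<le> \<nu> (A i) + C * measure M (A i)" for i using A(1) by (intro nonneg) blast
   moreover have "0 \<le> \<nu> (\<Union>i. A i) + C * measure M (\<Union>i. A i)" using A(1) by (intro nonneg) blast
   ultimately show "(\<Sum>i. \<mu> (A i)) = \<mu> (\<Union>i. A i)"
    unfolding \<mu>_def by (intro sums_unique[symmetric] iffD2[OF sums_ennreal])
  qed
 qed (use that in \<open>auto simp: sets_N positive_def \<mu>_def empty dest: sets.sets_into_space\<close>)
 have "absolutely_continuous M N"
  unfolding absolutely_continuous_def
 proof
  fix A assume A: "A \<in> null_sets M"
  then have "measure M A = 0" "A \<in> sets M" by (auto simp: measure_def null_sets_def)
  with bound[of A] emeasure_N[of A] show "A \<in> null_sets N" by (auto simp: \<mu>_def null_sets_def sets_N)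
 qed
 from Radon_Nikodym[OF this sets_N] obtain h where h: "h \<in> borel_measurable M" "density M h = N" by blast
 have hA: "(\<integral>\<^sup>+x\<in>A. h x \<partial>M) = ennreal (\<nu> A + C * measure M A)" if "A \<in> sets M" for A
  using emeasure_density[OF h(1) that] emeasure_N[OF that] h(2) by (simp add: \<mu>_def)
 have "(\<integral>\<^sup>+x. h x \<partial>M) = (\<integral>\<^sup>+x\<in>space M. h x \<partial>M)" by (intro nn_integral_cong) simp
 then have fin: "(\<integral>\<^sup>+x. h x \<partial>M) \<noteq> \<infinity>" using hA[OF sets.top] by simp
 define f where "f = (\<lambda>x. enn2real (h x) - C)"
 have fm: "f \<in> borel_measurable M" unfolding f_def using h(1) by measurable
 have AEh: "AE x in M. ennreal (enn2real (h x)) = h x"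
  using nn_integral_PInf_AE[OF h(1)] fin by (auto simp: less_top)
 have inth: "integrable M (\<lambda>x. enn2real (h x))"
 proof (rule integrableI_nonneg)
  show "(\<integral>\<^sup>+x. ennreal (enn2real (h x)) \<partial>M) < \<infinity>"
   unfolding nn_integral_cong_AE[OF AEh] using fin by (simp add: less_top[symmetric])
 next
  show "(\<lambda>x. enn2real (h x)) \<in> borel_measurable M" using h(1) by measurable
 qed simp
 have intf: "integrable M f" unfolding f_def using inth by simp
 have \<nu>f: "\<nu> A = (\<integral>x\<in>A. f x \<partial>M)" if A: "A \<in> sets M" for A
 proof -
  have "(\<integral>\<^sup>+x. ennreal (indicator A x * enn2real (h x)) \<partial>M) = (\<integral>\<^sup>+x\<in>A. h x \<partial>M)"
   by (rule nn_integral_cong_AE) (use AEh in eventually_elim, auto simp: indicator_def)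
  then have "ennreal (\<integral>x. indicator A x * enn2real (h x) \<partial>M) = ennreal (\<nu> A + C * measure M A)"
   unfolding hA[OF A, symmetric]
   by (subst nn_integral_eq_integral[symmetric]) (use integrable_mult_indicator[OF A inth] in auto)
  then have "(\<integral>x. indicator A x * enn2real (h x) \<partial>M) = \<nu> A + C * measure M A"
   using nonneg[OF A] by (subst (asm) ennreal_inj) (auto intro!: integral_nonneg)
  moreover have "(\<integral>x\<in>A. f x \<partial>M) = (\<integral>x. indicator A x * enn2real (h x) \<partial>M) - (\<integral>x. indicator A x * C \<partial>M)"
   unfolding set_lebesgue_integral_def f_def
   using integrable_mult_indicator[OF A inth] integrable_mult_indicator[OF A integrable_const[of C]]
   by (subst Bochner_Integration.integral_diff[symmetric]) (auto simp: algebra_simps)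
  ultimately show ?thesis using A by simp
 qed
 have le: "AE x in M. g x \<le> 0"
  if g: "integrable M g" "\<And>A. A \<in> sets M \<Longrightarrow> (\<integral>x\<in>A. g x \<partial>M) \<le> 0" for g :: "'x \<Rightarrow> real"
 proof -
  have gm: "g \<in> borel_measurable M" using g(1) by simp
  define A where "A = {x\<in>space M. 0 < g x}"
  have A: "A \<in> sets M" unfolding A_def using gm by measurable
  have int: "integrable M (\<lambda>x. indicator A x * g x)" using integrable_mult_indicator[OF A g(1)] by simp
  have nn: "AE x in M. 0 \<le> indicator A x * g x" by (auto simp: A_def indicator_def)
  have "(\<integral>x. indicator A x * g x \<partial>M) = 0"
   using g(2)[OF A] integral_nonneg_AE[OF nn] by (simp add: set_lebesgue_integral_def)
  then have "AE x in M. indicator A x * g x = 0" using integral_nonneg_eq_0_iff_AE[OF int nn] by simp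
  then show ?thesis using AE_space by eventually_elim (force simp: A_def indicator_def)
 qed
 have cint: "(\<integral>x\<in>A. c \<partial>M) = c * measure M A" if "A \<in> sets M" for A c
  using that by (simp add: set_lebesgue_integral_def)
 have si: "set_integrable M A f" "set_integrable M A (\<lambda>x. c)" if "A \<in> sets M" for A and c :: real
  unfolding set_integrable_def
  by (rule integrable_mult_indicator[OF that intf], rule integrable_mult_indicator[OF that integrable_const])
 have up: "AE x in M. f x - C \<le> 0"
 proof (rule le)
  fix A assume A: "A \<in> sets M"
  have "(\<integral>x\<in>A. f x - C \<partial>M) = \<nu> A - C * measure M A"
   unfolding set_integral_diff(2)[OF si(1)[OF A] si(2)[OF A]] cint[OF A] \<nu>f[OF A] ..
  then show "(\<integral>x\<in>A. f x - C \<partial>M) \<le> 0" using bound[OF A] by simp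
 qed (use intf in simp)
 have dn: "AE x in M. - C - f x \<le> 0"
 proof (rule le)
  fix A assume A: "A \<in> sets M"
  have "(\<integral>x\<in>A. - C - f x \<partial>M) = - C * measure M A - \<nu> A"
   unfolding set_integral_diff(2)[OF si(2)[OF A] si(1)[OF A]] cint[OF A] \<nu>f[OF A] ..
  then show "(\<integral>x\<in>A. - C - f x \<partial>M) \<le> 0" using bound[OF A] by simp
 qed (use intf in simp)
 \<comment> \<open>The density is bounded almost everywhere; truncation makes the bound hold at
   every point, without changing integrals.\<close>
 define g where "g = (\<lambda>x. min C (max (- C) (f x)))"
 have gm: "g \<in> borel_measurable M" unfolding g_def using fm by measurable
 have fg: "AE x in M. f x = g x" using up dn by eventually_elim (auto simp: g_def)
 show ?thesis
 proof (rule that[OF gm])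
  show "\<forall>x. \<bar>g x\<bar> \<le> C" using C by (auto simp: g_def abs_le_iff)
  show "\<forall>A\<in>sets M. \<nu> A = (\<integral>x\<in>A. g x \<partial>M)"
  proof
   fix A assume A: "A \<in> sets M"
   have "(\<integral>x\<in>A. f x \<partial>M) = (\<integral>x\<in>A. g x \<partial>M)"
    using fm gm fg A by (intro set_lebesgue_integral_cong_AE) auto
   with \<nu>f[OF A] show "\<nu> A = (\<integral>x\<in>A. g x \<partial>M)" by simp
  qed
 qed
qed

section \<open>Quotients with an invariant probability measure\<close>

text \<open>The group carries only a measurable structure \<open>B\<close> compatible with its
  operations. The measurable section \<open>s\<close> plays the part of a fundamental domain, and
  \<open>M\<close> is normalized to a probability measure.\<close>

locale measured_quotient = Group.group G for G :: "('g, 'b) monoid_scheme" (structure) +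
 fixes B :: "'g measure" and \<Gamma> :: "'g set" and M :: "'g set measure" and s :: "'g set \<Rightarrow> 'g"
 assumes space_B: "space B = carrier G"
  and mult_meas: "(\<lambda>p. fst p \<otimes> snd p) \<in> B \<Otimes>\<^sub>M B \<rightarrow>\<^sub>M B"
  and inv_meas: "(\<lambda>g. inv g) \<in> B \<rightarrow>\<^sub>M B"
  and singleton_meas: "\<And>c. c \<in> \<Gamma> \<Longrightarrow> {c} \<in> sets B"
  and subgroup: "subgroup \<Gamma> G" and countable: "countable \<Gamma>"
  and finite: "finite_measure M" and total: "measure M (space M) = 1"
  and space_M: "space M = lcosets \<Gamma>"
  and \<pi>_meas: "(\<lambda>g. l_coset G g \<Gamma>) \<in> B \<rightarrow>\<^sub>M M"
  and s_meas: "s \<in> M \<rightarrow>\<^sub>M B"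
  and s_coset: "\<And>x. x \<in> lcosets \<Gamma> \<Longrightarrow> l_coset G (s x) \<Gamma> = x"
  and invariant: "\<And>g A. g \<in> carrier G \<Longrightarrow> A \<in> sets M \<Longrightarrow> emeasure M (l_coset G g ` A) = emeasure M A"
begin

abbreviation act :: "'g \<Rightarrow> 'g set \<Rightarrow> 'g set" (infixr "\<rhd>" 70) where "g \<rhd> x \<equiv> l_coset G g x"

sublocale finite_measure M by (rule finite)
sublocale subgroup \<Gamma> G by (rule subgroup)

abbreviation \<G> :: "('g, 'b) monoid_scheme" where "\<G> \<equiv> G\<lparr>carrier := \<Gamma>\<rparr>"

definition \<pi> :: "'g \<Rightarrow> 'g set" where "\<pi> g = g \<rhd> \<Gamma>"

text \<open>The \<Gamma>-coordinate of \<open>g\<close> when the group is written as the image of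
  the section times \<Gamma>; it is equivariant for right multiplication by \<Gamma>.\<close>

definition \<kappa> :: "'g \<Rightarrow> 'g" where "\<kappa> g = inv (s (\<pi> g)) \<otimes> g"

text \<open>The two inversions turn the right equivariance of \<kappa> into a left one. Translating
  both the point and the argument by a group element multiplies the value by an element of \<Gamma>
  determined by the point: this is the random map from the big group to the lattice.\<close>

definition \<beta> :: "'g set \<Rightarrow> 'g \<Rightarrow> 'g" where "\<beta> x g = inv (\<kappa> (inv g \<otimes> s x))"

lemma \<G>_group: "Group.group \<G>"
 by (rule subgroup_imp_group[OF subgroup])

lemma \<pi>_space: "g \<in> carrier G \<Longrightarrow> \<pi> g \<in> space M"
 by (auto simp: \<pi>_def space_M LCOSETS_def)

lemma s_closed [simp]: "x \<in> space M \<Longrightarrow> s x \<in> carrier G"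
 using measurable_space[OF s_meas] space_B by auto

lemma \<pi>_s [simp]: "x \<in> space M \<Longrightarrow> \<pi> (s x) = x"
 by (simp add: \<pi>_def s_coset space_M)

lemma act_\<pi>: "g \<in> carrier G \<Longrightarrow> h \<in> carrier G \<Longrightarrow> g \<rhd> \<pi> h = \<pi> (g \<otimes> h)"
 unfolding \<pi>_def by (rule lcos_m_assoc[OF subset])

lemma \<pi>_mult [simp]: "g \<in> carrier G \<Longrightarrow> c \<in> \<Gamma> \<Longrightarrow> \<pi> (g \<otimes> c) = \<pi> g"
 using act_\<pi>[of g c] lcos_mult_one subset coset_join3[of c \<Gamma>] subgroup mem_carrier
 by (simp add: \<pi>_def)

lemma \<pi>_eqD:
 assumes "g \<in> carrier G" "h \<in> carrier G" "\<pi> g = \<pi> h"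
 shows "inv g \<otimes> h \<in> \<Gamma>"
proof -
 have "h \<in> \<pi> h" unfolding \<pi>_def l_coset_def using assms(2) one_closed by force
 then obtain c where c: "c \<in> \<Gamma>" "h = g \<otimes> c" unfolding assms(3)[symmetric] by (auto simp: \<pi>_def l_coset_def)
 then show ?thesis using assms(1) mem_carrier by (simp add: m_assoc[symmetric])
qed

lemma act_closed [simp]: "g \<in> carrier G \<Longrightarrow> x \<in> space M \<Longrightarrow> g \<rhd> x \<in> space M"
 using act_\<pi>[of g "s x"] \<pi>_space[of "g \<otimes> s x"] by simp

lemma act_eq: "g \<in> carrier G \<Longrightarrow> x \<in> space M \<Longrightarrow> g \<rhd> x = \<pi> (g \<otimes> s x)"
 using act_\<pi>[of g "s x"] by simp

lemma act_act: "g \<in> carrier G \<Longrightarrow> h \<in> carrier G \<Longrightarrow> x \<in> space M \<Longrightarrow> g \<rhd> (h \<rhd> x) = (g \<otimes> h) \<rhd> x"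
 using lcos_m_assoc[of x g h] sets.sets_into_space act_\<pi>[of "g \<otimes> h" "s x"] act_\<pi>[of h "s x"] act_\<pi>[of g "h \<otimes> s x"]
 by (simp add: m_assoc)

lemma act_one: "x \<in> space M \<Longrightarrow> \<one> \<rhd> x = x"
 using act_eq[of \<one> x] by simp

lemma \<kappa>_closed [simp]: "g \<in> carrier G \<Longrightarrow> \<kappa> g \<in> \<Gamma>"
 unfolding \<kappa>_def by (rule \<pi>_eqD) (simp_all add: \<pi>_space)

lemma \<kappa>_mult: "g \<in> carrier G \<Longrightarrow> c \<in> \<Gamma> \<Longrightarrow> \<kappa> (g \<otimes> c) = \<kappa> g \<otimes> c"
 unfolding \<kappa>_def using mem_carrier \<pi>_space by (simp add: m_assoc)

lemma \<beta>_closed [simp]: "g \<in> carrier G \<Longrightarrow> x \<in> space M \<Longrightarrow> \<beta> x g \<in> \<Gamma>"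
 unfolding \<beta>_def by (intro m_inv_closed \<kappa>_closed) simp_all

lemma s_\<pi>:
 assumes "g \<in> carrier G"
 obtains c where "c \<in> \<Gamma>" "s (\<pi> g) = g \<otimes> c"
proof (rule that[of "inv (\<kappa> g)"])
 show "s (\<pi> g) = g \<otimes> inv (\<kappa> g)"
  using assms \<pi>_space[OF assms] unfolding \<kappa>_def by (simp add: inv_mult_group m_assoc[symmetric])
qed (use assms in simp)

lemma \<beta>_act:
 assumes "g \<in> carrier G" "h \<in> carrier G" "x \<in> space M" "c \<in> \<Gamma>" "s (g \<rhd> x) = g \<otimes> s x \<otimes> c"
 shows "\<beta> (g \<rhd> x) (g \<otimes> h) = inv c \<otimes> \<beta> x h"
proof -
 have "inv (g \<otimes> h) \<otimes> (g \<otimes> s x \<otimes> c) = (inv h \<otimes> s x) \<otimes> c"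
  using assms mem_carrier by (simp add: inv_mult_group m_assoc) (simp add: m_assoc[symmetric])
 then show ?thesis
  unfolding \<beta>_def assms(5) using \<kappa>_mult[of "inv h \<otimes> s x" c] assms mem_carrier[OF \<kappa>_closed] mem_carrier
  by (simp add: inv_mult_group)
qed

lemma mult_meas': "f \<in> X \<rightarrow>\<^sub>M B \<Longrightarrow> h \<in> X \<rightarrow>\<^sub>M B \<Longrightarrow> (\<lambda>x. f x \<otimes> h x) \<in> X \<rightarrow>\<^sub>M B"
 using measurable_compose[OF measurable_Pair mult_meas, of f X h] by simp

lemma inv_meas': "f \<in> X \<rightarrow>\<^sub>M B \<Longrightarrow> (\<lambda>x. inv (f x)) \<in> X \<rightarrow>\<^sub>M B"
 by (rule measurable_compose[OF _ inv_meas])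

lemma s_meas': "f \<in> X \<rightarrow>\<^sub>M M \<Longrightarrow> (\<lambda>x. s (f x)) \<in> X \<rightarrow>\<^sub>M B"
 by (rule measurable_compose[OF _ s_meas])

lemma \<pi>_meas': "f \<in> X \<rightarrow>\<^sub>M B \<Longrightarrow> (\<lambda>x. \<pi> (f x)) \<in> X \<rightarrow>\<^sub>M M"
 unfolding \<pi>_def by (rule measurable_compose[OF _ \<pi>_meas])

lemma const_meas: "g \<in> carrier G \<Longrightarrow> (\<lambda>x. g) \<in> X \<rightarrow>\<^sub>M B"
 by (simp add: space_B)

lemma \<Gamma>_meas: "(\<lambda>x. f x) \<in> X \<rightarrow>\<^sub>M count_space \<Gamma> \<Longrightarrow> f \<in> X \<rightarrow>\<^sub>M B"
 by (rule measurable_compose[of f X "count_space \<Gamma>" "\<lambda>x. x" B]) (auto simp: space_B)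

lemma \<kappa>_meas': 
 assumes f: "f \<in> X \<rightarrow>\<^sub>M B"
 shows "(\<lambda>x. inv (\<kappa> (f x))) \<in> X \<rightarrow>\<^sub>M count_space \<Gamma>"
proof -
 have m: "(\<lambda>x. inv (\<kappa> (f x))) \<in> X \<rightarrow>\<^sub>M B"
  unfolding \<kappa>_def by (intro inv_meas' mult_meas' s_meas' \<pi>_meas' f)
 show ?thesis
  unfolding measurable_count_space_eq_countable[OF countable]
 proof (intro conjI ballI)
  show "(\<lambda>x. inv (\<kappa> (f x))) \<in> space X \<rightarrow> \<Gamma>"
   using measurable_space[OF f] space_B by (auto intro!: m_inv_closed)
  fix c assume "c \<in> \<Gamma>"
  from measurable_sets[OF m singleton_meas[OF this]]
  show "(\<lambda>x. inv (\<kappa> (f x))) -` {c} \<inter> space X \<in> sets X" .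
 qed
qed

lemma act_meas': "f \<in> X \<rightarrow>\<^sub>M B \<Longrightarrow> h \<in> X \<rightarrow>\<^sub>M M \<Longrightarrow> (\<lambda>x. f x \<rhd> h x) \<in> X \<rightarrow>\<^sub>M M"
proof -
 assume f: "f \<in> X \<rightarrow>\<^sub>M B" and h: "h \<in> X \<rightarrow>\<^sub>M M"
 have "f x \<rhd> h x = \<pi> (f x \<otimes> s (h x))" if "x \<in> space X" for x
  using measurable_space[OF f that] measurable_space[OF h that] space_B act_eq by simp
 moreover have "(\<lambda>x. \<pi> (f x \<otimes> s (h x))) \<in> X \<rightarrow>\<^sub>M M"
  by (intro \<pi>_meas' mult_meas' s_meas' f h)
 ultimately show ?thesis by (simp cong: measurable_cong)
qed

lemma act_meas: "g \<in> carrier G \<Longrightarrow> (\<lambda>x. g \<rhd> x) \<in> M \<rightarrow>\<^sub>M M"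
 by (intro act_meas' const_meas) auto

lemma act_inv_image:
 assumes "g \<in> carrier G" "A \<subseteq> space M"
 shows "(\<lambda>x. g \<rhd> x) -` A \<inter> space M = (\<lambda>x. inv g \<rhd> x) ` A"
proof (intro equalityI subsetI)
 fix x assume "x \<in> (\<lambda>x. g \<rhd> x) -` A \<inter> space M"
 then have "x \<in> space M" "g \<rhd> x \<in> A" by auto
 then show "x \<in> (\<lambda>x. inv g \<rhd> x) ` A"
  using assms(1) act_act[of "inv g" g x] act_one by (intro image_eqI[of _ _ "g \<rhd> x"]) simp_all
next
 fix y assume "y \<in> (\<lambda>x. inv g \<rhd> x) ` A"
 then obtain x where x: "x \<in> A" "x \<in> space M" "y = inv g \<rhd> x" using assms(2) by blast
 then show "y \<in> (\<lambda>x. g \<rhd> x) -` A \<inter> space M" using assms(1) act_act[of g "inv g" x] act_one by simp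
qed

lemma act_image_sets:
 assumes "g \<in> carrier G" "A \<in> sets M"
 shows "(\<lambda>x. g \<rhd> x) ` A \<in> sets M"
 using act_inv_image[of "inv g" A] measurable_sets[OF act_meas[of "inv g"] assms(2)] assms sets.sets_into_space[OF assms(2)]
 by simp

lemma act_distr:
 assumes g: "g \<in> carrier G"
 shows "distr M M (\<lambda>x. g \<rhd> x) = M"
proof (rule measure_eqI)
 fix A assume "A \<in> sets (distr M M (\<lambda>x. g \<rhd> x))"
 then have A: "A \<in> sets M" by simp
 show "emeasure (distr M M (\<lambda>x. g \<rhd> x)) A = emeasure M A"
  using emeasure_distr[OF act_meas[OF g] A] act_inv_image[OF g sets.sets_into_space[OF A]]
   invariant[OF inv_closed[OF g] A] by simp
qed simp

lemma \<beta>_meas: "g \<in> carrier G \<Longrightarrow> (\<lambda>x. \<beta> x g) \<in> M \<rightarrow>\<^sub>M count_space \<Gamma>"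
 unfolding \<beta>_def by (intro \<kappa>_meas' mult_meas' const_meas s_meas) simp

lemma act_s:
 assumes "g \<in> carrier G" "x \<in> space M"
 obtains c where "c \<in> \<Gamma>" "s (g \<rhd> x) = g \<otimes> s x \<otimes> c"
 using s_\<pi>[of "g \<otimes> s x"] act_eq[OF assms] assms by auto

sublocale rm: random_map M G \<G> "\<lambda>g x. g \<rhd> x" \<beta>
proof
 fix g x assume g: "g \<in> carrier G" and x: "x \<in> space M"
 obtain c where c: "c \<in> \<Gamma>" "s (g \<rhd> x) = g \<otimes> s x \<otimes> c" by (rule act_s[OF g x])
 show "\<exists>c\<in>carrier \<G>. \<forall>h\<in>carrier G. \<beta> (g \<rhd> x) (g \<otimes> h) = c \<otimes>\<^bsub>\<G>\<^esub> \<beta> x h"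
  using \<beta>_act[OF g _ x c] c(1) by (intro bexI[of _ "inv c"]) auto
qed (use finite total act_meas act_distr countable \<beta>_meas is_group in auto)

text \<open>The transfer from the lattice to the ambient group, with the invariant mean over
  finitely many cosets replaced by the invariant measure on the quotient.\<close>

definition j :: "nat \<Rightarrow> ('g list \<Rightarrow> real) \<Rightarrow> 'g list \<Rightarrow> real" where
 "j q = average M \<beta> G q"

end

section \<open>Null sets on the quotient and the averaged self-map of the lattice\<close>

context measured_quotient
begin

lemma ae_filter_nontrivial: "ae_filter M \<noteq> bot"
 using total by (auto simp: ae_filter_eq_bot_iff measure_def)

lemma act_null_sets:
 assumes "g \<in> carrier G" "N \<in> null_sets M"
 shows "(\<lambda>x. g \<rhd> x) ` N \<in> null_sets M"
 using assms act_image_sets[of g N] invariant[of g N] by (auto simp: null_sets_def)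

text \<open>The union of the countably many \<Gamma>-translates of the exceptional null set is null
  and invariant.\<close>

lemma AE_invariant:
 assumes "AE x in M. Q x"
 obtains N where "N \<in> null_sets M" "\<forall>c\<in>\<Gamma>. \<forall>x\<in>space M. c \<rhd> x \<in> N \<longleftrightarrow> x \<in> N" "\<forall>x\<in>space M. x \<notin> N \<longrightarrow> Q x"
proof -
 obtain N0 where N0: "{x\<in>space M. \<not> Q x} \<subseteq> N0" "N0 \<in> null_sets M"
  using assms by (auto simp: eventually_ae_filter)
 define N where "N = (\<Union>c\<in>\<Gamma>. (\<lambda>x. c \<rhd> x) ` N0)"
 have N0_space: "N0 \<subseteq> space M" using N0(2) sets.sets_into_space by blast
 have up: "c \<rhd> x \<in> N" if c: "c \<in> \<Gamma>" and x: "x \<in> N" for c x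
 proof -
  obtain d y where dy: "d \<in> \<Gamma>" "y \<in> N0" "x = d \<rhd> y" using x by (auto simp: N_def)
  then have "c \<rhd> x = (c \<otimes> d) \<rhd> y" using act_act[of c d y] c N0_space by auto
  then show ?thesis using dy c unfolding N_def by blast
 qed
 show ?thesis
 proof (rule that[of N])
  show "N \<in> null_sets M"
   unfolding N_def by (intro null_sets_UN' countable act_null_sets N0(2)) simp
  show "\<forall>x\<in>space M. x \<notin> N \<longrightarrow> Q x"
  proof (intro ballI impI)
   fix x assume x: "x \<in> space M" "x \<notin> N"
   have "x \<notin> N0"
   proof
    assume "x \<in> N0"
    then have "\<one> \<rhd> x \<in> N" unfolding N_def by (rule UN_I[OF subgroup.one_closed[OF subgroup] imageI])
    with x(2) act_one[OF x(1)] show False by simp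
   qed
   with x(1) N0(1) show "Q x" by blast
  qed
  show "\<forall>c\<in>\<Gamma>. \<forall>x\<in>space M. c \<rhd> x \<in> N \<longleftrightarrow> x \<in> N"
  proof (intro ballI iffI)
   fix c x assume c: "c \<in> \<Gamma>" and x: "x \<in> space M"
   show "c \<rhd> x \<in> N" if "x \<in> N" by (rule up[OF c that])
   show "x \<in> N" if "c \<rhd> x \<in> N"
   proof -
    have "inv c \<rhd> (c \<rhd> x) = x"
     using act_act[OF inv_closed[OF mem_carrier[OF c]] mem_carrier[OF c] x] l_inv[OF mem_carrier[OF c]] act_one[OF x] by simp
    with up[OF m_inv_closed[OF c] that] show ?thesis by simp
   qed
  qed
 qed
qed

lemma notin_sets:
 assumes "f \<in> X \<rightarrow>\<^sub>M M" "N \<in> sets M"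
 shows "{x\<in>space X. f x \<notin> N} \<in> sets X"
proof -
 have "{x\<in>space X. f x \<notin> N} = f -` (space M - N) \<inter> space X" using measurable_space[OF assms(1)] by blast
 then show ?thesis using measurable_sets[OF assms(1) sets.compl_sets[OF assms(2)]] by simp
qed

text \<open>Moving \<open>x\<close> by \<open>s y\<close> preserves the measure and replaces the
  product by the inverse of \<open>s x\<close>, up to a left factor in \<Gamma> to which the
  invariant set \<open>A\<close> is insensitive.\<close>

lemma AE_translate:
 assumes A: "A \<in> sets M" "\<forall>c\<in>\<Gamma>. \<forall>x\<in>space M. c \<rhd> x \<in> A \<longleftrightarrow> x \<in> A" and y: "y \<in> space M"
  and AE: "AE x in M. (\<pi> (inv (s x) \<otimes> s y) \<in> A) = b"
 shows "AE x in M. (\<pi> (inv (s x)) \<in> A) = b"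
proof -
 have "AE x in distr M M (\<lambda>x. s y \<rhd> x). (\<pi> (inv (s x) \<otimes> s y) \<in> A) = b"
  unfolding act_distr[OF s_closed[OF y]] by (rule AE)
 then have "AE x in M. (\<pi> (inv (s (s y \<rhd> x)) \<otimes> s y) \<in> A) = b"
 proof (rule iffD1[OF AE_distr_iff, rotated 2])
  have m: "(\<lambda>x. \<pi> (inv (s x) \<otimes> s y)) \<in> M \<rightarrow>\<^sub>M M"
   by (intro \<pi>_meas' mult_meas' inv_meas' s_meas const_meas s_closed y)
  have "{x\<in>space M. (\<pi> (inv (s x) \<otimes> s y) \<in> A) = True} \<in> sets M"
   using measurable_sets[OF m A(1)] by (simp add: vimage_def Int_def conj_commute)
  then show "{x\<in>space M. (\<pi> (inv (s x) \<otimes> s y) \<in> A) = b} \<in> sets M"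
   using notin_sets[OF m A(1)] by (cases b) simp_all
 next
  show "(\<lambda>x. s y \<rhd> x) \<in> M \<rightarrow>\<^sub>M M" by (rule act_meas[OF s_closed[OF y]])
 qed
 then show ?thesis using AE_space
 proof eventually_elim
  fix x assume x: "(\<pi> (inv (s (s y \<rhd> x)) \<otimes> s y) \<in> A) = b" "x \<in> space M"
  obtain c where c: "c \<in> \<Gamma>" "s (s y \<rhd> x) = s y \<otimes> s x \<otimes> c" by (rule act_s[OF s_closed[OF y] x(2)])
  have "inv (s (s y \<rhd> x)) \<otimes> s y = inv c \<otimes> inv (s x)"
   using c x(2) y mem_carrier by (simp add: inv_mult_group m_assoc)
  then have "\<pi> (inv (s (s y \<rhd> x)) \<otimes> s y) = inv c \<rhd> \<pi> (inv (s x))"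
   using act_\<pi>[of "inv c" "inv (s x)"] c(1) x(2) by simp
  with x(1) A(2) c(1) \<pi>_space[of "inv (s x)"] x(2) show "(\<pi> (inv (s x)) \<in> A) = b" by simp
 qed
qed

text \<open>The map in question depends on the section and is not induced by a translation. With an
  auxiliary \<open>y\<close> it becomes one: for each \<open>x\<close> the bad \<open>y\<close> form
  a translate of \<open>N\<close>. By Fubini some \<open>y\<close> has few bad \<open>x\<close>, and
  \<open>AE_translate\<close> removes that \<open>y\<close>.\<close>

lemma AE_inverse:
 assumes N: "N \<in> null_sets M" "\<forall>c\<in>\<Gamma>. \<forall>x\<in>space M. c \<rhd> x \<in> N \<longleftrightarrow> x \<in> N"
 shows "AE x in M. \<pi> (inv (s x)) \<notin> N"
proof -
 interpret P: pair_sigma_finite M M by unfold_locales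
 have NM: "N \<in> sets M" using N(1) by auto
 have m: "(\<lambda>p. \<pi> (inv (s (fst p)) \<otimes> s (snd p))) \<in> M \<Otimes>\<^sub>M M \<rightarrow>\<^sub>M M"
  by (intro \<pi>_meas' mult_meas' inv_meas' s_meas') measurable
 have "AE y in M. \<pi> (inv (s x) \<otimes> s y) \<notin> N" if x: "x \<in> space M" for x
 proof (rule AE_I')
  show "(\<lambda>z. s x \<rhd> z) ` N \<in> null_sets M" by (rule act_null_sets[OF s_closed[OF x] N(1)])
  show "{y\<in>space M. \<not> \<pi> (inv (s x) \<otimes> s y) \<notin> N} \<subseteq> (\<lambda>z. s x \<rhd> z) ` N"
  proof
   fix y assume "y \<in> {y\<in>space M. \<not> \<pi> (inv (s x) \<otimes> s y) \<notin> N}"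
   then have y: "y \<in> space M" "\<pi> (inv (s x) \<otimes> s y) \<in> N" by auto
   have "s x \<rhd> \<pi> (inv (s x) \<otimes> s y) = y"
    using act_\<pi>[of "s x" "inv (s x) \<otimes> s y"] x y(1) by (simp add: m_assoc[symmetric])
   then show "y \<in> (\<lambda>z. s x \<rhd> z) ` N" using y(2) by (metis imageI)
  qed
 qed
 then have "AE x in M. AE y in M. \<pi> (inv (s x) \<otimes> s y) \<notin> N" by (rule AE_I2)
 moreover have "{p\<in>space (M \<Otimes>\<^sub>M M). \<pi> (inv (s (fst p)) \<otimes> s (snd p)) \<notin> N} \<in> sets (M \<Otimes>\<^sub>M M)"
  by (rule notin_sets[OF m NM])
 ultimately have "AE y in M. AE x in M. \<pi> (inv (s x) \<otimes> s y) \<notin> N"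
  using P.AE_commute[of "\<lambda>x y. \<pi> (inv (s x) \<otimes> s y) \<notin> N"] by simp
 then have "AE y in M. y \<in> space M \<and> (AE x in M. \<pi> (inv (s x) \<otimes> s y) \<notin> N)"
  by (intro eventually_conj AE_space)
 then obtain y where y: "y \<in> space M" "AE x in M. \<pi> (inv (s x) \<otimes> s y) \<notin> N"
  using eventually_happens'[OF ae_filter_nontrivial] by blast
 have "AE x in M. (\<pi> (inv (s x) \<otimes> s y) \<in> N) = False" using y(2) by simp
 from AE_translate[OF NM N(2) y(1) this] show ?thesis by simp
qed

text \<open>By \<open>\<psi>_eq\<close> this is, up to a left factor in \<Gamma>, the composite of
  \<beta> at \<open>x\<close> with \<beta> at the coset of the inverse of \<open>s x\<close>. The
  normalization chosen here commutes with \<Gamma> exactly, so the averaged self-map is homotopic to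
  the identity.\<close>

definition \<psi> :: "'g set \<Rightarrow> 'g \<Rightarrow> 'g" where "\<psi> x g = inv (\<kappa> (inv (\<beta> x g) \<otimes> inv (s x)))"

lemma \<psi>_meas: "g \<in> carrier G \<Longrightarrow> (\<lambda>x. \<psi> x g) \<in> M \<rightarrow>\<^sub>M count_space \<Gamma>"
 unfolding \<psi>_def by (intro \<kappa>_meas' mult_meas' inv_meas' s_meas \<Gamma>_meas[OF \<beta>_meas])

lemma \<psi>_act:
 assumes c: "c \<in> \<Gamma>" and h: "h \<in> \<Gamma>" and x: "x \<in> space M"
 shows "\<psi> (c \<rhd> x) (c \<otimes> h) = c \<otimes> \<psi> x h"
proof -
 obtain d where d: "d \<in> \<Gamma>" "s (c \<rhd> x) = c \<otimes> s x \<otimes> d" by (rule act_s[OF mem_carrier[OF c] x])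
 note closed = mem_carrier[OF c] mem_carrier[OF h] mem_carrier[OF d(1)] s_closed[OF x] mem_carrier[OF \<beta>_closed[OF mem_carrier[OF h] x]]
 have "inv (inv d \<otimes> \<beta> x h) \<otimes> inv (c \<otimes> s x \<otimes> d) = (inv (\<beta> x h) \<otimes> inv (s x)) \<otimes> inv c"
  using closed by (simp add: inv_mult_group m_assoc) (simp add: m_assoc[symmetric])
 then have "\<psi> (c \<rhd> x) (c \<otimes> h) = inv (\<kappa> (inv (\<beta> x h) \<otimes> inv (s x)) \<otimes> inv c)"
  unfolding \<psi>_def \<beta>_act[OF closed(1,2) x d] d(2) using closed c by (simp add: \<kappa>_mult)
 also have "\<dots> = c \<otimes> \<psi> x h"
  unfolding \<psi>_def using closed mem_carrier[OF \<kappa>_closed[of "inv (\<beta> x h) \<otimes> inv (s x)"]] by (simp add: inv_mult_group)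
 finally show ?thesis .
qed

lemma \<psi>_eq:
 assumes h: "h \<in> \<Gamma>" and x: "x \<in> space M" and d: "d \<in> \<Gamma>" "s (\<pi> (inv (s x))) = inv (s x) \<otimes> d"
 shows "\<beta> (\<pi> (inv (s x))) (\<beta> x h) = inv d \<otimes> \<psi> x h"
proof -
 note closed = mem_carrier[OF h] mem_carrier[OF d(1)] s_closed[OF x] mem_carrier[OF \<beta>_closed[OF mem_carrier[OF h] x]]
 have "inv (\<beta> x h) \<otimes> (inv (s x) \<otimes> d) = (inv (\<beta> x h) \<otimes> inv (s x)) \<otimes> d" using closed by (simp add: m_assoc)
 then show ?thesis
  unfolding \<beta>_def[of "\<pi> (inv (s x))"] \<psi>_def d(2)
  using closed d(1) mem_carrier[OF \<kappa>_closed[of "inv (\<beta> x h) \<otimes> inv (s x)"]] by (simp add: \<kappa>_mult inv_mult_group)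
qed

lemma \<psi>_random_map: "random_map M \<G> \<G> (\<lambda>g x. g \<rhd> x) \<psi>"
proof (rule random_map.intro)
 fix c x assume "c \<in> carrier \<G>" "x \<in> space M"
 then show "\<exists>d\<in>carrier \<G>. \<forall>h\<in>carrier \<G>. \<psi> (c \<rhd> x) (c \<otimes>\<^bsub>\<G>\<^esub> h) = d \<otimes>\<^bsub>\<G>\<^esub> \<psi> x h"
  by (intro bexI[of _ c]) (simp_all add: \<psi>_act)
qed (use finite total \<G>_group act_meas act_distr countable \<psi>_meas in auto)

lemma \<psi>_homotopy:
 assumes a: "a \<in> cocycles \<G> q"
 shows "(\<lambda>gs. average M \<psi> \<G> q a gs - a gs) \<in> cobs \<G> q"
proof -
 have id: "random_map M \<G> \<G> (\<lambda>g x. g \<rhd> x) (\<lambda>x g. g)"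
 proof (rule random_map.intro)
  show "\<exists>d\<in>carrier \<G>. \<forall>h\<in>carrier \<G>. c \<otimes>\<^bsub>\<G>\<^esub> h = d \<otimes>\<^bsub>\<G>\<^esub> h" if "c \<in> carrier \<G>" for c using that by blast
 qed (use finite total \<G>_group act_meas act_distr countable in auto)
 have B: "(\<lambda>gs. average M \<psi> \<G> q a gs - average M (\<lambda>x g. g) \<G> q a gs) \<in> cobs \<G> q"
 proof (rule random_map_homotopy[OF id \<psi>_random_map _ a])
  fix c x assume "c \<in> carrier \<G>" "x \<in> space M"
  then show "\<exists>d\<in>carrier \<G>. \<forall>h\<in>carrier \<G>. c \<otimes>\<^bsub>\<G>\<^esub> h = d \<otimes>\<^bsub>\<G>\<^esub> h \<and> \<psi> (c \<rhd> x) (c \<otimes>\<^bsub>\<G>\<^esub> h) = d \<otimes>\<^bsub>\<G>\<^esub> \<psi> x h"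
   by (intro bexI[of _ c]) (simp_all add: \<psi>_act)
 qed
 have "average M (\<lambda>x g. g) \<G> q a gs = a gs" for gs
  using cochainsD(1)[OF cocyclesD(1)[OF a], of gs] total by (simp add: average_def)
 with B show ?thesis by simp
qed

end

section \<open>From densities on the quotient to coboundaries of the lattice\<close>

context measured_quotient
begin

lemma set_integral_bd:
 assumes "\<And>hs. length gs = Suc (length hs) \<Longrightarrow> set hs \<subseteq> set gs \<Longrightarrow> integrable M (e hs)" "A \<in> sets M"
 shows "(\<integral>x\<in>A. bd (\<lambda>hs. e hs x) gs \<partial>M) = bd (\<lambda>hs. \<integral>x\<in>A. e hs x \<partial>M) gs"
proof -
 have "(\<integral>x. bd (\<lambda>hs. indicator A x * e hs x) gs \<partial>M) = bd (\<lambda>hs. \<integral>x. indicator A x * e hs x \<partial>M) gs"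
  using integrable_mult_indicator[OF assms(2) assms(1)] by (intro integral_bd(1)) simp
 then show ?thesis by (simp add: set_lebesgue_integral_def bd_cmult)
qed

lemma set_integral_act:
 assumes "g \<in> carrier G" "A \<in> sets M" "f \<in> borel_measurable M"
 shows "(\<integral>x\<in>A. f (g \<rhd> x) \<partial>M) = (\<integral>x\<in>(\<lambda>x. g \<rhd> x) ` A. (f x :: real) \<partial>M)"
proof -
 let ?A = "(\<lambda>x. g \<rhd> x) ` A"
 have AM: "A \<subseteq> space M" by (rule sets.sets_into_space[OF assms(2)])
 have inv: "g \<rhd> x \<in> ?A \<longleftrightarrow> x \<in> A" if "x \<in> space M" for x
  using act_inv_image[of "inv g" A] act_act[of "inv g" g x] act_one[OF that] assms(1) AM that by auto
 have "(\<integral>x\<in>?A. f x \<partial>M) = (\<integral>x. indicator ?A (g \<rhd> x) *\<^sub>R f (g \<rhd> x) \<partial>M)"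
  unfolding set_lebesgue_integral_def
  by (rule integral_invariant[OF act_meas[OF assms(1)] act_distr[OF assms(1)], symmetric])
   (use assms act_image_sets in simp)
 also have "\<dots> = (\<integral>x\<in>A. f (g \<rhd> x) \<partial>M)"
  unfolding set_lebesgue_integral_def
  by (rule Bochner_Integration.integral_cong[OF refl]) (simp add: indicator_def inv)
 finally show ?thesis ..
qed

lemma countable_tuples: "countable (tuples \<G> k)"
 by (rule countable_subset[of _ "lists \<Gamma>"]) (auto simp: tuples_def countable_lists[OF countable])

text \<open>
 The densities \<open>e\<close> of the primitive \<open>E\<close> exhibit \<open>a\<close>, read along the orbit of almost every point,
 as a coboundary; integrating over the points \<open>\<pi> (inv (s x))\<close> keeps the \<open>\<Gamma>\<close>-invariance.
\<close>

lemma coboundary_from_densities: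
 fixes E :: "'g list \<Rightarrow> 'g set set \<Rightarrow> real"
 assumes a: "a \<in> cocycles \<G> (Suc k)" and C: "0 \<le> C"
  and add: "\<And>hs A A'. hs \<in> tuples \<G> k \<Longrightarrow> A \<in> sets M \<Longrightarrow> A' \<in> sets M \<Longrightarrow> A \<inter> A' = {} \<Longrightarrow> E hs (A \<union> A') = E hs A + E hs A'"
  and bound: "\<And>hs A. hs \<in> tuples \<G> k \<Longrightarrow> A \<in> sets M \<Longrightarrow> \<bar>E hs A\<bar> \<le> C * measure M A"
  and inv: "\<And>c hs A. c \<in> \<Gamma> \<Longrightarrow> hs \<in> tuples \<G> k \<Longrightarrow> A \<in> sets M \<Longrightarrow> E (map (\<lambda>x. c \<otimes> x) hs) ((\<lambda>x. c \<rhd> x) ` A) = E hs A"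
  and prim: "\<And>gs A. gs \<in> tuples \<G> (Suc k) \<Longrightarrow> A \<in> sets M \<Longrightarrow> (\<integral>x\<in>A. a (map (\<beta> x) gs) \<partial>M) = bd (\<lambda>hs. E hs A) gs"
 shows "a \<in> cobs \<G> (Suc k)"
proof -
 note aD = cocyclesD[OF a]
 have ex: "\<forall>hs. \<exists>f. f \<in> borel_measurable M \<and> (\<forall>x. \<bar>f x\<bar> \<le> C) \<and> (hs \<in> tuples \<G> k \<longrightarrow> (\<forall>A\<in>sets M. E hs A = (\<integral>x\<in>A. f x \<partial>M)))"
 proof
  fix hs
  show "\<exists>f. f \<in> borel_measurable M \<and> (\<forall>x. \<bar>f x\<bar> \<le> C) \<and> (hs \<in> tuples \<G> k \<longrightarrow> (\<forall>A\<in>sets M. E hs A = (\<integral>x\<in>A. f x \<partial>M)))"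
 proof (cases "hs \<in> tuples \<G> k")
  case True
  obtain f where "f \<in> borel_measurable M" "\<forall>x. \<bar>f x\<bar> \<le> C" "\<forall>A\<in>sets M. E hs A = (\<integral>x\<in>A. f x \<partial>M)"
   by (rule dominated_density[OF finite C add[OF True] bound[OF True]])
  then show ?thesis by blast
 next
  case False
  then show ?thesis using C by (intro exI[of _ "\<lambda>x. 0"]) simp
 qed
 qed
 from choice[OF ex] obtain e where e_all: "\<forall>hs. e hs \<in> borel_measurable M \<and> (\<forall>x. \<bar>e hs x\<bar> \<le> C) \<and>
   (hs \<in> tuples \<G> k \<longrightarrow> (\<forall>A\<in>sets M. E hs A = (\<integral>x\<in>A. e hs x \<partial>M)))"
  by blast
 have em: "e hs \<in> borel_measurable M" and ebound: "\<bar>e hs x\<bar> \<le> C" for hs x using e_all by blast+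
 have eE: "E hs A = (\<integral>x\<in>A. e hs x \<partial>M)" if "hs \<in> tuples \<G> k" "A \<in> sets M" for hs A using e_all that by blast
 have eint: "integrable M (e hs)" for hs by (rule bounded_integrable[OF finite em ebound])
 have sub: "set gs \<subseteq> carrier G" if "gs \<in> tuples \<G> q" for gs q using that subset by (auto simp: tuples_def)
 have face: "hs \<in> tuples \<G> k" if "gs \<in> tuples \<G> (Suc k)" "length gs = Suc (length hs)" "set hs \<subseteq> set gs" for gs hs
  using that by (rule tuples_face)
 have map\<G>: "map (\<lambda>x. c \<otimes> x) hs \<in> tuples \<G> k" if "c \<in> \<Gamma>" "hs \<in> tuples \<G> k" for c hs
  using tuples_map[OF \<G>_group, of c hs k] that by simp
 have aint: "integrable M (\<lambda>x. a (map (\<beta> x) gs))" if "gs \<in> tuples \<G> (Suc k)" for gs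
  by (rule rm.map_integrable[OF sub[OF that] aD(1)])
 have 1: "AE x in M. a (map (\<beta> x) gs) = bd (\<lambda>hs. e hs x) gs" if gs: "gs \<in> tuples \<G> (Suc k)" for gs
 proof (rule density_unique_real[OF aint[OF gs]])
  show "integrable M (\<lambda>x. bd (\<lambda>hs. e hs x) gs)" by (rule integral_bd(2)) (rule eint)
  fix A assume A: "A \<in> sets M"
  have "bd (\<lambda>hs. E hs A) gs = bd (\<lambda>hs. \<integral>x\<in>A. e hs x \<partial>M) gs"
   by (rule bd_cong) (rule eE[OF face[OF gs] A])
  then show "(\<integral>x\<in>A. a (map (\<beta> x) gs) \<partial>M) = (\<integral>x\<in>A. bd (\<lambda>hs. e hs x) gs \<partial>M)"
   using prim[OF gs A] set_integral_bd[of gs e, OF eint A] by simp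
 qed
 have 2: "AE x in M. e (map (\<lambda>x. c \<otimes> x) hs) (c \<rhd> x) = e hs x" if c: "c \<in> \<Gamma>" and hs: "hs \<in> tuples \<G> k" for c hs
 proof (rule density_unique_real[OF _ eint])
  note cG = mem_carrier[OF c]
  have m: "(\<lambda>x. e (map (\<lambda>x. c \<otimes> x) hs) (c \<rhd> x)) \<in> borel_measurable M"
   by (rule measurable_compose[OF act_meas[OF cG] em])
  show "integrable M (\<lambda>x. e (map (\<lambda>x. c \<otimes> x) hs) (c \<rhd> x))" by (rule bounded_integrable[OF finite m ebound])
  fix A assume A: "A \<in> sets M"
  show "(\<integral>x\<in>A. e (map (\<lambda>x. c \<otimes> x) hs) (c \<rhd> x) \<partial>M) = (\<integral>x\<in>A. e hs x \<partial>M)"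
   using set_integral_act[OF cG A em] eE[OF map\<G>[OF c hs] act_image_sets[OF cG A]] inv[OF c hs A] eE[OF hs A] by simp
 qed
 \<comment> \<open>The tuples of the lattice are countably many, so all identities for densities
   hold simultaneously off one null set.\<close>
 have "AE x in M. (\<forall>gs\<in>tuples \<G> (Suc k). a (map (\<beta> x) gs) = bd (\<lambda>hs. e hs x) gs) \<and>
   (\<forall>c\<in>\<Gamma>. \<forall>hs\<in>tuples \<G> k. e (map (\<lambda>x. c \<otimes> x) hs) (c \<rhd> x) = e hs x)"
  by (intro AE_conjI AE_ball_countable[THEN iffD2] ballI countable_tuples countable 1 2)
 then obtain N where N: "N \<in> null_sets M" "\<forall>c\<in>\<Gamma>. \<forall>x\<in>space M. c \<rhd> x \<in> N \<longleftrightarrow> x \<in> N"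
  and Nall: "\<forall>x\<in>space M. x \<notin> N \<longrightarrow> (\<forall>gs\<in>tuples \<G> (Suc k). a (map (\<beta> x) gs) = bd (\<lambda>hs. e hs x) gs) \<and>
   (\<forall>c\<in>\<Gamma>. \<forall>hs\<in>tuples \<G> k. e (map (\<lambda>x. c \<otimes> x) hs) (c \<rhd> x) = e hs x)"
  by (rule AE_invariant)
 have N1: "a (map (\<beta> x) gs) = bd (\<lambda>hs. e hs x) gs" if "x \<in> space M" "x \<notin> N" "gs \<in> tuples \<G> (Suc k)" for x gs
  using Nall that by blast
 have N2: "e (map (\<lambda>x. c \<otimes> x) hs) (c \<rhd> x) = e hs x" if "x \<in> space M" "x \<notin> N" "c \<in> \<Gamma>" "hs \<in> tuples \<G> k" for x c hs
  using Nall that by blast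
 define y where "y x = \<pi> (inv (s x))" for x
 have y_space: "y x \<in> space M" if "x \<in> space M" for x using that \<pi>_space[of "inv (s x)"] by (simp add: y_def)
 have y_meas: "y \<in> M \<rightarrow>\<^sub>M M" unfolding y_def by (intro \<pi>_meas' inv_meas' s_meas)
 have AEy: "AE x in M. y x \<notin> N" unfolding y_def by (rule AE_inverse[OF N])
 \<comment> \<open>By \<open>\<psi>_eq\<close> the boundary of \<open>F\<close> at \<open>x\<close>
   is the cocycle evaluated on the images under \<open>\<psi> x\<close>. The change of \<beta> under
   \<Gamma> is matched by the change of the point \<open>y x\<close>, so the integral of
   \<open>F\<close> is \<Gamma>-invariant.\<close>
 define F where "F hs x = e (map (\<beta> x) hs) (y x)" for hs x
 interpret rp: random_map M \<G> \<G> "\<lambda>g x. g \<rhd> x" \<psi> by (rule \<psi>_random_map)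
 have \<beta>t: "map (\<beta> x) hs \<in> tuples \<G> q" if "x \<in> space M" "hs \<in> tuples \<G> q" for x hs q
  by (rule tuples_map_closed[OF _ that(2)]) (simp add: that(1) mem_carrier)
 have Fm: "F hs \<in> borel_measurable M" if "hs \<in> tuples \<G> q" for hs q
 proof -
  have "(\<lambda>x. map (\<beta> x) hs) \<in> M \<rightarrow>\<^sub>M count_space (lists \<Gamma>)"
   using sub[OF that] by (intro measurable_map_countable[OF countable] \<beta>_meas) blast
  moreover have "(\<lambda>x. e i (y x)) \<in> borel_measurable M" for i by (rule measurable_compose[OF y_meas em])
  ultimately show ?thesis
   unfolding F_def using measurable_compose_countable'[of "lists \<Gamma>" "\<lambda>i x. e i (y x)", OF _ _ countable_lists[OF countable]]
   by blast
 qed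
 have Fbound: "\<bar>F hs x\<bar> \<le> C" for hs x unfolding F_def by (rule ebound)
 have Fint: "integrable M (F hs)" if "hs \<in> tuples \<G> q" for hs q by (rule bounded_integrable[OF finite Fm[OF that] Fbound])
 define \<Phi> where "\<Phi> hs = (\<integral>x. F hs x \<partial>M)" for hs
 have av: "average M \<psi> \<G> (Suc k) a \<in> cobs \<G> (Suc k)"
 proof (rule cobsI[OF rp.average_cochain[OF aD(1)] _ _ \<G>_group])
  fix k' assume "Suc k = Suc k'"
  then have k': "k' = k" by simp
  show "\<exists>w C. (\<forall>gs\<in>tuples \<G> k'. \<bar>w gs\<bar> \<le> C) \<and>
    (\<forall>g\<in>carrier \<G>. \<forall>gs\<in>tuples \<G> k'. w (map (\<lambda>x. g \<otimes>\<^bsub>\<G>\<^esub> x) gs) = w gs) \<and>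
    (\<forall>gs\<in>tuples \<G> (Suc k). average M \<psi> \<G> (Suc k) a gs = bd w gs)"
   unfolding k'
  proof (intro exI conjI ballI)
   fix hs assume hs: "hs \<in> tuples \<G> k"
   show "\<bar>\<Phi> hs\<bar> \<le> C" unfolding \<Phi>_def by (rule bounded_integral_bound[OF finite Fm[OF hs] Fbound total])
   fix c assume "c \<in> carrier \<G>"
   then have c: "c \<in> \<Gamma>" by simp
   note cG = mem_carrier[OF c]
   let ?hs = "map (\<lambda>x. c \<otimes> x) hs"
   note hs' = map\<G>[OF c hs]
   have "\<Phi> ?hs = (\<integral>x. F ?hs (c \<rhd> x) \<partial>M)"
    unfolding \<Phi>_def by (rule integral_invariant[OF act_meas[OF cG] act_distr[OF cG] Fm[OF hs'], symmetric])
   also have "\<dots> = \<Phi> hs"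
    unfolding \<Phi>_def
   proof (rule integral_cong_AE)
    show "(\<lambda>x. F ?hs (c \<rhd> x)) \<in> borel_measurable M" by (rule measurable_compose[OF act_meas[OF cG] Fm[OF hs']])
    show "F hs \<in> borel_measurable M" by (rule Fm[OF hs])
    show "AE x in M. F ?hs (c \<rhd> x) = F hs x"
     using AEy AE_space
    proof eventually_elim
     fix x assume yx: "y x \<notin> N" and x: "x \<in> space M"
     obtain d where d: "d \<in> \<Gamma>" "s (c \<rhd> x) = c \<otimes> s x \<otimes> d" by (rule act_s[OF cG x])
     note id = m_inv_closed[OF d(1)]
     have "map (\<beta> (c \<rhd> x)) ?hs = map (\<lambda>z. inv d \<otimes> z) (map (\<beta> x) hs)"
      using \<beta>_act[OF cG _ x d] sub[OF hs] by (simp add: subset_iff)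
     moreover have "y (c \<rhd> x) = inv d \<rhd> y x"
     proof -
      have "inv (c \<otimes> s x \<otimes> d) = (inv d \<otimes> inv (s x)) \<otimes> inv c"
       using cG d(1) mem_carrier x by (simp add: inv_mult_group m_assoc)
      then show ?thesis
       unfolding y_def d(2) using act_\<pi>[of "inv d" "inv (s x)"] mem_carrier[OF id] x c by simp
     qed
     ultimately show "F ?hs (c \<rhd> x) = F hs x"
      unfolding F_def using N2[OF y_space[OF x] yx id \<beta>t[OF x hs]] by (simp only:)
    qed
   qed
   finally show "\<Phi> (map (\<lambda>x. c \<otimes>\<^bsub>\<G>\<^esub> x) hs) = \<Phi> hs" by simp
  next
   fix gs assume gs: "gs \<in> tuples \<G> (Suc k)"
   have "(\<integral>x. a (map (\<psi> x) gs) \<partial>M) = (\<integral>x. bd (\<lambda>hs. F hs x) gs \<partial>M)"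
   proof (rule integral_cong_AE)
    show "(\<lambda>x. a (map (\<psi> x) gs)) \<in> borel_measurable M"
     by (rule rp.map_measurable) (use gs in \<open>simp add: tuples_def\<close>)
    have "integrable M (\<lambda>x. bd (\<lambda>hs. F hs x) gs)" by (rule integral_bd(2)) (rule Fint[OF face[OF gs]])
    then show "(\<lambda>x. bd (\<lambda>hs. F hs x) gs) \<in> borel_measurable M" by simp
    show "AE x in M. a (map (\<psi> x) gs) = bd (\<lambda>hs. F hs x) gs"
     using AEy AE_space
    proof eventually_elim
     fix x assume yx: "y x \<notin> N" and x: "x \<in> space M"
     obtain d where d: "d \<in> \<Gamma>" "s (\<pi> (inv (s x))) = inv (s x) \<otimes> d" by (rule s_\<pi>[of "inv (s x)"]) (use x in simp)
     have gs\<Gamma>: "set gs \<subseteq> \<Gamma>" using gs by (simp add: tuples_def)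
     have "map (\<beta> (y x)) (map (\<beta> x) gs) = map (\<lambda>z. inv d \<otimes> z) (map (\<psi> x) gs)"
      using \<psi>_eq[OF _ x d] gs\<Gamma> by (simp add: y_def subset_iff)
     then have "a (map (\<psi> x) gs) = a (map (\<beta> (y x)) (map (\<beta> x) gs))"
      using cochainsD(2)[OF aD(1) _ rp.map_tuples[OF x gs], of "inv d"] m_inv_closed[OF d(1)] by (simp del: map_map)
     also have "\<dots> = bd (\<lambda>hs. e hs (y x)) (map (\<beta> x) gs)"
      by (rule N1[OF y_space[OF x] yx \<beta>t[OF x gs]])
     also have "\<dots> = bd (\<lambda>hs. F hs x) gs" unfolding bd_map F_def ..
     finally show "a (map (\<psi> x) gs) = bd (\<lambda>hs. F hs x) gs" .
    qed
   qed
   also have "\<dots> = bd \<Phi> gs" unfolding \<Phi>_def by (rule integral_bd(1)) (rule Fint[OF face[OF gs]])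
   finally show "average M \<psi> \<G> (Suc k) a gs = bd \<Phi> gs" using gs by (simp add: average_def)
  qed
 qed simp
 \<comment> \<open>The average along \<psi> differs from the cocycle itself by the coboundary of
   \<open>\<psi>_homotopy\<close>.\<close>
 have "(\<lambda>gs. average M \<psi> \<G> (Suc k) a gs - (average M \<psi> \<G> (Suc k) a gs - a gs)) \<in> cobs \<G> (Suc k)"
  using fun_space.subspace_diff[OF subspace_cobs av \<psi>_homotopy[OF a]] by (simp only: fun_diff_def)
 then show ?thesis by simp
qed

end

section \<open>Reduction of injectivity to a primitive of the obstruction\<close>

context measured_quotient
begin

text \<open>A cochain of the whole group, with values in dominated additive set functions, whose
  coboundary is the obstruction: the partial averages of \<open>a\<close> over measurable sets minus
  their expected share of the full average.\<close>

definition primitive :: "('g list \<Rightarrow> real) \<Rightarrow> nat \<Rightarrow> ('g list \<Rightarrow> 'g set set \<Rightarrow> real) \<Rightarrow> real \<Rightarrow> bool" where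
 "primitive a k E C \<longleftrightarrow> (\<forall>hs\<in>tuples G k. (\<forall>A\<in>sets M. \<forall>A'\<in>sets M. A \<inter> A' = {} \<longrightarrow> E hs (A \<union> A') = E hs A + E hs A') \<and>
    (\<forall>A\<in>sets M. \<bar>E hs A\<bar> \<le> C * measure M A) \<and>
    (\<forall>g\<in>carrier G. \<forall>A\<in>sets M. E (map (\<lambda>x. g \<otimes> x) hs) ((\<lambda>x. g \<rhd> x) ` A) = E hs A)) \<and>
   (\<forall>gs\<in>tuples G (Suc k). \<forall>A\<in>sets M.
    (\<integral>x\<in>A. a (map (\<beta> x) gs) \<partial>M) - j (Suc k) a gs * measure M A = bd (\<lambda>hs. E hs A) gs)"

theorem j_injective:
 assumes a: "a \<in> cocycles \<G> q" and j: "j q a \<in> cobs G q"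
  and E: "\<And>k. q = Suc k \<Longrightarrow> \<exists>E C. primitive a k E C"
 shows "a \<in> cobs \<G> q"
proof (cases q)
 case 0
 note aD = cocyclesD[OF a]
 define v where "v = a [\<one>]"
 have const: "a [c] = v" if "c \<in> \<Gamma>" for c
  using cochainsD(2)[OF aD(1), of c "[\<one>]"] that subgroup.one_closed[OF subgroup] mem_carrier[OF that]
  by (simp add: tuples_def 0 v_def)
 have "(\<integral>x. a (map (\<beta> x) [\<one>]) \<partial>M) = (\<integral>x. v \<partial>M)"
  by (rule Bochner_Integration.integral_cong[OF refl]) (simp add: const)
 then have "j q a [\<one>] = v" using total unfolding j_def average_def by (simp add: tuples_def 0)
 then have "v = 0" using j by (simp add: 0)
 have "a gs = 0" if gs: "gs \<in> tuples \<G> 0" for gs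
 proof -
  obtain c where "gs = [c]" "c \<in> \<Gamma>" using gs by (auto simp: tuples_def length_Suc_conv)
  then show ?thesis using const[of c] \<open>v = 0\<close> by simp
 qed
 then show ?thesis using cochainsD(1)[OF aD(1)] 0 by (auto simp: fun_eq_iff)
next
 case (Suc k)
 obtain E C where "primitive a k E C" using E[OF Suc] by blast
 note E1 = conjunct1[OF this[unfolded primitive_def]] and E2 = conjunct2[OF this[unfolded primitive_def]]
 obtain b where b: "b \<in> cochains G k" "j q a = coboundary G k b" using j Suc by auto
 obtain C' where C': "0 \<le> C'" "\<forall>gs. \<bar>b gs\<bar> \<le> C'" by (rule cochains_bound[OF b(1)])
 \<comment> \<open>If the full average is the coboundary of \<open>b\<close>, adding
   \<open>b\<close> times the measure absorbs the mean term, and the partial averages themselves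
   acquire a primitive.\<close>
 define E' where "E' hs A = E hs A + b hs * measure M A" for hs A
 have sub: "hs \<in> tuples G q" if "hs \<in> tuples \<G> q" for hs q using that subset by (auto simp: tuples_def)
 have "a \<in> cobs \<G> (Suc k)"
 proof (rule coboundary_from_densities[where E = E' and C = "\<bar>C\<bar> + C'"])
  fix hs A assume hs: "hs \<in> tuples \<G> k" and A: "A \<in> sets M"
  have "\<bar>E hs A\<bar> \<le> C * measure M A" by (rule bspec[OF conjunct1[OF conjunct2[OF bspec[OF E1 sub[OF hs]]]] A])
  also have "\<dots> \<le> \<bar>C\<bar> * measure M A" by (intro mult_right_mono) auto
  finally have 1: "\<bar>E hs A\<bar> \<le> \<bar>C\<bar> * measure M A" .
  have 2: "\<bar>b hs * measure M A\<bar> \<le> C' * measure M A"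
   using mult_right_mono[OF spec[OF C'(2), of hs], of "measure M A"] by (simp only: abs_mult abs_of_nonneg[OF measure_nonneg] measure_nonneg simp_thms)
  show "\<bar>E' hs A\<bar> \<le> (\<bar>C\<bar> + C') * measure M A"
   unfolding E'_def distrib_right by (rule order_trans[OF abs_triangle_ineq add_mono[OF 1 2]])
  fix A' assume A': "A' \<in> sets M" "A \<inter> A' = {}"
  have "E hs (A \<union> A') = E hs A + E hs A'"
   using bspec[OF bspec[OF conjunct1[OF bspec[OF E1 sub[OF hs]]] A] A'(1)] A'(2) by simp
  then show "E' hs (A \<union> A') = E' hs A + E' hs A'"
   using finite_measure_Union[OF A A'] by (simp add: E'_def algebra_simps)
 next
  fix c hs A assume c: "c \<in> \<Gamma>" and hs: "hs \<in> tuples \<G> k" and A: "A \<in> sets M"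
  note cG = mem_carrier[OF c]
  have "E (map (\<lambda>x. c \<otimes> x) hs) ((\<lambda>x. c \<rhd> x) ` A) = E hs A"
   by (rule bspec[OF bspec[OF conjunct2[OF conjunct2[OF bspec[OF E1 sub[OF hs]]]] cG] A])
  moreover have "measure M ((\<lambda>x. c \<rhd> x) ` A) = measure M A" using invariant[OF cG A] by (simp add: measure_def)
  ultimately show "E' (map (\<lambda>x. c \<otimes> x) hs) ((\<lambda>x. c \<rhd> x) ` A) = E' hs A"
   using cochainsD(2)[OF b(1) cG sub[OF hs]] by (simp add: E'_def)
 next
  fix gs A assume gs: "gs \<in> tuples \<G> (Suc k)" and A: "A \<in> sets M"
  have "j q a gs = bd b gs" unfolding b(2) coboundary_eq using sub[OF gs] by simp
  moreover have "(\<integral>x\<in>A. a (map (\<beta> x) gs) \<partial>M) - j q a gs * measure M A = bd (\<lambda>hs. E hs A) gs"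
   using bspec[OF bspec[OF E2 sub[OF gs]] A] Suc by simp
  moreover have "bd (\<lambda>hs. E' hs A) gs = bd (\<lambda>hs. E hs A) gs + measure M A * bd b gs"
   unfolding E'_def by (simp only: bd_add bd_cmult mult.commute[of _ "measure M A"])
  ultimately show "(\<integral>x\<in>A. a (map (\<beta> x) gs) \<partial>M) = bd (\<lambda>hs. E' hs A) gs" by (simp add: mult.commute)
 qed (use a Suc C'(1) in auto)
 then show ?thesis using Suc by simp
qed

end

section \<open>Ergodicity\<close>

context measured_quotient
begin

definition vim :: "'g \<Rightarrow> 'g set set \<Rightarrow> 'g set set" where "vim g A = (\<lambda>x. g \<rhd> x) -` A \<inter> space M"

text \<open>A length function of \<open>g\<close> by \<open>disp_mult\<close>,
  \<open>disp_inv\<close> and \<open>disp_one\<close>; its zeros are the group elements preserving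
  \<open>A\<close> up to null sets.\<close>

definition disp :: "'g set set \<Rightarrow> 'g \<Rightarrow> real" where "disp A g = measure M (sym_diff A (vim g A))"

lemma vim_sets: "g \<in> carrier G \<Longrightarrow> A \<in> sets M \<Longrightarrow> vim g A \<in> sets M"
 unfolding vim_def by (rule measurable_sets[OF act_meas])

lemma vim_measure: "g \<in> carrier G \<Longrightarrow> A \<in> sets M \<Longrightarrow> measure M (vim g A) = measure M A"
 using measure_distr[OF act_meas, of g A] act_distr[of g] by (simp add: vim_def)

lemma vim_vim: "g \<in> carrier G \<Longrightarrow> h \<in> carrier G \<Longrightarrow> vim h (vim g A) = vim (g \<otimes> h) A"
 by (auto simp: vim_def act_act)

lemma vim_one: "A \<in> sets M \<Longrightarrow> vim \<one> A = A"
 using sets.sets_into_space[of A M] by (auto simp: vim_def act_one)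

lemma vim_sym_diff: "vim g (sym_diff A A') = sym_diff (vim g A) (vim g A')"
 by (auto simp: vim_def)

lemma sym_diff_triangle:
 assumes "A \<in> sets M" "A' \<in> sets M" "A'' \<in> sets M"
 shows "measure M (sym_diff A A'') \<le> measure M (sym_diff A A') + measure M (sym_diff A' A'')"
proof -
 have "measure M (sym_diff A A'') \<le> measure M (sym_diff A A' \<union> sym_diff A' A'')"
  by (rule finite_measure_mono) (use assms in auto)
 also have "\<dots> \<le> measure M (sym_diff A A') + measure M (sym_diff A' A'')"
  by (rule measure_Un_le) (use assms in auto)
 finally show ?thesis .
qed

lemma disp_one: "A \<in> sets M \<Longrightarrow> disp A \<one> = 0"
 by (simp add: disp_def vim_one)

lemma disp_mult:
 assumes "A \<in> sets M" "g \<in> carrier G" "h \<in> carrier G"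
 shows "disp A (g \<otimes> h) \<le> disp A g + disp A h"
proof -
 have S: "sym_diff A (vim g A) \<in> sets M" using assms by (intro sets.Un sets.Diff vim_sets)
 have "disp A (g \<otimes> h) \<le> disp A h + measure M (sym_diff (vim h A) (vim h (vim g A)))"
  unfolding disp_def vim_vim[OF assms(2,3), symmetric] using assms by (intro sym_diff_triangle vim_sets)
 also have "measure M (sym_diff (vim h A) (vim h (vim g A))) = disp A g"
  unfolding disp_def vim_sym_diff[symmetric] by (rule vim_measure[OF assms(3) S])
 finally show ?thesis by simp
qed

lemma disp_inv:
 assumes "A \<in> sets M" "g \<in> carrier G"
 shows "disp A (inv g) = disp A g"
proof -
 have S: "sym_diff A (vim g A) \<in> sets M" using assms by (intro sets.Un sets.Diff vim_sets)
 have "disp A g = measure M (vim (inv g) (sym_diff A (vim g A)))"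
  unfolding disp_def by (rule vim_measure[OF inv_closed[OF assms(2)] S, symmetric])
 also have "vim (inv g) (sym_diff A (vim g A)) = sym_diff (vim (inv g) A) A"
  unfolding vim_sym_diff using vim_vim[of g "inv g" A] assms by (simp add: vim_one)
 also have "measure M (sym_diff (vim (inv g) A) A) = disp A (inv g)"
  unfolding disp_def by (simp add: Un_commute)
 finally show ?thesis ..
qed

lemma disp_AE:
 assumes "A \<in> sets M" "g \<in> carrier G" "disp A g = 0"
 shows "AE x in M. (g \<rhd> x \<in> A) = (x \<in> A)"
proof (rule AE_I')
 have "sym_diff A (vim g A) \<in> sets M" using assms by (intro sets.Un sets.Diff vim_sets)
 then show "sym_diff A (vim g A) \<in> null_sets M" using assms(3) by (simp add: disp_def null_sets_def emeasure_eq_measure)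
qed (auto simp: vim_def)

text \<open>Transitivity of the group on its quotient, in measurable form. \<open>A\<close> is first
  made strictly \<Gamma>-invariant. For each \<open>x\<close>, almost every \<open>y\<close> is in
  the set exactly when its translate by the inverse of \<open>s x\<close> is. After Fubini,
  \<open>AE_translate\<close> makes the condition on the translate independent of \<open>y\<close>,
  so membership is almost surely constant.\<close>

lemma ergodic:
 assumes A: "A \<in> sets M" and disp: "\<And>g. g \<in> carrier G \<Longrightarrow> disp A g = 0"
 shows "(AE x in M. x \<in> A) \<or> (AE x in M. x \<notin> A)"
proof -
 interpret P: pair_sigma_finite M M by unfold_locales
 have "AE x in M. \<forall>c\<in>\<Gamma>. (c \<rhd> x \<in> A) = (x \<in> A)"
  using disp_AE[OF A mem_carrier disp[OF mem_carrier]] by (subst AE_ball_countable[OF countable]) blast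
 then obtain N where N: "N \<in> null_sets M" "\<forall>c\<in>\<Gamma>. \<forall>x\<in>space M. c \<rhd> x \<in> N \<longleftrightarrow> x \<in> N"
  "\<forall>x\<in>space M. x \<notin> N \<longrightarrow> (\<forall>c\<in>\<Gamma>. (c \<rhd> x \<in> A) = (x \<in> A))" by (rule AE_invariant)
 define A' where "A' = A - N"
 have A': "A' \<in> sets M" using A N(1) by (auto simp: A'_def)
 have A'inv: "\<forall>c\<in>\<Gamma>. \<forall>x\<in>space M. c \<rhd> x \<in> A' \<longleftrightarrow> x \<in> A'"
  unfolding A'_def using N(2,3) by blast
 have AA': "AE x in M. (x \<in> A) = (x \<in> A')"
  by (rule AE_I'[OF N(1)]) (auto simp: A'_def)
 have m: "(\<lambda>p. \<pi> (inv (s (fst p)) \<otimes> s (snd p))) \<in> M \<Otimes>\<^sub>M M \<rightarrow>\<^sub>M M"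
  by (intro \<pi>_meas' mult_meas' inv_meas' s_meas') measurable
 have fibre: "AE y in M. (\<pi> (inv (s x) \<otimes> s y) \<in> A') = (y \<in> A')" if x: "x \<in> space M" for x
 proof -
  have sx: "inv (s x) \<in> carrier G" using x by simp
  have "AE y in distr M M (\<lambda>y. inv (s x) \<rhd> y). (y \<in> A) = (y \<in> A')" unfolding act_distr[OF sx] by (rule AA')
  then have "AE y in M. (inv (s x) \<rhd> y \<in> A) = (inv (s x) \<rhd> y \<in> A')"
   by (rule AE_distrD[OF act_meas[OF sx]])
  with disp_AE[OF A sx disp[OF sx]] AA' AE_space show ?thesis
   by eventually_elim (simp add: act_eq[OF sx])
 qed
 define E1 where "E1 = {p\<in>space (M \<Otimes>\<^sub>M M). \<pi> (inv (s (fst p)) \<otimes> s (snd p)) \<in> A'}"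
 define E2 where "E2 = {p\<in>space (M \<Otimes>\<^sub>M M). snd p \<in> A'}"
 have "E1 \<in> sets (M \<Otimes>\<^sub>M M)" "E2 \<in> sets (M \<Otimes>\<^sub>M M)"
  using measurable_sets[OF m A'] measurable_sets[OF measurable_snd A', of M]
  by (simp_all add: E1_def E2_def vimage_def Int_def conj_commute)
 then have "space (M \<Otimes>\<^sub>M M) - sym_diff E1 E2 \<in> sets (M \<Otimes>\<^sub>M M)" by (intro sets.compl_sets sets.Un sets.Diff)
 moreover have "space (M \<Otimes>\<^sub>M M) - sym_diff E1 E2 =
   {p\<in>space (M \<Otimes>\<^sub>M M). (\<pi> (inv (s (fst p)) \<otimes> s (snd p)) \<in> A') = (snd p \<in> A')}"
  by (auto simp: E1_def E2_def)
 ultimately have E: "{p\<in>space (M \<Otimes>\<^sub>M M). (\<pi> (inv (s (fst p)) \<otimes> s (snd p)) \<in> A') = (snd p \<in> A')} \<in> sets (M \<Otimes>\<^sub>M M)"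
  by simp
 have "AE x in M. AE y in M. (\<pi> (inv (s x) \<otimes> s y) \<in> A') = (y \<in> A')" by (rule AE_I2) (rule fibre)
 then have "AE y in M. AE x in M. (\<pi> (inv (s x) \<otimes> s y) \<in> A') = (y \<in> A')"
  by (rule iffD1[OF P.AE_commute[OF E]])
 then have const: "AE y in M. AE x in M. (\<pi> (inv (s x)) \<in> A') = (y \<in> A')"
  using AE_space by eventually_elim (rule AE_translate[OF A' A'inv])
 have "(AE y in M. y \<in> A') \<or> (AE y in M. y \<notin> A')"
 proof (cases "AE x in M. \<pi> (inv (s x)) \<in> A'")
  case True
  have "AE y in M. y \<in> A'"
   using const
  proof eventually_elim
   fix y assume "AE x in M. (\<pi> (inv (s x)) \<in> A') = (y \<in> A')"
   with True have "AE x in M. y \<in> A'" by eventually_elim simp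
   then show "y \<in> A'" using eventually_happens'[OF ae_filter_nontrivial] by blast
  qed
  then show ?thesis ..
 next
  case False
  have "AE y in M. y \<notin> A'"
   using const
  proof eventually_elim
   fix y assume *: "AE x in M. (\<pi> (inv (s x)) \<in> A') = (y \<in> A')"
   show "y \<notin> A'"
   proof
    assume "y \<in> A'"
    with * have "AE x in M. \<pi> (inv (s x)) \<in> A'" by simp
    with False show False ..
   qed
  qed
  then show ?thesis ..
 qed
 then show ?thesis
 proof
  assume "AE y in M. y \<in> A'"
  then have "AE y in M. y \<in> A" by eventually_elim (simp add: A'_def)
  then show ?thesis ..
 next
  assume "AE y in M. y \<notin> A'"
  with AA' have "AE y in M. y \<notin> A" by eventually_elim simp
  then show ?thesis ..
 qed
qed

text \<open>The density is invariant under \<open>g\<close> almost everywhere, so the set where it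
  is negative is null or conull. In either case the density has almost surely constant sign, and
  total mass zero forces it to vanish.\<close>

lemma invariant_dominated_zero:
 assumes add: "\<And>A A'. A \<in> sets M \<Longrightarrow> A' \<in> sets M \<Longrightarrow> A \<inter> A' = {} \<Longrightarrow> \<nu> (A \<union> A') = \<nu> A + \<nu> A'"
  and bound: "\<And>A. A \<in> sets M \<Longrightarrow> \<bar>\<nu> A\<bar> \<le> C * measure M A" and total0: "\<nu> (space M) = 0"
  and g: "g \<in> carrier G" and inv: "\<And>A. A \<in> sets M \<Longrightarrow> \<nu> ((\<lambda>x. g \<rhd> x) ` A) = \<nu> A"
  and erg: "\<And>A h. A \<in> sets M \<Longrightarrow> disp A g = 0 \<Longrightarrow> h \<in> carrier G \<Longrightarrow> disp A h = 0"
  and A: "A \<in> sets M"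
 shows "\<nu> A = (0::real)"
proof -
 have "\<bar>\<nu> A\<bar> \<le> \<bar>C\<bar> * measure M A" if "A \<in> sets M" for A
  using bound[OF that] mult_right_mono[OF abs_ge_self[of C] measure_nonneg[of M A]] by linarith
 from dominated_density[OF finite abs_ge_zero add this]
 obtain f where f: "f \<in> borel_measurable M" "\<forall>x. \<bar>f x\<bar> \<le> \<bar>C\<bar>" "\<forall>A\<in>sets M. \<nu> A = (\<integral>x\<in>A. f x \<partial>M)" by blast
 have intf: "integrable M f" by (rule bounded_integrable[OF finite f(1) spec[OF f(2)]])
 have "AE x in M. f (g \<rhd> x) = f x"
 proof (rule density_unique_real[OF _ intf])
  have "(\<lambda>x. f (g \<rhd> x)) \<in> borel_measurable M" by (rule measurable_compose[OF act_meas[OF g] f(1)])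
  then show "integrable M (\<lambda>x. f (g \<rhd> x))" by (rule bounded_integrable[OF finite _ spec[OF f(2)]])
  fix A assume A: "A \<in> sets M"
  show "(\<integral>x\<in>A. f (g \<rhd> x) \<partial>M) = (\<integral>x\<in>A. f x \<partial>M)"
   using set_integral_act[OF g A f(1)] bspec[OF f(3) act_image_sets[OF g A]] bspec[OF f(3) A] inv[OF A] by simp
 qed
 note finv = this
 define A0 where "A0 = {x\<in>space M. f x < 0}"
 have A0: "A0 \<in> sets M" unfolding A0_def using f(1) by measurable
 have "disp A0 g = 0"
 proof -
  have "AE x in M. x \<notin> sym_diff A0 (vim g A0)"
   using finv AE_space by eventually_elim (auto simp: A0_def vim_def g)
  then have "emeasure M (sym_diff A0 (vim g A0)) = 0"
   using A0 vim_sets[OF g A0] by (subst AE_iff_measurable[symmetric, where P = "\<lambda>x. x \<notin> sym_diff A0 (vim g A0)"])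
    (auto simp: A0_def vim_def)
  then show ?thesis by (simp add: disp_def measure_def)
 qed
 then consider "AE x in M. x \<in> A0" | "AE x in M. x \<notin> A0" using ergodic[OF A0 erg[OF A0]] by blast
 moreover have int0: "(\<integral>x. f x \<partial>M) = 0"
  using bspec[OF f(3) sets.top] total0 by (simp add: set_lebesgue_integral_def cong: Bochner_Integration.integral_cong)
 ultimately have "AE x in M. f x = 0"
 proof cases
  case 1
  then have "AE x in M. 0 \<le> - f x" by eventually_elim (simp add: A0_def)
  from integral_nonneg_eq_0_iff_AE[OF _ this] intf int0 show ?thesis by simp
 next
  case 2
  with AE_space have "AE x in M. 0 \<le> f x" by eventually_elim (simp add: A0_def not_less)
  from integral_nonneg_eq_0_iff_AE[OF intf this] int0 show ?thesis by simp
 qed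
 then have "(\<integral>x\<in>A. f x \<partial>M) = (\<integral>x. 0 \<partial>M)"
  unfolding set_lebesgue_integral_def using f(1) A
  by (intro integral_cong_AE) (auto elim: eventually_mono)
 then show ?thesis using bspec[OF f(3) A] by simp
qed

end

section \<open>Continuity of the displacement\<close>

context measured_quotient
begin

text \<open>Invariance of the measure gives both halves of the symmetric difference the same size.
  It then suffices to control the points that leave \<open>A\<close>, and for open sets continuity
  speaks only about these.\<close>

lemma disp_eq:
 assumes A: "A \<in> sets M" and g: "g \<in> carrier G"
 shows "disp A g = 2 * measure M (A - vim g A)"
proof -
 note v = vim_sets[OF g A]
 have "measure M (A - vim g A) = measure M A - measure M (A \<inter> vim g A)" by (rule finite_measure_Diff'[OF A v])
 moreover have "measure M (vim g A - A) = measure M (vim g A) - measure M (vim g A \<inter> A)" by (rule finite_measure_Diff'[OF v A])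
 moreover have "disp A g = measure M (A - vim g A) + measure M (vim g A - A)"
  unfolding disp_def using A v by (intro finite_measure_Union) auto
 ultimately show ?thesis using vim_measure[OF g A] by (simp add: Int_commute)
qed

lemma disp_le: "A \<in> sets M \<Longrightarrow> g \<in> carrier G \<Longrightarrow> disp A g \<le> 2 * measure M A"
 unfolding disp_eq by (intro mult_left_mono finite_measure_mono) auto

lemma disp_Un:
 assumes "A \<in> sets M" "A' \<in> sets M" "g \<in> carrier G"
 shows "disp (A \<union> A') g \<le> disp A g + disp A' g"
proof -
 have S: "sym_diff A (vim g A) \<in> sets M" "sym_diff A' (vim g A') \<in> sets M" using assms by (auto intro!: vim_sets)
 have "disp (A \<union> A') g \<le> measure M (sym_diff A (vim g A) \<union> sym_diff A' (vim g A'))"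
  unfolding disp_def by (rule finite_measure_mono[OF _ sets.Un[OF S]]) (auto simp: vim_def)
 also have "\<dots> \<le> disp A g + disp A' g" unfolding disp_def by (rule measure_Un_le[OF S])
 finally show ?thesis .
qed

lemma disp_nonneg: "0 \<le> disp A g"
 by (simp add: disp_def)

text \<open>For open sets by dominated convergence: a point of the set stays in it under small
  translations. The remaining sets follow by induction over complements and disjoint unions, the
  open sets being closed under intersections.\<close>

lemma disp_continuous:
 assumes sets: "sets M = quotient_borel G X \<Gamma>" and h: "\<And>n. h n \<in> carrier G"
  and near: "\<And>g U. openin X U \<Longrightarrow> g \<in> U \<Longrightarrow> g \<in> carrier G \<Longrightarrow> eventually (\<lambda>n. h n \<otimes> g \<in> U) sequentially"
  and A: "A \<in> sets M"
 shows "(\<lambda>n. disp A (h n)) \<longlonglongrightarrow> 0"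
proof -
 let ?E = "{U. U \<subseteq> lcosets \<Gamma> \<and> openin X {g \<in> carrier G. l_coset G g \<Gamma> \<in> U}}"
 have sM: "sets M = sigma_sets (lcosets \<Gamma>) ?E" unfolding sets quotient_borel_def ..
 have As: "A \<in> sigma_sets (lcosets \<Gamma>) ?E" using A sM by simp
 have stable: "Int_stable ?E"
  proof (rule Int_stableI)
   fix U U' assume "U \<in> ?E" "U' \<in> ?E"
   moreover have "{g \<in> carrier G. l_coset G g \<Gamma> \<in> U \<inter> U'} = {g \<in> carrier G. l_coset G g \<Gamma> \<in> U} \<inter> {g \<in> carrier G. l_coset G g \<Gamma> \<in> U'}"
    by blast
   ultimately show "U \<inter> U' \<in> ?E" by (auto intro: openin_Int)
  qed
 have pow: "?E \<subseteq> Pow (lcosets \<Gamma>)" by blast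
 from stable pow As show ?thesis
 proof (induction rule: sigma_sets_induct_disjoint)
  case (basic U)
  then have U: "U \<in> sets M" "openin X {g \<in> carrier G. l_coset G g \<Gamma> \<in> U}" unfolding sM by auto
  have "(\<lambda>n. \<integral>x. indicator (U - vim (h n) U) x \<partial>M) \<longlonglongrightarrow> (\<integral>x. 0 \<partial>M :: real)"
  proof (rule integral_dominated_convergence[where w = "\<lambda>x. 1"])
   show "AE x in M. (\<lambda>n. indicator (U - vim (h n) U) x :: real) \<longlonglongrightarrow> 0"
   proof (rule AE_I2)
    fix x assume x: "x \<in> space M"
    show "(\<lambda>n. indicator (U - vim (h n) U) x :: real) \<longlonglongrightarrow> 0"
    proof (cases "x \<in> U")
     case True
     have "s x \<in> {g \<in> carrier G. l_coset G g \<Gamma> \<in> U}"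
      using x True s_coset[of x] by (simp add: space_M)
     from near[OF U(2) this s_closed[OF x]]
     have "eventually (\<lambda>n. indicator (U - vim (h n) U) x = (0::real)) sequentially"
      by eventually_elim (simp add: vim_def x act_eq[OF h x] \<pi>_def)
     then show ?thesis by (rule tendsto_eventually)
    qed simp
   qed
  qed (use U(1) vim_sets[OF h U(1)] in auto)
  then have "(\<lambda>n. 2 * measure M (U - vim (h n) U)) \<longlonglongrightarrow> 2 * 0"
   using U(1) vim_sets[OF h U(1)] by (intro tendsto_mult tendsto_const) simp
  then show ?case unfolding disp_eq[OF U(1) h] by simp
 next
  case empty
  show ?case by (simp add: disp_def vim_def)
 next
  case (compl A)
  then have A: "A \<in> sets M" using sM by simp
  then have AM: "A \<subseteq> space M" by (rule sets.sets_into_space)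
  have "sym_diff (lcosets \<Gamma> - A) (vim (h n) (lcosets \<Gamma> - A)) = sym_diff A (vim (h n) A)" for n
   using AM act_closed[OF h] unfolding vim_def space_M[symmetric] by blast
  then show ?case using compl by (simp add: disp_def)
 next
  case (union A)
  then have A: "A i \<in> sets M" for i using sM by auto
  define S where "S k = (\<Union>i<k. A i)" for k
  define R where "R k = (\<Union>i. A i) - S k" for k
  have Sm: "S k \<in> sets M" and Rm: "R k \<in> sets M" and Um: "(\<Union>i. A i) \<in> sets M" for k
   using A by (auto simp: S_def R_def)
  have S: "(\<lambda>n. disp (S k) (h n)) \<longlonglongrightarrow> 0" for k
  proof (induction k)
   case 0
   then show ?case by (simp add: S_def disp_def vim_def)
  next
   case (Suc k)
   have "S (Suc k) = S k \<union> A k" by (auto simp: S_def lessThan_Suc)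
   then have le: "disp (S (Suc k)) (h n) \<le> disp (S k) (h n) + disp (A k) (h n)" for n
    using disp_Un[OF Sm A h] by simp
   have sum: "(\<lambda>n. disp (S k) (h n) + disp (A k) (h n)) \<longlonglongrightarrow> 0"
    using tendsto_add[OF Suc union.IH, of k] by simp
   show ?case
    by (rule tendsto_sandwich[OF _ _ tendsto_const sum]) (use le disp_nonneg in auto)
  qed
  have R: "(\<lambda>k. measure M (R k)) \<longlonglongrightarrow> 0"
  proof -
   have "(\<Inter>k. R k) = {}" by (auto simp: R_def S_def)
   then have "measure M (\<Inter>k. R k) = 0" by simp
   moreover have "(\<lambda>k. measure M (R k)) \<longlonglongrightarrow> measure M (\<Inter>k. R k)"
    by (rule finite_Lim_measure_decseq) (use Rm in \<open>auto simp: decseq_def R_def S_def\<close>)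
   ultimately show ?thesis by simp
  qed
  show ?case
  proof (rule LIMSEQ_I)
   fix e :: real assume e: "0 < e"
   then have "0 < e / 4" by simp
   from order_tendstoD(2)[OF R this] obtain k where k: "measure M (R k) < e / 4"
    by (auto simp: eventually_sequentially)
   from order_tendstoD(2)[OF S[of k], of "e / 2"] e obtain n0 where n0: "\<forall>n\<ge>n0. disp (S k) (h n) < e / 2"
    by (auto simp: eventually_sequentially)
   show "\<exists>n0. \<forall>n\<ge>n0. norm (disp (\<Union>i. A i) (h n) - 0) < e"
   proof (intro exI allI impI)
    fix n assume "n0 \<le> n"
    then have "disp (S k) (h n) < e / 2" using n0 by blast
    moreover have "(\<Union>i. A i) = S k \<union> R k" by (auto simp: R_def S_def)
    then have "disp (\<Union>i. A i) (h n) \<le> disp (S k) (h n) + disp (R k) (h n)"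
     using disp_Un[OF Sm Rm h] by simp
    moreover have "disp (R k) (h n) \<le> 2 * measure M (R k)" by (rule disp_le[OF Rm h])
    ultimately show "norm (disp (\<Union>i. A i) (h n) - 0) < e" using k disp_nonneg[of "\<Union>i. A i" "h n"] by simp
   qed
  qed
 qed
qed

end

section \<open>Lattices give measured quotients\<close>

text \<open>\<open>F\<close> is a continuous formula for the quotient of two elements, defined on
  the whole coordinate space and not only on the image of the group. Continuity and measurability of
  the group operations thus reduce to those of a map between ordinary spaces.\<close>

locale coordinate_group = Group.group G for G :: "('g, 'b) monoid_scheme" (structure) +
 fixes c :: "'g \<Rightarrow> 'e::{second_countable_topology, t2_space}" and F :: "'e \<times> 'e \<Rightarrow> 'e" and X :: "'g topology"
 assumes openin_X: "openin X U \<longleftrightarrow> (\<exists>W. open W \<and> U = {g \<in> carrier G. c g \<in> W})"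
  and c_inj: "inj_on c (carrier G)"
  and F_cont: "continuous_on UNIV F"
  and F_eq: "g \<in> carrier G \<Longrightarrow> h \<in> carrier G \<Longrightarrow> F (c g, c h) = c (inv g \<otimes> h)"
begin

definition B :: "'g measure" where "B = vimage_algebra (carrier G) c borel"

lemma space_B: "space B = carrier G"
 by (simp add: B_def)

lemma c_meas: "c \<in> borel_measurable B"
 unfolding B_def by (rule measurable_vimage_algebra1) simp

lemma B_measurableI: "f \<in> space N \<rightarrow> carrier G \<Longrightarrow> (\<lambda>x. c (f x)) \<in> borel_measurable N \<Longrightarrow> f \<in> N \<rightarrow>\<^sub>M B"
 unfolding B_def by (rule measurable_vimage_algebra2)

lemma c_meas': "f \<in> N \<rightarrow>\<^sub>M B \<Longrightarrow> (\<lambda>x. c (f x)) \<in> borel_measurable N"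
 by (rule measurable_compose[OF _ c_meas])

lemma F_meas:
 assumes "f \<in> borel_measurable N" "h \<in> borel_measurable N"
 shows "(\<lambda>x. F (f x, h x)) \<in> borel_measurable N"
 by (rule borel_measurable_continuous_Pair[OF assms, of "\<lambda>x y. F (x, y)"]) (simp add: F_cont)

lemma div_meas:
 assumes f: "f \<in> N \<rightarrow>\<^sub>M B" and h: "h \<in> N \<rightarrow>\<^sub>M B"
 shows "(\<lambda>x. inv (f x) \<otimes> h x) \<in> N \<rightarrow>\<^sub>M B"
proof (rule B_measurableI)
 have cl: "f x \<in> carrier G" "h x \<in> carrier G" if "x \<in> space N" for x
  using measurable_space[OF f that] measurable_space[OF h that] by (simp_all add: space_B)
 then show "(\<lambda>x. inv (f x) \<otimes> h x) \<in> space N \<rightarrow> carrier G" by simp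
 have "(\<lambda>x. F (c (f x), c (h x))) \<in> borel_measurable N" by (intro F_meas c_meas' f h)
 moreover have "F (c (f x), c (h x)) = c (inv (f x) \<otimes> h x)" if "x \<in> space N" for x by (rule F_eq[OF cl[OF that]])
 ultimately show "(\<lambda>x. c (inv (f x) \<otimes> h x)) \<in> borel_measurable N" by (simp cong: measurable_cong)
qed

lemma const_meas: "g \<in> carrier G \<Longrightarrow> (\<lambda>x. g) \<in> N \<rightarrow>\<^sub>M B"
 by (simp add: space_B)

lemma inv_meas: "(\<lambda>g. inv g) \<in> B \<rightarrow>\<^sub>M B"
proof -
 have "(\<lambda>g. inv g \<otimes> \<one>) \<in> B \<rightarrow>\<^sub>M B" by (intro div_meas const_meas measurable_ident_sets[OF refl] one_closed)
 then show ?thesis using measurable_cong[of B "\<lambda>g. inv g \<otimes> \<one>" "\<lambda>g. inv g" B] by (simp add: space_B)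
qed

lemma mult_meas: "(\<lambda>p. fst p \<otimes> snd p) \<in> B \<Otimes>\<^sub>M B \<rightarrow>\<^sub>M B"
proof -
 have "(\<lambda>p. inv (inv (fst p)) \<otimes> snd p) \<in> B \<Otimes>\<^sub>M B \<rightarrow>\<^sub>M B"
  by (intro div_meas measurable_compose[OF measurable_fst inv_meas] measurable_snd)
 then show ?thesis
  using measurable_cong[of "B \<Otimes>\<^sub>M B" "\<lambda>p. inv (inv (fst p)) \<otimes> snd p" "\<lambda>p. fst p \<otimes> snd p" B]
  by (auto simp: space_B space_pair_measure)
qed

lemma openin_sets: "openin X U \<Longrightarrow> U \<in> sets B"
 using measurable_sets[OF c_meas borel_open]
 by (auto simp: openin_X space_B vimage_def Int_def conj_commute)

lemma sets_openin: "sets B = sigma_sets (carrier G) {U. openin X U}"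
proof -
 have "sets B = sets (vimage_algebra (carrier G) c (sigma UNIV {W. open W}))"
  unfolding B_def borel_def ..
 also have "vimage_algebra (carrier G) c (sigma UNIV {W. open W}) = sigma (carrier G) {c -` W \<inter> carrier G |W. W \<in> {W. open W}}"
  by (rule vimage_algebra_sigma) auto
 also have "{c -` W \<inter> carrier G |W. W \<in> {W. open W}} = {U. openin X U}"
  by (auto simp: openin_X vimage_def Int_def conj_commute)
 also have "sets (sigma (carrier G) {U. openin X U}) = sigma_sets (carrier G) {U. openin X U}"
  by (rule sets_measure_of) (auto simp: openin_X)
 finally show ?thesis .
qed

lemma openin_right_translate:
 assumes U: "openin X U" and h: "h \<in> carrier G"
 shows "openin X {g \<in> carrier G. g \<otimes> h \<in> U}"
proof -
 obtain W where W: "open W" "U = {g \<in> carrier G. c g \<in> W}" using U openin_X by blast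
 let ?f = "\<lambda>p. F (F (p, c \<one>), c h)"
 have "continuous_on UNIV ?f" by (intro continuous_on_compose2[OF F_cont] continuous_intros) auto
 then have "open (?f -` W)" using W(1) by (simp add: continuous_on_open_vimage)
 moreover have "c (g \<otimes> h) = ?f (c g)" if "g \<in> carrier G" for g
  using that h F_eq[of "inv g" h] by (simp add: F_eq)
 ultimately show ?thesis
  unfolding openin_X using h by (intro exI[of _ "?f -` W"]) (auto simp: W(2))
qed

text \<open>By discreteness every element has a neighbourhood that meets each left coset at most
  once, and second countability provides a sequence of these covering the group. The section picks
  the unique point of a coset in the first member of the sequence that the coset meets.\<close>

lemma measured_quotient_exists:
 assumes lat: "lattice_subgroup G X \<Gamma>"
 obtains M s where "measured_quotient G B \<Gamma> M s" "sets M = quotient_borel G X \<Gamma>"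
proof -
 have sub: "subgroup \<Gamma> G" and disc: "subtopology X \<Gamma> = discrete_topology \<Gamma>" using lat by (auto simp: lattice_subgroup_def)
 interpret S: subgroup \<Gamma> G by fact
 obtain \<mu> where \<mu>: "space \<mu> = lcosets \<Gamma>" "sets \<mu> = quotient_borel G X \<Gamma>" "finite_measure \<mu>" "emeasure \<mu> (space \<mu>) \<noteq> 0"
  "\<forall>g\<in>carrier G. \<forall>A\<in>sets \<mu>. emeasure \<mu> (l_coset G g ` A) = emeasure \<mu> A"
  using lat unfolding lattice_subgroup_def by blast
 interpret \<mu>: finite_measure \<mu> by (rule \<mu>(3))
 \<comment> \<open>Normalization of the given finite nonzero measure to total mass 1.\<close>
 define M where "M = scale_measure (1 / emeasure \<mu> (space \<mu>)) \<mu>"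
 have M_simps: "space M = lcosets \<Gamma>" "sets M = quotient_borel G X \<Gamma>"
  using \<mu>(1,2) by (simp_all add: M_def space_scale_measure)
 have total: "emeasure M (space M) = 1"
  using \<mu>(4) \<mu>.emeasure_finite by (simp add: M_def space_scale_measure ennreal_divide_times ennreal_divide_self less_top[symmetric])
 have point: "l_coset G g \<Gamma> \<in> lcosets \<Gamma>" if "g \<in> carrier G" for g using that by (auto simp: LCOSETS_def)
 obtain Wd where Wd: "openin X Wd" "Wd \<inter> \<Gamma> = {\<one>}"
 proof -
  have "openin (subtopology X \<Gamma>) {\<one>}" unfolding disc by simp
  then obtain Wd where "openin X Wd" "{\<one>} = Wd \<inter> \<Gamma>" unfolding openin_subtopology by blast
  then show ?thesis using that by blast
 qed
 obtain W where W: "open W" "Wd = {g \<in> carrier G. c g \<in> W}" using Wd(1) openin_X by blast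
 obtain BB :: "'e set set" where BB: "countable BB" "topological_basis BB" 
  using ex_countable_basis[where 'a = 'e] by blast
 define small where "small V \<longleftrightarrow> (\<forall>g\<in>carrier G. \<forall>h\<in>carrier G. c g \<in> V \<longrightarrow> c h \<in> V \<longrightarrow> inv g \<otimes> h \<in> \<Gamma> \<longrightarrow> g = h)" for V
 have cover: "\<exists>V\<in>BB. small V \<and> c g \<in> V" if g: "g \<in> carrier G" for g
 proof -
  have "open (F -` W)" using F_cont W(1) by (simp add: continuous_on_open_vimage)
  moreover have "F (c g, c g) \<in> W" using F_eq[OF g g] g Wd(2) W(2) by auto
  ultimately obtain V1 V2 where V: "open V1" "open V2" "(c g, c g) \<in> V1 \<times> V2" "V1 \<times> V2 \<subseteq> F -` W"
   using open_prod_elim[of "F -` W" "(c g, c g)"] by blast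
  obtain V where V': "V \<in> BB" "c g \<in> V" "V \<subseteq> V1 \<inter> V2"
   using topological_basisE[OF BB(2) open_Int[OF V(1,2)], of "c g"] V(3) by blast
  have "small V"
   unfolding small_def
  proof (intro ballI impI)
   fix h k assume hk: "h \<in> carrier G" "k \<in> carrier G" "c h \<in> V" "c k \<in> V" "inv h \<otimes> k \<in> \<Gamma>"
   have "F (c h, c k) \<in> W" using V(4) V'(3) hk(3,4) by blast
   then have "inv h \<otimes> k \<in> Wd \<inter> \<Gamma>" using F_eq[OF hk(1,2)] hk W(2) by simp
   then have "inv h \<otimes> k = \<one>" using Wd(2) by blast
   then show "h = k" using hk(1,2) by (metis inv_closed inv_equality inv_inv)
  qed
  then show ?thesis using V' by blast
 qed
 define Bs where "Bs = {V \<in> BB. small V}"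
 have Bs: "countable Bs" using BB(1) by (simp add: Bs_def)
 have "Bs \<noteq> {}" using cover[OF one_closed] by (auto simp: Bs_def)
 define V where "V n = {g \<in> carrier G. c g \<in> from_nat_into Bs n}" for n
 have smallV: "g = h" if "g \<in> V n" "h \<in> V n" "inv g \<otimes> h \<in> \<Gamma>" for g h n
  using that from_nat_into[OF \<open>Bs \<noteq> {}\<close>, of n] unfolding V_def Bs_def small_def by blast
 have VX: "openin X (V n)" for n
  unfolding openin_X V_def using from_nat_into[OF \<open>Bs \<noteq> {}\<close>, of n] topological_basis_open[OF BB(2)]
  by (intro exI[of _ "from_nat_into Bs n"]) (auto simp: Bs_def)
 have VG: "V n \<subseteq> carrier G" for n by (auto simp: V_def)
 have coverV: "\<exists>n. g \<in> V n" if g: "g \<in> carrier G" for g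
 proof -
  obtain U where "U \<in> Bs" "c g \<in> U" using cover[OF g] by (auto simp: Bs_def)
  then show ?thesis using from_nat_into_surj[OF Bs] g by (auto simp: V_def)
 qed
 have countable: "countable \<Gamma>"
 proof -
  \<comment> \<open>\<Gamma> is itself a coset, so it meets each \<open>V n\<close> at most once;
    this is why a lattice is countable.\<close>
  have "\<Gamma> \<subseteq> (\<Union>n. V n \<inter> \<Gamma>)" using coverV S.subset by blast
  moreover have "countable (V n \<inter> \<Gamma>)" for n
  proof (cases "V n \<inter> \<Gamma> = {}")
   case False
   then obtain g where g: "g \<in> V n" "g \<in> \<Gamma>" by blast
   have "V n \<inter> \<Gamma> \<subseteq> {g}" using smallV[OF _ g(1)] g(2) by (auto intro!: S.m_closed S.m_inv_closed)
   then show ?thesis by (rule countable_subset) simp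
  qed simp
  ultimately show ?thesis by (meson countable_UN countableI_type countable_subset)
 qed
 have coset_diff: "inv g \<otimes> h \<in> \<Gamma>" if gh: "g \<in> x" "h \<in> x" "x \<in> lcosets \<Gamma>" for g h x
 proof -
  obtain k where k: "k \<in> carrier G" "x = l_coset G k \<Gamma>" using gh(3) by (auto simp: LCOSETS_def)
  obtain a b where ab: "a \<in> \<Gamma>" "b \<in> \<Gamma>" "g = k \<otimes> a" "h = k \<otimes> b" using gh(1,2) k(2) by (auto simp: l_coset_def)
  have "inv g \<otimes> h = inv a \<otimes> b"
   using ab k(1) S.mem_carrier by (simp add: inv_mult_group m_assoc) (simp add: m_assoc[symmetric])
  then show ?thesis using ab by (simp add: S.m_closed S.m_inv_closed)
 qed
 have coset_self: "l_coset G g \<Gamma> = x" if gx: "g \<in> x" "x \<in> lcosets \<Gamma>" for g x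
 proof -
  obtain k where k: "k \<in> carrier G" "x = l_coset G k \<Gamma>" using gx(2) by (auto simp: LCOSETS_def)
  then obtain a where a: "a \<in> \<Gamma>" "g = k \<otimes> a" using gx(1) by (auto simp: l_coset_def)
  have "l_coset G a \<Gamma> = \<Gamma>" using a(1) sub by (intro coset_join3 S.mem_carrier)
  then show ?thesis using lcos_m_assoc[OF S.subset k(1) S.mem_carrier[OF a(1)]] k(2) a(2) by simp
 qed
 have cosetG: "x \<subseteq> carrier G" if "x \<in> lcosets \<Gamma>" for x
  using that l_coset_subset_G[OF S.subset] by (auto simp: LCOSETS_def)
 have self: "g \<in> l_coset G g \<Gamma>" if "g \<in> carrier G" for g
  using that S.one_closed by (force simp: l_coset_def)
 have hits: "\<exists>n. x \<inter> V n \<noteq> {}" if x: "x \<in> lcosets \<Gamma>" for x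
 proof -
  obtain g where "g \<in> carrier G" "x = l_coset G g \<Gamma>" using x by (auto simp: LCOSETS_def)
  then show ?thesis using self[of g] coverV[of g] by blast
 qed
 define n where "n x = (LEAST n. x \<inter> V n \<noteq> {})" for x
 define s where "s x = (SOME g. g \<in> x \<inter> V (n x))" for x
 have s: "s x \<in> x" "s x \<in> V (n x)" if x: "x \<in> lcosets \<Gamma>" for x
 proof -
  have "x \<inter> V (n x) \<noteq> {}" unfolding n_def by (rule LeastI_ex[OF hits[OF x]])
  then have "\<exists>g. g \<in> x \<inter> V (n x)" by blast
  from someI_ex[OF this] show "s x \<in> x" "s x \<in> V (n x)" unfolding s_def by blast+
 qed
 have open_image: "{x \<in> lcosets \<Gamma>. x \<inter> U \<noteq> {}} \<in> sets M" if U: "openin X U" for U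
 proof -
  have UG: "U \<subseteq> carrier G" using U by (auto simp: openin_X)
  have "{g \<in> carrier G. l_coset G g \<Gamma> \<in> {x \<in> lcosets \<Gamma>. x \<inter> U \<noteq> {}}} = (\<Union>a\<in>\<Gamma>. {g \<in> carrier G. g \<otimes> a \<in> U})"
   using point by (auto simp: l_coset_def)
  moreover have "openin X (\<Union>a\<in>\<Gamma>. {g \<in> carrier G. g \<otimes> a \<in> U})"
   by (intro openin_Union) (auto intro: openin_right_translate[OF U S.mem_carrier])
  ultimately show ?thesis unfolding M_simps quotient_borel_def by (intro sigma_sets.Basic) auto
 qed
 have s_meas: "s \<in> M \<rightarrow>\<^sub>M B"
 proof (rule measurable_sigma_sets[OF sets_openin])
  show "{U. openin X U} \<subseteq> Pow (carrier G)" by (auto simp: openin_X)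
  show "s \<in> space M \<rightarrow> carrier G" using s(1) cosetG unfolding M_simps by blast
  fix U assume "U \<in> {U. openin X U}"
  then have U: "openin X U" by simp
  \<comment> \<open>The preimage is sorted by the index of the first neighbourhood hit; each piece
    is a difference of sets of cosets meeting an open set, and these are open in the
    quotient.\<close>
  have "s -` U \<inter> space M = (\<Union>m. {x \<in> lcosets \<Gamma>. x \<inter> (V m \<inter> U) \<noteq> {}} - (\<Union>i<m. {x \<in> lcosets \<Gamma>. x \<inter> V i \<noteq> {}}))"
  proof (intro equalityI subsetI)
   fix x assume "x \<in> s -` U \<inter> space M"
   then have x: "x \<in> lcosets \<Gamma>" "s x \<in> U" by (auto simp: M_simps)
   have "x \<inter> V i = {}" if "i < n x" for i using not_less_Least[of i "\<lambda>n. x \<inter> V n \<noteq> {}"] that by (auto simp: n_def)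
   then show "x \<in> (\<Union>m. {x \<in> lcosets \<Gamma>. x \<inter> (V m \<inter> U) \<noteq> {}} - (\<Union>i<m. {x \<in> lcosets \<Gamma>. x \<inter> V i \<noteq> {}}))"
    using x s[OF x(1)] by (intro UN_I[of "n x"]) auto
  next
   fix x assume "x \<in> (\<Union>m. {x \<in> lcosets \<Gamma>. x \<inter> (V m \<inter> U) \<noteq> {}} - (\<Union>i<m. {x \<in> lcosets \<Gamma>. x \<inter> V i \<noteq> {}}))"
   then obtain m g where x: "x \<in> lcosets \<Gamma>" "g \<in> x" "g \<in> V m" "g \<in> U" "\<forall>i<m. x \<inter> V i = {}" by blast
   have "n x = m" unfolding n_def
    by (rule Least_equality) (use x in \<open>auto simp: not_less[symmetric]\<close>)
   then have "s x = g" using smallV[OF _ x(3) coset_diff[OF s(1)[OF x(1)] x(2,1)]] s(2)[OF x(1)] by simp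
   then show "x \<in> s -` U \<inter> space M" using x by (simp add: M_simps)
  qed
  also have "\<dots> \<in> sets M"
  proof (intro sets.countable_UN image_subsetI)
   fix m
   have "(\<Union>i<m. {x \<in> lcosets \<Gamma>. x \<inter> V i \<noteq> {}}) \<in> sets M" using open_image[OF VX] by blast
   then show "{x \<in> lcosets \<Gamma>. x \<inter> (V m \<inter> U) \<noteq> {}} - (\<Union>i<m. {x \<in> lcosets \<Gamma>. x \<inter> V i \<noteq> {}}) \<in> sets M"
    by (intro sets.Diff open_image openin_Int VX U)
  qed
  finally show "s -` U \<inter> space M \<in> sets M" .
 qed
 have \<pi>_meas: "(\<lambda>g. l_coset G g \<Gamma>) \<in> B \<rightarrow>\<^sub>M M"
 proof (rule measurable_sigma_sets[OF M_simps(2)[unfolded quotient_borel_def]])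
  show "(\<lambda>g. l_coset G g \<Gamma>) \<in> space B \<rightarrow> lcosets \<Gamma>" using point by (simp add: space_B)
  fix U assume "U \<in> {U. U \<subseteq> lcosets \<Gamma> \<and> openin X {g \<in> carrier G. l_coset G g \<Gamma> \<in> U}}"
  then have "openin X {g \<in> carrier G. l_coset G g \<Gamma> \<in> U}" by simp
  from openin_sets[OF this] show "(\<lambda>g. l_coset G g \<Gamma>) -` U \<inter> space B \<in> sets B"
   by (simp add: space_B vimage_def Int_def conj_commute)
 qed auto
 have "measured_quotient G B \<Gamma> M s"
 proof (intro measured_quotient.intro measured_quotient_axioms.intro)
  fix g assume "g \<in> \<Gamma>"
  then have "{g} = c -` {c g} \<inter> space B" using c_inj S.subset by (auto simp: inj_on_def space_B)
  also have "\<dots> \<in> sets B" by (rule measurable_sets[OF c_meas]) simp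
  finally show "{g} \<in> sets B" .
 next
  show "finite_measure M" by (rule finite_measureI) (simp add: total)
  show "measure M (space M) = 1" using total by (simp add: measure_def)
 next
  fix g A assume "g \<in> carrier G" "A \<in> sets M"
  then show "emeasure M (l_coset G g ` A) = emeasure M A" using \<mu>(5) by (simp add: M_def)
 next
  fix x assume "x \<in> lcosets \<Gamma>"
  then show "l_coset G (s x) \<Gamma> = x" by (intro coset_self s(1))
 qed (rule is_group space_B mult_meas inv_meas sub countable M_simps \<pi>_meas s_meas)+
 then show ?thesis using that M_simps(2) by blast
qed

end

section \<open>Averaging after restriction\<close>

locale quotient_hom = Q: measured_quotient G B \<Gamma> M s + Q': measured_quotient G' B' \<Gamma>' M' s'
 for G :: "('g, 'b) monoid_scheme" (structure) and B \<Gamma> M s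
  and G' :: "('h, 'd) monoid_scheme" and B' \<Gamma>' M' s' +
 fixes \<iota> :: "'h \<Rightarrow> 'g"
 assumes \<iota>_closed: "\<And>h. h \<in> carrier G' \<Longrightarrow> \<iota> h \<in> carrier G"
  and \<iota>_mult: "\<And>a b. a \<in> carrier G' \<Longrightarrow> b \<in> carrier G' \<Longrightarrow> \<iota> (a \<otimes>\<^bsub>G'\<^esub> b) = \<iota> a \<otimes> \<iota> b"
  and \<iota>_meas: "\<iota> \<in> B' \<rightarrow>\<^sub>M B"
begin

lemma \<iota>_inv: "h \<in> carrier G' \<Longrightarrow> \<iota> (inv\<^bsub>G'\<^esub> h) = inv (\<iota> h)"
 by (rule group_hom.hom_inv) (auto simp: group_hom_def group_hom_axioms_def hom_def \<iota>_closed \<iota>_mult Q.is_group Q'.is_group)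

lemma \<iota>_meas': "f \<in> X \<rightarrow>\<^sub>M B' \<Longrightarrow> (\<lambda>x. \<iota> (f x)) \<in> X \<rightarrow>\<^sub>M B"
 by (rule measurable_compose[OF _ \<iota>_meas])

sublocale P: pair_sigma_finite M' M by unfold_locales

definition T :: "'h \<Rightarrow> 'h set \<times> 'g set \<Rightarrow> 'h set \<times> 'g set" where
 "T g \<omega> = (l_coset G' g (fst \<omega>), l_coset G (\<iota> g) (snd \<omega>))"

definition \<psi>\<^sub>0 :: "'h set \<times> 'g set \<Rightarrow> 'h \<Rightarrow> 'g" where "\<psi>\<^sub>0 \<omega> g = Q.\<beta> (snd \<omega>) (\<iota> g)"

text \<open>After moving \<open>x\<close> by the image of \<open>s' y\<close>, and up to a left
  factor in \<Gamma>, this is \<beta> of the big quotient applied to the image of \<beta> of the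
  small one. The factor \<open>inv (\<iota> (s' (fst \<omega>)))\<close> makes it transform by the
  same element of \<Gamma> as \<open>\<psi>\<^sub>0\<close>, as the homotopy requires.\<close>

definition \<psi>\<^sub>1 :: "'h set \<times> 'g set \<Rightarrow> 'h \<Rightarrow> 'g" where
 "\<psi>\<^sub>1 \<omega> g = inv (Q.\<kappa> (\<iota> (Q'.\<kappa> (inv\<^bsub>G'\<^esub> g \<otimes>\<^bsub>G'\<^esub> s' (fst \<omega>))) \<otimes> inv (\<iota> (s' (fst \<omega>))) \<otimes> s (snd \<omega>)))"

lemma finite_prod: "finite_measure (M' \<Otimes>\<^sub>M M)"
 by (rule finite_measure_pair_measure) unfold_locales

lemma total_prod: "measure (M' \<Otimes>\<^sub>M M) (space (M' \<Otimes>\<^sub>M M)) = 1"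
proof -
 have "emeasure (M' \<Otimes>\<^sub>M M) (space M' \<times> space M) = 1"
  using Q.total Q'.total by (simp add: Q.emeasure_pair_measure_Times Q.emeasure_eq_measure Q'.emeasure_eq_measure)
 then show ?thesis by (simp add: space_pair_measure measure_def)
qed

lemma T_meas: "g \<in> carrier G' \<Longrightarrow> T g \<in> M' \<Otimes>\<^sub>M M \<rightarrow>\<^sub>M M' \<Otimes>\<^sub>M M"
 unfolding T_def
 by (intro measurable_Pair measurable_compose[OF measurable_fst Q'.act_meas] measurable_compose[OF measurable_snd Q.act_meas] \<iota>_closed)

lemma T_distr:
 assumes g: "g \<in> carrier G'"
 shows "distr (M' \<Otimes>\<^sub>M M) (M' \<Otimes>\<^sub>M M) (T g) = M' \<Otimes>\<^sub>M M"
proof -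
 have "distr M' M' (l_coset G' g) \<Otimes>\<^sub>M distr M M (l_coset G (\<iota> g)) =
   distr (M' \<Otimes>\<^sub>M M) (M' \<Otimes>\<^sub>M M) (\<lambda>(x, y). (l_coset G' g x, l_coset G (\<iota> g) y))"
 proof (rule pair_measure_distr[OF Q'.act_meas[OF g] Q.act_meas[OF \<iota>_closed[OF g]]])
  show "sigma_finite_measure (distr M M (l_coset G (\<iota> g)))"
   unfolding Q.act_distr[OF \<iota>_closed[OF g]] by unfold_locales
 qed
 then show ?thesis
  unfolding Q.act_distr[OF \<iota>_closed[OF g]] Q'.act_distr[OF g] by (simp add: T_def[abs_def] case_prod_unfold)
qed

lemma \<psi>\<^sub>0_meas: "g \<in> carrier G' \<Longrightarrow> (\<lambda>\<omega>. \<psi>\<^sub>0 \<omega> g) \<in> M' \<Otimes>\<^sub>M M \<rightarrow>\<^sub>M count_space \<Gamma>"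
 unfolding \<psi>\<^sub>0_def by (rule measurable_compose[OF measurable_snd Q.\<beta>_meas[OF \<iota>_closed]])

lemma \<kappa>'_meas: "f \<in> X \<rightarrow>\<^sub>M B' \<Longrightarrow> (\<lambda>x. Q'.\<kappa> (f x)) \<in> X \<rightarrow>\<^sub>M B'"
 unfolding Q'.\<kappa>_def by (intro Q'.mult_meas' Q'.inv_meas' Q'.s_meas' Q'.\<pi>_meas')

lemma \<psi>\<^sub>1_meas:
 assumes g: "g \<in> carrier G'"
 shows "(\<lambda>\<omega>. \<psi>\<^sub>1 \<omega> g) \<in> M' \<Otimes>\<^sub>M M \<rightarrow>\<^sub>M count_space \<Gamma>"
 unfolding \<psi>\<^sub>1_def
 by (intro Q.\<kappa>_meas' Q.mult_meas' Q.inv_meas' \<iota>_meas' \<kappa>'_meas Q'.mult_meas' Q'.const_meas Q'.inv_closed g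
   Q.s_meas' Q'.s_meas' measurable_fst measurable_snd)

lemma equiv:
 assumes g: "g \<in> carrier G'" and \<omega>: "\<omega> \<in> space (M' \<Otimes>\<^sub>M M)"
 shows "\<exists>c\<in>\<Gamma>. \<forall>h\<in>carrier G'. \<psi>\<^sub>0 (T g \<omega>) (g \<otimes>\<^bsub>G'\<^esub> h) = c \<otimes> \<psi>\<^sub>0 \<omega> h \<and> \<psi>\<^sub>1 (T g \<omega>) (g \<otimes>\<^bsub>G'\<^esub> h) = c \<otimes> \<psi>\<^sub>1 \<omega> h"
proof -
 obtain y x where yx: "\<omega> = (y, x)" "y \<in> space M'" "x \<in> space M" using \<omega> by (auto simp: space_pair_measure)
 obtain c where c: "c \<in> \<Gamma>" "s (l_coset G (\<iota> g) x) = \<iota> g \<otimes> s x \<otimes> c" by (rule Q.act_s[OF \<iota>_closed[OF g] yx(3)])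
 obtain d where d: "d \<in> \<Gamma>'" "s' (l_coset G' g y) = g \<otimes>\<^bsub>G'\<^esub> s' y \<otimes>\<^bsub>G'\<^esub> d" by (rule Q'.act_s[OF g yx(2)])
 note cG = Q.mem_carrier[OF c(1)] and dG = Q'.mem_carrier[OF d(1)] and sG = Q.s_closed[OF yx(3)] and sG' = Q'.s_closed[OF yx(2)]
 show ?thesis
 proof (intro bexI[of _ "inv c"] ballI conjI)
  fix h assume h: "h \<in> carrier G'"
  show "\<psi>\<^sub>0 (T g \<omega>) (g \<otimes>\<^bsub>G'\<^esub> h) = inv c \<otimes> \<psi>\<^sub>0 \<omega> h"
   using Q.\<beta>_act[OF \<iota>_closed[OF g] \<iota>_closed[OF h] yx(3) c] by (simp add: \<psi>\<^sub>0_def T_def yx(1) \<iota>_mult[OF g h])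
  define k where "k = Q'.\<kappa> (inv\<^bsub>G'\<^esub> h \<otimes>\<^bsub>G'\<^esub> s' y)"
  have k: "k \<in> carrier G'" unfolding k_def
   using h sG' by (intro Q'.mem_carrier[OF Q'.\<kappa>_closed]) simp
  have "inv\<^bsub>G'\<^esub> (g \<otimes>\<^bsub>G'\<^esub> h) \<otimes>\<^bsub>G'\<^esub> (g \<otimes>\<^bsub>G'\<^esub> s' y \<otimes>\<^bsub>G'\<^esub> d) = (inv\<^bsub>G'\<^esub> h \<otimes>\<^bsub>G'\<^esub> s' y) \<otimes>\<^bsub>G'\<^esub> d"
   using g h sG' dG by (simp add: Q'.inv_mult_group Q'.m_assoc) (simp add: Q'.m_assoc[symmetric])
  then have 1: "Q'.\<kappa> (inv\<^bsub>G'\<^esub> (g \<otimes>\<^bsub>G'\<^esub> h) \<otimes>\<^bsub>G'\<^esub> (g \<otimes>\<^bsub>G'\<^esub> s' y \<otimes>\<^bsub>G'\<^esub> d)) = k \<otimes>\<^bsub>G'\<^esub> d"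
   unfolding k_def using Q'.\<kappa>_mult[OF _ d(1), of "inv\<^bsub>G'\<^esub> h \<otimes>\<^bsub>G'\<^esub> s' y"] h sG' by simp
  define w where "w = \<iota> k \<otimes> inv (\<iota> (s' y)) \<otimes> s x"
  note closed = \<iota>_closed[OF k] \<iota>_closed[OF sG'] \<iota>_closed[OF g] \<iota>_closed[OF dG] sG cG
  have w: "w \<in> carrier G" unfolding w_def using closed by simp
  have "\<iota> (k \<otimes>\<^bsub>G'\<^esub> d) \<otimes> inv (\<iota> (g \<otimes>\<^bsub>G'\<^esub> s' y \<otimes>\<^bsub>G'\<^esub> d)) \<otimes> (\<iota> g \<otimes> s x \<otimes> c) = w \<otimes> c"
   unfolding w_def using closed g k sG' dG
   by (simp add: \<iota>_mult Q.inv_mult_group Q.m_assoc) (simp add: Q.m_assoc[symmetric])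
  then have "\<psi>\<^sub>1 (T g \<omega>) (g \<otimes>\<^bsub>G'\<^esub> h) = inv (Q.\<kappa> w \<otimes> c)"
   unfolding \<psi>\<^sub>1_def T_def yx(1) fst_conv snd_conv c(2) d(2) 1 by (simp add: Q.\<kappa>_mult[OF w c(1)])
  also have "\<dots> = inv c \<otimes> \<psi>\<^sub>1 \<omega> h"
   using Q.inv_mult_group[OF Q.mem_carrier[OF Q.\<kappa>_closed[OF w]] cG] by (simp add: \<psi>\<^sub>1_def yx(1) w_def k_def)
  finally show "\<psi>\<^sub>1 (T g \<omega>) (g \<otimes>\<^bsub>G'\<^esub> h) = inv c \<otimes> \<psi>\<^sub>1 \<omega> h" .
 qed (rule Q.m_inv_closed[OF c(1)])
qed

text \<open>For fixed \<open>y\<close> the translation of \<open>x\<close> by the image of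
  \<open>s' y\<close> preserves the measure and cancels the normalizing factor of
  \<open>\<psi>\<^sub>1\<close>.\<close>

lemma average_\<psi>\<^sub>1:
 assumes a: "a \<in> cochains Q.\<G> q" and gs: "gs \<in> tuples G' q" and y: "y \<in> space M'"
 shows "(\<integral>x. a (map (\<psi>\<^sub>1 (y, x)) gs) \<partial>M) = Q.j q a (map \<iota> (map (Q'.\<beta> y) gs))"
proof -
 have sub: "set gs \<subseteq> carrier G'" using gs by (simp add: tuples_def)
 note sG' = Q'.s_closed[OF y]
 note h = \<iota>_closed[OF sG']
 have \<psi>m: "(\<lambda>x. \<psi>\<^sub>1 (y, x) g) \<in> M \<rightarrow>\<^sub>M count_space \<Gamma>" if "g \<in> carrier G'" for g
  by (rule measurable_compose[OF measurable_Pair1'[OF y] \<psi>\<^sub>1_meas[OF that]])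
 have m: "(\<lambda>x. a (map (\<psi>\<^sub>1 (y, x)) gs)) \<in> borel_measurable M"
  by (rule measurable_real_countable[OF measurable_map_countable[OF Q.countable \<psi>m]]) (use sub in blast)
 have \<beta>c: "Q'.\<beta> y g \<in> carrier G'" if "g \<in> carrier G'" for g
  by (rule Q'.mem_carrier[OF Q'.\<beta>_closed[OF that y]])
 have t: "map \<iota> (map (Q'.\<beta> y) gs) \<in> tuples G q" using gs \<beta>c \<iota>_closed by (auto simp: tuples_def)
 have "(\<integral>x. a (map (\<psi>\<^sub>1 (y, x)) gs) \<partial>M) = (\<integral>x. a (map (\<psi>\<^sub>1 (y, l_coset G (\<iota> (s' y)) x)) gs) \<partial>M)"
  by (rule integral_invariant[OF Q.act_meas[OF h] Q.act_distr[OF h] m, symmetric])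
 also have "\<dots> = (\<integral>x. a (map (Q.\<beta> x) (map \<iota> (map (Q'.\<beta> y) gs))) \<partial>M)"
 proof (rule Bochner_Integration.integral_cong[OF refl])
  fix x assume x: "x \<in> space M"
  obtain c where c: "c \<in> \<Gamma>" "s (l_coset G (\<iota> (s' y)) x) = \<iota> (s' y) \<otimes> s x \<otimes> c" by (rule Q.act_s[OF h x])
  note cG = Q.mem_carrier[OF c(1)] and sG = Q.s_closed[OF x]
  have "\<psi>\<^sub>1 (y, l_coset G (\<iota> (s' y)) x) g = inv c \<otimes> Q.\<beta> x (\<iota> (Q'.\<beta> y g))" if g: "g \<in> carrier G'" for g
  proof -
   define k where "k = Q'.\<kappa> (inv\<^bsub>G'\<^esub> g \<otimes>\<^bsub>G'\<^esub> s' y)"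
   have k: "k \<in> carrier G'" unfolding k_def
    using g sG' by (intro Q'.mem_carrier[OF Q'.\<kappa>_closed]) simp
   note \<iota>k = \<iota>_closed[OF k]
   have "\<iota> k \<otimes> inv (\<iota> (s' y)) \<otimes> (\<iota> (s' y) \<otimes> s x \<otimes> c) = (\<iota> k \<otimes> s x) \<otimes> c"
    using \<iota>k h sG cG by (simp add: Q.m_assoc) (simp add: Q.m_assoc[symmetric])
   then have "\<psi>\<^sub>1 (y, l_coset G (\<iota> (s' y)) x) g = inv (Q.\<kappa> (\<iota> k \<otimes> s x) \<otimes> c)"
    unfolding \<psi>\<^sub>1_def fst_conv snd_conv c(2) k_def[symmetric] using Q.\<kappa>_mult[OF _ c(1), of "\<iota> k \<otimes> s x"] \<iota>k sG by simp
   also have "\<dots> = inv c \<otimes> inv (Q.\<kappa> (\<iota> k \<otimes> s x))"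
    using \<iota>k sG by (intro Q.inv_mult_group cG Q.mem_carrier[OF Q.\<kappa>_closed]) simp
   also have "inv (Q.\<kappa> (\<iota> k \<otimes> s x)) = Q.\<beta> x (\<iota> (Q'.\<beta> y g))"
    unfolding Q.\<beta>_def Q'.\<beta>_def k_def[symmetric] using \<iota>_inv[OF k] \<iota>k by simp
   finally show ?thesis .
  qed
  then have "map (\<psi>\<^sub>1 (y, l_coset G (\<iota> (s' y)) x)) gs = map (\<lambda>z. inv c \<otimes> z) (map (Q.\<beta> x) (map \<iota> (map (Q'.\<beta> y) gs)))"
   using sub by (simp add: subset_iff)
  then show "a (map (\<psi>\<^sub>1 (y, l_coset G (\<iota> (s' y)) x)) gs) = a (map (Q.\<beta> x) (map \<iota> (map (Q'.\<beta> y) gs)))"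
   using cochainsD(2)[OF a _ Q.rm.map_tuples[OF x t], of "inv c"] Q.m_inv_closed[OF c(1)] by (simp del: map_map)
 qed
 also have "\<dots> = Q.j q a (map \<iota> (map (Q'.\<beta> y) gs))" unfolding Q.j_def average_def using t by simp
 finally show ?thesis .
qed

text \<open>By Fubini both cochains are averages of \<open>a\<close> over the product of the two
  quotients, along \<open>\<psi>\<^sub>1\<close> and \<open>\<psi>\<^sub>0\<close>; the two random
  maps are homotopic.\<close>

theorem j_restr:
 assumes a: "a \<in> cocycles Q.\<G> q"
 shows "(\<lambda>gs. Q'.j q (restr Q'.\<G> \<iota> q (Q.j q a)) gs - restr G' \<iota> q (Q.j q a) gs) \<in> cobs G' q"
proof -
 note aD = cocyclesD[OF a]
 obtain C where C: "0 \<le> C" "\<forall>gs. \<bar>a gs\<bar> \<le> C" by (rule cochains_bound[OF aD(1)])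
 let ?M = "M' \<Otimes>\<^sub>M M"
 have rm: "random_map ?M G' Q.\<G> T \<psi>" if "\<psi> = \<psi>\<^sub>0 \<or> \<psi> = \<psi>\<^sub>1" for \<psi>
 proof (rule random_map.intro[OF finite_prod total_prod Q'.is_group T_meas T_distr])
  show "(\<lambda>\<omega>. \<psi> \<omega> g) \<in> ?M \<rightarrow>\<^sub>M count_space (carrier Q.\<G>)" if "g \<in> carrier G'" for g
   using \<psi>\<^sub>0_meas[OF that] \<psi>\<^sub>1_meas[OF that] \<open>\<psi> = \<psi>\<^sub>0 \<or> \<psi> = \<psi>\<^sub>1\<close> by auto
  show "\<exists>c\<in>carrier Q.\<G>. \<forall>h\<in>carrier G'. \<psi> (T g \<omega>) (g \<otimes>\<^bsub>G'\<^esub> h) = c \<otimes>\<^bsub>Q.\<G>\<^esub> \<psi> \<omega> h"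
   if "g \<in> carrier G'" "\<omega> \<in> space ?M" for g \<omega>
   using equiv[OF that] \<open>\<psi> = \<psi>\<^sub>0 \<or> \<psi> = \<psi>\<^sub>1\<close> by auto
 next
  show "countable (carrier Q.\<G>)" using Q.countable by simp
 qed
 have hom: "(\<lambda>gs. average ?M \<psi>\<^sub>1 G' q a gs - average ?M \<psi>\<^sub>0 G' q a gs) \<in> cobs G' q"
  by (rule random_map_homotopy[where T = T and \<Gamma> = Q.\<G>, OF rm rm _ a]) (simp_all add: equiv)
 have fub: "(\<integral>\<omega>. f \<omega> \<partial>?M) = (\<integral>y. (\<integral>x. f (y, x) \<partial>M) \<partial>M')"
  if f: "f \<in> borel_measurable ?M" "\<And>\<omega>. \<bar>f \<omega>\<bar> \<le> C" for f :: "_ \<Rightarrow> real"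
  by (rule P.integral_fst'[symmetric]) (rule bounded_integrable[OF finite_prod f])
 have eq: "average ?M \<psi>\<^sub>1 G' q a gs - average ?M \<psi>\<^sub>0 G' q a gs =
   Q'.j q (restr Q'.\<G> \<iota> q (Q.j q a)) gs - restr G' \<iota> q (Q.j q a) gs" for gs
 proof (cases "gs \<in> tuples G' q")
  case True
  then have sub: "set gs \<subseteq> carrier G'" by (simp add: tuples_def)
  have \<iota>gs: "map \<iota> gs \<in> tuples G q" using True \<iota>_closed by (intro tuples_map_closed)
  have m0: "(\<lambda>\<omega>. a (map (\<psi>\<^sub>0 \<omega>) gs)) \<in> borel_measurable ?M" "(\<lambda>\<omega>. a (map (\<psi>\<^sub>1 \<omega>) gs)) \<in> borel_measurable ?M"
   by (rule measurable_real_countable[OF measurable_map_countable[OF Q.countable \<psi>\<^sub>0_meas]], use sub in blast)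
    (rule measurable_real_countable[OF measurable_map_countable[OF Q.countable \<psi>\<^sub>1_meas]], use sub in blast)
  have "(\<integral>\<omega>. a (map (\<psi>\<^sub>0 \<omega>) gs) \<partial>?M) = (\<integral>y. Q.j q a (map \<iota> gs) \<partial>M')"
   unfolding fub[OF m0(1) spec[OF C(2)]] by (simp add: \<psi>\<^sub>0_def[abs_def] Q.j_def average_def \<iota>gs comp_def)
  also have "\<dots> = restr G' \<iota> q (Q.j q a) gs" using Q'.total True by (simp add: restr_def)
  finally have 0: "(\<integral>\<omega>. a (map (\<psi>\<^sub>0 \<omega>) gs) \<partial>?M) = restr G' \<iota> q (Q.j q a) gs" .
  have "(\<integral>\<omega>. a (map (\<psi>\<^sub>1 \<omega>) gs) \<partial>?M) = (\<integral>y. Q.j q a (map \<iota> (map (Q'.\<beta> y) gs)) \<partial>M')"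
   unfolding fub[OF m0(2) spec[OF C(2)]]
   by (rule Bochner_Integration.integral_cong[OF refl average_\<psi>\<^sub>1[OF aD(1) True]])
  also have "\<dots> = (\<integral>y. restr Q'.\<G> \<iota> q (Q.j q a) (map (Q'.\<beta> y) gs) \<partial>M')"
   by (rule Bochner_Integration.integral_cong[OF refl]) (simp add: restr_def Q'.rm.map_tuples[OF _ True] del: map_map)
  also have "\<dots> = Q'.j q (restr Q'.\<G> \<iota> q (Q.j q a)) gs" using True by (simp add: Q'.j_def average_def)
  finally show ?thesis using 0 True by (simp add: average_def)
 qed (simp add: Q'.j_def average_def restr_def)
 show ?thesis using hom unfolding eq .
qed

end

section \<open>Transvections\<close>

locale symplectic_field = symplectic_ring K r for K :: "'a::field_char_0 set" and r +
 assumes K_UNIV: "K = UNIV"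
begin

lemma in_K: "x \<in> K"
 by (simp add: K_UNIV)

lemma V_UNIV: "V = vecs r"
 using V_carrier VI[OF _ in_K] by blast

definition T :: "'a Matrix.vec \<Rightarrow> 'a \<Rightarrow> 'a mat" where
 "T u t = idm r + rank_one r u (t \<cdot>\<^sub>v u)"

lemma T_carrier_mat: "T u t \<in> mats r"
 by (simp add: T_def)

lemma T_apply:
 assumes "u \<in> vecs r" "x \<in> vecs r"
 shows "T u t *\<^sub>v x = x + (t * \<omega> u x) \<cdot>\<^sub>v u"
 unfolding T_def
 using add_mult_distrib_mat_vec[OF one_carrier_mat[of "2 * r"] rank_one_carrier assms(2)]
  rank_one_apply[OF assms(2), of "t \<cdot>\<^sub>v u" u] assms
 by (simp add: smult_smult_assoc mult.commute)

lemma T_closed [simp]: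
 assumes u: "u \<in> vecs r"
 shows "T u t \<in> carrier G"
proof (rule GI_form[OF T_carrier_mat])
 fix v w :: "'a Matrix.vec" assume vw: "v \<in> vecs r" "w \<in> vecs r"
 then show "\<omega> (T u t *\<^sub>v v) (T u t *\<^sub>v w) = \<omega> v w"
  using u sf_skew[of r v u] by (simp add: T_apply sf_linear)
qed (rule in_K)

lemma T_eqI:
 assumes "A \<in> carrier G" "u \<in> vecs r"
  and "\<And>x. x \<in> vecs r \<Longrightarrow> A *\<^sub>v x = x + (t * \<omega> u x) \<cdot>\<^sub>v u"
 shows "A = T u t"
 by (rule G_eqI) (use assms in \<open>simp_all add: T_apply\<close>)

lemma T_add:
 assumes "u \<in> vecs r"
 shows "T u s * T u t = T u (s + t)"
proof (rule T_eqI)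
 show "T u s * T u t \<in> carrier G" using m_closed[of "T u s" "T u t"] assms by simp
 fix x :: "'a Matrix.vec" assume x: "x \<in> vecs r"
 then have "(T u s * T u t) *\<^sub>v x = (x + (t * \<omega> u x) \<cdot>\<^sub>v u) + (s * \<omega> u x) \<cdot>\<^sub>v u"
  using assms by (simp add: apply_mult T_apply sf_linear)
 also have "\<dots> = x + ((s + t) * \<omega> u x) \<cdot>\<^sub>v u"
  using assms x by (intro eq_vecI) (auto simp: algebra_simps)
 finally show "(T u s * T u t) *\<^sub>v x = x + ((s + t) * \<omega> u x) \<cdot>\<^sub>v u" .
qed fact

lemma T_zero: "u \<in> vecs r \<Longrightarrow> T u 0 = idm r"
 by (rule T_eqI[symmetric]) (use one_closed in auto)

lemma T_inv: "u \<in> vecs r \<Longrightarrow> ginv (T u t) = T u (- t)"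
 by (rule inv_equality) (simp_all add: T_add T_zero)

lemma T_smult:
 assumes "u \<in> vecs r"
 shows "T (c \<cdot>\<^sub>v u) t = T u (c * c * t)"
 using assms by (intro T_eqI) (simp_all add: T_apply sf_linear smult_smult_assoc mult_ac)

lemma T_conj:
 assumes g: "g \<in> carrier G" and u: "u \<in> vecs r"
 shows "g * T u t * ginv g = T (g *\<^sub>v u) t"
proof (rule T_eqI)
 have gT: "g * T u t \<in> carrier G" using m_closed[of g "T u t"] g u by simp
 then show "g * T u t * ginv g \<in> carrier G" using m_closed[of "g * T u t" "ginv g"] g by simp
 show "g *\<^sub>v u \<in> vecs r" using g u by simp
 fix x :: "'a Matrix.vec" assume x: "x \<in> vecs r"
 let ?y = "ginv g *\<^sub>v x"
 have y: "?y \<in> vecs r" using g x by simp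
 have "(g * T u t * ginv g) *\<^sub>v x = g *\<^sub>v (T u t *\<^sub>v ?y)"
  using g gT u x y by (simp add: apply_mult)
 also have "\<dots> = g *\<^sub>v ?y + (t * \<omega> u ?y) \<cdot>\<^sub>v (g *\<^sub>v u)"
  using g u y by (simp add: T_apply apply_linear[OF g])
 also have "\<dots> = x + (t * \<omega> (g *\<^sub>v u) x) \<cdot>\<^sub>v (g *\<^sub>v u)"
  using apply_inv(1)[OF g x] sf_apply_inv[OF g u x] by simp
 finally show "(g * T u t * ginv g) *\<^sub>v x = x + (t * \<omega> (g *\<^sub>v u) x) \<cdot>\<^sub>v (g *\<^sub>v u)" .
qed

subsection \<open>Transvections generate\<close>

lemma T_fix: "\<lbrakk>u \<in> vecs r; x \<in> vecs r; \<omega> u x = 0\<rbrakk> \<Longrightarrow> T u t *\<^sub>v x = x"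
 by (simp add: T_apply) (intro eq_vecI; simp)

lemma T_step:
 assumes "a \<in> vecs r" "b \<in> vecs r" "\<omega> a b \<noteq> 0"
 shows "T (b - a) (1 / \<omega> b a) *\<^sub>v a = b"
proof -
 have "\<omega> b a \<noteq> 0" using assms(3) sf_skew[of r b a] by simp
 then have "T (b - a) (1 / \<omega> b a) *\<^sub>v a = a + 1 \<cdot>\<^sub>v (b - a)"
  using assms by (simp add: T_apply sf_linear)
 also have "\<dots> = b" using assms by (intro eq_vecI) auto
 finally show ?thesis .
qed

context
 fixes Z :: "'a mat set"
 assumes Z_mult: "\<And>g h. g \<in> Z \<Longrightarrow> h \<in> Z \<Longrightarrow> g * h \<in> Z" and Z_closed: "Z \<subseteq> carrier G"
  and Z_T: "\<And>u t. u \<in> vecs r \<Longrightarrow> T u t \<in> Z"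
begin

text \<open>The transvection along \<open>b - a\<close> with the right parameter takes
  \<open>a\<close> to \<open>b\<close>, and it fixes every vector on which pairing with
  \<open>a\<close> and with \<open>b\<close> agree.\<close>

lemma Z_step:
 assumes "a \<in> vecs r" "b \<in> vecs r" "\<omega> a b \<noteq> 0"
  "S \<subseteq> vecs r" "\<forall>w\<in>S. \<omega> a w = \<omega> b w"
 shows "\<exists>z\<in>Z. z *\<^sub>v a = b \<and> (\<forall>w\<in>S. z *\<^sub>v w = w)"
proof (intro bexI conjI ballI)
 show "T (b - a) (1 / \<omega> b a) *\<^sub>v a = b" by (rule T_step[OF assms(1-3)])
 show "T (b - a) (1 / \<omega> b a) *\<^sub>v w = w" if "w \<in> S" for w
  using assms that by (intro T_fix) (auto simp: sf_linear)
qed (use assms Z_T in auto)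

lemma Z_two_steps:
 assumes c: "a \<in> vecs r" "b \<in> vecs r" "m \<in> vecs r"
  and m: "\<omega> a b = 0 \<Longrightarrow> \<omega> a m \<noteq> 0 \<and> \<omega> m b \<noteq> 0"
  and S: "S \<subseteq> vecs r" "\<forall>w\<in>S. \<omega> a w = \<omega> b w" "\<forall>w\<in>S. \<omega> m w = \<omega> b w"
 shows "\<exists>z\<in>Z. z *\<^sub>v a = b \<and> (\<forall>w\<in>S. z *\<^sub>v w = w)"
proof (cases "\<omega> a b = 0")
 case True
 obtain z where z: "z \<in> Z" "z *\<^sub>v a = m" "\<forall>w\<in>S. z *\<^sub>v w = w"
  using Z_step[OF c(1,3) _ S(1)] m[OF True] S by auto
 obtain z' where z': "z' \<in> Z" "z' *\<^sub>v m = b" "\<forall>w\<in>S. z' *\<^sub>v w = w"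
  using Z_step[OF c(3,2) _ S(1)] m[OF True] S by auto
 have zG: "z \<in> carrier G" "z' \<in> carrier G" using z(1) z'(1) Z_closed by auto
 have "(z' * z) *\<^sub>v a = b" using z(2) z'(2) apply_mult[OF zG(2,1) c(1)] by simp
 moreover have "(z' * z) *\<^sub>v w = w" if "w \<in> S" for w
  using apply_mult[OF zG(2,1)] z(3) z'(3) that S(1) by (simp add: subset_iff)
 ultimately show ?thesis using Z_mult[OF z'(1) z(1)] by blast
qed (use Z_step[OF c(1,2) _ S(1,2)] in simp)

lemma Z_pair:
 assumes p: "p \<in> hyp" "p' \<in> hyp" and S: "S \<subseteq> vecs r"
  "\<forall>w\<in>S. \<omega> (fst p) w = 0 \<and> \<omega> (snd p) w = 0" "\<forall>w\<in>S. \<omega> (fst p') w = 0 \<and> \<omega> (snd p') w = 0"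
 shows "\<exists>z\<in>Z. act2 z p = p' \<and> (\<forall>w\<in>S. z *\<^sub>v w = w)"
proof -
 obtain u v where uv: "p = (u, v)" by (cases p)
 obtain u' v' where uv': "p' = (u', v')" by (cases p')
 have c: "u \<in> vecs r" "v \<in> vecs r" "u' \<in> vecs r" "v' \<in> vecs r"
  and one: "\<omega> u v = 1" "\<omega> u' v' = 1" using p by (auto simp: hyp_def uv uv' V_UNIV)
 have zero: "\<omega> u w = 0" "\<omega> v w = 0" "\<omega> u' w = 0" "\<omega> v' w = 0" if "w \<in> S" for w using S that by (auto simp: uv uv')
 have cS: "w \<in> vecs r" if "w \<in> S" for w using S that by blast
 \<comment> \<open>An intermediate vector pairing nontrivially with both \<open>u\<close> and
   \<open>u'\<close>. If neither partner works alone, the two missing pairings vanish and the sum of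
   the partners works.\<close>
 define m where "m = (if \<omega> v u' \<noteq> 0 then v else if \<omega> u v' \<noteq> 0 then v' else v + v')"
 have cm: "m \<in> vecs r" using c by (auto simp: m_def)
 have m: "\<omega> u m \<noteq> 0" "\<omega> m u' \<noteq> 0" using c one sf_skew[of r v' u'] by (auto simp: m_def sf_linear)
 have "\<omega> m w = 0" if "w \<in> S" for w using zero[OF that] c by (auto simp: m_def sf_linear)
 then obtain z where z: "z \<in> Z" "z *\<^sub>v u = u'" "\<forall>w\<in>S. z *\<^sub>v w = w"
  using Z_two_steps[OF c(1,3) cm _ S(1)] m zero by auto
 have zG: "z \<in> carrier G" using z(1) Z_closed by auto
 define b where "b = z *\<^sub>v v"
 have cb: "b \<in> vecs r" using zG c by (simp add: b_def)
 have bu: "\<omega> u' b = 1" using G_sf[OF zG c(1,2)] one z(2) by (simp add: b_def)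
 have bw: "\<omega> b w = 0" if "w \<in> S" for w
  using G_sf[OF zG c(2) cS[OF that]] zero[OF that] z(3) that by (simp add: b_def)
 have ub: "\<omega> b u' = - 1" "\<omega> v' u' = - 1" using bu one sf_skew[of r b u'] sf_skew[of r v' u'] by auto
 \<comment> \<open>The second vector is corrected while \<open>u'\<close> stays fixed:
   \<open>b\<close>, \<open>v'\<close> and the intermediate \<open>b + u'\<close> all pair with
   \<open>u'\<close> to the same value.\<close>
 obtain y where y: "y \<in> Z" "y *\<^sub>v b = v'" "\<forall>w\<in>insert u' S. y *\<^sub>v w = w"
  using Z_two_steps[OF cb c(4), of "b + u'" "insert u' S"] cb c bu ub one zero bw S(1) by (auto simp: sf_linear)
 have yG: "y \<in> carrier G" using y(1) Z_closed by auto
 have "act2 (y * z) p = p'"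
  using apply_mult[OF yG zG] c z(2) y by (simp add: act2_def uv uv' b_def)
 moreover have "(y * z) *\<^sub>v w = w" if "w \<in> S" for w
  using apply_mult[OF yG zG cS[OF that]] z(3) y(3) that by simp
 ultimately show ?thesis using Z_mult[OF y(1) z(1)] by blast
qed

text \<open>The standard pairs are matched with their images one at a time; each correction fixes
  the pairs already treated, as \<open>Z_pair\<close> fixes all vectors orthogonal to both the old
  and the new pair.\<close>

lemma Z_UNIV:
 assumes g: "g \<in> carrier G"
 shows "g \<in> Z"
proof -
 have "\<exists>z\<in>Z. \<forall>i<k. act2 z (std_pair i) = act2 g (std_pair i)" if "k \<le> r" for k
  using that
 proof (induction k)
  case 0
  then show ?case using Z_T[of "zv r"] by auto
 next
  case (Suc k)
  then obtain z where z: "z \<in> Z" "\<forall>i<k. act2 z (std_pair i) = act2 g (std_pair i)" by auto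
  have zG: "z \<in> carrier G" using z(1) Z_closed by auto
  let ?h = "ginv z \<otimes>\<^bsub>G\<^esub> g"
  have h: "?h \<in> carrier G" using zG g by (intro m_closed inv_closed)
  have zh: "z \<otimes>\<^bsub>G\<^esub> ?h = g" using zG g by (simp only: m_assoc[symmetric] inv_closed r_inv l_one)
  have hfix: "act2 ?h (std_pair i) = std_pair i" if "i < k" for i
  proof -
   have i: "std_pair i \<in> hyp" using that Suc.prems by (intro std_pair_hyp) simp
   have "act2 ?h (std_pair i) = act2 (ginv z) (act2 z (std_pair i))"
    using act2_mult[OF inv_closed[OF zG] g i] z(2) that by simp
   also have "\<dots> = act2 (ginv z \<otimes>\<^bsub>G\<^esub> z) (std_pair i)" by (rule act2_mult[OF inv_closed[OF zG] zG i, symmetric])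
   also have "\<dots> = std_pair i" unfolding l_inv[OF zG] by (rule act2_one[OF i])
   finally show ?thesis .
  qed
  let ?S = "\<Union>i\<in>{..<k}. {basis r i, basis r (r + i)}"
  have kh: "std_pair k \<in> hyp" using Suc.prems by (intro std_pair_hyp) simp
  have orth: "orth (std_pair k) (std_pair i)" "orth (act2 ?h (std_pair k)) (std_pair i)" if "i < k" for i
  proof -
   show 1: "orth (std_pair k) (std_pair i)" using that Suc.prems by (intro std_pair_orth) auto
   have "std_pair i \<in> hyp" using that Suc.prems by (intro std_pair_hyp) simp
   from act2_orth[OF h kh this 1] show "orth (act2 ?h (std_pair k)) (std_pair i)" unfolding hfix[OF that] .
  qed
  have "\<exists>y\<in>Z. act2 y (std_pair k) = act2 ?h (std_pair k) \<and> (\<forall>w\<in>?S. y *\<^sub>v w = w)"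
  proof (rule Z_pair[OF kh act2_closed[OF h kh]])
   show "\<forall>w\<in>?S. \<omega> (fst (std_pair k)) w = 0 \<and> \<omega> (snd (std_pair k)) w = 0"
    using orth(1) unfolding orth_def by auto
   show "\<forall>w\<in>?S. \<omega> (fst (act2 ?h (std_pair k))) w = 0 \<and> \<omega> (snd (act2 ?h (std_pair k))) w = 0"
    using orth(2) unfolding orth_def by auto
  qed auto
  then obtain y where y: "y \<in> Z" "act2 y (std_pair k) = act2 ?h (std_pair k)" "\<forall>w\<in>?S. y *\<^sub>v w = w" by blast
  have yG: "y \<in> carrier G" using y(1) Z_closed by auto
  have "act2 (z \<otimes>\<^bsub>G\<^esub> y) (std_pair i) = act2 g (std_pair i)" if "i < Suc k" for i
  proof (cases "i = k")
   case True
   have "act2 (z \<otimes>\<^bsub>G\<^esub> y) (std_pair k) = act2 z (act2 ?h (std_pair k))"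
    using act2_mult[OF zG yG kh] y(2) by simp
   also have "\<dots> = act2 g (std_pair k)" using act2_mult[OF zG h kh] zh by simp
   finally show ?thesis using True by simp
  next
   case False
   then have i: "i < k" "std_pair i \<in> hyp" using that Suc.prems by (auto intro: std_pair_hyp)
   have "act2 y (std_pair i) = std_pair i" using y(3) i(1) by (auto simp: act2_def)
   then show ?thesis using act2_mult[OF zG yG i(2)] z(2) i(1) by simp
  qed
  moreover have "z \<otimes>\<^bsub>G\<^esub> y \<in> Z" using Z_mult[OF z(1) y(1)] by simp
  ultimately show ?case by blast
 qed
 from this[of r] obtain z where z: "z \<in> Z" "\<forall>i<r. act2 z (std_pair i) = act2 g (std_pair i)" by auto
 have zG: "z \<in> carrier G" using z(1) Z_closed by auto
 note zc = G_carrier_mat[OF zG] and gc = G_carrier_mat[OF g]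
 have "z *\<^sub>v basis r j = g *\<^sub>v basis r j" if "j < 2 * r" for j
 proof (cases "j < r")
  case True
  then show ?thesis using z(2) by (simp add: act2_def)
 next
  case False
  then have "z *\<^sub>v basis r (r + (j - r)) = g *\<^sub>v basis r (r + (j - r))"
   using spec[OF z(2), of "j - r"] that by (simp add: act2_def)
  then show ?thesis using False by simp
 qed
 then have "z $$ (i, j) = g $$ (i, j)" if "i < 2 * r" "j < 2 * r" for i j
  using mat_apply_unit[OF zc that] mat_apply_unit[OF gc that] that by simp
 then have "z = g" using zc gc by (intro eq_matI) auto
 with z(1) show ?thesis by simp
qed

end

end

section \<open>Mautner phenomenon\<close>

locale symplectic_normed_field = symplectic_field K r for K :: "'a::real_normed_field set" and r
begin

text \<open>
 For a length function, the transvection \<open>T u 1\<close> of length zero forces its integer powers to have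
 length zero, and then the products \<open>T v (- s / 2) * T u (- 2 * n) * T v s * T u n\<close> with
 \<open>s = 1 / (2 * n)\<close>, which do not depend on \<open>n\<close>, conjugate \<open>T v t\<close> to \<open>T v (t / 4)\<close>.
\<close>

lemma nonorthogonal:
 assumes "v \<in> vecs r" "v \<noteq> zv r"
 shows "\<exists>w\<in>vecs r. \<omega> v w \<noteq> 0"
proof (rule ccontr)
 assume "\<not> (\<exists>w\<in>vecs r. \<omega> v w \<noteq> 0)"
 then have "\<omega> v w = 0" if "w \<in> vecs r" for w using that by simp
 from sf_nondegenerate[OF assms(1) this] assms(2) show False by simp
qed

context
 fixes \<rho> :: "'a mat \<Rightarrow> real"
 assumes nonneg: "\<And>g. 0 \<le> \<rho> g"
  and mult: "\<And>g h. g \<in> carrier G \<Longrightarrow> h \<in> carrier G \<Longrightarrow> \<rho> (g * h) \<le> \<rho> g + \<rho> h"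
  and inv_eq: "\<And>g. g \<in> carrier G \<Longrightarrow> \<rho> (ginv g) = \<rho> g"
  and one: "\<rho> (idm r) = 0"
  and lim: "\<And>v t. v \<in> vecs r \<Longrightarrow> t \<longlonglongrightarrow> 0 \<Longrightarrow> (\<lambda>n. \<rho> (T v (t n))) \<longlonglongrightarrow> 0"
begin

lemma mult_zero: "\<lbrakk>g \<in> carrier G; h \<in> carrier G; \<rho> g = 0; \<rho> h = 0\<rbrakk> \<Longrightarrow> \<rho> (g * h) = 0"
 using mult[of g h] nonneg[of "g * h"] by simp

lemma conj_le:
 assumes "g \<in> carrier G" "h \<in> carrier G" "\<rho> g = 0"
 shows "\<rho> (g * h * ginv g) \<le> \<rho> h"
proof -
 have gh: "g * h \<in> carrier G" using m_closed[of g h] assms by simp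
 show ?thesis using mult[OF gh, of "ginv g"] mult[OF assms(1,2)] inv_eq[OF assms(1)] assms by simp
qed

lemma T_nat_zero:
 assumes "u \<in> vecs r" "\<rho> (T u 1) = 0"
 shows "\<rho> (T u (of_nat n)) = 0"
proof (induction n)
 case 0
 then show ?case using assms(1) one by (simp add: T_zero)
next
 case (Suc n)
 then show ?case
  using mult_zero[of "T u 1" "T u (of_nat n)"] assms T_add[OF assms(1), of 1 "of_nat n"] by simp
qed

lemma contraction:
 assumes u: "u \<in> vecs r" and v: "v \<in> vecs r" and uv: "\<omega> u v = 1"
  and zero: "\<rho> (T u 1) = 0"
 obtains D where "D \<in> carrier G" "\<rho> D = 0" "D *\<^sub>v v = (1 / 2) \<cdot>\<^sub>v v"
proof -
 have vu: "\<omega> v u = - 1" using uv sf_skew[of r v u] by simp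
 define D where "D n = T v (- (1 / (4 * of_nat (Suc n)))) * (T u (- (2 * of_nat (Suc n))) * (T v (1 / (2 * of_nat (Suc n))) * T u (of_nat (Suc n))))" for n
 have cl: "T v s * T u t \<in> carrier G" "T u a * (T v s * T u t) \<in> carrier G"
  "T v b * (T u a * (T v s * T u t)) \<in> carrier G" for a b s t
  using m_closed[of "T v s" "T u t"] m_closed[of "T u a" "T v s * T u t"] m_closed[of "T v b" "T u a * (T v s * T u t)"] u v by simp_all
 have DG: "D n \<in> carrier G" for n unfolding D_def by (rule cl)
 \<comment> \<open>On the plane of \<open>u\<close> and \<open>v\<close> this is diagonal: it
   doubles \<open>u\<close> and halves \<open>v\<close>. The integer \<open>n\<close> has
   cancelled.\<close>
 have D_apply: "D n *\<^sub>v x = x - \<omega> v x \<cdot>\<^sub>v u - (\<omega> u x / 2) \<cdot>\<^sub>v v" if x: "x \<in> vecs r" for n x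
 proof -
  define N :: 'a where "N = of_nat (Suc n)"
  have N: "N \<noteq> 0" unfolding N_def by (simp del: of_nat_Suc)
  define a b where "a = \<omega> u x" and "b = \<omega> v x"
  define y1 where "y1 = x + (N * a) \<cdot>\<^sub>v u"
  define y2 where "y2 = y1 + (1 / (2 * N) * (b - N * a)) \<cdot>\<^sub>v v"
  define y3 where "y3 = y2 + (- (2 * N) * (a + 1 / (2 * N) * (b - N * a))) \<cdot>\<^sub>v u"
  define y4 where "y4 = y3 + (- (1 / (4 * N)) * (2 * b)) \<cdot>\<^sub>v v"
  have c: "y1 \<in> vecs r" "y2 \<in> vecs r" "y3 \<in> vecs r" "y4 \<in> vecs r"
   using u v x by (simp_all add: y1_def y2_def y3_def y4_def)
  have \<omega>1: "\<omega> v y1 = b - N * a" "\<omega> u y1 = a" using u v x vu by (simp_all add: y1_def sf_linear a_def b_def)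
  have \<omega>2: "\<omega> u y2 = a + 1 / (2 * N) * (b - N * a)" "\<omega> v y2 = b - N * a"
   using u v c \<omega>1 uv by (simp_all add: y2_def sf_linear)
  have "\<omega> v y3 = (b - N * a) + 2 * N * (a + 1 / (2 * N) * (b - N * a))"
   using u v c \<omega>2 vu by (simp add: y3_def sf_linear)
  then have \<omega>3: "\<omega> v y3 = 2 * b" using N by (simp add: field_simps)
  have "T u N *\<^sub>v x = y1" using u x by (simp add: T_apply y1_def a_def)
  moreover have "T v (1 / (2 * N)) *\<^sub>v y1 = y2" using v c \<omega>1 by (simp add: T_apply y2_def)
  moreover have "T u (- (2 * N)) *\<^sub>v y2 = y3" using u c by (simp only: T_apply \<omega>2 y3_def)
  moreover have "T v (- (1 / (4 * N))) *\<^sub>v y3 = y4" using v c by (simp only: T_apply \<omega>3 y4_def)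
  ultimately have "D n *\<^sub>v x = y4"
   unfolding D_def N_def[symmetric] using u v x c by (simp add: apply_mult cl)
  also have "y4 = x - b \<cdot>\<^sub>v u - (a / 2) \<cdot>\<^sub>v v"
  proof (rule eq_vecI)
   fix i assume "i < dim_vec (x - b \<cdot>\<^sub>v u - (a / 2) \<cdot>\<^sub>v v)"
   then have i: "i < 2 * r" using v by simp
   have "y4 $ i = x $ i + N * a * u $ i + 1 / (2 * N) * (b - N * a) * v $ i
     + - (2 * N) * (a + 1 / (2 * N) * (b - N * a)) * u $ i + - (1 / (4 * N)) * (2 * b) * v $ i"
    using u v x c i unfolding y4_def y3_def y2_def y1_def by simp
   also have "\<dots> = x $ i - b * u $ i - a / 2 * v $ i" using N by (simp add: field_simps)
   also have "\<dots> = (x - b \<cdot>\<^sub>v u - (a / 2) \<cdot>\<^sub>v v) $ i" using u v x i by simp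
   finally show "y4 $ i = (x - b \<cdot>\<^sub>v u - (a / 2) \<cdot>\<^sub>v v) $ i" .
  qed (use u v x c in simp)
  finally show ?thesis unfolding a_def b_def .
 qed
 have D_const: "D n = D 0" for n by (rule G_eqI[OF DG DG]) (simp add: D_apply)
 have \<rho>D: "\<rho> (D n) \<le> \<rho> (T v (- (1 / (4 * of_nat (Suc n))))) + \<rho> (T v (1 / (2 * of_nat (Suc n))))" for n
 proof -
  have "\<rho> (T u (of_nat (Suc n))) = 0" by (rule T_nat_zero[OF u zero])
  moreover have "\<rho> (T u (- (2 * of_nat (Suc n)))) = 0"
   using T_nat_zero[OF u zero, of "2 * Suc n"] inv_eq[of "T u (of_nat (2 * Suc n))"] T_inv[OF u, of "of_nat (2 * Suc n)"] u by simp
  ultimately show ?thesis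
   unfolding D_def
   using mult[of "T v (- (1 / (4 * of_nat (Suc n))))" "T u (- (2 * of_nat (Suc n))) * (T v (1 / (2 * of_nat (Suc n))) * T u (of_nat (Suc n)))"]
    mult[of "T u (- (2 * of_nat (Suc n)))" "T v (1 / (2 * of_nat (Suc n))) * T u (of_nat (Suc n))"]
    mult[of "T v (1 / (2 * of_nat (Suc n)))" "T u (of_nat (Suc n))"] cl u v
   by (simp del: of_nat_Suc)
 qed
 have l: "(\<lambda>n. 1 / (c * of_nat (Suc n)) :: 'a) \<longlonglongrightarrow> 0" for c :: 'a
  using tendsto_mult[OF tendsto_const[of "1 / c"] LIMSEQ_Suc[OF lim_1_over_n]] by simp
 have l4: "(\<lambda>n. - (1 / (4 * of_nat (Suc n))) :: 'a) \<longlonglongrightarrow> 0" using tendsto_minus[OF l[of 4]] by (simp only: minus_zero)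
 \<comment> \<open>The factors along \<open>u\<close> have length zero and those along
   \<open>v\<close> tend to the identity, so the fixed element \<open>D 0\<close> has arbitrarily
   small length.\<close>
 have "\<rho> (D 0) \<le> 0 + 0"
 proof (rule LIMSEQ_le_const[OF tendsto_add[OF lim[OF v l4] lim[OF v l[of 2]]]], intro exI allI impI)
  fix n
  show "\<rho> (D 0) \<le> \<rho> (T v (- (1 / (4 * of_nat (Suc n))))) + \<rho> (T v (1 / (2 * of_nat (Suc n))))"
   using \<rho>D[of n] unfolding D_const[of n] .
 qed
 then have "\<rho> (D 0) = 0" using nonneg[of "D 0"] by simp
 moreover have "D 0 *\<^sub>v v = (1 / 2) \<cdot>\<^sub>v v"
 proof (rule eq_vecI)
  fix i assume "i < dim_vec ((1 / 2) \<cdot>\<^sub>v v)"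
  then have i: "i < 2 * r" using v by simp
  have "(D 0 *\<^sub>v v) $ i = v $ i - (1 / 2) * v $ i"
   unfolding D_apply[OF v] sf_self uv using u v i by simp
  then show "(D 0 *\<^sub>v v) $ i = ((1 / 2) \<cdot>\<^sub>v v) $ i" using v i by (simp add: field_simps)
 qed (use v carrier_matD[OF G_carrier_mat[OF DG]] in simp)
 ultimately show ?thesis using that[OF DG] by blast
qed

text \<open>Conjugation by \<open>D\<close>, an element of length zero, preserves lengths and
  contracts the transvections along \<open>v\<close> to the identity by a factor 4 each time, the
  square of the factor on \<open>v\<close>.\<close>

lemma T_zero_dual:
 assumes u: "u \<in> vecs r" and v: "v \<in> vecs r" and uv: "\<omega> u v = 1"
  and zero: "\<rho> (T u 1) = 0"
 shows "\<rho> (T v t) = 0"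
proof -
 obtain D where D: "D \<in> carrier G" "\<rho> D = 0" "D *\<^sub>v v = (1 / 2) \<cdot>\<^sub>v v" by (rule contraction[OF assms])
 have DT: "D * T v s * ginv D = T v (s / 4)" for s
  using T_conj[OF D(1) v, of s] T_smult[OF v, of "1 / 2" s] D(3) by simp
 have le: "\<rho> (T v s) \<le> \<rho> (T v (s / 4))" for s
 proof -
  have X: "T v s \<in> carrier G" using v by simp
  have "ginv D \<otimes>\<^bsub>G\<^esub> (D \<otimes>\<^bsub>G\<^esub> T v s \<otimes>\<^bsub>G\<^esub> ginv D) \<otimes>\<^bsub>G\<^esub> D = T v s"
   using D(1) X by (simp add: m_assoc del: G_simps) (simp add: m_assoc[symmetric] del: G_simps)
  then have "ginv D * T v (s / 4) * ginv (ginv D) = T v s"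
   using D(1) DT[of s] by simp
  then show ?thesis using conj_le[of "ginv D" "T v (s / 4)"] D v inv_eq[of D] by simp
 qed
 have "\<rho> (T v t) \<le> \<rho> (T v (t * (1 / 4) ^ n))" for n
 proof (induction n)
  case (Suc n)
  then show ?case using le[of "t * (1 / 4) ^ n"] by simp
 qed simp
 then have "\<exists>N. \<forall>n\<ge>N. \<rho> (T v t) \<le> \<rho> (T v (t * (1 / 4) ^ n))" by blast
 moreover have "(\<lambda>n. t * (1 / 4) ^ n) \<longlonglongrightarrow> 0"
  by (intro tendsto_mult_right_zero LIMSEQ_power_zero) (simp add: norm_divide)
 ultimately have "\<rho> (T v t) \<le> 0" by (intro LIMSEQ_le_const[OF lim[OF v]])
 then show ?thesis using nonneg[of "T v t"] by simp
qed

lemma T_zero_nonorthogonal: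
 assumes u: "u \<in> vecs r" and v: "v \<in> vecs r" and uv: "\<omega> u v \<noteq> 0"
  and zero: "\<rho> (T u 1) = 0"
 shows "\<rho> (T v t) = 0"
proof -
 define v' where "v' = (1 / \<omega> u v) \<cdot>\<^sub>v v"
 have v': "v' \<in> vecs r" "\<omega> u v' = 1" using v u uv by (simp_all add: v'_def sf_linear)
 have "T v t = T v' (\<omega> u v * \<omega> u v * t)"
  using T_smult[OF v, of "1 / \<omega> u v" "\<omega> u v * \<omega> u v * t"] uv by (simp add: v'_def)
 then show ?thesis using T_zero_dual[OF u v' zero] by simp
qed

text \<open>Two nonzero vectors always have a common vector \<open>w\<close> orthogonal to neither,
  so two applications of the previous step reach every transvection. The elements of length zero are
  closed under products, and transvections generate.\<close>

lemma mautner: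
 assumes u: "u \<in> vecs r" "u \<noteq> zv r" and zero: "\<rho> (T u 1) = 0" and g: "g \<in> carrier G"
 shows "\<rho> g = 0"
proof -
 have "\<rho> (T v t) = 0" if v: "v \<in> vecs r" for v t
 proof (cases "v = zv r")
  case True
  have "0 \<cdot>\<^sub>v v = v" unfolding True by (intro eq_vecI) simp_all
  then have "T v t = idm r" using T_smult[OF v, of 0 t] T_zero[OF v] by simp
  then show ?thesis using one by simp
 next
  case False
  obtain a where a: "a \<in> vecs r" "\<omega> u a \<noteq> 0" using nonorthogonal[OF u] by blast
  obtain b where b: "b \<in> vecs r" "\<omega> v b \<noteq> 0" using nonorthogonal[OF v False] by blast
  define w where "w = (if \<omega> v a \<noteq> 0 then a else if \<omega> u b \<noteq> 0 then b else a + b)"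
  have w: "w \<in> vecs r \<and> \<omega> u w \<noteq> 0 \<and> \<omega> v w \<noteq> 0"
  proof (cases "\<omega> v a = 0 \<and> \<omega> u b = 0")
   case True
   then show ?thesis using a b by (simp add: w_def sf_add_right)
  next
   case False
   then show ?thesis unfolding w_def using a b by presburger
  qed
  then have w: "w \<in> vecs r" "\<omega> u w \<noteq> 0" "\<omega> v w \<noteq> 0" by simp_all
  have wv: "\<omega> w v \<noteq> 0" using w(3) unfolding sf_skew[of r w v] by simp
  show ?thesis
   by (rule T_zero_nonorthogonal[OF w(1) v wv T_zero_nonorthogonal[OF u(1) w(1,2) zero]])
 qed
 note T0 = this
 have "g \<in> {g \<in> carrier G. \<rho> g = 0}"
 proof (rule Z_UNIV[OF _ _ _ g])
  fix a b assume "a \<in> {g \<in> carrier G. \<rho> g = 0}" "b \<in> {g \<in> carrier G. \<rho> g = 0}"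
  then have ab: "a \<in> carrier G" "b \<in> carrier G" "\<rho> a = 0" "\<rho> b = 0" by simp_all
  show "a * b \<in> {g \<in> carrier G. \<rho> g = 0}" using mult_zero[OF ab] m_closed[OF ab(1,2)] by simp
 next
  fix v :: "'a Matrix.vec" and t assume "v \<in> vecs r"
  then show "T v t \<in> {g \<in> carrier G. \<rho> g = 0}" using T0 by simp
 qed blast
 then show ?thesis by simp
qed

end

end

section \<open>Injectivity of the averaging map\<close>

locale sp_quotient = SF: symplectic_normed_field K r + MQ: measured_quotient "Sp_over K r" B \<Gamma> M s
 for K :: "'a::real_normed_field set" and r and B \<Gamma> M s +
 assumes r_pos: "1 \<le> r"
  and disp_lim: "v \<in> vecs r \<Longrightarrow> t \<longlonglongrightarrow> 0 \<Longrightarrow> A \<in> sets M \<Longrightarrow> (\<lambda>n. MQ.disp A (SF.T v (t n))) \<longlonglongrightarrow> 0"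
begin

abbreviation G :: "'a mat monoid" where "G \<equiv> Sp_over K r"

abbreviation P :: "'a Matrix.vec set" where "P \<equiv> vecs r - {zv r}"

lemma disp_zero:
 assumes A: "A \<in> sets M" and u: "u \<in> vecs r" "u \<noteq> zv r" "MQ.disp A (SF.T u 1) = 0" and h: "h \<in> carrier G"
 shows "MQ.disp A h = 0"
proof (rule SF.mautner[of "MQ.disp A", OF _ _ _ _ _ u h])
 show "0 \<le> MQ.disp A g" for g by (rule MQ.disp_nonneg)
 show "MQ.disp A (g * k) \<le> MQ.disp A g + MQ.disp A k" if "g \<in> carrier G" "k \<in> carrier G" for g k
  using MQ.disp_mult[OF A that] by simp
 show "MQ.disp A (inv\<^bsub>G\<^esub> g) = MQ.disp A g" if "g \<in> carrier G" for g by (rule MQ.disp_inv[OF A that])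
 show "MQ.disp A (idm r) = 0" using MQ.disp_one[OF A] by simp
 show "(\<lambda>n. MQ.disp A (SF.T v (t n))) \<longlonglongrightarrow> 0" if "v \<in> vecs r" "t \<longlonglongrightarrow> 0" for v t
  by (rule disp_lim[OF that A])
qed

text \<open>The vectors lie in a frame of at most as many pairs; the first component of a further
  pair is orthogonal to them. Since single vectors replace pairs, no factor 2 is lost here.\<close>

lemma orthogonal_exists:
 assumes "length ps \<le> r - 1" "set ps \<subseteq> vecs r"
 shows "\<exists>p\<in>P. \<forall>b\<in>set ps. SF.\<omega> p b = 0"
proof -
 obtain qs where qs: "SF.frame qs" "length qs \<le> length ps" "\<forall>x\<in>set ps. x - SF.transfer qs qs x = zv r"
  using SF.frame_spanning[of ps] assms(2) SF.V_UNIV by blast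
 have "length qs < r" using qs(2) assms(1) r_pos by linarith
 then obtain p where p: "p \<in> SF.hyp" "\<forall>q\<in>set qs. SF.orth p q" by (rule SF.frame_extend_short[OF qs(1)])
 have fp: "fst p \<in> vecs r" using p(1) by simp
 have "SF.\<omega> (fst p) b = 0" if b: "b \<in> set ps" for b
 proof -
  have bc: "b \<in> vecs r" using b assms(2) by blast
  have tc: "SF.transfer qs qs b \<in> vecs r" using SF.frame_hyp[OF qs(1)] bc by simp
  have "SF.\<omega> (SF.transfer qs qs b) (fst p) = 0"
  proof (rule SF.sf_transfer_zero[OF SF.frame_hyp[OF qs(1)] fp])
   fix q assume "q \<in> set qs"
   from SF.orth_sym[OF bspec[OF p(2) this]] show "SF.\<omega> (fst q) (fst p) = 0 \<and> SF.\<omega> (snd q) (fst p) = 0"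
    by (simp add: SF.orth_def)
  qed
  then have "SF.\<omega> (fst p) (SF.transfer qs qs b) = 0"
   using sf_skew[of r "fst p" "SF.transfer qs qs b"] by simp
  moreover have "SF.\<omega> (fst p) (b - SF.transfer qs qs b) = 0" unfolding bspec[OF qs(3) b] by simp
  ultimately show ?thesis using bc tc by (simp add: sf_minus_right)
 qed
 moreover have "fst p \<noteq> zv r"
 proof
  assume "fst p = zv r"
  with SF.hypD(3)[OF p(1)] show False by simp
 qed
 ultimately show ?thesis using fp by blast
qed

text \<open>Domination is supplied by the bound in \<open>cochain\<close>, and countable additivity
  follows from it. The conditions kept here are those that pass to pointwise limits. Total mass zero
  excludes the invariant measure itself, the one coefficient for which \<open>W_fix\<close> would
  fail for trivial reasons.\<close>

definition W :: "('a mat set set \<Rightarrow> real) set" where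
 "W = {w. (\<forall>A\<in>sets M. \<forall>A'\<in>sets M. A \<inter> A' = {} \<longrightarrow> w (A \<union> A') = w A + w A') \<and> w (space M) = 0}"

definition ia :: "'a mat \<Rightarrow> 'a mat set set \<Rightarrow> 'a mat set set" where "ia g A = l_coset G g ` A"

lemma ia_sets: "g \<in> carrier G \<Longrightarrow> A \<in> sets M \<Longrightarrow> ia g A \<in> sets M"
 unfolding ia_def by (rule MQ.act_image_sets)

lemma ia_mult: "g \<in> carrier G \<Longrightarrow> h \<in> carrier G \<Longrightarrow> A \<in> sets M \<Longrightarrow> ia (g \<otimes>\<^bsub>G\<^esub> h) A = ia g (ia h A)"
 unfolding ia_def image_image using sets.sets_into_space[of A M]
 by (intro image_cong refl MQ.act_act[symmetric]) auto

lemma ia_one: "A \<in> sets M \<Longrightarrow> ia \<one>\<^bsub>G\<^esub> A = A"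
 unfolding ia_def using sets.sets_into_space[of A M] MQ.act_one by (auto simp: image_def subset_iff simp del: SF.G_simps)

lemma ia_disjoint:
 assumes "g \<in> carrier G" "A \<in> sets M" "A' \<in> sets M" "A \<inter> A' = {}"
 shows "ia g A \<inter> ia g A' = {}"
proof -
 have "x = y" if "x \<in> A" "y \<in> A'" "l_coset G g x = l_coset G g y" for x y
 proof -
  have xy: "x \<in> space M" "y \<in> space M" using that assms sets.sets_into_space by blast+
  have "l_coset G (inv\<^bsub>G\<^esub> g) (l_coset G g x) = l_coset G (inv\<^bsub>G\<^esub> g) (l_coset G g y)" using that(3) by simp
  then show ?thesis
   using MQ.act_act[of "inv\<^bsub>G\<^esub> g" g] xy assms(1) MQ.act_one by (simp del: SF.G_simps)
 qed
 then show ?thesis using assms(4) unfolding ia_def by blast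
qed

lemma ia_space:
 assumes g: "g \<in> carrier G"
 shows "ia g (space M) = space M"
proof (intro equalityI subsetI)
 fix x assume x: "x \<in> space M"
 have "x = l_coset G g (l_coset G (inv\<^bsub>G\<^esub> g) x)"
  using MQ.act_act[of g "inv\<^bsub>G\<^esub> g" x] MQ.act_one[OF x] g x by (simp del: SF.G_simps)
 then show "x \<in> ia g (space M)"
  unfolding ia_def by (rule image_eqI) (rule MQ.act_closed[OF SF.inv_closed[OF g] x])
next
 fix x assume "x \<in> ia g (space M)"
 then obtain y where "y \<in> space M" "x = l_coset G g y" unfolding ia_def by blast
 then show "x \<in> space M" using MQ.act_closed[OF g] by simp
qed

lemma transvection_complex:
 "transvection_complex G (\<lambda>g v. g *\<^sub>v v) (P) (\<lambda>u v. SF.\<omega> u v = 0)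
   ia (sets M) (measure M) W (r - 1) (\<lambda>u. SF.T u 1)"
proof (intro transvection_complex.intro equivariant_complex.intro equivariant_complex_axioms.intro transvection_complex_axioms.intro)
 show "Group.group G" by (rule SF.G_group)
 fix g h :: "'a mat" and p a b :: "'a Matrix.vec"
 show "g *\<^sub>v p \<in> P" if g: "g \<in> carrier G" and p: "p \<in> P"
 proof -
  have "g *\<^sub>v p \<noteq> zv r"
  proof
   assume "g *\<^sub>v p = zv r"
   then have "inv\<^bsub>G\<^esub> g *\<^sub>v zv r = p" using SF.apply_inv(2)[OF g, of p] p by simp
   moreover have "inv\<^bsub>G\<^esub> g *\<^sub>v zv r = zv r"
    using SF.G_carrier_mat[OF SF.inv_closed[OF g]] by (intro eq_vecI) auto
   ultimately show False using p by simp
  qed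
  then show ?thesis using g p by simp
 qed
 show "(g \<otimes>\<^bsub>G\<^esub> h) *\<^sub>v p = g *\<^sub>v (h *\<^sub>v p)" if "g \<in> carrier G" "h \<in> carrier G" "p \<in> P"
  using that by (simp add: SF.apply_mult)
 show "\<one>\<^bsub>G\<^esub> *\<^sub>v p = p" if "p \<in> P" using that by simp
 show "SF.\<omega> (g *\<^sub>v a) (g *\<^sub>v b) = 0" if "g \<in> carrier G" "a \<in> P"
  "b \<in> P" "SF.\<omega> a b = 0"
  using that SF.G_sf by simp
 show "SF.T a 1 \<in> carrier G" if "a \<in> P" using that by simp
 show "SF.T a 1 *\<^sub>v a = a" if "a \<in> P" using that SF.T_fix[of a a 1] by simp
 show "SF.T a 1 *\<^sub>v b = b" if "a \<in> P" "b \<in> P" "SF.\<omega> a b = 0"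
  using that SF.T_fix[of a b 1] by simp
 show "SF.T (g *\<^sub>v a) 1 = g \<otimes>\<^bsub>G\<^esub> SF.T a 1 \<otimes>\<^bsub>G\<^esub> inv\<^bsub>G\<^esub> g" if "g \<in> carrier G" "a \<in> P"
  using that SF.T_conj[of g a 1] by simp
next
 fix ps :: "'a Matrix.vec list" assume "length ps \<le> r - 1" "set ps \<subseteq> P"
 then show "\<exists>p\<in>P. \<forall>b\<in>set ps. SF.\<omega> p b = 0" by (intro orthogonal_exists) auto
next
 fix g h A assume g: "g \<in> carrier G" and A: "A \<in> sets M"
 show "ia g A \<in> sets M" by (rule ia_sets[OF g A])
 show "measure M (ia g A) = measure M A" unfolding ia_def using MQ.invariant[OF g A] by (simp add: measure_def)
 show "ia (g \<otimes>\<^bsub>G\<^esub> h) A = ia g (ia h A)" if "h \<in> carrier G" by (rule ia_mult[OF g that A])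
next
 fix A assume A: "A \<in> sets M"
 show "0 \<le> measure M A" by simp
 show "ia \<one>\<^bsub>G\<^esub> A = A" by (rule ia_one[OF A])
next
 show "(\<lambda>A. 0) \<in> W" by (simp add: W_def)
 show "(\<lambda>A. v A + w A) \<in> W" if "v \<in> W" "w \<in> W" for v w using that by (simp add: W_def)
 show "(\<lambda>A. c * v A) \<in> W" if "v \<in> W" for c v using that by (simp add: W_def distrib_left)
 show "(\<lambda>A. w (ia g A)) \<in> W" if g: "g \<in> carrier G" and w: "w \<in> W" for g w
 proof -
  have "w (ia g (A \<union> A')) = w (ia g A) + w (ia g A')" if "A \<in> sets M" "A' \<in> sets M" "A \<inter> A' = {}" for A A'
  proof -
   have "ia g (A \<union> A') = ia g A \<union> ia g A'" by (simp add: ia_def image_Un)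
   then show ?thesis using w ia_sets[OF g that(1)] ia_sets[OF g that(2)] ia_disjoint[OF g that] by (simp add: W_def)
  qed
  then show ?thesis using w ia_space[OF g] by (simp add: W_def)
 qed
next
 fix X :: "nat filter" and v l
 assume X: "X \<noteq> bot" and v: "\<And>k :: nat. v k \<in> W" and l: "\<And>A. A \<in> sets M \<Longrightarrow> ((\<lambda>k. v k A) \<longlongrightarrow> l A) X"
 have "l (A \<union> A') = l A + l A'" if A: "A \<in> sets M" "A' \<in> sets M" "A \<inter> A' = {}" for A A'
 proof (rule tendsto_unique[OF X l])
  show "A \<union> A' \<in> sets M" using A by blast
  have "v k (A \<union> A') = v k A + v k A'" for k using v[of k] A by (simp add: W_def)
  then show "((\<lambda>k. v k (A \<union> A')) \<longlongrightarrow> l A + l A') X" using tendsto_add[OF l[OF A(1)] l[OF A(2)]] by simp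
 qed
 moreover have "l (space M) = 0"
 proof (rule tendsto_unique[OF X l[OF sets.top]])
  have "v k (space M) = 0" for k using v[of k] by (simp add: W_def)
  then show "((\<lambda>k. v k (space M)) \<longlongrightarrow> 0) X" by simp
 qed
 ultimately show "l \<in> W" by (simp add: W_def)
next
 fix u w C A assume u: "u \<in> P" and w: "w \<in> W"
  and bound: "\<And>A. A \<in> sets M \<Longrightarrow> \<bar>w A\<bar> \<le> C * measure M A"
  and inv: "\<And>A. A \<in> sets M \<Longrightarrow> w (ia (SF.T u 1) A) = w A" and A: "A \<in> sets M"
 show "w A = 0"
 proof (rule MQ.invariant_dominated_zero[OF _ bound _ _ _ _ A])
  show "SF.T u 1 \<in> carrier G" using u by simp
  show "w (l_coset G (SF.T u 1) ` A) = w A" if "A \<in> sets M" for A using inv[OF that] by (simp add: ia_def)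
  show "w (A \<union> A') = w A + w A'" if "A \<in> sets M" "A' \<in> sets M" "A \<inter> A' = {}" for A A' using w that by (simp add: W_def)
  show "w (space M) = 0" using w by (simp add: W_def)
  show "MQ.disp A h = 0" if "A \<in> sets M" "MQ.disp A (SF.T u 1) = 0" "h \<in> carrier G" for A h
   using disp_zero[OF that(1) _ _ that(2,3)] u by simp
 qed
qed

theorem j_injective:
 assumes a: "a \<in> cocycles MQ.\<G> q" and q: "2 * q \<le> r - 1" and j: "MQ.j q a \<in> cobs G q"
 shows "a \<in> cobs MQ.\<G> q"
proof (rule MQ.j_injective[OF a j])
 fix k assume qk: "q = Suc k"
 interpret TC: transvection_complex G "\<lambda>g v. g *\<^sub>v v" "P" "\<lambda>u v. SF.\<omega> u v = 0"
  ia "sets M" "measure M" W "r - 1" "\<lambda>u. SF.T u 1" by (rule transvection_complex)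
 note aD = cocyclesD[OF a]
 note jD = cocyclesD[OF MQ.rm.average_cocycle[OF a], folded MQ.j_def]
 obtain C where C: "0 \<le> C" "\<forall>gs. \<bar>a gs\<bar> \<le> C" by (rule cochains_bound[OF aD(1)])
 obtain C' where C': "0 \<le> C'" "\<forall>gs. \<bar>MQ.j q a gs\<bar> \<le> C'" by (rule cochains_bound[OF jD(1)])
 \<comment> \<open>Partial averages minus the share of the full average: subtracting the mean is
   what gives total mass zero.\<close>
 define x where "x (s :: 'a Matrix.vec list) gs A = (\<integral>y\<in>A. a (map (MQ.\<beta> y) gs) \<partial>M) - MQ.j q a gs * measure M A" for s gs A
 have sub: "set gs \<subseteq> carrier G" if "gs \<in> tuples G q'" for gs q' using that by (simp add: tuples_def)
 have meas: "(\<lambda>y. a (map (MQ.\<beta> y) gs)) \<in> borel_measurable M" if "gs \<in> tuples G q'" for gs q'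
  by (rule MQ.rm.map_measurable[OF sub[OF that]])
 have int: "integrable M (\<lambda>y. a (map (MQ.\<beta> y) gs))" if "gs \<in> tuples G q'" for gs q'
  by (rule bounded_integrable[OF MQ.finite meas[OF that] spec[OF C(2)]])
 have sint: "set_integrable M A (\<lambda>y. a (map (MQ.\<beta> y) gs))" if "gs \<in> tuples G q'" "A \<in> sets M" for gs A q'
  unfolding set_integrable_def by (rule integrable_mult_indicator[OF that(2) int[OF that(1)]])
 have "TC.cochain {[]} q x"
 proof (rule TC.cochainI[where C = "C + C'"])
  fix s gs assume "s \<in> {[] :: 'a Matrix.vec list}" and gs: "gs \<in> tuples G q"
  have "x s gs (A \<union> A') = x s gs A + x s gs A'" if A: "A \<in> sets M" "A' \<in> sets M" "A \<inter> A' = {}" for A A'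
   unfolding x_def set_integral_Un[OF A(3) sint[OF gs A(1)] sint[OF gs A(2)]] MQ.finite_measure_Union[OF A]
   by (simp add: algebra_simps)
  moreover have "x s gs (space M) = 0"
  proof -
   have "(\<integral>y\<in>space M. a (map (MQ.\<beta> y) gs) \<partial>M) = MQ.j q a gs"
    unfolding MQ.j_def average_def set_lebesgue_integral_def using gs
    by (simp add: indicator_def cong: Bochner_Integration.integral_cong)
   then show ?thesis using MQ.total by (simp add: x_def)
  qed
  ultimately show "x s gs \<in> W" by (simp add: W_def)
  fix A assume A: "A \<in> sets M"
  have "\<bar>\<integral>y\<in>A. a (map (MQ.\<beta> y) gs) \<partial>M\<bar> \<le> (\<integral>y. C * indicator A y \<partial>M)"
  proof -
   have "\<bar>\<integral>y\<in>A. a (map (MQ.\<beta> y) gs) \<partial>M\<bar> \<le> (\<integral>y. \<bar>indicator A y *\<^sub>R a (map (MQ.\<beta> y) gs)\<bar> \<partial>M)"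
    unfolding set_lebesgue_integral_def by (rule integral_abs_bound)
   also have "\<dots> \<le> (\<integral>y. C * indicator A y \<partial>M)"
   proof (rule integral_mono)
    show "integrable M (\<lambda>y. \<bar>indicator A y *\<^sub>R a (map (MQ.\<beta> y) gs)\<bar>)"
     using sint[OF gs A] by (intro integrable_abs) (simp add: set_integrable_def)
    show "integrable M (\<lambda>y. C * indicator A y)" using A by (intro integrable_mult_right) (simp add: less_top[symmetric])
    show "\<bar>indicator A y *\<^sub>R a (map (MQ.\<beta> y) gs)\<bar> \<le> C * indicator A y" for y
     using C by (simp add: indicator_def)
   qed
   finally show ?thesis .
  qed
  also have "\<dots> = C * measure M A" using A by simp
  finally have 1: "\<bar>\<integral>y\<in>A. a (map (MQ.\<beta> y) gs) \<partial>M\<bar> \<le> C * measure M A" .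
  have "\<bar>MQ.j q a gs * measure M A\<bar> \<le> C' * measure M A"
   unfolding abs_mult using spec[OF C'(2), of gs] by (intro mult_mono) auto
  with 1 show "\<bar>x s gs A\<bar> \<le> (C + C') * measure M A"
   unfolding x_def distrib_right by linarith
  fix g assume g: "g \<in> carrier G"
  have gs': "map (\<lambda>h. g \<otimes>\<^bsub>G\<^esub> h) gs \<in> tuples G q" by (rule tuples_map[OF SF.G_group g gs])
  have "(\<integral>y\<in>ia g A. a (map (MQ.\<beta> y) (map (\<lambda>h. g \<otimes>\<^bsub>G\<^esub> h) gs)) \<partial>M) =
    (\<integral>y\<in>A. a (map (MQ.\<beta> (l_coset G g y)) (map (\<lambda>h. g \<otimes>\<^bsub>G\<^esub> h) gs)) \<partial>M)"
   unfolding ia_def by (rule MQ.set_integral_act[OF g A meas[OF gs'], symmetric])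
  also have "\<dots> = (\<integral>y\<in>A. a (map (MQ.\<beta> y) gs) \<partial>M)"
  proof (rule set_lebesgue_integral_cong[OF A], intro allI impI)
   fix y assume "y \<in> A"
   then have y: "y \<in> space M" using sets.sets_into_space[OF A] by blast
   obtain c where c: "c \<in> carrier MQ.\<G>" "\<forall>h\<in>carrier G. MQ.\<beta> (l_coset G g y) (g \<otimes>\<^bsub>G\<^esub> h) = c \<otimes>\<^bsub>MQ.\<G>\<^esub> MQ.\<beta> y h"
    using MQ.rm.equiv[OF g y] by blast
   have "map (MQ.\<beta> (l_coset G g y)) (map (\<lambda>h. g \<otimes>\<^bsub>G\<^esub> h) gs) = map (\<lambda>z. c \<otimes>\<^bsub>MQ.\<G>\<^esub> z) (map (MQ.\<beta> y) gs)"
    using c(2) sub[OF gs] by (simp add: subset_iff del: SF.G_simps)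
   then show "a (map (MQ.\<beta> (l_coset G g y)) (map (\<lambda>h. g \<otimes>\<^bsub>G\<^esub> h) gs)) = a (map (MQ.\<beta> y) gs)"
    by (simp only: cochainsD(2)[OF aD(1) c(1) MQ.rm.map_tuples[OF y gs]])
  qed
  finally show "x (map (\<lambda>v. g *\<^sub>v v) s) (map (\<lambda>h. g \<otimes>\<^bsub>G\<^esub> h) gs) (ia g A) = x s gs A"
   unfolding x_def cochainsD(2)[OF jD(1) g gs] using TC.wt_ia[OF g A] by (simp del: SF.G_simps map_map)
 qed
 moreover have "TC.null {[]} (Suc q) (TC.dd x)"
  unfolding TC.agree_def
 proof (intro ballI)
  fix s gs A assume "s \<in> {[] :: 'a Matrix.vec list}" and gs: "gs \<in> tuples G (Suc q)" and A: "A \<in> sets M"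
  have "bd (\<lambda>hs. \<integral>y\<in>A. a (map (MQ.\<beta> y) hs) \<partial>M) gs = (\<integral>y\<in>A. bd (\<lambda>hs. a (map (MQ.\<beta> y) hs)) gs \<partial>M)"
   by (rule MQ.set_integral_bd[OF int[OF tuples_face[OF gs]] A, symmetric])
  also have "\<dots> = (\<integral>y\<in>A. 0 \<partial>M)"
  proof (rule set_lebesgue_integral_cong[OF A], intro allI impI)
   fix y assume "y \<in> A"
   then have "y \<in> space M" using sets.sets_into_space[OF A] by blast
   from aD(2)[OF MQ.rm.map_tuples[OF this gs]] show "bd (\<lambda>hs. a (map (MQ.\<beta> y) hs)) gs = 0" by (simp only: bd_map)
  qed
  also have "\<dots> = 0" by simp
  finally have 1: "bd (\<lambda>hs. \<integral>y\<in>A. a (map (MQ.\<beta> y) hs) \<partial>M) gs = 0" .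
  have 2: "bd (\<lambda>hs. MQ.j q a hs * measure M A) gs = 0"
   using bd_cmult[of "measure M A" "MQ.j q a" gs] jD(2)[OF gs] by (simp add: mult.commute)
  show "TC.dd x s gs A = 0" unfolding TC.dd_def x_def bd_diff 1 2 by simp
 qed
 ultimately have "TC.cob {[]} q x"
  using q by (intro TC.vanishing[of 0]) (simp_all add: TC.points_def)
 then obtain w where w: "TC.cochain {[]} k w" "TC.agree {[]} (Suc k) x (TC.dd w)" unfolding qk TC.cob_Suc by blast
 obtain C2 where C2: "0 \<le> C2" "\<forall>s\<in>{[]}. \<forall>gs\<in>tuples G k. \<forall>A\<in>sets M. \<bar>w s gs A\<bar> \<le> C2 * measure M A"
  by (rule TC.cochain_bound[OF w(1)])
 show "\<exists>E C. MQ.primitive a k E C"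
  unfolding MQ.primitive_def
 proof (intro exI[of _ "w []"] exI[of _ C2] conjI ballI impI)
  fix hs A A' assume hs: "hs \<in> tuples G k" and A: "A \<in> sets M" "A' \<in> sets M" "A \<inter> A' = {}"
  show "w [] hs (A \<union> A') = w [] hs A + w [] hs A'"
   using TC.cochainD(1)[OF w(1) singletonI hs] A by (simp add: W_def)
 next
  fix hs A assume hs: "hs \<in> tuples G k" and A: "A \<in> sets M"
  show "\<bar>w [] hs A\<bar> \<le> C2 * measure M A" using C2(2) hs A by simp
  fix g assume "g \<in> carrier G"
  from TC.cochainD(2)[OF w(1) this singletonI hs A]
  show "w [] (map (\<lambda>x. g \<otimes>\<^bsub>G\<^esub> x) hs) ((\<lambda>x. l_coset G g x) ` A) = w [] hs A"
   by (simp add: ia_def del: SF.G_simps)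
 next
  fix gs A assume "gs \<in> tuples G (Suc k)" "A \<in> sets M"
  then show "(\<integral>x\<in>A. a (map (MQ.\<beta> x) gs) \<partial>M) - MQ.j (Suc k) a gs * measure M A = bd (\<lambda>hs. w [] hs A) gs"
   using w(2) unfolding TC.agree_def TC.dd_def x_def qk by blast
 qed
qed

end

section \<open>Lattices in symplectic groups over normed fields\<close>

text \<open>Extension by zero puts the coordinates of all sizes into one type, a countable power of
  the field, which is second countable and whose product topology induces that of the group.\<close>

definition coords :: "nat \<Rightarrow> 'a::zero mat \<Rightarrow> nat \<times> nat \<Rightarrow> 'a" where
 "coords r A ij = (if fst ij < 2 * r \<and> snd ij < 2 * r then A $$ ij else 0)"

text \<open>The entries of the inverse, as given by \<open>Sp_entries_inverse\<close>, turned into a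
  formula that makes sense for arbitrary arrays and is continuous on all of them.\<close>

definition inv_coords :: "nat \<Rightarrow> (nat \<times> nat \<Rightarrow> 'a::comm_ring_1) \<Rightarrow> nat \<Rightarrow> nat \<Rightarrow> 'a" where
 "inv_coords r p i l = (if i < r then sf r (basis r l) (Matrix.vec (2 * r) (\<lambda>m. p (m, r + i)))
   else - sf r (basis r l) (Matrix.vec (2 * r) (\<lambda>m. p (m, i - r))))"

definition div_coords :: "nat \<Rightarrow> (nat \<times> nat \<Rightarrow> 'a::comm_ring_1) \<times> (nat \<times> nat \<Rightarrow> 'a) \<Rightarrow> nat \<times> nat \<Rightarrow> 'a" where
 "div_coords r pq ij = (if fst ij < 2 * r \<and> snd ij < 2 * r
   then \<Sum>l<2 * r. inv_coords r (fst pq) (fst ij) l * snd pq (l, snd ij) else 0)"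

lemma sf_vec: "sf r u (Matrix.vec (2 * r) f) = (\<Sum>x<r. u $ x * f (r + x) - u $ (r + x) * f x)"
 by (simp add: symplectic_form_def)

lemma Sp_over_UNIV: "Sp_over UNIV r = Sp r"
 by (simp add: Sp_over_def Sp_def)

lemma continuous_div_coords:
 "continuous_on UNIV (div_coords r :: (nat \<times> nat \<Rightarrow> 'a::real_normed_field) \<times> _ \<Rightarrow> _)"
proof (rule continuous_on_coordinatewise_then_product)
 fix ij :: "nat \<times> nat"
 have fc: "continuous_on UNIV (\<lambda>pq :: (nat \<times> nat \<Rightarrow> 'a) \<times> (nat \<times> nat \<Rightarrow> 'a). fst pq k)"
  and sc: "continuous_on UNIV (\<lambda>pq :: (nat \<times> nat \<Rightarrow> 'a) \<times> (nat \<times> nat \<Rightarrow> 'a). snd pq k)" for k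
  by (rule continuous_on_product_then_coordinatewise, intro continuous_intros)+
 have ic: "continuous_on UNIV (\<lambda>pq :: (nat \<times> nat \<Rightarrow> 'a) \<times> (nat \<times> nat \<Rightarrow> 'a). inv_coords r (fst pq) i l)" for i l
 proof (cases "i < r")
  case True
  then show ?thesis unfolding inv_coords_def sf_vec if_P[OF True]
   by (intro continuous_on_sum continuous_on_diff continuous_on_mult continuous_on_const fc)
 next
  case False
  then show ?thesis unfolding inv_coords_def sf_vec if_not_P[OF False]
   by (intro continuous_on_minus continuous_on_sum continuous_on_diff continuous_on_mult continuous_on_const fc)
 qed
 show "continuous_on UNIV (\<lambda>pq :: (nat \<times> nat \<Rightarrow> 'a) \<times> (nat \<times> nat \<Rightarrow> 'a). div_coords r pq ij)"
 proof (cases "fst ij < 2 * r \<and> snd ij < 2 * r")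
  case True
  show ?thesis unfolding div_coords_def if_P[OF True] by (intro continuous_on_sum continuous_on_mult ic sc)
 next
  case False
  show ?thesis unfolding div_coords_def if_not_P[OF False] by (rule continuous_on_const)
 qed
qed

context symplectic_normed_field
begin

lemma inv_coords:
 assumes g: "g \<in> carrier G" and il: "i < 2 * r" "l < 2 * r"
 shows "inv_coords r (coords r g) i l = (ginv g) $$ (i, l)"
proof -
 have S: "g \<in> carrier (Sp r)" "ginv g \<in> carrier (Sp r)" using g inv_closed[OF g] by (auto simp: carrier_G)
 have gi: "g * ginv g = idm r" using r_inv[OF g] by simp
 note gm = G_carrier_mat[OF g]
 have col: "g *\<^sub>v basis r k = Matrix.vec (2 * r) (\<lambda>m. coords r g (m, k))" if "k < 2 * r" for k
  using gm that mat_apply_unit[OF gm] by (intro eq_vecI) (auto simp: coords_def)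
 show ?thesis
 proof (cases "i < r")
  case True
  then show ?thesis
   using Sp_entries_inverse(1)[OF S gi il(2), of i] col[of "r + i"] by (simp add: inv_coords_def)
 next
  case False
  then show ?thesis
   using Sp_entries_inverse(2)[OF S gi il(2), of "i - r"] col[of "i - r"] il(1) by (simp add: inv_coords_def)
 qed
qed

lemma div_coords:
 assumes g: "g \<in> carrier G" and h: "h \<in> carrier G"
 shows "div_coords r (coords r g, coords r h) = coords r (ginv g \<otimes>\<^bsub>G\<^esub> h)"
proof
 fix ij :: "nat \<times> nat"
 obtain i j where ij: "ij = (i, j)" by (cases ij)
 show "div_coords r (coords r g, coords r h) ij = coords r (ginv g \<otimes>\<^bsub>G\<^esub> h) ij"
 proof (cases "i < 2 * r \<and> j < 2 * r")
  case True
  note gm = G_carrier_mat[OF inv_closed[OF g]] and hm = G_carrier_mat[OF h]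
  have "(ginv g * h) $$ (i, j) = (\<Sum>l\<in>{0..<2 * r}. (ginv g) $$ (i, l) * h $$ (l, j))"
   using gm hm True by (auto simp: scalar_prod_def intro!: sum.cong)
  also have "\<dots> = (\<Sum>l<2 * r. inv_coords r (coords r g) i l * coords r h (l, j))"
   using True inv_coords[OF g] by (intro sum.cong) (auto simp: coords_def)
  finally show ?thesis using True by (simp add: ij div_coords_def coords_def)
 qed (auto simp: ij div_coords_def coords_def)
qed

lemma coords_inj: "inj_on (coords r) (carrier G)"
proof (rule inj_onI)
 fix g h assume gh: "g \<in> carrier G" "h \<in> carrier G" "coords r g = coords r h"
 show "g = h"
 proof (rule eq_matI)
  fix i j assume "i < dim_row h" "j < dim_col h"
  then have "i < 2 * r" "j < 2 * r" using G_carrier_mat[OF gh(2)] by auto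
  then show "g $$ (i, j) = h $$ (i, j)" using fun_cong[OF gh(3), of "(i, j)"] by (simp add: coords_def)
 qed (use G_carrier_mat[OF gh(1)] G_carrier_mat[OF gh(2)] in auto)
qed

lemma carrier_G_eq: "carrier G = carrier (Sp r)"
 unfolding K_UNIV Sp_over_UNIV ..

lemma openin_Sp_topology:
 "openin (Sp_topology r) U \<longleftrightarrow> (\<exists>W. open W \<and> U = {g \<in> carrier G. coords r g \<in> (W :: (nat \<times> nat \<Rightarrow> 'a) set)})"
proof
 let ?I = "{..<2 * r} \<times> {..<2 * r}"
 let ?X = "product_topology (\<lambda>_. euclidean :: 'a topology) ?I"
 let ?f = "\<lambda>M :: 'a mat. \<lambda>ij \<in> ?I. M $$ ij"
 assume "openin (Sp_topology r) U"
 then obtain S where S: "openin ?X S" "U = ?f -` S \<inter> carrier (Sp r)"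
  unfolding Sp_topology_def openin_pullback_topology by blast
 define \<phi> where "\<phi> p = restrict p ?I" for p :: "nat \<times> nat \<Rightarrow> 'a"
 have "continuous_map euclidean ?X \<phi>"
  unfolding continuous_map_componentwise
 proof (intro conjI ballI)
  show "\<phi> ` topspace euclidean \<subseteq> extensional ?I" by (auto simp: \<phi>_def)
  fix k assume "k \<in> ?I"
  then have "(\<lambda>x. \<phi> x k) = (\<lambda>x. x k)" by (auto simp: \<phi>_def)
  then show "continuous_map euclidean euclidean (\<lambda>x. \<phi> x k)"
   by simp
 qed
 from openin_continuous_map_preimage[OF this S(1)] have "open (\<phi> -` S)" by (simp add: vimage_def)
 moreover have "\<phi> (coords r M) = ?f M" for M by (auto simp: \<phi>_def coords_def fun_eq_iff)
 ultimately show "\<exists>W. open W \<and> U = {g \<in> carrier G. coords r g \<in> W}"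
  unfolding S(2) carrier_G_eq by (intro exI[of _ "\<phi> -` S"]) auto
next
 let ?I = "{..<2 * r} \<times> {..<2 * r}"
 let ?X = "product_topology (\<lambda>_. euclidean :: 'a topology) ?I"
 let ?f = "\<lambda>M :: 'a mat. \<lambda>ij \<in> ?I. M $$ ij"
 assume "\<exists>W. open W \<and> U = {g \<in> carrier G. coords r g \<in> W}"
 then obtain W where W: "open W" "U = {g \<in> carrier (Sp r). coords r g \<in> W}" unfolding carrier_G_eq by blast
 have top: "topspace (Sp_topology r) = (carrier (Sp r) :: 'a mat set)"
  unfolding Sp_topology_def topspace_pullback_topology by auto
 have "continuous_map (Sp_topology r) (product_topology (\<lambda>_. euclidean) UNIV) (coords r :: 'a mat \<Rightarrow> _)"
  unfolding continuous_map_componentwise_UNIV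
 proof
  fix ij :: "nat \<times> nat"
  show "continuous_map (Sp_topology r) euclidean (\<lambda>M. coords r M ij :: 'a)"
  proof (cases "ij \<in> ?I")
   case True
   have "continuous_map (Sp_topology r) euclidean ((\<lambda>h. h ij) \<circ> ?f)"
    unfolding Sp_topology_def by (intro continuous_map_pullback continuous_map_product_projection True)
   moreover have "(\<lambda>h. h ij) \<circ> ?f = (\<lambda>M. coords r M ij)" using True by (auto simp: fun_eq_iff coords_def)
   ultimately show ?thesis by simp
  next
   case False
   then have "(\<lambda>M :: 'a mat. coords r M ij) = (\<lambda>M. 0)" by (cases ij) (auto simp: coords_def fun_eq_iff)
   then show ?thesis by simp
  qed
 qed
 from openin_continuous_map_preimage[OF this, of W] W show "openin (Sp_topology r) U"
  unfolding euclidean_product_topology top by simp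
qed

end

lemma coordinate_group_Sp:
 "coordinate_group (Sp_over (UNIV :: 'a::{real_normed_field,second_countable_topology} set) r) (coords r) (div_coords r) (Sp_topology r)"
proof -
 interpret symplectic_normed_field "UNIV :: 'a set" r
  by (intro symplectic_normed_field.intro symplectic_field.intro symplectic_ring_UNIV symplectic_field_axioms.intro refl)
 show ?thesis
  by (intro coordinate_group.intro coordinate_group_axioms.intro G_group openin_Sp_topology coords_inj continuous_div_coords div_coords)
qed

abbreviation Sp_borel :: "nat \<Rightarrow> 'a::{real_normed_field,second_countable_topology} mat measure" where
 "Sp_borel r \<equiv> coordinate_group.B (Sp_over UNIV r) (coords r)"

lemma symplectic_normed_field_UNIV: "symplectic_normed_field (UNIV :: 'a::real_normed_field set)"
 by (intro symplectic_normed_field.intro symplectic_field.intro symplectic_ring_UNIV symplectic_field_axioms.intro refl)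

lemma sp_quotient_exists:
 fixes \<Gamma> :: "'a::{real_normed_field,second_countable_topology} mat set"
 assumes lat: "lattice_subgroup (Sp r) (Sp_topology r) \<Gamma>" and r: "1 \<le> r"
 obtains M s where "sp_quotient (UNIV :: 'a set) r (Sp_borel r) \<Gamma> M s"
proof -
 interpret S: symplectic_normed_field "UNIV :: 'a set" r by (rule symplectic_normed_field_UNIV)
 interpret C: coordinate_group "Sp_over (UNIV :: 'a set) r" "coords r" "div_coords r" "Sp_topology r"
  by (rule coordinate_group_Sp)
 obtain M s where Ms: "measured_quotient (Sp_over (UNIV :: 'a set) r) C.B \<Gamma> M s"
  and sets: "sets M = quotient_borel (Sp_over (UNIV :: 'a set) r) (Sp_topology r) \<Gamma>"
  by (rule C.measured_quotient_exists[OF lat[folded Sp_over_UNIV]])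
 interpret Q: measured_quotient "Sp_over (UNIV :: 'a set) r" C.B \<Gamma> M s by (rule Ms)
 \<comment> \<open>For fixed \<open>v\<close> and \<open>g\<close> the entries of the product are
   polynomials in the parameter of the transvection, with value \<open>g\<close> at 0. This feeds
   \<open>disp_continuous\<close>.\<close>
 have near: "eventually (\<lambda>n. S.T v (t n) \<otimes>\<^bsub>S.G\<^esub> g \<in> U) sequentially"
  if v: "v \<in> vecs r" and t: "t \<longlonglongrightarrow> 0" and U: "openin (Sp_topology r) U" "g \<in> U" and g: "g \<in> carrier S.G"
  for v t U g
 proof -
  obtain W where W: "open W" "U = {g \<in> carrier S.G. coords r g \<in> W}" using U(1) C.openin_X by blast
  note gm = S.G_carrier_mat[OF g]
  have "continuous_on UNIV (\<lambda>x. coords r (S.T v x * g) :: nat \<times> nat \<Rightarrow> 'a)"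
  proof (rule continuous_on_coordinatewise_then_product)
   fix ij :: "nat \<times> nat"
   obtain i j where ij: "ij = (i, j)" by (cases ij)
   show "continuous_on UNIV (\<lambda>x. coords r (S.T v x * g) ij)"
   proof (cases "i < 2 * r \<and> j < 2 * r")
    case True
    have "coords r (S.T v x * g) ij = (\<Sum>l\<in>{0..<2 * r}. ((idm r) $$ (i, l) + x * v $ i * sf_dual r v $ l) * g $$ (l, j))" for x
     using True gm v S.T_carrier_mat[of v x]
     by (auto simp: ij coords_def scalar_prod_def S.T_def rank_one_def intro!: sum.cong)
    then show ?thesis by (simp only:) (intro continuous_intros)
   next
    case False
    then have "coords r (S.T v x * g) ij = 0" for x by (auto simp: ij coords_def)
    then show ?thesis by simp
   qed
  qed
  from continuous_on_tendsto_compose[OF this t]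
  have lim: "(\<lambda>n. coords r (S.T v (t n) * g)) \<longlonglongrightarrow> coords r (S.T v 0 * g)" by simp
  have "coords r (S.T v 0 * g) \<in> W" using U(2) W(2) S.T_zero[OF v] gm by simp
  from topological_tendstoD[OF lim W(1) this] show ?thesis
  proof eventually_elim
   fix n assume "coords r (S.T v (t n) * g) \<in> W"
   then show "S.T v (t n) \<otimes>\<^bsub>S.G\<^esub> g \<in> U"
    unfolding W(2) using S.m_closed[OF S.T_closed[OF v] g, of "t n"] by simp
  qed
 qed
 have "sp_quotient (UNIV :: 'a set) r C.B \<Gamma> M s"
 proof (intro sp_quotient.intro sp_quotient_axioms.intro symplectic_normed_field_UNIV Ms r)
  fix v :: "'a Matrix.vec" and t :: "nat \<Rightarrow> 'a" and A assume v: "v \<in> vecs r" and t: "t \<longlonglongrightarrow> 0" and A: "A \<in> sets M"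
  show "(\<lambda>n. Q.disp A (S.T v (t n))) \<longlonglongrightarrow> 0"
   by (rule Q.disp_continuous[OF sets S.T_closed[OF v] near[OF v t] A])
 qed
 then show ?thesis by (rule that)
qed

lemma emb_measurable: "emb k \<in> Sp_borel k \<rightarrow>\<^sub>M (Sp_borel (Suc k) :: 'a::{real_normed_field,second_countable_topology} mat measure)"
proof -
 interpret S: symplectic_normed_field "UNIV :: 'a set" "Suc k" by (rule symplectic_normed_field_UNIV)
 interpret C: coordinate_group "Sp_over (UNIV :: 'a set) k" "coords k" "div_coords k" "Sp_topology k"
  by (rule coordinate_group_Sp)
 interpret C': coordinate_group "Sp_over (UNIV :: 'a set) (Suc k)" "coords (Suc k)" "div_coords (Suc k)" "Sp_topology (Suc k)"
  by (rule coordinate_group_Sp)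
 show ?thesis
 proof (rule C'.B_measurableI)
  show "emb k \<in> space C.B \<rightarrow> carrier (Sp_over UNIV (Suc k))"
   using S.emb_closed[OF _ refl] by (auto simp: C.space_B)
  have coord: "(\<lambda>A. coords k A ij) \<in> borel_measurable C.B" for ij :: "nat \<times> nat"
   by (rule measurable_product_then_coordinatewise[OF C.c_meas])
  show "(\<lambda>A. coords (Suc k) (emb k A)) \<in> borel_measurable C.B"
  proof (rule measurable_coordinatewise_then_product)
   fix ij :: "nat \<times> nat"
   obtain i j where ij: "ij = (i, j)" by (cases ij)
   let ?low = "\<lambda>i. if i < k then i else i - 1"
   consider "\<not> (i < 2 * Suc k \<and> j < 2 * Suc k)" | "i < 2 * Suc k" "j < 2 * Suc k" "i = k \<or> i = 2 * k + 1 \<or> j = k \<or> j = 2 * k + 1"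
    | "i < 2 * Suc k" "j < 2 * Suc k" "\<not> (i = k \<or> i = 2 * k + 1 \<or> j = k \<or> j = 2 * k + 1)" by blast
   then show "(\<lambda>A. coords (Suc k) (emb k A) ij) \<in> borel_measurable C.B"
   proof cases
    case 1
    then have "(\<lambda>A. coords (Suc k) (emb k A) ij) = (\<lambda>A :: 'a mat. 0)" by (auto simp: ij coords_def)
    then show ?thesis by simp
   next
    case 2
    then have "(\<lambda>A. coords (Suc k) (emb k A) ij) = (\<lambda>A :: 'a mat. if i = j then 1 else 0)"
     by (simp add: ij coords_def emb_def)
    then show ?thesis by simp
   next
    case 3
    then have "?low i < 2 * k" "?low j < 2 * k" by auto
    then have "(\<lambda>A. coords (Suc k) (emb k A) ij) = (\<lambda>A :: 'a mat. coords k A (?low i, ?low j))"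
     using 3 by (simp add: ij coords_def emb_def)
    then show ?thesis using coord by simp
   qed
  qed
 qed
qed

text \<open>
 The comparison map sends \<open>a\<close> to the restriction to \<open>\<Gamma> r\<close> of its average over the quotient of the bigger group.
\<close>

theorem lattices_stable:
 fixes \<Gamma> :: "nat \<Rightarrow> 'a::{real_normed_field,second_countable_topology} mat set"
 assumes lat: "\<forall>r\<ge>1. lattice_subgroup (Sp r) (Sp_topology r) (\<Gamma> r)"
 shows "bounded_cohomology_stable (\<lambda>r. (Sp r)\<lparr>carrier := \<Gamma> r\<rparr>)"
proof (rule bounded_cohomology_stableI)
 fix r :: nat assume r: "1 \<le> r"
 interpret S: symplectic_normed_field "UNIV :: 'a set" r by (rule symplectic_normed_field_UNIV)
 have "subgroup (\<Gamma> r) (Sp_over UNIV r)" using lat r unfolding Sp_over_UNIV lattice_subgroup_def by blast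
 from S.subgroup_imp_group[OF this] show "Group.group ((Sp r)\<lparr>carrier := \<Gamma> r\<rparr>)" unfolding Sp_over_UNIV .
next
 fix q :: nat
 let ?\<Gamma> = "\<lambda>k. (Sp k)\<lparr>carrier := \<Gamma> k\<rparr>"
 have "\<exists>t. comparison (?\<Gamma> (Suc k)) (?\<Gamma> k) q t" if k: "2 * (q + 2)\<^sup>2 \<le> k" for k
 proof -
  \<comment> \<open>One bound on \<open>k\<close> covers the nontrivial rank, the stable range of
    the ambient group of size \<open>Suc k\<close>, and the range in which averaging is
    injective.\<close>
  have k1: "1 \<le> k" and qk: "2 * q \<le> Suc k - 1" using k by (auto simp: power2_eq_square)
  obtain M s where Ms: "sp_quotient (UNIV :: 'a set) (Suc k) (Sp_borel (Suc k)) (\<Gamma> (Suc k)) M s"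
   using sp_quotient_exists[of "Suc k" "\<Gamma> (Suc k)"] lat by auto
  obtain M' s' where Ms': "sp_quotient (UNIV :: 'a set) k (Sp_borel k) (\<Gamma> k) M' s'"
   using sp_quotient_exists[of k "\<Gamma> k"] lat k1 by auto
  interpret A: sp_quotient "UNIV :: 'a set" "Suc k" "Sp_borel (Suc k)" "\<Gamma> (Suc k)" M s by (rule Ms)
  interpret A': sp_quotient "UNIV :: 'a set" k "Sp_borel k" "\<Gamma> k" M' s' by (rule Ms')
  have closed: "emb k a \<in> carrier A.G" if "a \<in> carrier A'.G" for a by (rule A.SF.emb_closed[OF that refl])
  have mult: "emb k (a \<otimes>\<^bsub>A'.G\<^esub> b) = emb k a \<otimes>\<^bsub>A.G\<^esub> emb k b" if "a \<in> carrier A'.G" "b \<in> carrier A'.G" for a b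
   using emb_mult[OF A'.SF.G_carrier_mat[OF that(1)] A'.SF.G_carrier_mat[OF that(2)]] by simp
  interpret H: quotient_hom A.G "Sp_borel (Suc k)" "\<Gamma> (Suc k)" M s A'.G "Sp_borel k" "\<Gamma> k" M' s' "emb k"
   by (intro quotient_hom.intro quotient_hom_axioms.intro A.MQ.measured_quotient_axioms A'.MQ.measured_quotient_axioms
     closed mult emb_measurable)
  have sub: "a \<in> carrier A'.G" if "a \<in> carrier A'.MQ.\<G>" for a using A'.MQ.mem_carrier that by simp
  have closed': "emb k a \<in> carrier A.G" if "a \<in> carrier A'.MQ.\<G>" for a by (rule closed[OF sub[OF that]])
  have mult': "emb k (a \<otimes>\<^bsub>A'.MQ.\<G>\<^esub> b) = emb k a \<otimes>\<^bsub>A.G\<^esub> emb k b" if "a \<in> carrier A'.MQ.\<G>" "b \<in> carrier A'.MQ.\<G>" for a b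
   using mult[OF sub[OF that(1)] sub[OF that(2)]] by simp
  define t where "t a = restr A'.MQ.\<G> (emb k) q (A.MQ.j q a)" for a
  have jc: "A.MQ.j q a \<in> cocycles A.G q" if "a \<in> cocycles A.MQ.\<G> q" for a
   unfolding A.MQ.j_def by (rule A.MQ.rm.average_cocycle[OF that])
  have tc: "t a \<in> cocycles A'.MQ.\<G> q" if "a \<in> cocycles A.MQ.\<G> q" for a
   unfolding t_def by (rule restr_cocycle[OF closed' mult' A'.MQ.\<G>_group jc[OF that]])
  have tB: "t a \<in> cobs A'.MQ.\<G> q \<longleftrightarrow> a \<in> cobs A.MQ.\<G> q" if a: "a \<in> cocycles A.MQ.\<G> q" for a
  proof
   assume "a \<in> cobs A.MQ.\<G> q"
   then have "A.MQ.j q a \<in> cobs A.G q" unfolding A.MQ.j_def by (rule A.MQ.rm.average_coboundaries)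
   from restr_coboundaries[OF closed' mult' A'.MQ.\<G>_group this] show "t a \<in> cobs A'.MQ.\<G> q"
    unfolding t_def .
  next
   assume "t a \<in> cobs A'.MQ.\<G> q"
   then have 1: "A'.MQ.j q (t a) \<in> cobs A'.G q" unfolding A'.MQ.j_def by (rule A'.MQ.rm.average_coboundaries)
   \<comment> \<open>Averaging \<open>t a\<close> over the small quotient gives, up to a coboundary,
     the restriction of the average of \<open>a\<close>. Injectivity is then pulled back in two
     stages, from restriction and from averaging.\<close>
   have "(\<lambda>gs. A'.MQ.j q (t a) gs - (A'.MQ.j q (t a) gs - restr A'.G (emb k) q (A.MQ.j q a) gs)) \<in> cobs A'.G q"
    using fun_space.subspace_diff[OF subspace_cobs 1 H.j_restr[OF a, folded t_def]] by (simp only: fun_diff_def)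
   then have 2: "restr A'.G (emb k) q (A.MQ.j q a) \<in> cobs A'.G q" by simp
   have "A.MQ.j q a \<in> cobs A.G q"
    by (rule A.SF.restr_injective[OF refl _ jc[OF a] 2]) (use k in simp)
   then show "a \<in> cobs A.MQ.\<G> q" by (rule A.j_injective[OF a qk])
  qed
  have add: "t (\<lambda>gs. a gs + b gs) = (\<lambda>gs. t a gs + t b gs)" if "a \<in> cocycles A.MQ.\<G> q" "b \<in> cocycles A.MQ.\<G> q" for a b
   using A.MQ.rm.average_add[OF cocyclesD(1)[OF that(1)] cocyclesD(1)[OF that(2)]]
   by (simp add: t_def restr_def A.MQ.j_def fun_eq_iff)
  have cmult: "t (\<lambda>gs. c * a gs) = (\<lambda>gs. c * t a gs)" for c a
   by (simp add: t_def restr_def A.MQ.j_def fun_eq_iff A.MQ.rm.average_cmult)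
  have "comparison A.MQ.\<G> A'.MQ.\<G> q t"
   unfolding comparison_def by (intro ballI conjI allI tc tB add cmult)
  then show ?thesis unfolding Sp_over_UNIV by (rule exI[of _ t])
 qed
 moreover have "1 \<le> 2 * (q + 2)\<^sup>2" by (simp add: power2_eq_square)
 ultimately show "\<exists>R\<ge>1. \<forall>k\<ge>R. \<exists>t. comparison (?\<Gamma> (Suc k)) (?\<Gamma> k) q t"
  by (intro exI[of _ "2 * (q + 2)\<^sup>2"] conjI allI impI)
qed

theorem theorem1p1:
  shows "(\<forall>\<Gamma> :: nat \<Rightarrow> real mat set.
            (\<forall>r\<ge>1. lattice_subgroup (Sp r) (Sp_topology r) (\<Gamma> r)) \<longrightarrow>
            bounded_cohomology_stable (\<lambda>r. (Sp r)\<lparr>carrier := \<Gamma> r\<rparr>))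
       \<and> (\<forall>\<Gamma> :: nat \<Rightarrow> complex mat set.
            (\<forall>r\<ge>1. lattice_subgroup (Sp r) (Sp_topology r) (\<Gamma> r)) \<longrightarrow>
            bounded_cohomology_stable (\<lambda>r. (Sp r)\<lparr>carrier := \<Gamma> r\<rparr>))
       \<and> bounded_cohomology_stable (Sp_over (\<int> :: real set))
       \<and> bounded_cohomology_stable (Sp_over gaussian_integers)"
  by (intro conjI allI impI lattices_stable symplectic_ring.Sp_over_stable
      symplectic_ring_Ints symplectic_ring_gaussian) simp_all

end
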